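(* Let $\Omega\subset\mathbb{R}^3$ be a bounded domain with $\partial\Omega\in C^{1,1}$, let $\lambda_D,\tau>0$ be constants, let $C\in L^\infty(\Omega)$, and let $D,p\in L^\infty(\Omega)$ be such that for some $\delta_0>0$ $$D(x)\ge\delta_0>0,\qquad 0\le p(x)\le1-\delta_0\qquad\text{for }x\in\Omega.$$ Let $V_D\in W^{2,q_0}(\Omega)$ for some $q_0>3$ and $n_D\in W^{1,\infty}(\Omega)$ (both independent of time) satisfy $n_D\ge n_*$ in $\Omega$ for some constant $n_*>0$ and $$\log(n_D/2)+V_D=\text{const. in }\Omega .$$ Let $0\le n_\pm^0\in L^\infty(\Omega)$, and let $(n_+,n_-,V)$ be a weak solution, in the sense specified in the context, to $$\partial_tn_+-\operatorname{div}\big(D(1+p)(\nabla n_++n_+\nabla V)\big)=\frac1{2\tau}(n_--n_+),$$ $$\partial_tn_--\operatorname{div}\big(D(1-p)(\nabla n_-+n_-\nabla V)\big)=\frac1{2\tau}(n_+-n_-),$$ $$-\lambda_D^2\Delta V=n_++n_--C(x)\qquad\text{in }\Omega,\ t>0,$$ $$n_+=n_-=\tfrac12n_D,\quad V=V_D\ \text{ on }\partial\Omega,\ t>0,\qquad n_\pm(0)=n_\pm^0\ \text{ in }\Omega.$$ Define $$H_0(t)=\int_\Omega\Big(h(n_+)+h(n_-)+\frac{\lambda_D^2}2|\nabla(V-V_D)|^2\Big)dx,\qquad h(n_\pm)=\int_{n_D/2}^{n_\pm}\big(\log s-\log(n_D/2)\big)ds,$$ where $n_\pm$ and $V$ are evaluated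 at time $t$. Then $t\mapsto H_0(t)$ is nonincreasing for $t>0$.
   Context: Function space: $W^{1,2}(0,T;H_0^1,L^2)=H^1(0,T;H^{-1}(\Omega))\cap L^2(0,T;H_0^1(\Omega))$, which embeds into $C([0,T];L^2(\Omega))$. Weak solution here means: for every $T>0$, $n_\pm-\tfrac12n_D\in W^{1,2}(0,T;H_0^1,L^2)$; $0\le n_\pm\in L^\infty(0,\infty;L^\infty(\Omega))$; $V\in L^\infty(0,\infty;W^{2,q_0}(\Omega))$; the initial conditions hold in $L^2(\Omega)$; for a.e. $t>0$ and all $\phi\in H_0^1(\Omega)$, $$\langle\partial_tn_\pm,\phi\rangle+\int_\Omega D(1\pm p)(\nabla n_\pm+n_\pm\nabla V)\cdot\nabla\phi\,dx=\mp\frac1{2\tau}\int_\Omega(n_+-n_-)\phi\,dx,$$ where $\langle\cdot,\cdot\rangle$ is the duality between $H^{-1}(\Omega)$ and $H_0^1(\Omega)$; and $-\lambda_D^2\Delta V(t)=n_+(t)+n_-(t)-C$ in $\Omega$ with $V(t)=V_D$ on $\partial\Omega$. The functions $n_\pm$ are identified with their representatives in $C([0,\infty);L^2(\Omega))$, and $V(t)$ is the corresponding solution of the Poisson problem for every $t$. In the definition of $h$, the values $n_D=n_D(x)$ and $n_\pm=n_\pm(x,t)$ are inserted pointwise, with $h(0)$ understood via the convergent integral. *)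

theory Defs
  imports "HOL-Analysis.Analysis"
begin

text \<open>Elements of Lebesgue and Sobolev spaces are represented by functions on the whole Euclidean
  space; only their values almost everywhere in \<open>\<Omega>\<close> matter.\<close>

section \<open>Lebesgue spaces\<close>

definition Lp :: "real \<Rightarrow> 'a::euclidean_space set \<Rightarrow> ('a \<Rightarrow> 'b::euclidean_space) set" where
  "Lp q \<Omega> = {f \<in> borel_measurable (lebesgue_on \<Omega>).
     integrable (lebesgue_on \<Omega>) (\<lambda>x. norm (f x) powr q)}"

definition Lp_norm :: "real \<Rightarrow> 'a::euclidean_space set \<Rightarrow> ('a \<Rightarrow> 'b::euclidean_space) \<Rightarrow> real" where
  "Lp_norm q \<Omega> f = (LINT x|lebesgue_on \<Omega>. norm (f x) powr q) powr (1 / q)"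

definition Linf :: "'a::euclidean_space set \<Rightarrow> ('a \<Rightarrow> 'b::euclidean_space) set" where
  "Linf \<Omega> = {f \<in> borel_measurable (lebesgue_on \<Omega>).
     \<exists>K. AE x in lebesgue_on \<Omega>. norm (f x) \<le> K}"

definition locally_integrable ::
    "'a::euclidean_space set \<Rightarrow> ('a \<Rightarrow> 'b::euclidean_space) \<Rightarrow> bool" where
  "locally_integrable \<Omega> f \<longleftrightarrow>
     (\<forall>K. compact K \<and> K \<subseteq> \<Omega> \<longrightarrow> set_integrable lebesgue K f)"


section \<open>Test functions and weak derivatives\<close>

primrec Ck :: "nat \<Rightarrow> ('a::euclidean_space \<Rightarrow> real) \<Rightarrow> bool" where
  "Ck 0 f \<longleftrightarrow> continuous_on UNIV f"
| "Ck (Suc k) f \<longleftrightarrow> f differentiable_on UNIV \<and>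
     (\<forall>b\<in>Basis. Ck k (\<lambda>x. frechet_derivative f (at x) b))"

definition test_functions :: "'a::euclidean_space set \<Rightarrow> ('a \<Rightarrow> real) set" where
  "test_functions \<Omega> = {\<phi>. (\<forall>k. Ck k \<phi>) \<and>
     compact (closure {x. \<phi> x \<noteq> 0}) \<and> closure {x. \<phi> x \<noteq> 0} \<subseteq> \<Omega>}"

definition grad :: "('a::euclidean_space \<Rightarrow> real) \<Rightarrow> 'a \<Rightarrow> 'a" where
  "grad f x = (\<Sum>b\<in>Basis. frechet_derivative f (at x) b *\<^sub>R b)"

definition has_weak_grad ::
    "'a::euclidean_space set \<Rightarrow> ('a \<Rightarrow> real) \<Rightarrow> ('a \<Rightarrow> 'a) \<Rightarrow> bool" where
  "has_weak_grad \<Omega> f g \<longleftrightarrow> locally_integrable \<Omega> f \<and> locally_integrable \<Omega> g \<and>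
     (\<forall>\<phi>\<in>test_functions \<Omega>.
        (LINT x|lebesgue_on \<Omega>. f x *\<^sub>R grad \<phi> x) = - (LINT x|lebesgue_on \<Omega>. \<phi> x *\<^sub>R g x))"

text \<open>The weak gradient is unique up to null sets; a representative is chosen.\<close>

definition wgrad :: "'a::euclidean_space set \<Rightarrow> ('a \<Rightarrow> real) \<Rightarrow> 'a \<Rightarrow> 'a" where
  "wgrad \<Omega> f = (SOME g. has_weak_grad \<Omega> f g)"

definition has_weak_div ::
    "'a::euclidean_space set \<Rightarrow> ('a \<Rightarrow> 'a) \<Rightarrow> ('a \<Rightarrow> real) \<Rightarrow> bool" where
  "has_weak_div \<Omega> G w \<longleftrightarrow> locally_integrable \<Omega> G \<and> locally_integrable \<Omega> w \<and>
     (\<forall>\<phi>\<in>test_functions \<Omega>.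
        (LINT x|lebesgue_on \<Omega>. G x \<bullet> grad \<phi> x) = - (LINT x|lebesgue_on \<Omega>. w x * \<phi> x))"

text \<open>\<open>\<Delta> = div \<circ> grad\<close>; for a function in \<open>W\<^sup>2\<^sup>,\<^sup>q\<close> this is the sum of
  its pure second weak derivatives.\<close>

definition has_weak_laplacian ::
    "'a::euclidean_space set \<Rightarrow> ('a \<Rightarrow> real) \<Rightarrow> ('a \<Rightarrow> real) \<Rightarrow> bool" where
  "has_weak_laplacian \<Omega> u w \<longleftrightarrow> (\<exists>G. has_weak_grad \<Omega> u G \<and> has_weak_div \<Omega> G w)"


section \<open>Sobolev spaces\<close>

definition H1 :: "'a::euclidean_space set \<Rightarrow> ('a \<Rightarrow> real) set" where
  "H1 \<Omega> = {u \<in> Lp 2 \<Omega>. \<exists>g\<in>Lp 2 \<Omega>. has_weak_grad \<Omega> u g}"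

definition H1_norm :: "'a::euclidean_space set \<Rightarrow> ('a \<Rightarrow> real) \<Rightarrow> real" where
  "H1_norm \<Omega> u = sqrt ((Lp_norm 2 \<Omega> u)\<^sup>2 + (Lp_norm 2 \<Omega> (wgrad \<Omega> u))\<^sup>2)"

definition W1inf :: "'a::euclidean_space set \<Rightarrow> ('a \<Rightarrow> real) set" where
  "W1inf \<Omega> = {u \<in> Linf \<Omega>. \<exists>g\<in>Linf \<Omega>. has_weak_grad \<Omega> u g}"

definition W2 :: "real \<Rightarrow> 'a::euclidean_space set \<Rightarrow> ('a \<Rightarrow> real) set" where
  "W2 q \<Omega> = {u \<in> Lp q \<Omega>. \<exists>g\<in>Lp q \<Omega>. has_weak_grad \<Omega> u g \<and>
     (\<forall>b\<in>Basis. \<exists>k\<in>Lp q \<Omega>. has_weak_grad \<Omega> (\<lambda>x. g x \<bullet> b) k)}"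

definition W2_norm :: "real \<Rightarrow> 'a::euclidean_space set \<Rightarrow> ('a \<Rightarrow> real) \<Rightarrow> real" where
  "W2_norm q \<Omega> u = Lp_norm q \<Omega> u + Lp_norm q \<Omega> (wgrad \<Omega> u) +
     (\<Sum>b\<in>Basis. Lp_norm q \<Omega> (wgrad \<Omega> (\<lambda>x. wgrad \<Omega> u x \<bullet> b)))"

text \<open>The closure of the test functions in \<open>H1\<close>.\<close>

definition H01 :: "'a::euclidean_space set \<Rightarrow> ('a \<Rightarrow> real) set" where
  "H01 \<Omega> = {u \<in> H1 \<Omega>. \<exists>\<phi>. (\<forall>k. \<phi> k \<in> test_functions \<Omega>) \<and>
     (\<lambda>k::nat. H1_norm \<Omega> (\<lambda>x. \<phi> k x - u x)) \<longlonglongrightarrow> 0}"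

text \<open>The dual space of \<open>H01\<close>. Boundedness makes a functional independent of the representative
  of its argument; its values outside \<open>H01\<close> are irrelevant.\<close>

definition Hm1 :: "'a::euclidean_space set \<Rightarrow> (('a \<Rightarrow> real) \<Rightarrow> real) set" where
  "Hm1 \<Omega> = {F.
     (\<forall>u\<in>H01 \<Omega>. \<forall>v\<in>H01 \<Omega>. F (\<lambda>x. u x + v x) = F u + F v) \<and>
     (\<forall>c. \<forall>u\<in>H01 \<Omega>. F (\<lambda>x. c * u x) = c * F u) \<and>
     (\<exists>K. \<forall>u\<in>H01 \<Omega>. \<bar>F u\<bar> \<le> K * H1_norm \<Omega> u)}"

definition Hm1_norm :: "'a::euclidean_space set \<Rightarrow> (('a \<Rightarrow> real) \<Rightarrow> real) \<Rightarrow> real" where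
  "Hm1_norm \<Omega> F = (SUP u\<in>{u \<in> H01 \<Omega>. H1_norm \<Omega> u \<le> 1}. \<bar>F u\<bar>)"


section \<open>Functions of time with values in a normed function space\<close>

text \<open>Strong (Bochner) measurability of \<open>u\<close> on \<open>I\<close> with values in the space \<open>X\<close> normed by \<open>N\<close>:
  almost everywhere limit, in the norm \<open>N\<close>, of \<open>X\<close>-valued simple functions.\<close>

definition bochner_measurable ::
    "real set \<Rightarrow> ('c \<Rightarrow> real) set \<Rightarrow> (('c \<Rightarrow> real) \<Rightarrow> real) \<Rightarrow> (real \<Rightarrow> 'c \<Rightarrow> real) \<Rightarrow> bool" where
  "bochner_measurable I X N u \<longleftrightarrow>
     (\<exists>s. (\<forall>k::nat. finite (s k ` I) \<and> s k ` I \<subseteq> X \<and>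
              (\<forall>f. {t \<in> I. s k t = f} \<in> sets lebesgue)) \<and>
          (AE t in lebesgue_on I.
              u t \<in> X \<and> (\<lambda>k. N (\<lambda>x. s k t x - u t x)) \<longlonglongrightarrow> 0))"

definition L2_bochner ::
    "real set \<Rightarrow> ('c \<Rightarrow> real) set \<Rightarrow> (('c \<Rightarrow> real) \<Rightarrow> real) \<Rightarrow> (real \<Rightarrow> 'c \<Rightarrow> real) set" where
  "L2_bochner I X N = {u. bochner_measurable I X N u \<and>
     integrable (lebesgue_on I) (\<lambda>t. (N (u t))\<^sup>2)}"

definition Linf_bochner ::
    "real set \<Rightarrow> ('c \<Rightarrow> real) set \<Rightarrow> (('c \<Rightarrow> real) \<Rightarrow> real) \<Rightarrow> (real \<Rightarrow> 'c \<Rightarrow> real) set" where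
  "Linf_bochner I X N = {u. bochner_measurable I X N u \<and>
     (\<exists>K. AE t in lebesgue_on I. N (u t) \<le> K)}"

text \<open>\<open>F \<in> L\<^sup>2(0,T;H\<^sup>-\<^sup>1)\<close> is the distributional time derivative of \<open>u\<close> on \<open>(0,T)\<close>. The identity
  \<open>\<integral>\<psi>' u dt = - \<integral>\<psi> F dt\<close> between elements of \<open>H\<^sup>-\<^sup>1\<close> is tested with all \<open>\<phi> \<in> H01\<close>,
  where \<open>u t\<close> acts through the \<open>L\<^sup>2\<close> inner product.\<close>

definition has_time_deriv ::
    "'a::euclidean_space set \<Rightarrow> real \<Rightarrow> (real \<Rightarrow> 'a \<Rightarrow> real) \<Rightarrow>
     (real \<Rightarrow> ('a \<Rightarrow> real) \<Rightarrow> real) \<Rightarrow> bool" where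
  "has_time_deriv \<Omega> T u F \<longleftrightarrow>
     F \<in> L2_bochner {0<..<T} (Hm1 \<Omega>) (Hm1_norm \<Omega>) \<and>
     (\<forall>\<psi>\<in>test_functions {0<..<T}. \<forall>\<phi>\<in>H01 \<Omega>.
        (LINT t|lebesgue_on {0<..<T}. deriv \<psi> t * (LINT x|lebesgue_on \<Omega>. u t x * \<phi> x)) =
        - (LINT t|lebesgue_on {0<..<T}. \<psi> t * F t \<phi>))"

text \<open>\<open>H\<^sup>1(0,T;H\<^sup>-\<^sup>1) \<inter> L\<^sup>2(0,T;H01)\<close>; membership of \<open>u\<close> itself in \<open>L\<^sup>2(0,T;H\<^sup>-\<^sup>1)\<close> follows from
  the second space.\<close>

definition W12 :: "real \<Rightarrow> 'a::euclidean_space set \<Rightarrow> (real \<Rightarrow> 'a \<Rightarrow> real) set" where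
  "W12 T \<Omega> = {u \<in> L2_bochner {0<..<T} (H01 \<Omega>) (H1_norm \<Omega>). \<exists>F. has_time_deriv \<Omega> T u F}"

text \<open>\<open>C([0,\<infinity>);L\<^sup>2(\<Omega>))\<close>\<close>

definition C_L2 :: "'a::euclidean_space set \<Rightarrow> (real \<Rightarrow> 'a \<Rightarrow> real) set" where
  "C_L2 \<Omega> = {u. \<forall>t\<ge>0. u t \<in> Lp 2 \<Omega> \<and>
     ((\<lambda>s. Lp_norm 2 \<Omega> (\<lambda>x. u s x - u t x)) \<longlongrightarrow> 0) (at t within {0..})}"


section \<open>Domains\<close>

text \<open>Near each boundary point, in suitable orthonormal coordinates, \<open>\<Omega>\<close> lies strictly above the
  graph of a differentiable function with Lipschitz continuous gradient.\<close>

definition C11_boundary :: "(real^3) set \<Rightarrow> bool" where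
  "C11_boundary \<Omega> \<longleftrightarrow>
     (\<forall>x0\<in>frontier \<Omega>. \<exists>r>0. \<exists>(A :: real^3 \<Rightarrow> real^3) (\<gamma> :: real^2 \<Rightarrow> real) g L.
        orthogonal_transformation A \<and>
        (\<forall>y. GDERIV \<gamma> y :> g y) \<and> L-lipschitz_on UNIV g \<and>
        \<Omega> \<inter> ball x0 r = {x \<in> ball x0 r. \<gamma> (vector [A x $ 1, A x $ 2]) < A x $ 3})"


section \<open>The spin drift-diffusion system\<close>

text \<open>Membership of \<open>n\<^sub>\<plusminus>\<close> in \<open>L\<^sup>\<infinity>(0,\<infinity>;L\<^sup>\<infinity>(\<Omega>))\<close> is
  an essential bound in time and space: \<open>n\<^sub>\<plusminus>\<close> is strongly measurable with values in \<open>L\<^sup>2\<close> by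
  its other properties, whereas strong measurability with values in the non-separable space
  \<open>L\<^sup>\<infinity>\<close> is not part of the usual notion.\<close>

definition weak_solution ::
    "(real^3) set \<Rightarrow> real \<Rightarrow> real \<Rightarrow> (real^3 \<Rightarrow> real) \<Rightarrow> (real^3 \<Rightarrow> real) \<Rightarrow> (real^3 \<Rightarrow> real) \<Rightarrow>
     real \<Rightarrow> (real^3 \<Rightarrow> real) \<Rightarrow> (real^3 \<Rightarrow> real) \<Rightarrow> (real^3 \<Rightarrow> real) \<Rightarrow> (real^3 \<Rightarrow> real) \<Rightarrow>
     (real \<Rightarrow> real^3 \<Rightarrow> real) \<Rightarrow> (real \<Rightarrow> real^3 \<Rightarrow> real) \<Rightarrow> (real \<Rightarrow> real^3 \<Rightarrow> real) \<Rightarrow> bool" where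
  "weak_solution \<Omega> lam \<tau> C D p q0 VD nD n0p n0m np nm V \<longleftrightarrow>
     (\<forall>T>0. (\<lambda>t x. np t x - nD x / 2) \<in> W12 T \<Omega> \<and> (\<lambda>t x. nm t x - nD x / 2) \<in> W12 T \<Omega>) \<and>
     np \<in> C_L2 \<Omega> \<and> nm \<in> C_L2 \<Omega> \<and>
     (\<exists>K. AE t in lebesgue_on {0<..}. AE x in lebesgue_on \<Omega>.
        0 \<le> np t x \<and> np t x \<le> K \<and> 0 \<le> nm t x \<and> nm t x \<le> K) \<and>
     V \<in> Linf_bochner {0<..} (W2 q0 \<Omega>) (W2_norm q0 \<Omega>) \<and>
     (AE x in lebesgue_on \<Omega>. np 0 x = n0p x \<and> nm 0 x = n0m x) \<and>
     (\<exists>Fp Fm.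
        (\<forall>T>0. has_time_deriv \<Omega> T np Fp \<and> has_time_deriv \<Omega> T nm Fm) \<and>
        (AE t in lebesgue_on {0<..}. \<forall>\<phi>\<in>H01 \<Omega>.
           Fp t \<phi> + (LINT x|lebesgue_on \<Omega>. D x * (1 + p x) *
               ((wgrad \<Omega> (np t) x + np t x *\<^sub>R wgrad \<Omega> (V t) x) \<bullet> wgrad \<Omega> \<phi> x))
             = - (1 / (2 * \<tau>)) * (LINT x|lebesgue_on \<Omega>. (np t x - nm t x) * \<phi> x) \<and>
           Fm t \<phi> + (LINT x|lebesgue_on \<Omega>. D x * (1 - p x) *
               ((wgrad \<Omega> (nm t) x + nm t x *\<^sub>R wgrad \<Omega> (V t) x) \<bullet> wgrad \<Omega> \<phi> x))
             = (1 / (2 * \<tau>)) * (LINT x|lebesgue_on \<Omega>. (np t x - nm t x) * \<phi> x))) \<and>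
     (\<forall>t\<ge>0. (\<lambda>x. V t x - VD x) \<in> H01 \<Omega> \<and>
        (\<exists>w. has_weak_laplacian \<Omega> (V t) w \<and>
             (AE x in lebesgue_on \<Omega>. - lam\<^sup>2 * w x = np t x + nm t x - C x)))"

text \<open>The oriented integral \<open>\<integral>\<^sub>a\<^sup>y (log s - log a) ds\<close>, to be used with \<open>a = n\<^sub>D / 2 > 0\<close> and
  \<open>y \<ge> 0\<close>; the integrand is Lebesgue integrable also for \<open>y = 0\<close>.\<close>

definition entropy_density :: "real \<Rightarrow> real \<Rightarrow> real" where
  "entropy_density a y = (LBINT s=ereal a..ereal y. ln s - ln a)"

definition H0 ::
    "(real^3) set \<Rightarrow> real \<Rightarrow> (real^3 \<Rightarrow> real) \<Rightarrow> (real^3 \<Rightarrow> real) \<Rightarrow>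
     (real \<Rightarrow> real^3 \<Rightarrow> real) \<Rightarrow> (real \<Rightarrow> real^3 \<Rightarrow> real) \<Rightarrow> (real \<Rightarrow> real^3 \<Rightarrow> real) \<Rightarrow>
     real \<Rightarrow> real" where
  "H0 \<Omega> lam VD nD np nm V t =
     (LINT x|lebesgue_on \<Omega>.
        entropy_density (nD x / 2) (np t x) + entropy_density (nD x / 2) (nm t x) +
        lam\<^sup>2 / 2 * (norm (wgrad \<Omega> (\<lambda>x. V t x - VD x) x))\<^sup>2)"

end

theory Submission
  imports Defs "HOL-Analysis.Analysis"
begin

text \<open>With \<open>a = n\<^sub>D / 2\<close>, \<open>z\<^sub>\<plusminus> = n\<^sub>\<plusminus> / a\<close> and \<open>W = V - V\<^sub>D\<close>, the equilibrium condition gives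
  \<open>\<nabla>n\<^sub>\<plusminus> + n\<^sub>\<plusminus>\<nabla>V = a (\<nabla>z\<^sub>\<plusminus> + z\<^sub>\<plusminus>\<nabla>W)\<close>, so formally \<open>log z\<^sub>\<plusminus> + W\<close> is an admissible test function that
  makes the fluxes dissipative and the reaction term nonnegative. Since \<open>log z\<^sub>\<plusminus>\<close> need not belong to
  \<open>H01\<close>, the densities are shifted by \<open>\<epsilon> a\<close>; completing the square shows that the shift costs at most
  \<open>\<epsilon> a |\<nabla>W|\<^sup>2 / 4\<close>, which vanishes as \<open>\<epsilon> \<rightarrow> 0\<close>.

  No chain rule in time is needed: by convexity, the increment of the regularised energy over
  \<open>[t - h, t]\<close> is at most the integral over \<open>r\<close> of \<open>\<partial>\<^sub>tn\<^sub>\<plusminus>(r)\<close> paired with the test function at the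
  fixed time \<open>t\<close>. Replacing \<open>\<partial>\<^sub>tn\<^sub>\<plusminus>(r)\<close> by \<open>\<partial>\<^sub>tn\<^sub>\<plusminus>(t)\<close> produces an error that is \<open>o(h)\<close> after integration in
  \<open>t\<close>, because \<open>n\<^sub>\<plusminus> - a \<in> L\<^sup>2(0,T;H01)\<close> is close to a continuous function of time.\<close>

section \<open>Square integrable functions\<close>

text \<open>The order of the limits is what makes the argument work. For fixed
  \<open>\<epsilon>\<close> the test functions at time \<open>t\<close> are bounded in
  \<open>H01\<close> by a constant of order \<open>1 / \<epsilon>\<close> times
  \<open>density_norm t\<close>, which is only square integrable in \<open>t\<close>. The error of
  replacing the derivatives at \<open>r\<close> by those at \<open>t\<close> is a product of this
  norm with an \<open>H01\<close> distance between the densities at the two times. Young's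
  inequality with weight \<open>\<theta>\<close> splits it into \<open>\<theta>\<close> times an
  integrable function and \<open>1 / \<theta>\<close> times a squared distance of arbitrarily small
  integral. So \<open>h\<close> is chosen after \<open>\<theta>\<close>, and both are disposed of
  before \<open>\<epsilon>\<close> tends to 0. The increments are controlled at almost every
  \<open>t\<close> only; integrated over an interval they telescope to averages of the energy over
  windows of length \<open>h\<close> at its two ends, and continuity of the energy in time turns
  these into values. In the energy itself the Poisson equation rewrites the increment of the field
  term as a pairing of the increments of \<open>np + nm\<close> with \<open>W\<close>, which is how
  \<open>W\<close> enters the test function.\<close>

definition sq_int :: "'a measure \<Rightarrow> ('a \<Rightarrow> 'b::euclidean_space) \<Rightarrow> bool" where
  "sq_int M f \<longleftrightarrow> f \<in> borel_measurable M \<and> integrable M (\<lambda>x. (norm (f x))\<^sup>2)"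

text \<open>The measure is arbitrary because square integrability is needed over
  \<open>\<Omega>\<close> and over intervals of time. Plain squares replace \<open>powr 2\<close>;
  \<open>Lp2_iff\<close> and \<open>Lp_norm2\<close> are the bridge to the spaces of the
  statement.\<close>

definition L2norm :: "'a measure \<Rightarrow> ('a \<Rightarrow> 'b::euclidean_space) \<Rightarrow> real" where
  "L2norm M f = sqrt (LINT x|M. (norm (f x))\<^sup>2)"

lemma sq_int_measurable: "sq_int M f \<Longrightarrow> f \<in> borel_measurable M"
  by (simp add: sq_int_def)

lemma sq_int_integrable: "sq_int M f \<Longrightarrow> integrable M (\<lambda>x. (norm (f x))\<^sup>2)"
  by (simp add: sq_int_def)

lemma L2norm_nonneg [simp]: "0 \<le> L2norm M f"
  by (simp add: L2norm_def)

lemma L2norm_sq: "(L2norm M f)\<^sup>2 = (LINT x|M. (norm (f x))\<^sup>2)"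
  by (simp add: L2norm_def)

lemma sq_int_bound:
  assumes "f \<in> borel_measurable M" "integrable M g" "AE x in M. (norm (f x))\<^sup>2 \<le> g x"
  shows "sq_int M f"
  unfolding sq_int_def
proof
  show "integrable M (\<lambda>x. (norm (f x))\<^sup>2)"
    by (rule Bochner_Integration.integrable_bound[OF assms(2)]) (use assms in \<open>auto elim!: eventually_mono\<close>)
qed fact

lemma sq_int_mono:
  assumes "f \<in> borel_measurable M" "sq_int M g" "AE x in M. norm (f x) \<le> c * norm (g x)"
  shows "sq_int M f"
proof (rule sq_int_bound)
  show "integrable M (\<lambda>x. c\<^sup>2 * (norm (g x))\<^sup>2)"
    using assms(2) by (simp add: sq_int_def)
  show "AE x in M. (norm (f x))\<^sup>2 \<le> c\<^sup>2 * (norm (g x))\<^sup>2"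
    using assms(3) by eventually_elim (metis norm_ge_zero power_mono power_mult_distrib)
qed fact

lemma L2norm_mono:
  assumes "sq_int M g" "AE x in M. norm (f x) \<le> c * norm (g x)" "0 \<le> c"
  shows "L2norm M f \<le> c * L2norm M g"
proof -
  have "(LINT x|M. (norm (f x))\<^sup>2) \<le> (LINT x|M. c\<^sup>2 * (norm (g x))\<^sup>2)"
  proof (rule integral_mono_AE')
    show "integrable M (\<lambda>x. c\<^sup>2 * (norm (g x))\<^sup>2)"
      using assms(1) by (simp add: sq_int_def)
    show "AE x in M. (norm (f x))\<^sup>2 \<le> c\<^sup>2 * (norm (g x))\<^sup>2"
      using assms(2) by eventually_elim (metis norm_ge_zero power_mono power_mult_distrib)
  qed auto
  then have "L2norm M f \<le> sqrt (c\<^sup>2 * (LINT x|M. (norm (g x))\<^sup>2))"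
    by (simp add: L2norm_def)
  then show ?thesis using \<open>0 \<le> c\<close> by (simp add: L2norm_def real_sqrt_mult)
qed

lemma sq_int_add:
  assumes "sq_int M f" "sq_int M g"
  shows "sq_int M (\<lambda>x. f x + g x)"
proof (rule sq_int_bound)
  show "integrable M (\<lambda>x. 2 * (norm (f x))\<^sup>2 + 2 * (norm (g x))\<^sup>2)"
    using assms by (simp add: sq_int_def)
  have "(norm (a + b))\<^sup>2 \<le> 2 * (norm a)\<^sup>2 + 2 * (norm b)\<^sup>2" for a b :: 'b
  proof -
    have "(norm (a + b))\<^sup>2 \<le> (norm a + norm b)\<^sup>2" by (simp add: norm_triangle_ineq power_mono)
    also have "\<dots> \<le> 2 * (norm a)\<^sup>2 + 2 * (norm b)\<^sup>2" using sum_squares_bound[of "norm a" "norm b"] by (simp add: power2_sum)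
    finally show ?thesis .
  qed
  then show "AE x in M. (norm (f x + g x))\<^sup>2 \<le> 2 * (norm (f x))\<^sup>2 + 2 * (norm (g x))\<^sup>2" by simp
qed (use assms in \<open>auto simp: sq_int_def\<close>)

lemma sq_int_zero [simp]: "sq_int M (\<lambda>x. 0)"
  by (simp add: sq_int_def)

lemma sq_int_scaleR: "sq_int M f \<Longrightarrow> sq_int M (\<lambda>x. c *\<^sub>R f x)"
  by (rule sq_int_mono[where g=f and c="\<bar>c\<bar>"]) (auto simp: sq_int_def)

lemma sq_int_cmult: "sq_int M f \<Longrightarrow> sq_int M (\<lambda>x. c * f x :: real)"
  using sq_int_scaleR[of M f c] by simp

lemma sq_int_minus: "sq_int M f \<Longrightarrow> sq_int M (\<lambda>x. - f x)"
  by (simp add: sq_int_def)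

lemma sq_int_diff: "sq_int M f \<Longrightarrow> sq_int M g \<Longrightarrow> sq_int M (\<lambda>x. f x - g x)"
  using sq_int_add[of M f "\<lambda>x. - g x"] sq_int_minus[of M g] by simp

lemma sq_int_cong_AE:
  assumes "sq_int M f" "g \<in> borel_measurable M" "AE x in M. f x = g x"
  shows "sq_int M g"
  by (rule sq_int_mono[where g=f and c=1]) (use assms in auto)

lemma L2norm_cong_AE:
  assumes "AE x in M. f x = g x" "f \<in> borel_measurable M" "g \<in> borel_measurable M"
  shows "L2norm M f = L2norm M g"
  unfolding L2norm_def using assms
  by (intro arg_cong[where f=sqrt] integral_cong_AE) (auto elim!: eventually_mono)

lemma L2norm_scaleR: "L2norm M (\<lambda>x. c *\<^sub>R f x) = \<bar>c\<bar> * L2norm M f"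
  by (simp add: L2norm_def power_mult_distrib real_sqrt_mult)

lemma L2norm_minus_commute: "L2norm M (\<lambda>x. f x - g x) = L2norm M (\<lambda>x. g x - f x)"
  by (simp add: L2norm_def norm_minus_commute)

lemma sq_int_norm_mult:
  assumes "sq_int M f" "sq_int M g"
  shows "integrable M (\<lambda>x. norm (f x) * norm (g x))"
proof (rule Bochner_Integration.integrable_bound)
  show "integrable M (\<lambda>x. (norm (f x))\<^sup>2 + (norm (g x))\<^sup>2)"
    using assms by (simp add: sq_int_def)
  show "AE x in M. norm (norm (f x) * norm (g x)) \<le> norm ((norm (f x))\<^sup>2 + (norm (g x))\<^sup>2)"
  proof (rule AE_I2)
    fix x
    have "norm (f x) * norm (g x) \<le> (norm (f x))\<^sup>2 + (norm (g x))\<^sup>2"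
    proof -
      have "2 * (norm (f x) * norm (g x)) \<le> (norm (f x))\<^sup>2 + (norm (g x))\<^sup>2"
        using sum_squares_bound[of "norm (f x)" "norm (g x)"] by simp
      moreover have "0 \<le> norm (f x) * norm (g x)" by simp
      ultimately show ?thesis by linarith
    qed
    then show "norm (norm (f x) * norm (g x)) \<le> norm ((norm (f x))\<^sup>2 + (norm (g x))\<^sup>2)"
      by simp
  qed
qed (use assms in \<open>auto simp: sq_int_def\<close>)

text \<open>The quadratic form \<open>s^2 * A - 2 * s * t * I + t^2 * B\<close> is the integral of a
  square. Its values at \<open>(I, A)\<close> and \<open>(B, I)\<close> are \<open>A\<close> and
  \<open>B\<close> times \<open>A * B - I^2\<close>, so one of them settles the claim unless both
  integrals vanish.\<close>

lemma Cauchy_Schwarz_norm_integral: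
  assumes "sq_int M f" "sq_int M g"
  shows "(LINT x|M. norm (f x) * norm (g x)) \<le> L2norm M f * L2norm M g"
proof -
  define A where "A = (LINT x|M. (norm (f x))\<^sup>2)"
  define B where "B = (LINT x|M. (norm (g x))\<^sup>2)"
  define I where "I = (LINT x|M. norm (f x) * norm (g x))"
  have int: "integrable M (\<lambda>x. (norm (f x))\<^sup>2)" "integrable M (\<lambda>x. (norm (g x))\<^sup>2)"
    "integrable M (\<lambda>x. norm (f x) * norm (g x))"
    using assms sq_int_norm_mult by (auto simp: sq_int_def)
  have A0: "A \<ge> 0" and B0: "B \<ge> 0" and I0: "I \<ge> 0"
    by (auto simp: A_def B_def I_def)
  have *: "0 \<le> s\<^sup>2 * A - 2 * s * t * I + t\<^sup>2 * B" for s t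
  proof -
    have "0 \<le> (LINT x|M. (s * norm (f x) - t * norm (g x))\<^sup>2)" by simp
    also have "\<dots> = (LINT x|M. s\<^sup>2 * (norm (f x))\<^sup>2 - (2 * s * t) * (norm (f x) * norm (g x)) + t\<^sup>2 * (norm (g x))\<^sup>2)"
      by (intro Bochner_Integration.integral_cong) (auto simp: power2_diff algebra_simps power_mult_distrib)
    also have "\<dots> = s\<^sup>2 * A - 2 * s * t * I + t\<^sup>2 * B"
      using int unfolding A_def B_def I_def by simp
    finally show ?thesis .
  qed
  have "I\<^sup>2 \<le> A * B"
  proof (cases "A > 0 \<or> B > 0")
    case True
    then show ?thesis
    proof
      assume "A > 0"
      have "0 \<le> A * (A * B - I\<^sup>2)"
        using *[of I A] by (simp add: algebra_simps power2_eq_square)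
      with \<open>A > 0\<close> show ?thesis by (simp add: zero_le_mult_iff)
    next
      assume "B > 0"
      have "0 \<le> B * (A * B - I\<^sup>2)"
        using *[of B I] by (simp add: algebra_simps power2_eq_square)
      with \<open>B > 0\<close> show ?thesis by (simp add: zero_le_mult_iff)
    qed
  next
    case False
    then have "A = 0" "B = 0" using A0 B0 by auto
    with *[of 1 1] I0 show ?thesis by simp
  qed
  then have "I \<le> sqrt (A * B)"
    using I0 real_le_rsqrt by blast
  then show ?thesis
    by (simp add: I_def A_def B_def L2norm_def real_sqrt_mult)
qed

lemma sq_int_mult_integrable:
  fixes f g :: "'a \<Rightarrow> real"
  assumes "sq_int M f" "sq_int M g"
  shows "integrable M (\<lambda>x. f x * g x)"
  by (rule Bochner_Integration.integrable_bound[OF sq_int_norm_mult[OF assms]])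
     (use assms in \<open>auto simp: sq_int_def abs_mult\<close>)

lemma sq_int_inner_integrable:
  assumes "sq_int M f" "sq_int M g"
  shows "integrable M (\<lambda>x. f x \<bullet> g x)"
  by (rule Bochner_Integration.integrable_bound[OF sq_int_norm_mult[OF assms]])
     (use assms in \<open>auto simp: sq_int_def Cauchy_Schwarz_ineq2\<close>)

lemma sq_int_scaleR_integrable:
  fixes f :: "'a \<Rightarrow> real"
  assumes "sq_int M f" "sq_int M g"
  shows "integrable M (\<lambda>x. f x *\<^sub>R g x)"
  by (rule Bochner_Integration.integrable_bound[OF sq_int_norm_mult[OF assms]])
     (use assms in \<open>auto simp: sq_int_def\<close>)

lemma Cauchy_Schwarz_integral:
  assumes "sq_int M f" "sq_int M g"
  shows "\<bar>LINT x|M. f x \<bullet> g x\<bar> \<le> L2norm M f * L2norm M g"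
proof -
  have "\<bar>LINT x|M. f x \<bullet> g x\<bar> \<le> (LINT x|M. \<bar>f x \<bullet> g x\<bar>)" by (rule integral_abs_bound)
  also have "\<dots> \<le> (LINT x|M. norm (f x) * norm (g x))"
    by (intro integral_mono integrable_abs sq_int_inner_integrable sq_int_norm_mult assms Cauchy_Schwarz_ineq2)
  also have "\<dots> \<le> L2norm M f * L2norm M g" by (rule Cauchy_Schwarz_norm_integral[OF assms])
  finally show ?thesis .
qed

lemma L2norm_triangle:
  assumes "sq_int M f" "sq_int M g"
  shows "L2norm M (\<lambda>x. f x + g x) \<le> L2norm M f + L2norm M g"
proof -
  have "(L2norm M (\<lambda>x. f x + g x))\<^sup>2 \<le> (LINT x|M. (norm (f x))\<^sup>2 + 2 * (norm (f x) * norm (g x)) + (norm (g x))\<^sup>2)"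
    unfolding L2norm_sq
  proof (rule integral_mono)
    show "integrable M (\<lambda>x. (norm (f x + g x))\<^sup>2)" using sq_int_add[OF assms] by (simp add: sq_int_def)
    show "integrable M (\<lambda>x. (norm (f x))\<^sup>2 + 2 * (norm (f x) * norm (g x)) + (norm (g x))\<^sup>2)"
      using assms sq_int_norm_mult[OF assms] by (simp add: sq_int_def)
    fix x
    have "(norm (f x + g x))\<^sup>2 \<le> (norm (f x) + norm (g x))\<^sup>2" by (simp add: norm_triangle_ineq power_mono)
    then show "(norm (f x + g x))\<^sup>2 \<le> (norm (f x))\<^sup>2 + 2 * (norm (f x) * norm (g x)) + (norm (g x))\<^sup>2"
      by (simp add: power2_sum)
  qed
  also have "\<dots> = (L2norm M f)\<^sup>2 + 2 * (LINT x|M. norm (f x) * norm (g x)) + (L2norm M g)\<^sup>2"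
    using assms sq_int_norm_mult[OF assms] by (simp add: sq_int_def L2norm_sq)
  also have "\<dots> \<le> (L2norm M f)\<^sup>2 + 2 * (L2norm M f * L2norm M g) + (L2norm M g)\<^sup>2"
    using Cauchy_Schwarz_norm_integral[OF assms] by simp
  also have "\<dots> = (L2norm M f + L2norm M g)\<^sup>2" by (simp add: power2_sum)
  finally show ?thesis by (meson L2norm_nonneg add_nonneg_nonneg power2_le_imp_le)
qed

lemma L2norm_triangle_diff:
  assumes "sq_int M f" "sq_int M g"
  shows "L2norm M (\<lambda>x. f x - g x) \<le> L2norm M f + L2norm M g"
  using L2norm_triangle[OF assms(1) sq_int_minus[OF assms(2)]]
  by (simp add: L2norm_def)

lemma L2norm_triangle3:
  assumes "sq_int M f" "sq_int M g" "sq_int M h"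
  shows "L2norm M (\<lambda>x. f x - h x) \<le> L2norm M (\<lambda>x. f x - g x) + L2norm M (\<lambda>x. g x - h x)"
  using L2norm_triangle[OF sq_int_diff[OF assms(1,2)] sq_int_diff[OF assms(2,3)]] by simp

lemma L2norm_rev_triangle:
  assumes "sq_int M f" "sq_int M g"
  shows "\<bar>L2norm M f - L2norm M g\<bar> \<le> L2norm M (\<lambda>x. f x - g x)"
proof -
  have "L2norm M f \<le> L2norm M (\<lambda>x. f x - g x) + L2norm M g"
    using L2norm_triangle[OF sq_int_diff[OF assms] assms(2)] by simp
  moreover have "L2norm M g \<le> L2norm M (\<lambda>x. g x - f x) + L2norm M f"
    using L2norm_triangle[OF sq_int_diff[OF assms(2,1)] assms(1)] by simp
  ultimately show ?thesis by (simp add: L2norm_minus_commute[of M g f])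
qed

lemma L2norm_bounded_mult:
  fixes b :: "'a \<Rightarrow> real"
  assumes "sq_int M f" "b \<in> borel_measurable M" "AE x in M. \<bar>b x\<bar> \<le> K" "0 \<le> K"
  shows "sq_int M (\<lambda>x. b x *\<^sub>R f x)" "L2norm M (\<lambda>x. b x *\<^sub>R f x) \<le> K * L2norm M f"
proof -
  have *: "AE x in M. norm (b x *\<^sub>R f x) \<le> K * norm (f x)"
    using assms(3) by eventually_elim (simp add: mult_right_mono)
  show "sq_int M (\<lambda>x. b x *\<^sub>R f x)"
    by (rule sq_int_mono[OF _ assms(1) *]) (use assms in \<open>auto simp: sq_int_def\<close>)
  show "L2norm M (\<lambda>x. b x *\<^sub>R f x) \<le> K * L2norm M f"
    by (rule L2norm_mono[OF assms(1) * assms(4)])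
qed

lemma L2norm_bounded_mult_right:
  fixes f :: "'a \<Rightarrow> real" and b :: "'a \<Rightarrow> 'b::euclidean_space"
  assumes "sq_int M f" "b \<in> borel_measurable M" "AE x in M. norm (b x) \<le> K" "0 \<le> K"
  shows "sq_int M (\<lambda>x. f x *\<^sub>R b x)" "L2norm M (\<lambda>x. f x *\<^sub>R b x) \<le> K * L2norm M f"
proof -
  have *: "AE x in M. norm (f x *\<^sub>R b x) \<le> K * norm (f x)"
    using assms(3) by eventually_elim (simp add: mult.commute[of K] mult_left_mono)
  show "sq_int M (\<lambda>x. f x *\<^sub>R b x)"
    by (rule sq_int_mono[OF _ assms(1) *]) (use assms in \<open>auto simp: sq_int_def\<close>)
  show "L2norm M (\<lambda>x. f x *\<^sub>R b x) \<le> K * L2norm M f"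
    by (rule L2norm_mono[OF assms(1) * assms(4)])
qed

lemma tendsto_integral_inner:
  assumes "\<And>k. sq_int M (f k)" "sq_int M f0" "sq_int M g"
    and "((\<lambda>k. L2norm M (\<lambda>x. f k x - f0 x)) \<longlongrightarrow> 0) F"
  shows "((\<lambda>k. LINT x|M. f k x \<bullet> g x) \<longlongrightarrow> (LINT x|M. f0 x \<bullet> g x)) F"
proof (rule tendsto_dist_iff[THEN iffD2], rule Lim_null_comparison)
  show "\<forall>\<^sub>F k in F. norm (dist (LINT x|M. f k x \<bullet> g x) (LINT x|M. f0 x \<bullet> g x)) \<le> L2norm M (\<lambda>x. f k x - f0 x) * L2norm M g"
  proof (rule always_eventually, rule allI)
    fix k
    have "(LINT x|M. f k x \<bullet> g x) - (LINT x|M. f0 x \<bullet> g x) = (LINT x|M. (f k x - f0 x) \<bullet> g x)"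
      using assms by (simp add: inner_diff_left sq_int_inner_integrable)
    then show "norm (dist (LINT x|M. f k x \<bullet> g x) (LINT x|M. f0 x \<bullet> g x)) \<le> L2norm M (\<lambda>x. f k x - f0 x) * L2norm M g"
      using Cauchy_Schwarz_integral[OF sq_int_diff[OF assms(1)[of k] assms(2)] assms(3)]
      by (simp add: dist_real_def)
  qed
  show "((\<lambda>k. L2norm M (\<lambda>x. f k x - f0 x) * L2norm M g) \<longlongrightarrow> 0) F"
    using tendsto_mult_right[OF assms(4), of "L2norm M g"] by simp
qed

lemma L2_dominated_convergence:
  fixes f :: "nat \<Rightarrow> 'a \<Rightarrow> 'b::euclidean_space"
  assumes "\<And>k. f k \<in> borel_measurable M" "f0 \<in> borel_measurable M"
    and "integrable M h" "\<And>k. AE x in M. (norm (f k x - f0 x))\<^sup>2 \<le> h x"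
    and "AE x in M. (\<lambda>k. f k x) \<longlonglongrightarrow> f0 x"
  shows "(\<lambda>k. L2norm M (\<lambda>x. f k x - f0 x)) \<longlonglongrightarrow> 0"
proof -
  have "(\<lambda>k. LINT x|M. (norm (f k x - f0 x))\<^sup>2) \<longlonglongrightarrow> (LINT x|M. 0)"
  proof (rule integral_dominated_convergence[where w=h])
    show "AE x in M. (\<lambda>k. (norm (f k x - f0 x))\<^sup>2) \<longlonglongrightarrow> 0"
      using assms(5)
    proof eventually_elim
      case (elim x)
      then have "(\<lambda>k. f k x - f0 x) \<longlonglongrightarrow> 0" by (simp add: LIM_zero)
      then have "(\<lambda>k. (norm (f k x - f0 x))\<^sup>2) \<longlonglongrightarrow> (norm (0::'b))\<^sup>2" by (intro tendsto_intros)
      then show ?case by simp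
    qed
  qed (use assms in auto)
  then have "(\<lambda>k. sqrt (LINT x|M. (norm (f k x - f0 x))\<^sup>2)) \<longlonglongrightarrow> sqrt 0"
    by (intro tendsto_real_sqrt) simp
  then show ?thesis by (simp add: L2norm_def)
qed

lemma L2_AE_subseq:
  assumes "\<And>k::nat. sq_int M (f k)" "sq_int M f0" "(\<lambda>k. L2norm M (\<lambda>x. f k x - f0 x)) \<longlonglongrightarrow> 0"
  obtains r where "strict_mono r" "AE x in M. (\<lambda>k. f (r k) x) \<longlonglongrightarrow> f0 x"
proof -
  have "(\<lambda>k. (L2norm M (\<lambda>x. f k x - f0 x))\<^sup>2) \<longlonglongrightarrow> 0\<^sup>2"
    using assms(3) by (intro tendsto_intros)
  then have "(\<lambda>k. LINT x|M. norm ((norm (f k x - f0 x))\<^sup>2)) \<longlonglongrightarrow> 0"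
    by (simp add: L2norm_sq)
  from tendsto_L1_AE_subseq[OF _ this] assms sq_int_diff[of M]
  obtain r :: "nat \<Rightarrow> nat" where r: "strict_mono r" "AE x in M. (\<lambda>k. (norm (f (r k) x - f0 x))\<^sup>2) \<longlonglongrightarrow> 0"
    by (auto simp: sq_int_def)
  have "AE x in M. (\<lambda>k. f (r k) x) \<longlonglongrightarrow> f0 x"
    using r(2)
  proof eventually_elim
    case (elim x)
    then have "(\<lambda>k. sqrt ((norm (f (r k) x - f0 x))\<^sup>2)) \<longlonglongrightarrow> sqrt 0" by (intro tendsto_real_sqrt)
    then have "(\<lambda>k. norm (f (r k) x - f0 x)) \<longlonglongrightarrow> 0" by simp
    then show ?case by (simp add: LIM_zero_iff tendsto_norm_zero_iff)
  qed
  with r(1) show ?thesis using that by blast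
qed

lemma L2norm_0_AE:
  assumes "sq_int M f" "L2norm M f = 0"
  shows "AE x in M. f x = 0"
proof -
  have "AE x in M. (norm (f x))\<^sup>2 = 0"
    using assms integral_nonneg_eq_0_iff_AE[of M "\<lambda>x. (norm (f x))\<^sup>2"]
    by (simp add: sq_int_def L2norm_def)
  then show ?thesis by simp
qed

lemma (in finite_measure) sq_int_imp_integrable:
  assumes "sq_int M f"
  shows "integrable M f"
proof (rule Bochner_Integration.integrable_bound)
  show "integrable M (\<lambda>x. 1 + (norm (f x))\<^sup>2)" using assms by (simp add: sq_int_def)
  have "a \<le> 1 + a\<^sup>2" for a :: real
    using zero_le_power2[of "a - 1/2"] by (simp add: power2_diff field_simps)
  then show "AE x in M. norm (f x) \<le> norm (1 + (norm (f x))\<^sup>2)"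
    by simp
qed (use assms in \<open>simp add: sq_int_def\<close>)

lemma (in finite_measure) sq_int_bounded:
  assumes "f \<in> borel_measurable M" "AE x in M. norm (f x) \<le> K"
  shows "sq_int M f"
proof (rule sq_int_bound)
  show "AE x in M. (norm (f x))\<^sup>2 \<le> K\<^sup>2" using assms(2) by eventually_elim (simp add: power_mono)
qed (use assms in auto)

lemma Lp2_iff: "f \<in> Lp 2 \<Omega> \<longleftrightarrow> sq_int (lebesgue_on \<Omega>) f"
  by (simp add: Lp_def sq_int_def)

lemma Lp_norm2: "Lp_norm 2 \<Omega> f = L2norm (lebesgue_on \<Omega>) f"
  by (simp add: Lp_norm_def L2norm_def powr_half_sqrt)

section \<open>Calculus of smooth functions\<close>

lemma grad_inner_Basis: "b \<in> Basis \<Longrightarrow> grad f x \<bullet> b = frechet_derivative f (at x) b"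
  by (simp add: grad_def inner_sum_left inner_Basis if_distrib cong: if_cong)

lemma has_derivative_grad:
  assumes "f differentiable (at x)"
  shows "(f has_derivative (\<lambda>h. grad f x \<bullet> h)) (at x)"
proof -
  have D: "(f has_derivative frechet_derivative f (at x)) (at x)"
    using assms by (simp add: frechet_derivative_works)
  interpret bounded_linear "frechet_derivative f (at x)" by (rule has_derivative_bounded_linear[OF D])
  have "frechet_derivative f (at x) h = grad f x \<bullet> h" for h
  proof -
    have "frechet_derivative f (at x) h = frechet_derivative f (at x) (\<Sum>b\<in>Basis. (h \<bullet> b) *\<^sub>R b)"
      by (simp add: euclidean_representation)
    also have "\<dots> = (\<Sum>b\<in>Basis. (h \<bullet> b) * frechet_derivative f (at x) b)"
      by (simp add: sum scaleR)
    also have "\<dots> = grad f x \<bullet> h"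
      by (simp add: grad_def inner_sum_left inner_commute[of h] mult.commute)
    finally show ?thesis .
  qed
  then have "frechet_derivative f (at x) = (\<lambda>h. grad f x \<bullet> h)" by (rule ext)
  with D show ?thesis by argo
qed

lemma gradI:
  assumes "(f has_derivative (\<lambda>h. v \<bullet> h)) (at x)"
  shows "grad f x = v"
proof (rule euclidean_eqI)
  fix b :: 'a assume "b \<in> Basis"
  then show "grad f x \<bullet> b = v \<bullet> b"
    using frechet_derivative_at[OF assms] by (simp add: grad_inner_Basis fun_eq_iff)
qed

text \<open>Trades the \<open>frechet_derivative\<close> in the recursion for any explicit gradient
  field, so that inductions on \<open>k\<close> only have to exhibit a gradient with
  \<open>Ck\<close> components.\<close>

lemma Ck_SucI:
  assumes "\<And>x. (f has_derivative (\<lambda>h. g x \<bullet> h)) (at x)" "\<And>b. b \<in> Basis \<Longrightarrow> Ck k (\<lambda>x. g x \<bullet> b)"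
  shows "Ck (Suc k) f"
proof -
  have "frechet_derivative f (at x) = (\<lambda>h. g x \<bullet> h)" for x
    using frechet_derivative_at[OF assms(1)] by simp
  then show ?thesis
    using assms by (auto simp: differentiable_on_def intro: differentiableI)
qed

lemma Ck_Suc_differentiable: "Ck (Suc k) f \<Longrightarrow> f differentiable (at x)"
  by (simp add: differentiable_on_def)

lemma Ck_Suc_grad: "Ck (Suc k) f \<Longrightarrow> b \<in> Basis \<Longrightarrow> Ck k (\<lambda>x. grad f x \<bullet> b)"
  by (simp add: grad_inner_Basis)

lemma Ck_continuous: "Ck k f \<Longrightarrow> continuous_on UNIV f"
proof (cases k)
  case (Suc m)
  assume "Ck k f"
  then have "f differentiable_on UNIV" unfolding Suc Ck.simps by blast
  then show ?thesis by (rule differentiable_imp_continuous_on)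
qed simp

lemma Ck_SucD: "Ck (Suc k) f \<Longrightarrow> Ck k f"
proof (induction k arbitrary: f)
  case 0
  from Ck_continuous[OF this] show ?case by simp
next
  case (Suc k)
  have d: "f differentiable_on UNIV" using Suc.prems by simp
  have "Ck k (\<lambda>x. frechet_derivative f (at x) b)" if "b \<in> Basis" for b
  proof -
    have "Ck (Suc k) (\<lambda>x. frechet_derivative f (at x) b)"
      using Suc.prems that unfolding Ck.simps(2)[of "Suc k"] by blast
    then show ?thesis by (rule Suc.IH)
  qed
  with d show ?case by simp
qed

lemma Ck_const: "Ck k (\<lambda>x. c)"
proof (induction k arbitrary: c)
  case 0 then show ?case by simp
next
  case (Suc k)
  show ?case by (rule Ck_SucI[where g="\<lambda>_. 0"]) (auto simp: Suc)
qed

lemma Ck_inner_const: "Ck k (\<lambda>x. x \<bullet> a)"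
proof (cases k)
  case (Suc m)
  show ?thesis unfolding Suc
    by (rule Ck_SucI[where g="\<lambda>_. a"])
       (auto intro!: derivative_eq_intros Ck_const simp: inner_commute)
qed (auto intro!: continuous_intros)

lemma has_derivative_add_inner:
  assumes "(f has_derivative (\<lambda>h. v \<bullet> h)) F" "(g has_derivative (\<lambda>h. w \<bullet> h)) F"
  shows "((\<lambda>x. f x + g x) has_derivative (\<lambda>h. (v + w) \<bullet> h)) F"
  using has_derivative_add[OF assms] by (simp add: inner_add_left)

lemma has_derivative_mult_inner:
  fixes f g :: "'a::euclidean_space \<Rightarrow> real"
  assumes "(f has_derivative (\<lambda>h. v \<bullet> h)) (at x)" "(g has_derivative (\<lambda>h. w \<bullet> h)) (at x)"
  shows "((\<lambda>x. f x * g x) has_derivative (\<lambda>h. (f x *\<^sub>R w + g x *\<^sub>R v) \<bullet> h)) (at x)"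
  using has_derivative_mult[OF assms] by (simp add: inner_add_left algebra_simps)

lemma Ck_add: "Ck k f \<Longrightarrow> Ck k g \<Longrightarrow> Ck k (\<lambda>x. f x + g x)"
proof (induction k arbitrary: f g)
  case 0 then show ?case by (auto intro: continuous_intros)
next
  case (Suc k)
  show ?case
    by (rule Ck_SucI[OF has_derivative_add_inner[OF has_derivative_grad has_derivative_grad]])
       (use Suc in \<open>auto simp: inner_add_left intro!: Ck_Suc_differentiable Suc.IH Ck_Suc_grad simp del: Ck.simps\<close>)
qed

lemma Ck_mult: "Ck k f \<Longrightarrow> Ck k g \<Longrightarrow> Ck k (\<lambda>x. f x * g x)"
proof (induction k arbitrary: f g)
  case 0 then show ?case by (auto intro: continuous_intros)
next
  case (Suc k)
  show ?case
    by (rule Ck_SucI[OF has_derivative_mult_inner[OF has_derivative_grad has_derivative_grad]])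
       (use Suc in \<open>auto simp: inner_add_left intro!: Ck_Suc_differentiable Ck_add Suc.IH Ck_Suc_grad intro: Ck_SucD simp del: Ck.simps\<close>)
qed

lemma Ck_sum: "(\<And>i. i \<in> I \<Longrightarrow> Ck k (f i)) \<Longrightarrow> Ck k (\<lambda>x. \<Sum>i\<in>I. f i x)"
  by (induction I rule: infinite_finite_induct) (auto intro: Ck_const Ck_add)

section \<open>A smooth function that is flat at the origin\<close>

definition flat :: "nat \<Rightarrow> real \<Rightarrow> real" where
  "flat k s = (if s \<le> 0 then 0 else (1 / s) ^ k * exp (- (1 / s)))"

lemma flat_tendsto_0: "(flat k \<longlongrightarrow> 0) (at 0)"
proof -
  have "((\<lambda>s::real. (1 / s) ^ k / exp (1 / s)) \<longlongrightarrow> 0) (at_right 0)"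
    using filterlim_compose[OF tendsto_power_div_exp_0 filterlim_inverse_at_top_right, of k]
    by (simp add: inverse_eq_divide)
  then have R: "(flat k \<longlongrightarrow> 0) (at_right 0)"
  proof (rule Lim_transform_eventually)
    show "\<forall>\<^sub>F s in at_right 0. (1 / s) ^ k / exp (1 / s) = flat k s"
      by (simp add: eventually_at_filter flat_def exp_minus divide_inverse)
  qed
  have L: "(flat k \<longlongrightarrow> 0) (at_left 0)"
    by (rule Lim_transform_eventually[OF tendsto_const]) (simp add: eventually_at_filter flat_def)
  show ?thesis using L R by (simp add: filterlim_at_split)
qed

text \<open>The classical function is \<open>flat 0\<close>. The powers of \<open>1 / s\<close> are
  part of the definition because derivatives then stay in the span of the family, which closes the
  induction in \<open>Ck_flat\<close>.\<close>

lemma flat_deriv: "(flat k has_real_derivative (flat (k + 2) s - real k * flat (Suc k) s)) (at s)"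
proof -
  consider "s < 0" | "s = 0" | "s > 0" by linarith
  then show ?thesis
  proof cases
    case 1
    have "((\<lambda>_. 0) has_real_derivative 0) (at s)" by simp
    then have "(flat k has_real_derivative 0) (at s)"
      by (rule has_field_derivative_transform_within_open[where S="{..<0}"]) (use 1 in \<open>auto simp: flat_def\<close>)
    with 1 show ?thesis by (simp add: flat_def)
  next
    case 2
    \<comment> \<open>At the origin the difference quotient of \<open>flat k\<close> is
      \<open>flat (Suc k)\<close> itself.\<close>
    have "((\<lambda>h. (flat k (0 + h) - flat k 0) / h) \<longlongrightarrow> 0) (at 0)"
    proof (rule Lim_transform_eventually[OF flat_tendsto_0[of "Suc k"]])
      show "\<forall>\<^sub>F h in at 0. flat (Suc k) h = (flat k (0 + h) - flat k 0) / h"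
        by (simp add: eventually_at_filter flat_def)
    qed
    moreover have "flat (k + 2) s - real k * flat (Suc k) s = 0" using 2 by (simp add: flat_def)
    ultimately show ?thesis using 2 unfolding DERIV_def by simp
  next
    case 3
    have "((\<lambda>s. (1 / s) ^ k * exp (- (1 / s))) has_real_derivative
        (real k * (1 / s) ^ (k - 1) * (- (1 / s\<^sup>2))) * exp (- (1 / s)) + (1 / s) ^ k * (exp (- (1 / s)) * (1 / s\<^sup>2))) (at s)"
      using 3 by (auto intro!: derivative_eq_intros simp: power2_eq_square)
    moreover have "(real k * (1 / s) ^ (k - 1) * (- (1 / s\<^sup>2))) * exp (- (1 / s)) + (1 / s) ^ k * (exp (- (1 / s)) * (1 / s\<^sup>2))
        = flat (k + 2) s - real k * flat (Suc k) s"
      using 3 by (cases k) (auto simp: flat_def power2_eq_square algebra_simps add_divide_distrib)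
    ultimately have "((\<lambda>s. (1 / s) ^ k * exp (- (1 / s))) has_real_derivative flat (k + 2) s - real k * flat (Suc k) s) (at s)"
      by simp
    then show ?thesis
      by (rule has_field_derivative_transform_within_open[where S="{0<..}"]) (use 3 in \<open>auto simp: flat_def\<close>)
  qed
qed

lemma has_derivative_compose_inner:
  assumes "(G has_real_derivative c) (at (f x))" "(f has_derivative (\<lambda>h. v \<bullet> h)) (at x)"
  shows "((\<lambda>x. G (f x)) has_derivative (\<lambda>h. (c *\<^sub>R v) \<bullet> h)) (at x)"
  using DERIV_compose_FDERIV[OF assms] by (simp add: mult.commute)

lemma Ck_flat:
  assumes "\<And>k. Ck k q"
  shows "Ck k (\<lambda>x. flat j (q x))"
proof (induction k arbitrary: j)
  case 0
  have "continuous_on UNIV (flat j)"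
    using flat_deriv by (auto intro!: continuous_at_imp_continuous_on DERIV_isCont)
  then show ?case using Ck_continuous[OF assms[of 0]]
    by (auto intro: continuous_on_compose2)
next
  case (Suc k)
  have q: "q differentiable (at x)" for x using assms[of "Suc k"] Ck_Suc_differentiable by blast
  show ?case
  proof (rule Ck_SucI[OF has_derivative_compose_inner[OF flat_deriv has_derivative_grad[OF q]]])
    fix b :: 'a assume b: "b \<in> Basis"
    have "Ck k (\<lambda>x. (flat (j + 2) (q x) + (- real j) * flat (Suc j) (q x)) * (grad q x \<bullet> b))"
      by (intro Ck_mult Ck_add Ck_const Suc.IH Ck_Suc_grad[OF assms b])
    then show "Ck k (\<lambda>x. ((flat (j + 2) (q x) - real j * flat (Suc j) (q x)) *\<^sub>R grad q x) \<bullet> b)"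
      by simp
  qed
qed

section \<open>Test functions\<close>

lemma test_functions_Ck: "\<phi> \<in> test_functions \<Omega> \<Longrightarrow> Ck k \<phi>"
  by (simp add: test_functions_def)

lemma test_functionsI:
  assumes "\<And>k. Ck k \<phi>" "compact K" "K \<subseteq> \<Omega>" "\<And>x. x \<notin> K \<Longrightarrow> \<phi> x = 0"
  shows "\<phi> \<in> test_functions \<Omega>"
proof -
  have c1: "closure {x. \<phi> x \<noteq> 0} \<subseteq> K"
  proof (rule closure_minimal)
    show "{x. \<phi> x \<noteq> 0} \<subseteq> K" using assms(4) by blast
    show "closed K" by (rule compact_imp_closed[OF assms(2)])
  qed
  have c2: "compact (closure {x. \<phi> x \<noteq> 0})"
    using compact_Int_closed[OF assms(2) closed_closure, of "{x. \<phi> x \<noteq> 0}"] c1 by (simp add: Int_absorb1)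
  show ?thesis
    using assms(1) c2 order_trans[OF c1 assms(3)] unfolding test_functions_def by blast
qed

lemma test_functionsE:
  assumes "\<phi> \<in> test_functions \<Omega>"
  obtains K where "compact K" "K \<subseteq> \<Omega>" "\<And>x. x \<notin> K \<Longrightarrow> \<phi> x = 0" "\<And>x. x \<notin> K \<Longrightarrow> grad \<phi> x = 0"
proof -
  define K where "K = closure {x. \<phi> x \<noteq> 0}"
  have K: "compact K" "K \<subseteq> \<Omega>" using assms by (auto simp: test_functions_def K_def)
  have 0: "\<phi> x = 0" if "x \<notin> K" for x
    using that closure_subset[of "{x. \<phi> x \<noteq> 0}"] by (auto simp: K_def)
  have "grad \<phi> x = 0" if "x \<notin> K" for x
  proof (rule gradI)
    have "((\<lambda>_. 0) has_derivative (\<lambda>h. 0 \<bullet> h)) (at x)" by simp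
    then show "(\<phi> has_derivative (\<lambda>h. 0 \<bullet> h)) (at x)"
      by (rule has_derivative_transform_within_open[where s="- K"])
         (use that K 0 in \<open>auto simp: compact_imp_closed open_Compl\<close>)
  qed
  with K 0 show ?thesis using that by blast
qed

lemma test_functions_mult:
  assumes "\<phi> \<in> test_functions \<Omega>" "\<And>k. Ck k f"
  shows "(\<lambda>x. \<phi> x * f x) \<in> test_functions \<Omega>" "(\<lambda>x. f x * \<phi> x) \<in> test_functions \<Omega>"
proof -
  obtain K where K: "compact K" "K \<subseteq> \<Omega>" "\<And>x. x \<notin> K \<Longrightarrow> \<phi> x = 0"
    using test_functionsE[OF assms(1)] by metis
  show "(\<lambda>x. \<phi> x * f x) \<in> test_functions \<Omega>"
    by (rule test_functionsI[OF Ck_mult K(1,2)]) (use assms K test_functions_Ck in auto)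
  then show "(\<lambda>x. f x * \<phi> x) \<in> test_functions \<Omega>" by (simp add: mult.commute)
qed

lemma test_functions_add:
  assumes "\<phi> \<in> test_functions \<Omega>" "\<psi> \<in> test_functions \<Omega>"
  shows "(\<lambda>x. \<phi> x + \<psi> x) \<in> test_functions \<Omega>"
proof -
  obtain K where K: "compact K" "K \<subseteq> \<Omega>" "\<And>x. x \<notin> K \<Longrightarrow> \<phi> x = 0"
    using test_functionsE[OF assms(1)] by metis
  obtain L where L: "compact L" "L \<subseteq> \<Omega>" "\<And>x. x \<notin> L \<Longrightarrow> \<psi> x = 0"
    using test_functionsE[OF assms(2)] by metis
  show ?thesis
    by (rule test_functionsI[OF Ck_add compact_Un[OF K(1) L(1)]]) (use assms K L test_functions_Ck in auto)
qed

lemma test_functions_scale: "\<phi> \<in> test_functions \<Omega> \<Longrightarrow> (\<lambda>x. c * \<phi> x) \<in> test_functions \<Omega>"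
  using test_functions_mult(2)[OF _ Ck_const] .

lemma test_functions_diff:
  assumes "\<phi> \<in> test_functions \<Omega>" "\<psi> \<in> test_functions \<Omega>"
  shows "(\<lambda>x. \<phi> x - \<psi> x) \<in> test_functions \<Omega>"
  using test_functions_add[OF assms(1) test_functions_scale[OF assms(2), of "-1"]] by simp

lemma test_functions_partial:
  assumes "\<phi> \<in> test_functions \<Omega>" "b \<in> Basis"
  shows "(\<lambda>x. grad \<phi> x \<bullet> b) \<in> test_functions \<Omega>"
proof -
  obtain K where K: "compact K" "K \<subseteq> \<Omega>" "\<And>x. x \<notin> K \<Longrightarrow> grad \<phi> x = 0"
    using test_functionsE[OF assms(1)] by metis
  show ?thesis
    by (rule test_functionsI[OF Ck_Suc_grad K(1,2)]) (use assms K in \<open>auto simp: test_functions_Ck simp del: Ck.simps\<close>)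
qed

lemma test_functions_differentiable: "\<phi> \<in> test_functions \<Omega> \<Longrightarrow> \<phi> differentiable (at x)"
  using Ck_Suc_differentiable[OF test_functions_Ck] by blast

lemma test_functions_has_derivative:
  "\<phi> \<in> test_functions \<Omega> \<Longrightarrow> (\<phi> has_derivative (\<lambda>h. grad \<phi> x \<bullet> h)) (at x)"
  by (rule has_derivative_grad[OF test_functions_differentiable])

lemma test_functions_continuous: "\<phi> \<in> test_functions \<Omega> \<Longrightarrow> continuous_on UNIV \<phi>"
  using Ck_continuous[OF test_functions_Ck] by blast

lemma continuous_grad:
  assumes "\<And>b. b \<in> Basis \<Longrightarrow> continuous_on UNIV (\<lambda>x. g x \<bullet> b)"
  shows "continuous_on UNIV g"
proof -
  have "continuous_on UNIV (\<lambda>x. \<Sum>b\<in>Basis. (g x \<bullet> b) *\<^sub>R b)"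
    by (intro continuous_intros assms)
  then show ?thesis by (simp add: euclidean_representation)
qed

lemma test_functions_continuous_grad: "\<phi> \<in> test_functions \<Omega> \<Longrightarrow> continuous_on UNIV (grad \<phi>)"
  by (rule continuous_grad) (rule test_functions_continuous[OF test_functions_partial])

lemma grad_mult:
  assumes "f differentiable (at x)" "g differentiable (at x)"
  shows "grad (\<lambda>x. f x * g x) x = f x *\<^sub>R grad g x + g x *\<^sub>R grad f x"
  by (rule gradI[OF has_derivative_mult_inner[OF has_derivative_grad has_derivative_grad]]) fact+

lemma grad_diff:
  assumes "f differentiable (at x)" "g differentiable (at x)"
  shows "grad (\<lambda>x. f x - g x) x = grad f x - grad g x"
  by (rule gradI) (use has_derivative_diff[OF assms[THEN has_derivative_grad]] in \<open>simp add: inner_diff_left\<close>)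

section \<open>Continuous functions of compact support\<close>

lemma compactly_supported_bounded:
  fixes f :: "'a::euclidean_space \<Rightarrow> 'b::real_normed_vector"
  assumes "continuous_on UNIV f" "compact K" "\<And>x. x \<notin> K \<Longrightarrow> f x = 0"
  obtains B where "0 < B" "\<And>x. norm (f x) \<le> B"
proof -
  have "compact (f ` K)" using assms compact_continuous_image continuous_on_subset by blast
  then obtain B where "0 < B" "\<And>x. x \<in> K \<Longrightarrow> norm (f x) \<le> B"
    using compact_imp_bounded bounded_pos by (metis image_eqI)
  then have "norm (f x) \<le> B" for x using assms(3) by (cases "x \<in> K") auto
  with \<open>0 < B\<close> show ?thesis using that by blast
qed

lemma compactly_supported_integrable:
  fixes f :: "'a::euclidean_space \<Rightarrow> 'b::euclidean_space"
  assumes "continuous_on UNIV f" "compact K" "\<And>x. x \<notin> K \<Longrightarrow> f x = 0"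
  shows "integrable lborel f" "integrable lebesgue f"
proof -
  have "integrable lborel (\<lambda>x. indicator K x *\<^sub>R f x)"
    by (rule borel_integrable_compact[OF assms(2) continuous_on_subset[OF assms(1)]]) simp
  moreover have "(\<lambda>x. indicator K x *\<^sub>R f x) = f"
    using assms(3) by (auto simp: indicator_def fun_eq_iff)
  ultimately show "integrable lborel f" by simp
  then show "integrable lebesgue f"
    using integrable_completion[of f lborel] by auto
qed

lemma compact_thicken:
  fixes K :: "'a::euclidean_space set"
  assumes "compact K"
  shows "compact (\<Union>x\<in>K. cball x r)"
proof -
  have "(\<Union>x\<in>K. cball x r) = {x + y | x y. x \<in> K \<and> y \<in> cball 0 r}"
  proof (intro set_eqI iffI)
    fix z assume "z \<in> (\<Union>x\<in>K. cball x r)"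
    then obtain x where "x \<in> K" "dist x z \<le> r" by auto
    then have "z = x + (z - x) \<and> x \<in> K \<and> z - x \<in> cball 0 r" by (simp add: dist_norm norm_minus_commute)
    then show "z \<in> {x + y | x y. x \<in> K \<and> y \<in> cball 0 r}" by blast
  next
    fix z assume "z \<in> {x + y | x y. x \<in> K \<and> y \<in> cball 0 r}"
    then obtain x y where "x \<in> K" "norm y \<le> r" "z = x + y" by auto
    then have "x \<in> K \<and> z \<in> cball x r" by (simp add: dist_norm)
    then show "z \<in> (\<Union>x\<in>K. cball x r)" by blast
  qed
  then show ?thesis using compact_sums[OF assms compact_cball, of 0 r] by simp
qed

text \<open>Heine-Cantor on the closed 1-neighbourhood of \<open>K\<close>: if one of two points at
  distance below 1 lies in \<open>K\<close>, both lie in that neighbourhood, and otherwise both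
  values are 0. The bound \<open>d \<le> 1\<close> is passed on because mollification with radius
  below \<open>d\<close> then keeps the support in a fixed compact set.\<close>

lemma compactly_supported_uniformly_continuous:
  fixes f :: "'a::euclidean_space \<Rightarrow> 'b::real_normed_vector"
  assumes "continuous_on UNIV f" "compact K" "\<And>x. x \<notin> K \<Longrightarrow> f x = 0" "0 < e"
  obtains d where "0 < d" "d \<le> 1" "\<And>x y. dist x y < d \<Longrightarrow> dist (f x) (f y) < e"
proof -
  define L where "L = (\<Union>x\<in>K. cball x 1)"
  have L: "compact L" unfolding L_def by (rule compact_thicken[OF assms(2)])
  have "uniformly_continuous_on L f"
    by (rule compact_uniformly_continuous[OF continuous_on_subset[OF assms(1)] L]) simp
  then obtain d where d: "0 < d" "\<And>x y. x \<in> L \<Longrightarrow> y \<in> L \<Longrightarrow> dist y x < d \<Longrightarrow> dist (f y) (f x) < e"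
    unfolding uniformly_continuous_on_def using assms(4) by metis
  show ?thesis
  proof (rule that[of "min d 1"])
    fix x y :: 'a assume xy: "dist x y < min d 1"
    show "dist (f x) (f y) < e"
    proof (cases "x \<in> K \<or> y \<in> K")
      case True
      then have "x \<in> L" "y \<in> L" unfolding L_def using xy by (fastforce simp: dist_commute)+
      then show ?thesis using d xy by auto
    next
      case False
      then show ?thesis using assms by auto
    qed
  qed (use d in auto)
qed

lemma lborel_integral_translate:
  fixes f :: "'a::euclidean_space \<Rightarrow> 'b::euclidean_space"
  assumes "f \<in> borel_measurable borel"
  shows "(LINT x|lborel. f (c + x)) = (LINT x|lborel. f x)"
proof -
  have "(LINT x|lborel. f x) = (LINT x|distr lborel borel ((+) c). f x)"
    by (simp add: lborel_distr_plus)
  also have "\<dots> = (LINT x|lborel. f (c + x))"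
    by (rule integral_distr) (use assms in auto)
  finally show ?thesis by simp
qed

lemma lborel_nn_integral_translate:
  fixes f :: "'a::euclidean_space \<Rightarrow> ennreal"
  assumes "f \<in> borel_measurable borel"
  shows "(\<integral>\<^sup>+x. f (c + x) \<partial>lborel) = (\<integral>\<^sup>+x. f x \<partial>lborel)"
proof -
  have "(\<integral>\<^sup>+x. f x \<partial>lborel) = (\<integral>\<^sup>+x. f x \<partial>distr lborel borel ((+) c))"
    by (simp add: lborel_distr_plus)
  also have "\<dots> = (\<integral>\<^sup>+x. f (c + x) \<partial>lborel)"
    by (rule nn_integral_distr) (use assms in auto)
  finally show ?thesis by simp
qed

text \<open>By translation invariance the difference quotients of \<open>f\<close> have integral \<open>0\<close>.\<close>

lemma integral_grad_eq_0:
  fixes f :: "'a::euclidean_space \<Rightarrow> real"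
  assumes D: "\<And>x. (f has_derivative (\<lambda>h. g x \<bullet> h)) (at x)" and g: "continuous_on UNIV g"
    and K: "compact K" "\<And>x. x \<notin> K \<Longrightarrow> f x = 0"
  shows "(LINT x|lebesgue. g x) = 0" "integrable lebesgue g"
proof -
  have contf: "continuous_on UNIV f"
    using D by (meson continuous_at_imp_continuous_on has_derivative_continuous)
  have g0: "g x = 0" if "x \<notin> K" for x
  proof -
    have "((\<lambda>_. 0) has_derivative (\<lambda>h. 0 \<bullet> h)) (at x)" by simp
    then have "(f has_derivative (\<lambda>h. 0 \<bullet> h)) (at x)"
      by (rule has_derivative_transform_within_open[where s="- K"])
         (use that K in \<open>auto simp: compact_imp_closed open_Compl\<close>)
    from gradI[OF this] gradI[OF D] show ?thesis by simp
  qed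
  obtain B where B: "0 < B" "\<And>x. norm (g x) \<le> B"
    using compactly_supported_bounded[OF g K(1) g0] by blast
  have bm[measurable]: "f \<in> borel_measurable borel" "g \<in> borel_measurable borel"
    using contf g by (auto intro: borel_measurable_continuous_onI)
  have intf: "integrable lborel f" by (rule compactly_supported_integrable(1)[OF contf K])
  have intg: "integrable lborel g" by (rule compactly_supported_integrable(1)[OF g K(1) g0])
  show "integrable lebesgue g" by (rule compactly_supported_integrable(2)[OF g K(1) g0])
  have "(LINT x|lborel. g x) = 0"
  proof (rule euclidean_eqI)
    fix b :: 'a assume b: "b \<in> Basis"
    define t where "t n = 1 / real (Suc n)" for n
    have t: "t n > 0" "t n \<le> 1" for n by (auto simp: t_def)
    have t0: "t \<longlonglongrightarrow> 0" unfolding t_def using LIMSEQ_Suc[OF lim_1_over_n[where 'a=real]] by simp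
    \<comment> \<open>Since \<open>t n \<le> 1\<close>, every difference quotient \<open>q n\<close>
      vanishes outside \<open>L\<close>. Together with the Lipschitz bound \<open>B\<close> this
      gives the integrable majorant.\<close>
    define L where "L = (\<Union>x\<in>K. cball x 1)"
    have L: "compact L" unfolding L_def by (rule compact_thicken[OF K(1)])
    have lip: "\<bar>f x - f y\<bar> \<le> B * norm (x - y)" for x y
    proof -
      have "norm (f x - f y) \<le> B * norm (x - y)"
      proof (rule differentiable_bound[where S=UNIV])
        show "(f has_derivative (\<lambda>h. g x \<bullet> h)) (at x within UNIV)" for x using D by simp
        show "onorm (\<lambda>h. g x \<bullet> h) \<le> B" for x
        proof (rule onorm_le)
          fix h have "norm (g x \<bullet> h) \<le> norm (g x) * norm h" using Cauchy_Schwarz_ineq2 by simp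
          also have "\<dots> \<le> B * norm h" using B by (intro mult_right_mono) auto
          finally show "norm (g x \<bullet> h) \<le> B * norm h" .
        qed
      qed auto
      then show ?thesis by simp
    qed
    define q where "q n x = (f (t n *\<^sub>R b + x) - f x) / t n" for n x
    have q0: "(LINT x|lborel. q n x) = 0" for n
    proof -
      have "integrable lborel (\<lambda>x. f (t n *\<^sub>R b + x))"
      proof -
        have "integrable (distr lborel borel ((+) (t n *\<^sub>R b))) f" using intf by (simp add: lborel_distr_plus)
        then show ?thesis by (subst (asm) integrable_distr_eq) auto
      qed
      then show ?thesis
        using intf lborel_integral_translate[of f "t n *\<^sub>R b"] by (simp add: q_def)
    qed
    have "(\<lambda>n. LINT x|lborel. q n x) \<longlonglongrightarrow> (LINT x|lborel. g x \<bullet> b)"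
    proof (rule integral_dominated_convergence[where w="\<lambda>x. indicator L x * B"])
      show "integrable lborel (\<lambda>x. indicator L x * B)"
        using borel_integrable_compact[OF L, of "\<lambda>_. B"] by simp
      show "AE x in lborel. (\<lambda>n. q n x) \<longlonglongrightarrow> g x \<bullet> b"
      proof (rule AE_I2)
        fix x
        have "((\<lambda>s. f (s *\<^sub>R b + x)) has_real_derivative (g x \<bullet> b)) (at 0)"
        proof -
          have "((\<lambda>s. s *\<^sub>R b + x) has_derivative (\<lambda>s. s *\<^sub>R b)) (at 0)"
            by (auto intro!: derivative_eq_intros)
          from has_derivative_compose[OF this, of f "\<lambda>h. g x \<bullet> h"] D
          show ?thesis by (simp add: has_field_derivative_def mult.commute[of _ "g x \<bullet> b"])
        qed
        then have "((\<lambda>h. (f (h *\<^sub>R b + x) - f x) / h) \<longlongrightarrow> g x \<bullet> b) (at 0)"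
          by (simp add: DERIV_def)
        moreover have "filterlim t (at 0) sequentially"
          using t0 t(1) by (simp add: filterlim_at eventually_sequentiallyI less_imp_neq[symmetric] order_less_imp_not_eq2)
        ultimately show "(\<lambda>n. q n x) \<longlonglongrightarrow> g x \<bullet> b"
          unfolding q_def using filterlim_compose by fastforce
      qed
      show "AE x in lborel. norm (q n x) \<le> indicator L x * B" for n
      proof (rule AE_I2)
        fix x
        show "norm (q n x) \<le> indicator L x * B"
        proof (cases "x \<in> L")
          case True
          have "\<bar>f (t n *\<^sub>R b + x) - f x\<bar> \<le> B * t n"
            using lip[of "t n *\<^sub>R b + x" x] t[of n] b by simp
          then show ?thesis using True t[of n] by (simp add: q_def field_simps)
        next
          case False
          then have "x \<notin> K" "t n *\<^sub>R b + x \<notin> K"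
            using t[of n] b unfolding L_def by (auto simp: dist_norm)
          then show ?thesis using K B(1) by (simp add: q_def indicator_def)
        qed
      qed
    qed (auto simp: q_def)
    then have "(LINT x|lborel. g x \<bullet> b) = 0" by (simp add: q0 LIMSEQ_const_iff)
    then show "(LINT x|lborel. g x) \<bullet> b = 0 \<bullet> b" using intg by simp
  qed
  then show "(LINT x|lebesgue. g x) = 0" by (simp add: integral_completion)
qed

section \<open>Bump functions and mollifiers\<close>

definition bump :: "real \<Rightarrow> 'a::euclidean_space \<Rightarrow> real" where
  "bump r x = flat 0 (r\<^sup>2 - (norm x)\<^sup>2)"

lemma bump_nonneg: "bump r x \<ge> 0"
  by (simp add: bump_def flat_def)

lemma bump_pos_iff: "r > 0 \<Longrightarrow> bump r x > 0 \<longleftrightarrow> norm x < r"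
proof -
  assume "r > 0"
  then have "r\<^sup>2 - (norm x)\<^sup>2 \<le> 0 \<longleftrightarrow> r \<le> norm x"
    using abs_le_square_iff[of r "norm x"] by simp
  then show ?thesis by (auto simp: bump_def flat_def)
qed

lemma bump_test:
  assumes "r > 0"
  shows "bump r \<in> test_functions (UNIV :: 'a::euclidean_space set)"
proof (rule test_functionsI)
  \<comment> \<open>Summed over coordinates, the argument of \<open>flat\<close> is visibly a
    polynomial.\<close>
  have eq: "r\<^sup>2 - (norm x)\<^sup>2 = r\<^sup>2 + (\<Sum>b\<in>Basis. (- 1) * ((x \<bullet> b) * (x \<bullet> b)))" for x :: 'a
    unfolding power2_norm_eq_inner by (subst euclidean_inner) (simp add: sum_negf)
  show "Ck k (bump r :: 'a \<Rightarrow> real)" for k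
    unfolding bump_def[abs_def] eq
    by (intro Ck_flat Ck_add Ck_sum Ck_mult Ck_const Ck_inner_const)
  show "bump r x = 0" if "x \<notin> cball 0 r" for x :: 'a
    using bump_pos_iff[OF assms, of x] bump_nonneg[of r x] that by simp
qed auto

definition mollifier :: "real \<Rightarrow> 'a::euclidean_space \<Rightarrow> real" where
  "mollifier r x = bump r x / (LINT x|lebesgue. bump r (x::'a))"

text \<open>The normalising integral is positive: otherwise the bump would vanish almost everywhere,
  although it is positive on an open ball, which is not negligible.\<close>

lemma mollifier:
  assumes "r > 0"
  shows "mollifier r \<in> test_functions (UNIV :: 'a::euclidean_space set)"
    and "\<And>x::'a. 0 \<le> mollifier r x" and "(LINT x|lebesgue. mollifier r (x::'a)) = 1"
    and "\<And>x::'a. r \<le> norm x \<Longrightarrow> mollifier r x = 0"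
proof -
  let ?I = "LINT x|lebesgue. bump r (x::'a)"
  have int: "integrable lebesgue (bump r :: 'a \<Rightarrow> real)"
    using compactly_supported_integrable(2)[OF test_functions_continuous[OF bump_test[OF assms]]]
      test_functionsE[OF bump_test[OF assms]] by metis
  have "?I > 0"
  proof (rule ccontr)
    assume "\<not> ?I > 0"
    then have "?I = 0" using Bochner_Integration.integral_nonneg[of lebesgue "bump r :: 'a \<Rightarrow> real"] bump_nonneg by (metis less_eq_real_def)
    then have "AE x in lebesgue. bump r (x::'a) = 0"
      using integral_nonneg_eq_0_iff_AE[OF int] bump_nonneg by (metis AE_I2)
    then have "AE x in lebesgue. (x::'a) \<notin> ball 0 r"
    proof eventually_elim
      case (elim x) then show ?case using bump_pos_iff[OF assms, of x] by auto
    qed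
    then have "ball (0::'a) r \<in> null_sets lebesgue" by (subst AE_iff_null_sets) auto
    then have "negligible (ball (0::'a) r)" by (simp add: negligible_iff_null_sets)
    then show False using open_not_negligible[of "ball (0::'a) r"] assms by simp
  qed
  have "mollifier r = (\<lambda>x::'a. (1 / ?I) * bump r x)" by (simp add: mollifier_def fun_eq_iff)
  then show "mollifier r \<in> test_functions (UNIV :: 'a::euclidean_space set)"
    using test_functions_scale[OF bump_test[OF assms], of "1 / ?I"] by simp
  show "0 \<le> mollifier r x" for x :: 'a
    unfolding mollifier_def by (rule divide_nonneg_pos[OF bump_nonneg \<open>?I > 0\<close>])
  show "(LINT x|lebesgue. mollifier r (x::'a)) = 1"
    using \<open>?I > 0\<close> by (simp add: mollifier_def)
  show "mollifier r x = 0" if "r \<le> norm x" for x :: 'a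
    using bump_pos_iff[OF assms, of x] bump_nonneg[of r x] that by (simp add: mollifier_def)
qed

section \<open>Mollification\<close>

definition conv :: "('a::euclidean_space \<Rightarrow> real) \<Rightarrow> ('a \<Rightarrow> real) \<Rightarrow> 'a \<Rightarrow> real" where
  "conv \<rho> f x = (LINT y|lebesgue. \<rho> (x - y) * f y)"

lemma continuous_lebesgue_measurable:
  fixes f :: "'a::euclidean_space \<Rightarrow> 'b::euclidean_space"
  assumes "continuous_on UNIV f"
  shows "f \<in> borel_measurable lebesgue"
  by (rule measurable_completion) (use borel_measurable_continuous_onI[OF assms] in simp)

lemma continuous_shift:
  fixes \<rho> :: "'a::euclidean_space \<Rightarrow> 'b::euclidean_space"
  assumes "continuous_on UNIV \<rho>"
  shows "continuous_on UNIV (\<lambda>y. \<rho> (x - y))"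
  by (rule continuous_on_compose2[OF assms]) (auto intro: continuous_intros)

lemma integrable_bounded_scaleR:
  fixes \<rho> :: "'a \<Rightarrow> 'b::euclidean_space" and f :: "'a \<Rightarrow> real"
  assumes "\<rho> \<in> borel_measurable M" "\<And>x. norm (\<rho> x) \<le> B" "integrable M f"
  shows "integrable M (\<lambda>y. f y *\<^sub>R \<rho> y)"
proof (rule Bochner_Integration.integrable_bound[where f="\<lambda>y. B * f y"])
  show "AE y in M. norm (f y *\<^sub>R \<rho> y) \<le> norm (B * f y)"
  proof (rule AE_I2)
    fix y
    have "norm (\<rho> y) * \<bar>f y\<bar> \<le> \<bar>B\<bar> * \<bar>f y\<bar>"
      using assms(2)[of y] by (intro mult_right_mono) auto
    then show "norm (f y *\<^sub>R \<rho> y) \<le> norm (B * f y)" by (simp add: abs_mult mult.commute)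
  qed
qed (use assms in auto)

lemma test_functions_bounded:
  assumes "\<phi> \<in> test_functions \<Omega>"
  obtains B where "0 < B" "\<And>x. \<bar>\<phi> x\<bar> \<le> B" "\<And>x. norm (grad \<phi> x) \<le> B"
proof -
  obtain K where K: "compact K" "\<And>x. x \<notin> K \<Longrightarrow> \<phi> x = 0" "\<And>x. x \<notin> K \<Longrightarrow> grad \<phi> x = 0"
    using test_functionsE[OF assms] by metis
  obtain B1 where B1: "0 < B1" "\<And>x. norm (\<phi> x) \<le> B1"
    using compactly_supported_bounded[OF test_functions_continuous[OF assms] K(1,2)] by blast
  obtain B2 where B2: "0 < B2" "\<And>x. norm (grad \<phi> x) \<le> B2"
    using compactly_supported_bounded[OF test_functions_continuous_grad[OF assms] K(1,3)] by blast
  show ?thesis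
    by (rule that[of "max B1 B2"]) (use B1 B2 in \<open>auto simp: le_max_iff_disj\<close>)
qed

lemma conv_integrable:
  fixes \<rho> :: "'a::euclidean_space \<Rightarrow> real"
  assumes "\<rho> \<in> test_functions UNIV" "integrable lebesgue f"
  shows "integrable lebesgue (\<lambda>y. \<rho> (x - y) * f y)" "integrable lebesgue (\<lambda>y. f y *\<^sub>R grad \<rho> (x - y))"
proof -
  obtain B where B: "\<And>x. \<bar>\<rho> x\<bar> \<le> B" "\<And>x. norm (grad \<rho> x) \<le> B"
    using test_functions_bounded[OF assms(1)] by metis
  have "integrable lebesgue (\<lambda>y. f y *\<^sub>R \<rho> (x - y))"
    by (rule integrable_bounded_scaleR[OF continuous_lebesgue_measurable[OF continuous_shift[OF test_functions_continuous[OF assms(1)]]], where B=B])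
       (use B assms in auto)
  then show "integrable lebesgue (\<lambda>y. \<rho> (x - y) * f y)" by (simp add: mult.commute)
  show "integrable lebesgue (\<lambda>y. f y *\<^sub>R grad \<rho> (x - y))"
    by (rule integrable_bounded_scaleR[OF continuous_lebesgue_measurable[OF continuous_shift[OF test_functions_continuous_grad[OF assms(1)]]], where B=B])
       (use B assms in auto)
qed

text \<open>The gradient is uniformly continuous by compact support, so the mean value inequality
  gives a remainder that is uniform in \<open>z\<close>. This uniformity lets the remainder be
  pulled out of a convolution integral.\<close>

lemma test_functions_uniform_derivative:
  assumes \<phi>: "\<phi> \<in> test_functions \<Omega>" and "0 < e"
  obtains d where "0 < d" "\<And>z h. norm h < d \<Longrightarrow> \<bar>\<phi> (z + h) - \<phi> z - grad \<phi> z \<bullet> h\<bar> \<le> e * norm h"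
proof -
  obtain K where K: "compact K" "\<And>x. x \<notin> K \<Longrightarrow> grad \<phi> x = 0"
    using test_functionsE[OF \<phi>] by metis
  obtain d where d: "0 < d" "\<And>x y. dist x y < d \<Longrightarrow> dist (grad \<phi> x) (grad \<phi> y) < e"
    using compactly_supported_uniformly_continuous[OF test_functions_continuous_grad[OF \<phi>] K \<open>0 < e\<close>] by metis
  show ?thesis
  proof (rule that[OF d(1)])
    fix z h :: 'a assume h: "norm h < d"
    have "norm (\<phi> (z + h) - \<phi> z - grad \<phi> z \<bullet> (z + h - z)) \<le> norm (z + h - z) * e"
    proof (rule differentiable_bound_linearization[where S="ball z d" and f'="\<lambda>x h. grad \<phi> x \<bullet> h"])
      show "z + t *\<^sub>R (z + h - z) \<in> ball z d" if "t \<in> {0..1}" for t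
      proof -
        have "\<bar>t\<bar> * norm h \<le> 1 * norm h" using that by (intro mult_right_mono) auto
        then show ?thesis using h by (simp add: dist_norm)
      qed
      show "(\<phi> has_derivative (\<lambda>h. grad \<phi> x \<bullet> h)) (at x within ball z d)" for x
        by (rule has_derivative_at_withinI[OF test_functions_has_derivative[OF \<phi>]])
      show "onorm ((\<lambda>h. grad \<phi> x \<bullet> h) - (\<lambda>h. grad \<phi> z \<bullet> h)) \<le> e" if "x \<in> ball z d" for x
      proof (rule onorm_le)
        fix k
        have "norm (((\<lambda>h. grad \<phi> x \<bullet> h) - (\<lambda>h. grad \<phi> z \<bullet> h)) k) = \<bar>(grad \<phi> x - grad \<phi> z) \<bullet> k\<bar>"
          by (simp add: inner_diff_left)
        also have "\<dots> \<le> norm (grad \<phi> x - grad \<phi> z) * norm k" by (rule Cauchy_Schwarz_ineq2)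
        also have "\<dots> \<le> e * norm k"
          using d(2)[of x z] that by (intro mult_right_mono) (auto simp: dist_norm norm_minus_commute)
        finally show "norm (((\<lambda>h. grad \<phi> x \<bullet> h) - (\<lambda>h. grad \<phi> z \<bullet> h)) k) \<le> e * norm k" .
      qed
    qed (use d in auto)
    then show "\<bar>\<phi> (z + h) - \<phi> z - grad \<phi> z \<bullet> h\<bar> \<le> e * norm h" by (simp add: mult.commute)
  qed
qed

lemma conv_has_derivative:
  assumes \<rho>: "\<rho> \<in> test_functions UNIV" and f: "integrable lebesgue f"
  shows "(conv \<rho> f has_derivative (\<lambda>h. (LINT y|lebesgue. f y *\<^sub>R grad \<rho> (x - y)) \<bullet> h)) (at x)"
  unfolding has_derivative_at_alt
proof (intro conjI allI impI)
  show "bounded_linear (\<lambda>h. (LINT y|lebesgue. f y *\<^sub>R grad \<rho> (x - y)) \<bullet> h)"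
    by (rule bounded_linear_inner_right)
  fix e :: real assume "0 < e"
  define N where "N = (LINT y|lebesgue. \<bar>f y\<bar>)"
  have N: "0 \<le> N" by (simp add: N_def)
  \<comment> \<open>Dividing by \<open>1 + N\<close> instead of \<open>N\<close> covers the case
    that \<open>f\<close> vanishes almost everywhere.\<close>
  define e' where "e' = e / (1 + N)"
  have e': "0 < e'" "e' * N \<le> e" using \<open>0 < e\<close> N by (auto simp: e'_def field_simps)
  obtain d where d: "0 < d" "\<And>z h. norm h < d \<Longrightarrow> \<bar>\<rho> (z + h) - \<rho> z - grad \<rho> z \<bullet> h\<bar> \<le> e' * norm h"
    using test_functions_uniform_derivative[OF \<rho> e'(1)] by blast
  show "\<exists>d>0. \<forall>y. norm (y - x) < d \<longrightarrow>
      norm (conv \<rho> f y - conv \<rho> f x - (LINT y|lebesgue. f y *\<^sub>R grad \<rho> (x - y)) \<bullet> (y - x)) \<le> e * norm (y - x)"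
  proof (intro exI conjI allI impI)
    fix y assume y: "norm (y - x) < d"
    let ?D = "\<lambda>w. (\<rho> (y - w) - \<rho> (x - w) - grad \<rho> (x - w) \<bullet> (y - x)) * f w"
    have int: "integrable lebesgue ?D"
    proof -
      have "integrable lebesgue (\<lambda>w. \<rho> (y - w) * f w - \<rho> (x - w) * f w - (f w *\<^sub>R grad \<rho> (x - w)) \<bullet> (y - x))"
        by (intro Bochner_Integration.integrable_diff integrable_inner_left conv_integrable \<rho> f)
      then show ?thesis by (simp add: algebra_simps)
    qed
    have "conv \<rho> f y - conv \<rho> f x - (LINT y|lebesgue. f y *\<^sub>R grad \<rho> (x - y)) \<bullet> (y - x)
        = (LINT w|lebesgue. \<rho> (y - w) * f w - \<rho> (x - w) * f w - (f w *\<^sub>R grad \<rho> (x - w)) \<bullet> (y - x))"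
      unfolding conv_def
      by (simp add: conv_integrable \<rho> f integral_inner_left[symmetric] integrable_inner_left del: integral_inner_left inner_scaleR_left)
    also have "\<dots> = (LINT w|lebesgue. ?D w)"
      by (intro Bochner_Integration.integral_cong) (auto simp: algebra_simps)
    finally have "norm (conv \<rho> f y - conv \<rho> f x - (LINT y|lebesgue. f y *\<^sub>R grad \<rho> (x - y)) \<bullet> (y - x))
        = norm (LINT w|lebesgue. ?D w)" by simp
    also have "\<dots> \<le> (LINT w|lebesgue. norm (?D w))" by (rule integral_norm_bound)
    also have "\<dots> \<le> (LINT w|lebesgue. (e' * norm (y - x)) * \<bar>f w\<bar>)"
    proof (rule integral_mono)
      show "integrable lebesgue (\<lambda>w. norm (?D w))" using int by (rule integrable_norm)
      show "integrable lebesgue (\<lambda>w. (e' * norm (y - x)) * \<bar>f w\<bar>)" using f by simp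
      fix w
      have "\<bar>\<rho> (y - w) - \<rho> (x - w) - grad \<rho> (x - w) \<bullet> (y - x)\<bar> \<le> e' * norm (y - x)"
        using d(2)[OF y, of "x - w"] by (simp add: algebra_simps)
      then show "norm (?D w) \<le> (e' * norm (y - x)) * \<bar>f w\<bar>"
        by (simp add: abs_mult mult_right_mono)
    qed
    also have "\<dots> = (e' * N) * norm (y - x)" by (simp add: N_def)
    also have "\<dots> \<le> e * norm (y - x)" using e'(2) by (intro mult_right_mono) auto
    finally show "norm (conv \<rho> f y - conv \<rho> f x - (LINT y|lebesgue. f y *\<^sub>R grad \<rho> (x - y)) \<bullet> (y - x)) \<le> e * norm (y - x)" .
  qed (fact d(1))
qed

lemma grad_conv:
  assumes "\<rho> \<in> test_functions UNIV" "integrable lebesgue f"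
  shows "grad (conv \<rho> f) x = (LINT y|lebesgue. f y *\<^sub>R grad \<rho> (x - y))"
  by (rule gradI[OF conv_has_derivative[OF assms]])

lemma grad_conv_inner:
  assumes "\<rho> \<in> test_functions UNIV" "integrable lebesgue f"
  shows "(LINT y|lebesgue. f y *\<^sub>R grad \<rho> (x - y)) \<bullet> b = conv (\<lambda>z. grad \<rho> z \<bullet> b) f x"
  unfolding conv_def using conv_integrable(2)[OF assms]
  by (subst integral_inner_left[symmetric]) (auto simp: mult.commute)

text \<open>A partial derivative of \<open>conv \<rho> f\<close> is the convolution of
  \<open>f\<close> with a partial derivative of \<open>\<rho>\<close>, again a test function; hence
  the induction is over all \<open>\<rho>\<close> while \<open>f\<close> stays merely
  integrable.\<close>

lemma conv_Ck:
  assumes "\<rho> \<in> test_functions UNIV" "integrable lebesgue f"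
  shows "Ck k (conv \<rho> f)"
  using assms(1)
proof (induction k arbitrary: \<rho>)
  case 0
  have "continuous_on UNIV (conv \<rho> f)"
    using conv_has_derivative[OF 0 assms(2)]
    by (meson continuous_at_imp_continuous_on has_derivative_continuous)
  then show ?case by simp
next
  case (Suc k)
  show ?case
  proof (rule Ck_SucI[OF conv_has_derivative[OF Suc.prems assms(2)]])
    fix b :: 'a assume b: "b \<in> Basis"
    show "Ck k (\<lambda>x. (LINT y|lebesgue. f y *\<^sub>R grad \<rho> (x - y)) \<bullet> b)"
      using Suc.IH[OF test_functions_partial[OF Suc.prems b]]
      by (simp add: grad_conv_inner[OF Suc.prems assms(2)])
  qed
qed

lemma conv_support:
  assumes "\<And>x. x \<notin> K \<Longrightarrow> f x = 0" "\<And>x. r \<le> norm x \<Longrightarrow> \<rho> x = 0" "x \<notin> (\<Union>y\<in>K. cball y r)"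
  shows "conv \<rho> f x = 0"
proof -
  have "\<rho> (x - y) * f y = 0" for y
    using assms by (cases "y \<in> K") (auto simp: dist_norm norm_minus_commute)
  then show ?thesis by (simp only: conv_def Bochner_Integration.integral_zero)
qed

lemma conv_mollifier_test:
  assumes "0 < r" "compact K" "\<And>x. x \<notin> K \<Longrightarrow> f x = 0" "integrable lebesgue f" "(\<Union>y\<in>K. cball y r) \<subseteq> \<Omega>"
  shows "conv (mollifier r) f \<in> test_functions \<Omega>"
proof (rule test_functionsI[OF conv_Ck])
  show "conv (mollifier r) f x = 0" if "x \<notin> (\<Union>y\<in>K. cball y r)" for x
    by (rule conv_support[OF assms(3) _ that]) (use mollifier(4)[OF assms(1)] in auto)
qed (use assms mollifier compact_thicken in auto)

lemma lborel_reflect: "distr lborel borel (\<lambda>y. x - y) = (lborel :: 'a::euclidean_space measure)"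
  by (subst lborel_affine[of "-1" x]) (auto simp: density_1)

lemma lborel_integral_reflect:
  fixes f :: "'a::euclidean_space \<Rightarrow> 'b::euclidean_space"
  assumes "f \<in> borel_measurable borel"
  shows "(LINT y|lborel. f (x - y)) = (LINT y|lborel. f y)"
proof -
  have "(LINT y|lborel. f y) = (LINT y|distr lborel borel (\<lambda>y. x - y). f y)"
    by (simp add: lborel_reflect)
  also have "\<dots> = (LINT y|lborel. f (x - y))"
    by (rule integral_distr) (use assms in auto)
  finally show ?thesis by simp
qed

lemma mollifier_borel: "0 < r \<Longrightarrow> mollifier r \<in> borel_measurable (borel :: 'a::euclidean_space measure)"
  by (intro borel_measurable_continuous_onI test_functions_continuous[OF mollifier(1)])

lemma mollifier_integrable:
  assumes "0 < r" shows "integrable lebesgue (mollifier r :: 'a::euclidean_space \<Rightarrow> real)"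
  using compactly_supported_integrable(2)[OF test_functions_continuous[OF mollifier(1)[OF assms]]]
    test_functionsE[OF mollifier(1)[OF assms]] by metis

lemma mollifier_shift_integral:
  assumes "0 < r"
  shows "(LINT y|lebesgue. mollifier r (x - y :: 'a::euclidean_space)) = 1"
    "integrable lebesgue (\<lambda>y. mollifier r (x - y))"
proof -
  note [measurable] = mollifier_borel[OF assms, where 'a='a]
  have "(LINT y|lebesgue. mollifier r (x - y)) = (LINT y|lborel. mollifier r (x - y))"
    by (intro integral_completion) simp
  also have "\<dots> = (LINT y|lborel. mollifier r (y :: 'a))" by (rule lborel_integral_reflect) simp
  also have "\<dots> = 1" using mollifier(3)[OF assms, where 'a='a] by (simp add: integral_completion)
  finally show *: "(LINT y|lebesgue. mollifier r (x - y)) = 1" .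
  \<comment> \<open>A function that is not integrable has integral 0 by convention, so the value 1
    already proves integrability.\<close>
  show "integrable lebesgue (\<lambda>y. mollifier r (x - y))"
    using * not_integrable_integral_eq by force
qed

lemma conv_mollifier_bound:
  assumes "0 < r" "integrable lebesgue f" "AE x in lebesgue. \<bar>f x\<bar> \<le> M"
  shows "\<bar>conv (mollifier r) f x\<bar> \<le> M"
proof -
  have "\<bar>conv (mollifier r) f x\<bar> \<le> (LINT y|lebesgue. \<bar>mollifier r (x - y) * f y\<bar>)"
    unfolding conv_def by (rule integral_abs_bound)
  also have "\<dots> \<le> (LINT y|lebesgue. M * mollifier r (x - y))"
  proof (rule integral_mono_AE)
    show "integrable lebesgue (\<lambda>y. \<bar>mollifier r (x - y) * f y\<bar>)"
      by (intro integrable_abs conv_integrable mollifier assms)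
    show "integrable lebesgue (\<lambda>y. M * mollifier r (x - y))"
      using mollifier_shift_integral(2)[OF assms(1), of x] by simp
    show "AE y in lebesgue. \<bar>mollifier r (x - y) * f y\<bar> \<le> M * mollifier r (x - y)"
      using assms(3)
      by eventually_elim (simp add: abs_mult mollifier(2)[OF assms(1)] mult.commute[of M] mult_left_mono)
  qed
  also have "\<dots> = M" by (simp add: mollifier_shift_integral[OF assms(1)])
  finally show ?thesis .
qed

text \<open>Young's inequality in L1: by Tonelli the order of integration is exchanged, and the
  mollifier integrates to 1 in \<open>x\<close> for every fixed \<open>y\<close>.\<close>

lemma conv_mollifier_L1:
  assumes r: "0 < r" and f: "integrable lebesgue f"
  shows "integrable lebesgue (conv (mollifier r) f)"
    and "(LINT x|lebesgue. \<bar>conv (mollifier r) f x\<bar>) \<le> (LINT x|lebesgue. \<bar>f x\<bar>)"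
proof -
  let ?\<rho> = "mollifier r :: 'a \<Rightarrow> real"
  note \<rho>[measurable] = mollifier_borel[OF r, where 'a='a]
  \<comment> \<open>Fubini is applied to the product of two copies of \<open>lborel\<close>, so
    \<open>f\<close> is replaced by a Borel representative, which changes neither the convolution
    nor the norm.\<close>
  obtain f' where f'[measurable]: "f' \<in> borel_measurable lborel" and ff': "AE x in lborel. f x = f' x"
    using completion_ex_borel_measurable_real[of f lborel] f by auto
  have ff'': "AE x in lebesgue. f x = f' x" using ff' by (rule AE_completion)
  have f'l: "f' \<in> borel_measurable lebesgue" by (rule measurable_completion[OF f'])
  have f'i: "integrable lebesgue f'"
    by (rule integrable_cong_AE_imp[OF f f'l]) (use ff'' in auto)
  have eq: "conv ?\<rho> f x = conv ?\<rho> f' x" for x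
    unfolding conv_def
    by (intro integral_cong_AE)
       (use ff'' conv_integrable[OF mollifier(1)[OF r] f] conv_integrable[OF mollifier(1)[OF r] f'i] in \<open>auto elim!: eventually_mono\<close>)
  have "(\<integral>\<^sup>+x. ennreal \<bar>conv ?\<rho> f x\<bar> \<partial>lebesgue) = (\<integral>\<^sup>+x. ennreal \<bar>conv ?\<rho> f' x\<bar> \<partial>lborel)"
    by (simp add: nn_integral_completion eq)
  also have "\<dots> \<le> (\<integral>\<^sup>+x. (\<integral>\<^sup>+y. ennreal (?\<rho> (x - y)) * ennreal \<bar>f' y\<bar> \<partial>lborel) \<partial>lborel)"
  proof (rule nn_integral_mono)
    fix x
    have "ennreal (norm (conv ?\<rho> f' x)) \<le> (\<integral>\<^sup>+y. ennreal (norm (?\<rho> (x - y) * f' y)) \<partial>lebesgue)"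
      unfolding conv_def by (rule integral_norm_bound_ennreal[OF conv_integrable(1)[OF mollifier(1)[OF r] f'i]])
    also have "\<dots> = (\<integral>\<^sup>+y. ennreal (?\<rho> (x - y)) * ennreal \<bar>f' y\<bar> \<partial>lborel)"
      unfolding nn_integral_completion
      by (intro nn_integral_cong) (simp add: abs_mult mollifier(2)[OF r] ennreal_mult)
    finally show "ennreal \<bar>conv ?\<rho> f' x\<bar> \<le> (\<integral>\<^sup>+y. ennreal (?\<rho> (x - y)) * ennreal \<bar>f' y\<bar> \<partial>lborel)" by simp
  qed
  also have "\<dots> = (\<integral>\<^sup>+y. (\<integral>\<^sup>+x. ennreal (?\<rho> (x - y)) * ennreal \<bar>f' y\<bar> \<partial>lborel) \<partial>lborel)"
    by (rule lborel_pair.Fubini') measurable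
  also have "\<dots> = (\<integral>\<^sup>+y. ennreal \<bar>f' y\<bar> \<partial>lborel)"
  proof (rule nn_integral_cong)
    fix y
    have "(\<integral>\<^sup>+x. ennreal (?\<rho> (x - y)) * ennreal \<bar>f' y\<bar> \<partial>lborel) = (\<integral>\<^sup>+x. ennreal (?\<rho> (x - y)) \<partial>lborel) * ennreal \<bar>f' y\<bar>"
      by (rule nn_integral_multc) measurable
    also have "(\<integral>\<^sup>+x. ennreal (?\<rho> (x - y)) \<partial>lborel) = (\<integral>\<^sup>+x. ennreal (?\<rho> x) \<partial>lborel)"
      using lborel_nn_integral_translate[of "\<lambda>x. ennreal (?\<rho> x)" "- y"] by simp
    also have "\<dots> = (\<integral>\<^sup>+x. ennreal (?\<rho> x) \<partial>lebesgue)" by (simp add: nn_integral_completion)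
    also have "\<dots> = ennreal (LINT x|lebesgue. ?\<rho> x)"
      by (rule nn_integral_eq_integral[OF mollifier_integrable[OF r]]) (simp add: mollifier(2)[OF r])
    also have "\<dots> = 1" by (simp add: mollifier(3)[OF r])
    finally show "(\<integral>\<^sup>+x. ennreal (?\<rho> (x - y)) * ennreal \<bar>f' y\<bar> \<partial>lborel) = ennreal \<bar>f' y\<bar>" by simp
  qed
  also have "\<dots> = (\<integral>\<^sup>+y. ennreal \<bar>f y\<bar> \<partial>lborel)"
    by (rule nn_integral_cong_AE) (use ff' in \<open>auto elim!: eventually_mono\<close>)
  also have "\<dots> = (\<integral>\<^sup>+y. ennreal \<bar>f y\<bar> \<partial>lebesgue)" by (simp add: nn_integral_completion)
  also have "\<dots> = ennreal (LINT y|lebesgue. \<bar>f y\<bar>)"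
    by (rule nn_integral_eq_integral) (use f in auto)
  finally have *: "(\<integral>\<^sup>+x. ennreal \<bar>conv ?\<rho> f x\<bar> \<partial>lebesgue) \<le> ennreal (LINT y|lebesgue. \<bar>f y\<bar>)" .
  have m: "conv ?\<rho> f \<in> borel_measurable lebesgue"
    by (rule continuous_lebesgue_measurable[OF Ck_continuous[OF conv_Ck[OF mollifier(1)[OF r] f, of 0]]])
  show int: "integrable lebesgue (conv ?\<rho> f)"
    by (rule integrableI_bounded[OF m]) (use * in \<open>auto simp: less_top[symmetric] top_unique\<close>)
  have "ennreal (LINT x|lebesgue. \<bar>conv ?\<rho> f x\<bar>) = (\<integral>\<^sup>+x. ennreal \<bar>conv ?\<rho> f x\<bar> \<partial>lebesgue)"
    by (rule nn_integral_eq_integral[symmetric]) (use int in auto)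
  with * have "ennreal (LINT x|lebesgue. \<bar>conv ?\<rho> f x\<bar>) \<le> ennreal (LINT y|lebesgue. \<bar>f y\<bar>)" by simp
  then show "(LINT x|lebesgue. \<bar>conv ?\<rho> f x\<bar>) \<le> (LINT x|lebesgue. \<bar>f x\<bar>)"
    by (subst (asm) ennreal_le_iff) auto
qed

section \<open>Cutoff functions\<close>

lemma cutoff_thick:
  fixes K :: "'a::euclidean_space set"
  assumes "compact K" "0 < r" "(\<Union>x\<in>K. cball x (3 * r)) \<subseteq> \<Omega>"
  obtains \<eta> where "\<eta> \<in> test_functions \<Omega>" "\<And>x. 0 \<le> \<eta> x" "\<And>x. \<eta> x \<le> 1"
    "\<And>x. x \<in> (\<Union>x\<in>K. ball x r) \<Longrightarrow> \<eta> x = 1" "\<And>x. x \<notin> (\<Union>x\<in>K. cball x (3 * r)) \<Longrightarrow> \<eta> x = 0"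
proof -
  \<comment> \<open>The indicator of the \<open>2 * r\<close> neighbourhood, mollified at radius
    \<open>r\<close>, is 1 on the \<open>r\<close> neighbourhood of \<open>K\<close> and 0 outside
    the \<open>3 * r\<close> neighbourhood.\<close>
  define L where "L = (\<Union>x\<in>K. cball x (2 * r))"
  have L: "compact L" unfolding L_def by (rule compact_thicken[OF assms(1)])
  have Lm: "L \<in> lmeasurable" by (rule lmeasurable_compact[OF L])
  define f where "f = (indicator L :: 'a \<Rightarrow> real)"
  have f: "integrable lebesgue f" unfolding f_def using Lm by (simp add: lmeasurable_iff_integrable)
  have LL: "(\<Union>y\<in>L. cball y r) \<subseteq> (\<Union>x\<in>K. cball x (3 * r))"
  proof
    fix z assume "z \<in> (\<Union>y\<in>L. cball y r)"
    then obtain x y where xy: "x \<in> K" "dist x y \<le> 2 * r" "dist y z \<le> r" by (auto simp: L_def)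
    have "dist x z \<le> 3 * r" using dist_triangle[of x z y] xy by linarith
    then show "z \<in> (\<Union>x\<in>K. cball x (3 * r))" using xy by auto
  qed
  note \<rho> = mollifier[OF assms(2), where 'a='a]
  show ?thesis
  proof (rule that[of "conv (mollifier r) f"])
    show "conv (mollifier r) f \<in> test_functions \<Omega>"
      by (rule conv_mollifier_test[OF assms(2) L _ f]) (use LL assms(3) in \<open>auto simp: f_def\<close>)
    show "0 \<le> conv (mollifier r) f x" for x
      unfolding conv_def by (rule Bochner_Integration.integral_nonneg) (simp add: \<rho> f_def)
    show "conv (mollifier r) f x \<le> 1" for x
      using conv_mollifier_bound[OF assms(2) f, of 1 x] by (auto simp: f_def indicator_def)
    show "conv (mollifier r) f x = 0" if "x \<notin> (\<Union>x\<in>K. cball x (3 * r))" for x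
    proof (rule conv_support[where K=L and r=r])
      show "x \<notin> (\<Union>y\<in>L. cball y r)" using that LL by blast
    qed (use \<rho>(4) in \<open>auto simp: f_def\<close>)
    show "conv (mollifier r) f x = 1" if x: "x \<in> (\<Union>x\<in>K. ball x r)" for x
    proof -
      obtain k where k: "k \<in> K" "dist k x < r" using x by auto
      have "mollifier r (x - y) * f y = mollifier r (x - y)" for y
      proof (cases "norm (x - y) < r")
        case True
        then have "dist k y \<le> 2 * r" using dist_triangle[of k y x] k by (simp add: dist_norm)
        then have "y \<in> L" using k by (auto simp: L_def)
        then show ?thesis by (simp add: f_def)
      qed (simp add: \<rho>(4))
      then show ?thesis by (simp only: conv_def mollifier_shift_integral(1)[OF assms(2)])
    qed
  qed
qed

lemma cutoff:
  fixes K :: "'a::euclidean_space set"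
  assumes "compact K" "open \<Omega>" "K \<subseteq> \<Omega>"
  obtains \<eta> U where "\<eta> \<in> test_functions \<Omega>" "\<And>x. 0 \<le> \<eta> x" "\<And>x. \<eta> x \<le> 1"
    "open U" "K \<subseteq> U" "\<And>x. x \<in> U \<Longrightarrow> \<eta> x = 1"
proof -
  obtain e where e: "0 < e" "(\<Union>x\<in>K. cball x e) \<subseteq> \<Omega>"
    using compact_subset_open_imp_cball_epsilon_subset[OF assms] by blast
  have r: "0 < e / 3" "(\<Union>x\<in>K. cball x (3 * (e / 3))) \<subseteq> \<Omega>" using e by auto
  obtain \<eta> where \<eta>: "\<eta> \<in> test_functions \<Omega>" "\<And>x. 0 \<le> \<eta> x" "\<And>x. \<eta> x \<le> 1"
    "\<And>x. x \<in> (\<Union>x\<in>K. ball x (e / 3)) \<Longrightarrow> \<eta> x = 1"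
    using cutoff_thick[OF assms(1) r] by metis
  show ?thesis
    by (rule that[OF \<eta>(1-3), of "\<Union>x\<in>K. ball x (e / 3)"]) (use \<eta>(4) r in auto)
qed

text \<open>Cutoffs of neighbourhoods that shrink to the closed set \<open>K\<close>. They carry
  identities that are known for test functions over to indicators of compact sets.\<close>

lemma cutoff_sequence:
  fixes K :: "'a::euclidean_space set"
  assumes "compact K" "open \<Omega>" "K \<subseteq> \<Omega>"
  obtains \<eta> :: "nat \<Rightarrow> 'a \<Rightarrow> real" where "\<And>n. \<eta> n \<in> test_functions \<Omega>" "\<And>n x. 0 \<le> \<eta> n x" "\<And>n x. \<eta> n x \<le> 1"
    "\<And>x. (\<lambda>n. \<eta> n x) \<longlonglongrightarrow> indicator K x"
proof -
  obtain e where e: "0 < e" "(\<Union>x\<in>K. cball x e) \<subseteq> \<Omega>"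
    using compact_subset_open_imp_cball_epsilon_subset[OF assms] by blast
  define r where "r n = e / 3 / real (Suc n)" for n
  have r: "0 < r n" "3 * r n \<le> e" for n using e by (auto simp: r_def field_simps)
  have r0: "r \<longlonglongrightarrow> 0"
    unfolding r_def using LIMSEQ_Suc[OF lim_const_over_n[of "e / 3"]] by simp
  have "\<forall>n. \<exists>\<eta>. \<eta> \<in> test_functions \<Omega> \<and> (\<forall>x. 0 \<le> \<eta> x) \<and> (\<forall>x. \<eta> x \<le> 1) \<and>
    (\<forall>x\<in>(\<Union>x\<in>K. ball x (r n)). \<eta> x = 1) \<and> (\<forall>x. x \<notin> (\<Union>x\<in>K. cball x (3 * r n)) \<longrightarrow> \<eta> x = 0)"
  proof
    fix n
    have "(\<Union>x\<in>K. cball x (3 * r n)) \<subseteq> \<Omega>" using e(2) r(2)[of n] by fastforce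
    from cutoff_thick[OF assms(1) r(1) this] show "\<exists>\<eta>. \<eta> \<in> test_functions \<Omega> \<and> (\<forall>x. 0 \<le> \<eta> x) \<and> (\<forall>x. \<eta> x \<le> 1) \<and>
    (\<forall>x\<in>(\<Union>x\<in>K. ball x (r n)). \<eta> x = 1) \<and> (\<forall>x. x \<notin> (\<Union>x\<in>K. cball x (3 * r n)) \<longrightarrow> \<eta> x = 0)" by metis
  qed
  then obtain \<eta> where \<eta>: "\<And>n. \<eta> n \<in> test_functions \<Omega>" "\<And>n x. 0 \<le> \<eta> n x" "\<And>n x. \<eta> n x \<le> 1"
    "\<And>n x. x \<in> (\<Union>x\<in>K. ball x (r n)) \<Longrightarrow> \<eta> n x = 1" "\<And>n x. x \<notin> (\<Union>x\<in>K. cball x (3 * r n)) \<Longrightarrow> \<eta> n x = 0"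
    by metis
  show ?thesis
  proof (rule that[OF \<eta>(1-3)])
    fix x
    show "(\<lambda>n. \<eta> n x) \<longlonglongrightarrow> indicator K x"
    proof (cases "x \<in> K")
      case True
      then have "\<eta> n x = 1" for n using \<eta>(4)[of x n] r(1)[of n] by force
      with True show ?thesis by simp
    next
      case False
      have "open (- K)" using compact_imp_closed[OF assms(1)] by auto
      then obtain d where d: "0 < d" "ball x d \<subseteq> - K" using False open_contains_ball by blast
      have "(\<lambda>n. 3 * r n) \<longlonglongrightarrow> 3 * 0" by (intro tendsto_intros r0)
      then have "\<forall>\<^sub>F n in sequentially. 3 * r n < d" using d by (intro order_tendstoD) auto
      then have "\<forall>\<^sub>F n in sequentially. 0 = \<eta> n x"
      proof eventually_elim
        case (elim n)
        have "x \<notin> (\<Union>x\<in>K. cball x (3 * r n))" using d elim by (force simp: dist_commute)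
        then show ?case using \<eta>(5) by simp
      qed
      then show ?thesis using False by (simp add: tendsto_eventually eventually_mono)
    qed
  qed
qed

section \<open>Convergence of mollifications in L1\<close>

lemma continuous_approx_L1:
  fixes f :: "'a::euclidean_space \<Rightarrow> real"
  assumes f: "f \<in> borel_measurable lebesgue" and M: "AE x in lebesgue. \<bar>f x\<bar> \<le> M"
    and K: "compact K" "\<And>x. x \<notin> K \<Longrightarrow> f x = 0" and "0 < e"
  obtains h L where "continuous_on UNIV h" "compact L" "\<And>x. x \<notin> L \<Longrightarrow> h x = 0"
    "(LINT x|lebesgue. \<bar>f x - h x\<bar>) < e"
proof -
  obtain \<eta> U where \<eta>: "\<eta> \<in> test_functions (UNIV :: 'a set)" "\<And>x. 0 \<le> \<eta> x" "\<And>x. \<eta> x \<le> 1" "K \<subseteq> U" "\<And>x. x \<in> U \<Longrightarrow> \<eta> x = 1"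
    using cutoff[OF K(1) open_UNIV] by (metis subset_UNIV)
  obtain L where L: "compact L" "\<And>x. x \<notin> L \<Longrightarrow> \<eta> x = 0" using test_functionsE[OF \<eta>(1)] by metis
  have "f measurable_on UNIV" using lebesgue_measurable_imp_measurable_on[OF f] by simp
  then obtain N g where N: "negligible N" and g: "\<And>n. continuous_on UNIV (g n)"
    and lim: "\<And>x. x \<notin> N \<Longrightarrow> (\<lambda>n. g n x) \<longlonglongrightarrow> f x"
    unfolding measurable_on_def by auto
  \<comment> \<open>The \<open>g n\<close> are continuous and converge to \<open>f\<close> off a
    null set, but without any bound. Clipping to \<open>[-M, M]\<close> and multiplying by a cutoff
    that is 1 on \<open>K\<close> leave the limit unchanged and provide a majorant.\<close>
  define h where "h n x = \<eta> x * max (- M) (min M (g n x))" for n x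
  have ch: "continuous_on UNIV (h n)" for n
    unfolding h_def by (intro continuous_intros continuous_on_max continuous_on_min g test_functions_continuous[OF \<eta>(1)])
  have h0: "h n x = 0" if "x \<notin> L" for n x using L(2)[OF that] by (simp add: h_def)
  have f\<eta>: "\<eta> x * f x = f x" for x using K(2) \<eta>(4,5) by (cases "x \<in> K") auto
  have NN: "AE x in lebesgue. x \<notin> N" using N by (simp add: negligible_iff_null_sets AE_not_in)
  have "(\<lambda>n. LINT x|lebesgue. \<bar>f x - h n x\<bar>) \<longlonglongrightarrow> (LINT x|(lebesgue :: 'a measure). (0::real))"
  proof (rule integral_dominated_convergence[where w="\<lambda>x. indicator (K \<union> L) x * (2 * \<bar>M\<bar>)"])
    show "(\<lambda>x. \<bar>f x - h n x\<bar>) \<in> borel_measurable lebesgue" for n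
      using f continuous_lebesgue_measurable[OF ch[of n]] by auto
    have "K \<union> L \<in> lmeasurable" by (intro lmeasurable_compact compact_Un K L)
    then have "integrable lebesgue (indicator (K \<union> L) :: 'a \<Rightarrow> real)" by (simp add: lmeasurable_iff_integrable)
    then show "integrable lebesgue (\<lambda>x. indicator (K \<union> L) x * (2 * \<bar>M\<bar>))" by (rule integrable_mult_left)
    show "AE x in lebesgue. (\<lambda>n. \<bar>f x - h n x\<bar>) \<longlonglongrightarrow> 0"
      using NN M
    proof eventually_elim
      case (elim x)
      have "(\<lambda>n. \<bar>f x - h n x\<bar>) \<longlonglongrightarrow> \<bar>f x - \<eta> x * max (- M) (min M (f x))\<bar>"
        unfolding h_def by (intro tendsto_intros tendsto_max tendsto_min lim elim)
      moreover have "max (- M) (min M (f x)) = f x" using elim by auto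
      ultimately show ?case by (simp add: f\<eta>)
    qed
    show "AE x in lebesgue. norm \<bar>f x - h n x\<bar> \<le> indicator (K \<union> L) x * (2 * \<bar>M\<bar>)" for n
      using M
    proof eventually_elim
      case (elim x)
      show ?case
      proof (cases "x \<in> K \<union> L")
        case True
        have "\<bar>h n x\<bar> \<le> 1 * \<bar>M\<bar>"
          unfolding h_def abs_mult using \<eta>(2,3) elim by (intro mult_mono) auto
        then show ?thesis using True elim by auto
      next
        case False
        then show ?thesis using K(2) h0 by auto
      qed
    qed
  qed simp
  then have "\<forall>\<^sub>F n in sequentially. (LINT x|lebesgue. \<bar>f x - h n x\<bar>) < e"
    using \<open>0 < e\<close> by (intro order_tendstoD) auto
  then obtain n where "(LINT x|lebesgue. \<bar>f x - h n x\<bar>) < e"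
    using eventually_happens'[OF sequentially_bot] by blast
  from ch[of n] L(1) _ this show ?thesis by (rule that) (rule h0)
qed

lemma bounded_support_integrable:
  fixes f :: "'a::euclidean_space \<Rightarrow> real"
  assumes "f \<in> borel_measurable lebesgue" "AE x in lebesgue. \<bar>f x\<bar> \<le> M" "compact K" "\<And>x. x \<notin> K \<Longrightarrow> f x = 0"
  shows "integrable lebesgue f"
proof (rule Bochner_Integration.integrable_bound[where f="\<lambda>x. indicator K x * M"])
  have "K \<in> lmeasurable" by (rule lmeasurable_compact[OF assms(3)])
  then have "integrable lebesgue (indicator K :: 'a \<Rightarrow> real)" by (simp add: lmeasurable_iff_integrable)
  then show "integrable lebesgue (\<lambda>x. indicator K x * M)" by (rule integrable_mult_left)
  show "AE x in lebesgue. norm (f x) \<le> norm (indicator K x * M)"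
    using assms(2)
  proof eventually_elim
    case (elim x) then show ?case using assms(4)[of x] by (cases "x \<in> K") auto
  qed
qed fact

lemma conv_diff:
  assumes "\<rho> \<in> test_functions UNIV" "integrable lebesgue f" "integrable lebesgue g"
  shows "conv \<rho> (\<lambda>x. f x - g x) x = conv \<rho> f x - conv \<rho> g x"
  unfolding conv_def using conv_integrable(1)[OF assms(1)] assms by (simp add: right_diff_distrib)

lemma conv_mollifier_close:
  assumes r: "0 < r" and h: "integrable lebesgue h"
    and e: "\<And>y. dist y x < r \<Longrightarrow> \<bar>h y - h x\<bar> \<le> e"
  shows "\<bar>conv (mollifier r) h x - h x\<bar> \<le> e"
proof -
  note \<rho> = mollifier[OF r, where 'a='a]
  note sh = mollifier_shift_integral[OF r, where 'a='a]
  have "conv (mollifier r) h x - h x = (LINT y|lebesgue. mollifier r (x - y) * h y - mollifier r (x - y) * h x)"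
    unfolding conv_def using conv_integrable(1)[OF \<rho>(1) h] sh by simp
  then have "\<bar>conv (mollifier r) h x - h x\<bar> \<le> (LINT y|lebesgue. \<bar>mollifier r (x - y) * h y - mollifier r (x - y) * h x\<bar>)"
    by (simp only: integral_abs_bound)
  also have "\<dots> \<le> (LINT y|lebesgue. e * mollifier r (x - y))"
  proof (rule integral_mono)
    show "integrable lebesgue (\<lambda>y. \<bar>mollifier r (x - y) * h y - mollifier r (x - y) * h x\<bar>)"
      using conv_integrable(1)[OF \<rho>(1) h] sh by simp
    show "integrable lebesgue (\<lambda>y. e * mollifier r (x - y))" using sh by simp
    fix y
    show "\<bar>mollifier r (x - y) * h y - mollifier r (x - y) * h x\<bar> \<le> e * mollifier r (x - y)"
    proof (cases "norm (x - y) < r")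
      case True
      have "mollifier r (x - y) * \<bar>h y - h x\<bar> \<le> mollifier r (x - y) * e"
        using e[of y] True by (intro mult_left_mono \<rho>) (auto simp: dist_norm norm_minus_commute)
      moreover have "\<bar>mollifier r (x - y) * h y - mollifier r (x - y) * h x\<bar> = mollifier r (x - y) * \<bar>h y - h x\<bar>"
        by (simp add: right_diff_distrib[symmetric] abs_mult \<rho>(2))
      ultimately show ?thesis by (simp add: mult.commute[of e])
    qed (simp add: \<rho>(4))
  qed
  also have "\<dots> = e" using sh by simp
  finally show ?thesis .
qed

text \<open>A three-part estimate through a continuous \<open>h\<close> of compact support close to
  \<open>f\<close> in L1. By \<open>conv_mollifier_L1\<close> mollification does not increase the L1
  norm of \<open>f - h\<close>, and \<open>h\<close> is approximated uniformly, with error at most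
  \<open>e'\<close> and supported in the bounded set \<open>P\<close>; \<open>e'\<close> is chosen
  so that \<open>e' * m \<le> e / 3\<close>.\<close>

lemma mollify_L1_convergence:
  fixes f :: "'a::euclidean_space \<Rightarrow> real"
  assumes f: "f \<in> borel_measurable lebesgue" and M: "AE x in lebesgue. \<bar>f x\<bar> \<le> M"
    and K: "compact K" "\<And>x. x \<notin> K \<Longrightarrow> f x = 0" and "0 < e"
  obtains R where "0 < R" "\<And>r. 0 < r \<Longrightarrow> r < R \<Longrightarrow> (LINT x|lebesgue. \<bar>conv (mollifier r) f x - f x\<bar>) < e"
proof -
  have "0 < e / 3" using \<open>0 < e\<close> by simp
  then obtain h L where h: "continuous_on UNIV h" "compact L" "\<And>x. x \<notin> L \<Longrightarrow> h x = 0"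
    "(LINT x|lebesgue. \<bar>f x - h x\<bar>) < e / 3"
    using continuous_approx_L1[OF f M K] by metis
  have fi: "integrable lebesgue f" by (rule bounded_support_integrable[OF f M K])
  have hi: "integrable lebesgue h" by (rule compactly_supported_integrable(2)[OF h(1-3)])
  define P where "P = (\<Union>x\<in>L. cball x 1)"
  have P: "P \<in> lmeasurable" unfolding P_def by (intro lmeasurable_compact compact_thicken h)
  define m where "m = measure lebesgue P"
  have m: "0 \<le> m" by (simp add: m_def)
  define e' where "e' = e / (3 * (1 + m))"
  have e': "0 < e'" "e' * m \<le> e / 3" using \<open>0 < e\<close> m by (auto simp: e'_def field_simps)
  obtain d where d: "0 < d" "d \<le> 1" "\<And>x y. dist x y < d \<Longrightarrow> dist (h x) (h y) < e'"
    using compactly_supported_uniformly_continuous[OF h(1-3) e'(1)] by blast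
  show ?thesis
  proof (rule that[OF d(1)])
    fix r assume r: "0 < r" "r < d"
    note \<rho> = mollifier[OF r(1), where 'a='a]
    let ?\<rho> = "mollifier r :: 'a \<Rightarrow> real"
    have i1: "integrable lebesgue (conv ?\<rho> (\<lambda>x. f x - h x))"
      by (intro conv_mollifier_L1 r Bochner_Integration.integrable_diff fi hi)
    have i2: "integrable lebesgue (conv ?\<rho> h)" "integrable lebesgue (conv ?\<rho> f)"
      by (intro conv_mollifier_L1 r fi hi)+
    have "(LINT x|lebesgue. \<bar>conv ?\<rho> f x - f x\<bar>)
      \<le> (LINT x|lebesgue. \<bar>conv ?\<rho> (\<lambda>x. f x - h x) x\<bar> + \<bar>conv ?\<rho> h x - h x\<bar> + \<bar>f x - h x\<bar>)"
    proof (rule integral_mono)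
      show "integrable lebesgue (\<lambda>x. \<bar>conv ?\<rho> f x - f x\<bar>)" using i2 fi by simp
      show "integrable lebesgue (\<lambda>x. \<bar>conv ?\<rho> (\<lambda>x. f x - h x) x\<bar> + \<bar>conv ?\<rho> h x - h x\<bar> + \<bar>f x - h x\<bar>)"
        using i1 i2 fi hi by simp
    qed (auto simp: conv_diff[OF \<rho>(1) fi hi])
    also have "\<dots> = (LINT x|lebesgue. \<bar>conv ?\<rho> (\<lambda>x. f x - h x) x\<bar>) + (LINT x|lebesgue. \<bar>conv ?\<rho> h x - h x\<bar>)
        + (LINT x|lebesgue. \<bar>f x - h x\<bar>)"
      using i1 i2 fi hi by simp
    also have "(LINT x|lebesgue. \<bar>conv ?\<rho> (\<lambda>x. f x - h x) x\<bar>) \<le> (LINT x|lebesgue. \<bar>f x - h x\<bar>)"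
      by (intro conv_mollifier_L1 r Bochner_Integration.integrable_diff fi hi)
    also have "(LINT x|lebesgue. \<bar>conv ?\<rho> h x - h x\<bar>) \<le> (LINT x|lebesgue. indicator P x * e')"
    proof (rule integral_mono)
      show "integrable lebesgue (\<lambda>x. \<bar>conv ?\<rho> h x - h x\<bar>)" using i2 hi by simp
      have "integrable lebesgue (indicator P :: 'a \<Rightarrow> real)" using P by (simp add: lmeasurable_iff_integrable)
      then show "integrable lebesgue (\<lambda>x. indicator P x * e')" by (rule integrable_mult_left)
      fix x
      show "\<bar>conv ?\<rho> h x - h x\<bar> \<le> indicator P x * e'"
      proof (cases "x \<in> P")
        case True
        have "\<bar>conv ?\<rho> h x - h x\<bar> \<le> e'"
        proof (rule conv_mollifier_close[OF r(1) hi])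
          fix y assume "dist y x < r"
          then have "dist (h y) (h x) < e'" using r(2) by (intro d(3)) simp
          then show "\<bar>h y - h x\<bar> \<le> e'" by (simp add: dist_real_def)
        qed
        then show ?thesis using True by simp
      next
        case False
        then have "x \<notin> L" by (auto simp: P_def)
        moreover have "x \<notin> (\<Union>x\<in>L. cball x r)" using False r d(2) by (auto simp: P_def)
        ultimately show ?thesis using False h(3) conv_support[OF h(3), where r=r and \<rho>="?\<rho>" and x=x] \<rho>(4) by simp
      qed
    qed
    also have "(LINT x|lebesgue. indicator P x * e') = e' * m"
      using P by (simp add: m_def fmeasurable_def)
    finally show "(LINT x|lebesgue. \<bar>conv ?\<rho> f x - f x\<bar>) < e"
      using h(4) e'(2) by linarith
  qed
qed

section \<open>Weak gradients\<close>

lemma lebesgue_on_support: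
  fixes f :: "'a::euclidean_space \<Rightarrow> 'b::euclidean_space"
  assumes "\<Omega> \<in> sets lebesgue" "\<And>x. x \<notin> \<Omega> \<Longrightarrow> f x = 0"
  shows "(LINT x|lebesgue_on \<Omega>. f x) = (LINT x|lebesgue. f x)"
    "integrable (lebesgue_on \<Omega>) f \<longleftrightarrow> integrable lebesgue f"
    "f \<in> borel_measurable (lebesgue_on \<Omega>) \<longleftrightarrow> f \<in> borel_measurable lebesgue"
proof -
  have eq: "(\<lambda>x. if x \<in> \<Omega> then f x else 0) = f" using assms(2) by auto
  show "(LINT x|lebesgue_on \<Omega>. f x) = (LINT x|lebesgue. f x)"
    using Lebesgue_Measure.integral_restrict_UNIV[OF assms(1), of f] unfolding eq by simp
  show "integrable (lebesgue_on \<Omega>) f \<longleftrightarrow> integrable lebesgue f"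
    using Lebesgue_Measure.integrable_restrict_UNIV[OF assms(1), of f] unfolding eq by simp
  show "f \<in> borel_measurable (lebesgue_on \<Omega>) \<longleftrightarrow> f \<in> borel_measurable lebesgue"
    using borel_measurable_if[OF assms(1), of f] unfolding eq by simp
qed

text \<open>Completeness of Lebesgue measure, carried over to \<open>\<Omega>\<close> by extending
  with 0.\<close>

lemma borel_measurable_lebesgue_on_AE:
  fixes f :: "'a::euclidean_space \<Rightarrow> 'b::euclidean_space"
  assumes "\<Omega> \<in> sets lebesgue" "f \<in> borel_measurable (lebesgue_on \<Omega>)" "AE x in lebesgue_on \<Omega>. f x = g x"
  shows "g \<in> borel_measurable (lebesgue_on \<Omega>)"
proof -
  have "AE x in lebesgue. (if x \<in> \<Omega> then f x else 0) = (if x \<in> \<Omega> then g x else 0)"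
    using assms(1,3) by (simp add: AE_restrict_space_iff)
  from borel_measurable_AE[OF _ this] show ?thesis
    using assms(1,2) by (simp add: borel_measurable_if)
qed

lemma locally_integrable_integrable:
  fixes f :: "'a::euclidean_space \<Rightarrow> 'b::euclidean_space"
  assumes "\<Omega> \<in> sets lebesgue" "integrable (lebesgue_on \<Omega>) f"
  shows "locally_integrable \<Omega> f"
  unfolding locally_integrable_def
proof (intro allI impI, elim conjE)
  fix K assume K: "compact K" "K \<subseteq> \<Omega>"
  have "set_integrable lebesgue \<Omega> f"
    using assms unfolding set_integrable_def by (subst (asm) integrable_restrict_space) auto
  then show "set_integrable lebesgue K f"
    by (rule set_integrable_subset) (use K lmeasurable_compact[OF K(1)] in \<open>auto simp: fmeasurable_def\<close>)
qed

lemma locally_integrable_bounded_mult: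
  fixes f :: "'a::euclidean_space \<Rightarrow> real" and g :: "'a \<Rightarrow> 'b::euclidean_space"
  assumes "\<Omega> \<in> sets lebesgue" "locally_integrable \<Omega> g" "compact K" "K \<subseteq> \<Omega>" "\<And>x. x \<notin> K \<Longrightarrow> f x = 0"
    "f \<in> borel_measurable lebesgue" "\<And>x. \<bar>f x\<bar> \<le> B"
  shows "integrable (lebesgue_on \<Omega>) (\<lambda>x. f x *\<^sub>R g x)" "integrable lebesgue (\<lambda>x. f x *\<^sub>R g x)"
proof -
  have i: "integrable lebesgue (\<lambda>x. indicator K x *\<^sub>R g x)"
    using assms unfolding locally_integrable_def set_integrable_def by blast
  have "integrable lebesgue (\<lambda>x. f x *\<^sub>R (indicator K x *\<^sub>R g x))"
  proof (rule Bochner_Integration.integrable_bound[where f="\<lambda>x. B *\<^sub>R (indicator K x *\<^sub>R g x)"])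
    show "AE x in lebesgue. norm (f x *\<^sub>R (indicator K x *\<^sub>R g x)) \<le> norm (B *\<^sub>R (indicator K x *\<^sub>R g x))"
    proof (rule AE_I2)
      fix x
      have "\<bar>f x\<bar> \<le> \<bar>B\<bar>" using assms(7)[of x] by linarith
      then have "\<bar>f x\<bar> * norm (indicator K x *\<^sub>R g x) \<le> \<bar>B\<bar> * norm (indicator K x *\<^sub>R g x)"
        by (rule mult_right_mono) simp
      then show "norm (f x *\<^sub>R (indicator K x *\<^sub>R g x)) \<le> norm (B *\<^sub>R (indicator K x *\<^sub>R g x))"
        by (simp only: norm_scaleR)
    qed
    show "integrable lebesgue (\<lambda>x. B *\<^sub>R (indicator K x *\<^sub>R g x))"
      by (rule integrable_scaleR_right) (rule i)
    show "(\<lambda>x. f x *\<^sub>R (indicator K x *\<^sub>R g x)) \<in> borel_measurable lebesgue"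
      by (rule borel_measurable_scaleR[OF assms(6) borel_measurable_integrable[OF i]])
  qed
  moreover have "(\<lambda>x. f x *\<^sub>R (indicator K x *\<^sub>R g x)) = (\<lambda>x. f x *\<^sub>R g x)"
  proof
    fix x show "f x *\<^sub>R (indicator K x *\<^sub>R g x) = f x *\<^sub>R g x"
      using assms(5)[of x] by (cases "x \<in> K") auto
  qed
  ultimately show *: "integrable lebesgue (\<lambda>x. f x *\<^sub>R g x)" by simp
  then show "integrable (lebesgue_on \<Omega>) (\<lambda>x. f x *\<^sub>R g x)"
    by (subst lebesgue_on_support(2)[OF assms(1)]) (use assms(4,5) in auto)
qed

lemma locally_integrable_test:
  fixes g :: "'a::euclidean_space \<Rightarrow> 'b::euclidean_space"
  assumes "\<Omega> \<in> sets lebesgue" "locally_integrable \<Omega> g" "\<phi> \<in> test_functions \<Omega>"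
  shows "integrable (lebesgue_on \<Omega>) (\<lambda>x. \<phi> x *\<^sub>R g x)" "integrable lebesgue (\<lambda>x. \<phi> x *\<^sub>R g x)"
proof -
  obtain K where K: "compact K" "K \<subseteq> \<Omega>" "\<And>x. x \<notin> K \<Longrightarrow> \<phi> x = 0" using test_functionsE[OF assms(3)] by metis
  obtain B where B: "\<And>x. \<bar>\<phi> x\<bar> \<le> B" using test_functions_bounded[OF assms(3)] by metis
  have m: "\<phi> \<in> borel_measurable lebesgue"
    by (rule continuous_lebesgue_measurable[OF test_functions_continuous[OF assms(3)]])
  show "integrable (lebesgue_on \<Omega>) (\<lambda>x. \<phi> x *\<^sub>R g x)" "integrable lebesgue (\<lambda>x. \<phi> x *\<^sub>R g x)"
    using locally_integrable_bounded_mult[OF assms(1,2) K m B] by auto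
qed

lemma locally_integrable_grad_test:
  fixes f :: "'a::euclidean_space \<Rightarrow> real"
  assumes "\<Omega> \<in> sets lebesgue" "locally_integrable \<Omega> f" "\<phi> \<in> test_functions \<Omega>"
  shows "integrable (lebesgue_on \<Omega>) (\<lambda>x. f x *\<^sub>R grad \<phi> x)"
proof -
  have "integrable (lebesgue_on \<Omega>) (\<lambda>x. \<Sum>b\<in>Basis. ((grad \<phi> x \<bullet> b) *\<^sub>R f x) *\<^sub>R b)"
    by (intro Bochner_Integration.integrable_sum integrable_scaleR_left locally_integrable_test assms test_functions_partial)
  moreover have "(\<lambda>x. \<Sum>b\<in>Basis. ((grad \<phi> x \<bullet> b) *\<^sub>R f x) *\<^sub>R b) = (\<lambda>x. f x *\<^sub>R grad \<phi> x)"
  proof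
    fix x
    have "(\<Sum>b\<in>Basis. ((grad \<phi> x \<bullet> b) *\<^sub>R f x) *\<^sub>R b) = f x *\<^sub>R (\<Sum>b\<in>Basis. (grad \<phi> x \<bullet> b) *\<^sub>R b)"
      by (simp add: scaleR_sum_right mult.commute)
    then show "(\<Sum>b\<in>Basis. ((grad \<phi> x \<bullet> b) *\<^sub>R f x) *\<^sub>R b) = f x *\<^sub>R grad \<phi> x"
      by (simp add: euclidean_representation)
  qed
  ultimately show ?thesis by simp
qed

section \<open>The fundamental lemma of the calculus of variations\<close>

lemma integral_compact_eq_0:
  fixes g :: "'a::euclidean_space \<Rightarrow> 'b::euclidean_space"
  assumes "open \<Omega>" "locally_integrable \<Omega> g"
    and 0: "\<And>\<phi>. \<phi> \<in> test_functions \<Omega> \<Longrightarrow> (LINT x|lebesgue_on \<Omega>. \<phi> x *\<^sub>R g x) = 0"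
    and K: "compact K" "K \<subseteq> \<Omega>"
  shows "(LINT x|lebesgue. indicator K x *\<^sub>R g x) = 0"
proof -
  have \<Omega>: "\<Omega> \<in> sets lebesgue" using assms(1) by auto
  \<comment> \<open>The fixed cutoff \<open>\<zeta>\<close>, equal to 1 near \<open>K\<close>, is
    there for the majorant \<open>norm (\<zeta> x *\<^sub>R g x)\<close>: the function
    \<open>g\<close> is only locally integrable, so the cutoffs \<open>\<eta> n\<close> alone would
    not be dominated.\<close>
  obtain \<zeta> U where \<zeta>: "\<zeta> \<in> test_functions \<Omega>" "\<And>x. 0 \<le> \<zeta> x" "\<And>x. \<zeta> x \<le> 1" "K \<subseteq> U" "\<And>x. x \<in> U \<Longrightarrow> \<zeta> x = 1"
    using cutoff[OF K(1) assms(1) K(2)] by metis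
  obtain \<eta> :: "nat \<Rightarrow> 'a \<Rightarrow> real" where \<eta>: "\<And>n. \<eta> n \<in> test_functions \<Omega>" "\<And>n x. 0 \<le> \<eta> n x" "\<And>n x. \<eta> n x \<le> 1"
    "\<And>x. (\<lambda>n. \<eta> n x) \<longlonglongrightarrow> indicator K x"
    using cutoff_sequence[OF K(1) assms(1) K(2)] by metis
  have t: "(\<lambda>x. \<zeta> x * \<eta> n x) \<in> test_functions \<Omega>" for n
    by (rule test_functions_mult(1)[OF \<zeta>(1) test_functions_Ck[OF \<eta>(1)]])
  have "(\<lambda>n. LINT x|lebesgue. (\<zeta> x * \<eta> n x) *\<^sub>R g x) \<longlonglongrightarrow> (LINT x|lebesgue. indicator K x *\<^sub>R g x)"
  proof (rule integral_dominated_convergence[where w="\<lambda>x. norm (\<zeta> x *\<^sub>R g x)"])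
    show "integrable lebesgue (\<lambda>x. norm (\<zeta> x *\<^sub>R g x))"
      by (intro integrable_norm locally_integrable_test(2)[OF \<Omega> assms(2) \<zeta>(1)])
    show "(\<lambda>x. (\<zeta> x * \<eta> n x) *\<^sub>R g x) \<in> borel_measurable lebesgue" for n
      using locally_integrable_test(2)[OF \<Omega> assms(2) t[of n]] by auto
    show "(\<lambda>x. indicator K x *\<^sub>R g x) \<in> borel_measurable lebesgue"
      using assms(2) K by (auto simp: locally_integrable_def set_integrable_def)
    show "AE x in lebesgue. (\<lambda>n. (\<zeta> x * \<eta> n x) *\<^sub>R g x) \<longlonglongrightarrow> indicator K x *\<^sub>R g x"
    proof (rule AE_I2)
      fix x
      have "(\<lambda>n. (\<zeta> x * \<eta> n x) *\<^sub>R g x) \<longlonglongrightarrow> (\<zeta> x * indicator K x) *\<^sub>R g x"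
        by (intro tendsto_intros \<eta>(4))
      moreover have "\<zeta> x * indicator K x = indicator K x" using \<zeta>(4,5) by (auto simp: indicator_def)
      ultimately show "(\<lambda>n. (\<zeta> x * \<eta> n x) *\<^sub>R g x) \<longlonglongrightarrow> indicator K x *\<^sub>R g x" by simp
    qed
    show "AE x in lebesgue. norm ((\<zeta> x * \<eta> n x) *\<^sub>R g x) \<le> norm (\<zeta> x *\<^sub>R g x)" for n
    proof (rule AE_I2)
      fix x
      have "\<bar>\<zeta> x\<bar> * \<bar>\<eta> n x\<bar> \<le> \<bar>\<zeta> x\<bar> * 1" using \<eta>(2,3)[of n x] by (intro mult_left_mono) auto
      then show "norm ((\<zeta> x * \<eta> n x) *\<^sub>R g x) \<le> norm (\<zeta> x *\<^sub>R g x)"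
        by (simp add: abs_mult mult_right_mono)
    qed
  qed
  moreover have "(LINT x|lebesgue. (\<zeta> x * \<eta> n x) *\<^sub>R g x) = 0" for n
  proof -
    obtain L where L: "L \<subseteq> \<Omega>" "\<And>x. x \<notin> L \<Longrightarrow> \<zeta> x * \<eta> n x = 0" using test_functionsE[OF t] by metis
    have "(LINT x|lebesgue. (\<zeta> x * \<eta> n x) *\<^sub>R g x) = (LINT x|lebesgue_on \<Omega>. (\<zeta> x * \<eta> n x) *\<^sub>R g x)"
      by (rule lebesgue_on_support(1)[OF \<Omega>, symmetric]) (metis L scaleR_zero_left subsetD)
    then show ?thesis using 0[OF t] by simp
  qed
  ultimately show ?thesis by (simp add: LIMSEQ_const_iff)
qed

text \<open>Inner regularity: up to arbitrarily small measure the set where \<open>h\<close> is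
  positive is exhausted by a closed set \<open>F\<close>, which is compact because it lies in
  \<open>K\<close>. As \<open>h\<close> is positive on \<open>F\<close> with integral 0,
  \<open>F\<close> is a null set.\<close>

lemma AE_le_0_if_compact_integrals_0:
  fixes h :: "'a::euclidean_space \<Rightarrow> real"
  assumes h: "integrable lebesgue h"
    and 0: "\<And>F. compact F \<Longrightarrow> F \<subseteq> {x. 0 < h x} \<Longrightarrow> (LINT x|lebesgue. indicator F x * h x) = 0"
    and K: "compact K" "\<And>x. x \<notin> K \<Longrightarrow> h x = 0"
  shows "AE x in lebesgue. h x \<le> 0"
proof -
  define P where "P = {x. 0 < h x}"
  have hm: "h \<in> borel_measurable lebesgue" using h by simp
  have "P = {x \<in> space lebesgue. 0 < h x}" by (simp add: P_def)
  also have "\<dots> \<in> sets lebesgue" by (rule borel_measurable_less) (use hm in auto)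
  finally have P: "P \<in> sets lebesgue" .
  have le: "emeasure lebesgue P \<le> ennreal e" if e: "e > 0" for e
  proof -
    obtain F where F: "closed F" "F \<subseteq> P" "P - F \<in> lmeasurable" "emeasure lebesgue (P - F) < ennreal e"
      using sets_lebesgue_inner_closed[OF P e] by metis
    have "F \<subseteq> K" using F(2) K(2) by (force simp: P_def)
    then have cF: "compact F" using compact_Int_closed[OF K(1) F(1)] by (simp add: Int_absorb1)
    have FS: "F \<in> sets lebesgue" using lmeasurable_compact[OF cF] by auto
    have "AE x in lebesgue. indicator F x * h x = 0"
    proof (subst integral_nonneg_eq_0_iff_AE[symmetric])
      show "integrable lebesgue (\<lambda>x. indicator F x * h x)"
        using integrable_mult_indicator[OF FS h] by simp
      show "AE x in lebesgue. 0 \<le> indicator F x * h x"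
        using F(2) by (intro AE_I2) (auto simp: P_def indicator_def)
      show "(LINT x|lebesgue. indicator F x * h x) = 0" using 0[OF cF] F(2) by (simp add: P_def)
    qed
    then have "AE x in lebesgue. x \<notin> F"
      by eventually_elim (use F(2) in \<open>auto simp: P_def\<close>)
    then have F0: "F \<in> null_sets lebesgue" using FS by (simp add: AE_iff_null_sets)
    have "emeasure lebesgue P \<le> emeasure lebesgue (F \<union> (P - F))"
      by (rule emeasure_mono) (use P FS in auto)
    also have "\<dots> \<le> emeasure lebesgue F + emeasure lebesgue (P - F)"
      by (rule emeasure_subadditive) (use P FS in auto)
    also have "\<dots> \<le> ennreal e" using F0 F(4) by (auto simp: null_sets_def)
    finally show ?thesis .
  qed
  have "emeasure lebesgue P = 0"
  proof (rule ccontr)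
    assume *: "emeasure lebesgue P \<noteq> 0"
    have "emeasure lebesgue P \<noteq> \<infinity>" using le[of 1] by (auto simp: top_unique)
    then obtain m where m: "emeasure lebesgue P = ennreal m" "0 \<le> m" by (cases "emeasure lebesgue P") auto
    then have "m > 0" using * by (cases "m = 0") auto
    then show False using le[of "m / 2"] m by (simp add: ennreal_le_iff)
  qed
  then have "P \<in> null_sets lebesgue" using P by (simp add: null_sets_def)
  then have "AE x in lebesgue. x \<notin> P" by (rule AE_not_in)
  then show ?thesis by eventually_elim (simp add: P_def)
qed

text \<open>The one-sided result is applied to the scalar functions \<open>g x \<bullet> b\<close>
  and \<open>g x \<bullet> (- b)\<close> for the basis vectors \<open>b\<close>, on each member of a
  countable exhaustion of \<open>\<Omega>\<close> by compact sets.\<close>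

lemma fundamental_lemma:
  fixes g :: "'a::euclidean_space \<Rightarrow> 'b::euclidean_space"
  assumes "open \<Omega>" "locally_integrable \<Omega> g"
    and "\<And>\<phi>. \<phi> \<in> test_functions \<Omega> \<Longrightarrow> (LINT x|lebesgue_on \<Omega>. \<phi> x *\<^sub>R g x) = 0"
  shows "AE x in lebesgue_on \<Omega>. g x = 0"
proof -
  have \<Omega>: "\<Omega> \<in> sets lebesgue" using assms(1) by auto
  have i: "integrable lebesgue (\<lambda>x. indicator K x *\<^sub>R g x)" if "compact K" "K \<subseteq> \<Omega>" for K
    using assms(2) that by (auto simp: locally_integrable_def set_integrable_def)
  have le: "AE x in lebesgue. indicator K x * (g x \<bullet> b) \<le> 0" if K: "compact K" "K \<subseteq> \<Omega>" for K b
  proof (rule AE_le_0_if_compact_integrals_0[OF _ _ K(1)])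
    show "integrable lebesgue (\<lambda>x. indicator K x * (g x \<bullet> b))"
      using integrable_inner_left[OF i[OF K], of b] by simp
    fix F assume F: "compact F" "F \<subseteq> {x. 0 < indicator K x * (g x \<bullet> b)}"
    have FK: "F \<subseteq> K"
    proof
      fix x assume "x \<in> F"
      then have "0 < indicator K x * (g x \<bullet> b)" using F by blast
      then show "x \<in> K" by (cases "x \<in> K") auto
    qed
    then have F\<Omega>: "F \<subseteq> \<Omega>" using K by auto
    have "(LINT x|lebesgue. indicator F x * (indicator K x * (g x \<bullet> b))) = (LINT x|lebesgue. (indicator F x *\<^sub>R g x) \<bullet> b)"
      using FK by (intro Bochner_Integration.integral_cong) (auto simp: indicator_def)
    also have "\<dots> = (LINT x|lebesgue. indicator F x *\<^sub>R g x) \<bullet> b"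
      by (rule integral_inner_left) (use i[OF F(1) F\<Omega>] in auto)
    also have "\<dots> = 0" using integral_compact_eq_0[OF assms F(1) F\<Omega>] by simp
    finally show "(LINT x|lebesgue. indicator F x * (indicator K x * (g x \<bullet> b))) = 0" .
  qed auto
  obtain C :: "nat \<Rightarrow> 'a set" where C: "\<And>n. compact (C n)" "\<And>n. C n \<subseteq> \<Omega>" "\<Union>(range C) = \<Omega>"
    using open_Union_compact_subsets[OF assms(1)] by metis
  have "AE x in lebesgue. \<forall>n. \<forall>b\<in>Basis. indicator (C n) x * (g x \<bullet> b) \<le> 0 \<and> indicator (C n) x * (g x \<bullet> (- b)) \<le> 0"
    unfolding AE_all_countable
  proof
    fix n
    show "AE x in lebesgue. \<forall>b\<in>Basis. indicator (C n) x * (g x \<bullet> b) \<le> 0 \<and> indicator (C n) x * (g x \<bullet> (- b)) \<le> 0"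
      by (intro AE_finite_allI finite_Basis AE_conjI le C)
  qed
  then have "AE x in lebesgue. x \<in> \<Omega> \<longrightarrow> g x = 0"
  proof eventually_elim
    case (elim x)
    show ?case
    proof
      assume "x \<in> \<Omega>"
      then obtain n where n: "x \<in> C n" using C(3) by blast
      show "g x = 0"
      proof (rule euclidean_eqI)
        fix b :: 'b assume "b \<in> Basis"
        with elim n have "indicator (C n) x * (g x \<bullet> b) \<le> 0" "indicator (C n) x * (g x \<bullet> (- b)) \<le> 0" by blast+
        with n show "g x \<bullet> b = 0 \<bullet> b" by simp
      qed
    qed
  qed
  then show ?thesis using \<Omega> by (simp add: AE_restrict_space_iff)
qed

lemma locally_integrable_diff:
  fixes f g :: "'a::euclidean_space \<Rightarrow> 'b::euclidean_space"
  assumes "locally_integrable \<Omega> f" "locally_integrable \<Omega> g"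
  shows "locally_integrable \<Omega> (\<lambda>x. f x - g x)"
  using assms by (auto simp: locally_integrable_def intro: set_integral_diff)

lemma locally_integrable_cmult:
  fixes f :: "'a::euclidean_space \<Rightarrow> 'b::euclidean_space"
  assumes "locally_integrable \<Omega> f"
  shows "locally_integrable \<Omega> (\<lambda>x. c *\<^sub>R f x)"
  using assms by (auto simp: locally_integrable_def intro: set_integrable_scaleR_right)

lemma has_weak_grad_unique:
  fixes g g' :: "'a::euclidean_space \<Rightarrow> 'a"
  assumes "open \<Omega>" "has_weak_grad \<Omega> f g" "has_weak_grad \<Omega> f g'"
  shows "AE x in lebesgue_on \<Omega>. g x = g' x"
proof -
  have \<Omega>: "\<Omega> \<in> sets lebesgue" using assms(1) by auto
  have l: "locally_integrable \<Omega> g" "locally_integrable \<Omega> g'" using assms by (auto simp: has_weak_grad_def)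
  have "AE x in lebesgue_on \<Omega>. g x - g' x = 0"
  proof (rule fundamental_lemma[OF assms(1) locally_integrable_diff[OF l]])
    fix \<phi> assume \<phi>: "\<phi> \<in> test_functions \<Omega>"
    have "(LINT x|lebesgue_on \<Omega>. \<phi> x *\<^sub>R (g x - g' x))
        = (LINT x|lebesgue_on \<Omega>. \<phi> x *\<^sub>R g x) - (LINT x|lebesgue_on \<Omega>. \<phi> x *\<^sub>R g' x)"
      using locally_integrable_test(1)[OF \<Omega> l(1) \<phi>] locally_integrable_test(1)[OF \<Omega> l(2) \<phi>]
      by (simp add: scaleR_diff_right)
    also have "\<dots> = 0" using assms(2,3) \<phi> unfolding has_weak_grad_def
      by (metis add.inverse_inverse diff_self)
    finally show "(LINT x|lebesgue_on \<Omega>. \<phi> x *\<^sub>R (g x - g' x)) = 0" .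
  qed
  then show ?thesis by simp
qed

lemma wgrad_eq:
  assumes "open \<Omega>" "has_weak_grad \<Omega> f g"
  shows "AE x in lebesgue_on \<Omega>. wgrad \<Omega> f x = g x" "has_weak_grad \<Omega> f (wgrad \<Omega> f)"
proof -
  show *: "has_weak_grad \<Omega> f (wgrad \<Omega> f)" unfolding wgrad_def by (rule someI[where P="has_weak_grad \<Omega> f", OF assms(2)])
  show "AE x in lebesgue_on \<Omega>. wgrad \<Omega> f x = g x" by (rule has_weak_grad_unique[OF assms(1) * assms(2)])
qed

lemma locally_integrable_cong_AE:
  fixes f g :: "'a::euclidean_space \<Rightarrow> 'b::euclidean_space"
  assumes "\<Omega> \<in> sets lebesgue" "locally_integrable \<Omega> f" "AE x in lebesgue_on \<Omega>. f x = g x"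
  shows "locally_integrable \<Omega> g"
  unfolding locally_integrable_def set_integrable_def
proof (intro allI impI, elim conjE)
  fix K assume K: "compact K" "K \<subseteq> \<Omega>"
  have i: "integrable lebesgue (\<lambda>x. indicator K x *\<^sub>R f x)"
    using assms K by (auto simp: locally_integrable_def set_integrable_def)
  have ae: "AE x in lebesgue. indicator K x *\<^sub>R f x = indicator K x *\<^sub>R g x"
    using assms(1,3) K(2) by (simp add: AE_restrict_space_iff) (auto elim!: eventually_mono simp: indicator_def)
  show "integrable lebesgue (\<lambda>x. indicator K x *\<^sub>R g x)"
    by (rule integrable_cong_AE_imp[OF i borel_measurable_AE[OF borel_measurable_integrable[OF i] ae]])
       (use ae in \<open>auto elim!: eventually_mono\<close>)
qed

lemma has_weak_grad_cong_AE:
  fixes g g' :: "'a::euclidean_space \<Rightarrow> 'a"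
  assumes \<Omega>: "\<Omega> \<in> sets lebesgue" and w: "has_weak_grad \<Omega> f g"
    and f: "AE x in lebesgue_on \<Omega>. f x = f' x" and g: "AE x in lebesgue_on \<Omega>. g x = g' x"
  shows "has_weak_grad \<Omega> f' g'"
proof -
  have l: "locally_integrable \<Omega> f" "locally_integrable \<Omega> g" using w by (auto simp: has_weak_grad_def)
  have l': "locally_integrable \<Omega> f'" "locally_integrable \<Omega> g'"
    using locally_integrable_cong_AE[OF \<Omega> l(1) f] locally_integrable_cong_AE[OF \<Omega> l(2) g] by auto
  show ?thesis
    unfolding has_weak_grad_def
  proof (intro conjI ballI l')
    fix \<phi> assume \<phi>: "\<phi> \<in> test_functions \<Omega>"
    have "(LINT x|lebesgue_on \<Omega>. f' x *\<^sub>R grad \<phi> x) = (LINT x|lebesgue_on \<Omega>. f x *\<^sub>R grad \<phi> x)"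
      by (rule integral_cong_AE)
         (use f locally_integrable_grad_test[OF \<Omega> l(1) \<phi>] locally_integrable_grad_test[OF \<Omega> l'(1) \<phi>] in \<open>auto elim!: eventually_mono\<close>)
    moreover have "(LINT x|lebesgue_on \<Omega>. \<phi> x *\<^sub>R g' x) = (LINT x|lebesgue_on \<Omega>. \<phi> x *\<^sub>R g x)"
      by (rule integral_cong_AE)
         (use g locally_integrable_test(1)[OF \<Omega> l(2) \<phi>] locally_integrable_test(1)[OF \<Omega> l'(2) \<phi>] in \<open>auto elim!: eventually_mono\<close>)
    ultimately show "(LINT x|lebesgue_on \<Omega>. f' x *\<^sub>R grad \<phi> x) = - (LINT x|lebesgue_on \<Omega>. \<phi> x *\<^sub>R g' x)"
      using w \<phi> by (simp add: has_weak_grad_def)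
  qed
qed

lemma has_weak_grad_diff:
  fixes g g' :: "'a::euclidean_space \<Rightarrow> 'a"
  assumes \<Omega>: "\<Omega> \<in> sets lebesgue" and w: "has_weak_grad \<Omega> f g" "has_weak_grad \<Omega> f' g'"
  shows "has_weak_grad \<Omega> (\<lambda>x. f x - f' x) (\<lambda>x. g x - g' x)"
proof -
  have l: "locally_integrable \<Omega> f" "locally_integrable \<Omega> g" "locally_integrable \<Omega> f'" "locally_integrable \<Omega> g'"
    using w by (auto simp: has_weak_grad_def)
  show ?thesis
    unfolding has_weak_grad_def
  proof (intro conjI ballI locally_integrable_diff l)
    fix \<phi> assume \<phi>: "\<phi> \<in> test_functions \<Omega>"
    note i = locally_integrable_grad_test[OF \<Omega> l(1) \<phi>] locally_integrable_grad_test[OF \<Omega> l(3) \<phi>]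
      locally_integrable_test(1)[OF \<Omega> l(2) \<phi>] locally_integrable_test(1)[OF \<Omega> l(4) \<phi>]
    show "(LINT x|lebesgue_on \<Omega>. (f x - f' x) *\<^sub>R grad \<phi> x) = - (LINT x|lebesgue_on \<Omega>. \<phi> x *\<^sub>R (g x - g' x))"
      using w \<phi> i by (simp add: has_weak_grad_def scaleR_diff_left scaleR_diff_right)
  qed
qed

lemma has_weak_grad_scaleR:
  fixes g :: "'a::euclidean_space \<Rightarrow> 'a"
  assumes "has_weak_grad \<Omega> f g"
  shows "has_weak_grad \<Omega> (\<lambda>x. c * f x) (\<lambda>x. c *\<^sub>R g x)"
proof -
  have l: "locally_integrable \<Omega> f" "locally_integrable \<Omega> g" using assms by (auto simp: has_weak_grad_def)
  show ?thesis
    unfolding has_weak_grad_def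
  proof (intro conjI ballI locally_integrable_cmult l)
    show "locally_integrable \<Omega> (\<lambda>x. c * f x)" using locally_integrable_cmult[OF l(1), of c] by simp
    fix \<phi> assume \<phi>: "\<phi> \<in> test_functions \<Omega>"
    have "(LINT x|lebesgue_on \<Omega>. (c * f x) *\<^sub>R grad \<phi> x) = c *\<^sub>R (LINT x|lebesgue_on \<Omega>. f x *\<^sub>R grad \<phi> x)"
      by (subst integral_scaleR_right[symmetric]) simp
    also have "\<dots> = c *\<^sub>R (- (LINT x|lebesgue_on \<Omega>. \<phi> x *\<^sub>R g x))"
      using assms \<phi> by (simp add: has_weak_grad_def)
    also have "\<dots> = - (LINT x|lebesgue_on \<Omega>. c *\<^sub>R (\<phi> x *\<^sub>R g x))"
      by (subst integral_scaleR_right) simp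
    finally show "(LINT x|lebesgue_on \<Omega>. (c * f x) *\<^sub>R grad \<phi> x) = - (LINT x|lebesgue_on \<Omega>. \<phi> x *\<^sub>R (c *\<^sub>R g x))"
      by (simp add: mult.commute)
  qed
qed

lemma has_weak_grad_add:
  fixes g g' :: "'a::euclidean_space \<Rightarrow> 'a"
  assumes \<Omega>: "\<Omega> \<in> sets lebesgue" and w: "has_weak_grad \<Omega> f g" "has_weak_grad \<Omega> f' g'"
  shows "has_weak_grad \<Omega> (\<lambda>x. f x + f' x) (\<lambda>x. g x + g' x)"
  using has_weak_grad_diff[OF \<Omega> w(1) has_weak_grad_scaleR[OF w(2), of "-1"]] by simp

lemma locally_integrable_continuous:
  fixes f :: "'a::euclidean_space \<Rightarrow> 'b::euclidean_space"
  assumes "continuous_on UNIV f"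
  shows "locally_integrable \<Omega> f"
  unfolding locally_integrable_def set_integrable_def
proof (intro allI impI)
  fix K assume "compact K \<and> K \<subseteq> \<Omega>"
  then have "integrable lborel (\<lambda>x. indicator K x *\<^sub>R f x)"
    using borel_integrable_compact[of K f] continuous_on_subset[OF assms, of K] by simp
  then show "integrable lebesgue (\<lambda>x. indicator K x *\<^sub>R f x)"
    using integrable_completion[of "\<lambda>x. indicator K x *\<^sub>R f x" lborel] by auto
qed

text \<open>Integration by parts: the gradient of \<open>f x * \<phi> x\<close> is continuous, of
  compact support, and has integral 0.\<close>

lemma has_weak_grad_C1:
  fixes f :: "'a::euclidean_space \<Rightarrow> real"
  assumes \<Omega>: "\<Omega> \<in> sets lebesgue" and D: "\<And>x. (f has_derivative (\<lambda>h. g x \<bullet> h)) (at x)" and g: "continuous_on UNIV g"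
  shows "has_weak_grad \<Omega> f g"
proof -
  have f: "continuous_on UNIV f"
    using D by (meson continuous_at_imp_continuous_on has_derivative_continuous)
  note l = locally_integrable_continuous[OF f, of \<Omega>] locally_integrable_continuous[OF g, of \<Omega>]
  show ?thesis
    unfolding has_weak_grad_def
  proof (intro conjI ballI l)
    fix \<phi> assume \<phi>: "\<phi> \<in> test_functions \<Omega>"
    obtain K where K: "compact K" "K \<subseteq> \<Omega>" "\<And>x. x \<notin> K \<Longrightarrow> \<phi> x = 0" "\<And>x. x \<notin> K \<Longrightarrow> grad \<phi> x = 0"
      using test_functionsE[OF \<phi>] by metis
    have "(LINT x|lebesgue. f x *\<^sub>R grad \<phi> x + \<phi> x *\<^sub>R g x) = 0"
      by (rule integral_grad_eq_0(1)[OF has_derivative_mult_inner[OF D test_functions_has_derivative[OF \<phi>]] _ K(1)])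
         (use K in \<open>auto intro!: continuous_intros f g test_functions_continuous[OF \<phi>] test_functions_continuous_grad[OF \<phi>]\<close>)
    moreover have "(LINT x|lebesgue_on \<Omega>. f x *\<^sub>R grad \<phi> x + \<phi> x *\<^sub>R g x) = (LINT x|lebesgue. f x *\<^sub>R grad \<phi> x + \<phi> x *\<^sub>R g x)"
      by (rule lebesgue_on_support(1)[OF \<Omega>]) (metis K(2-4) add_0 scaleR_zero_left scaleR_zero_right subsetD)
    ultimately have "(LINT x|lebesgue_on \<Omega>. f x *\<^sub>R grad \<phi> x) + (LINT x|lebesgue_on \<Omega>. \<phi> x *\<^sub>R g x) = 0"
      using locally_integrable_grad_test[OF \<Omega> l(1) \<phi>] locally_integrable_test(1)[OF \<Omega> l(2) \<phi>] by simp
    then show "(LINT x|lebesgue_on \<Omega>. f x *\<^sub>R grad \<phi> x) = - (LINT x|lebesgue_on \<Omega>. \<phi> x *\<^sub>R g x)"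
      by (simp add: eq_neg_iff_add_eq_0)
  qed
qed

text \<open>Boundedness makes the measure \<open>M\<close> finite, so that bounded functions are
  square integrable and square integrable ones are integrable.\<close>

locale bounded_open =
  fixes \<Omega> :: "'a::euclidean_space set"
  assumes op: "open \<Omega>" and bd: "bounded \<Omega>"
begin

abbreviation M :: "'a measure" where "M \<equiv> lebesgue_on \<Omega>"

lemma sets_\<Omega>: "\<Omega> \<in> sets lebesgue"
  using op by auto

lemma lmeasurable_\<Omega>: "\<Omega> \<in> lmeasurable"
  using lmeasurable_open[OF bd op] .

sublocale finite_measure M
  by (rule finite_measure_lebesgue_on[OF lmeasurable_\<Omega>])

lemma sq_int_locally_integrable:
  fixes f :: "'a \<Rightarrow> 'b::euclidean_space"
  assumes "sq_int M f" shows "locally_integrable \<Omega> f"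
  by (rule locally_integrable_integrable[OF sets_\<Omega> sq_int_imp_integrable[OF assms]])

lemma sq_int_test:
  assumes "\<phi> \<in> test_functions \<Omega>'"
  shows "sq_int M \<phi>" "sq_int M (grad \<phi>)"
proof -
  obtain B where B: "\<And>x. \<bar>\<phi> x\<bar> \<le> B" "\<And>x. norm (grad \<phi> x) \<le> B" using test_functions_bounded[OF assms] by metis
  show "sq_int M \<phi>"
    by (rule sq_int_bounded[where K=B])
       (use B in \<open>auto intro: measurable_restrict_space1[OF continuous_lebesgue_measurable[OF test_functions_continuous[OF assms]]]\<close>)
  show "sq_int M (grad \<phi>)"
    by (rule sq_int_bounded[where K=B])
       (use B in \<open>auto intro: measurable_restrict_space1[OF continuous_lebesgue_measurable[OF test_functions_continuous_grad[OF assms]]]\<close>)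
qed

lemma sq_int_AE:
  fixes f g :: "'a \<Rightarrow> 'b::euclidean_space"
  assumes "sq_int M f" "AE x in M. f x = g x"
  shows "sq_int M g" "L2norm M g = L2norm M f"
proof -
  have m: "g \<in> borel_measurable M"
    by (rule borel_measurable_lebesgue_on_AE[OF sets_\<Omega> sq_int_measurable[OF assms(1)] assms(2)])
  show "sq_int M g" by (rule sq_int_cong_AE[OF assms(1) m assms(2)])
  show "L2norm M g = L2norm M f"
    by (rule L2norm_cong_AE[symmetric, OF assms(2) sq_int_measurable[OF assms(1)] m])
qed

lemma sq_int_wgrad:
  assumes "has_weak_grad \<Omega> f g" "sq_int M g"
  shows "sq_int M (wgrad \<Omega> f)" "L2norm M (wgrad \<Omega> f) = L2norm M g"
proof -
  have "AE x in M. g x = wgrad \<Omega> f x"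
    using wgrad_eq(1)[OF op assms(1)] by eventually_elim simp
  from sq_int_AE[OF assms(2) this] show "sq_int M (wgrad \<Omega> f)" "L2norm M (wgrad \<Omega> f) = L2norm M g" by auto
qed

text \<open>The weak limit of the gradients suffices to identify the gradient of a strong limit.\<close>

lemma has_weak_grad_limit:
  fixes g :: "nat \<Rightarrow> 'a \<Rightarrow> 'a"
  assumes w: "\<And>k. has_weak_grad \<Omega> (f k) (g k)" and f: "\<And>k. sq_int M (f k)" "sq_int M f0" "sq_int M g0"
    and lim: "(\<lambda>k. L2norm M (\<lambda>x. f k x - f0 x)) \<longlonglongrightarrow> 0"
    and limg: "\<And>\<phi>. \<phi> \<in> test_functions \<Omega> \<Longrightarrow> (\<lambda>k. LINT x|M. \<phi> x *\<^sub>R g k x) \<longlonglongrightarrow> (LINT x|M. \<phi> x *\<^sub>R g0 x)"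
  shows "has_weak_grad \<Omega> f0 g0"
  unfolding has_weak_grad_def
proof (intro conjI ballI sq_int_locally_integrable f)
  fix \<phi> assume \<phi>: "\<phi> \<in> test_functions \<Omega>"
  have "(\<lambda>k. LINT x|M. f k x *\<^sub>R grad \<phi> x) \<longlonglongrightarrow> (LINT x|M. f0 x *\<^sub>R grad \<phi> x)"
  proof (rule tendsto_dist_iff[THEN iffD2], rule Lim_null_comparison)
    show "\<forall>\<^sub>F k in sequentially. norm (dist (LINT x|M. f k x *\<^sub>R grad \<phi> x) (LINT x|M. f0 x *\<^sub>R grad \<phi> x))
        \<le> L2norm M (\<lambda>x. f k x - f0 x) * L2norm M (grad \<phi>)"
    proof (rule always_eventually, rule allI)
      fix k
      have "(LINT x|M. f k x *\<^sub>R grad \<phi> x) - (LINT x|M. f0 x *\<^sub>R grad \<phi> x) = (LINT x|M. (f k x - f0 x) *\<^sub>R grad \<phi> x)"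
        using f sq_int_test[OF \<phi>] by (simp add: scaleR_diff_left sq_int_scaleR_integrable)
      also have "norm \<dots> \<le> (LINT x|M. norm ((f k x - f0 x) *\<^sub>R grad \<phi> x))" by (rule integral_norm_bound)
      also have "\<dots> = (LINT x|M. norm (f k x - f0 x) * norm (grad \<phi> x))" by simp
      also have "\<dots> \<le> L2norm M (\<lambda>x. f k x - f0 x) * L2norm M (grad \<phi>)"
        by (intro Cauchy_Schwarz_norm_integral sq_int_diff f sq_int_test[OF \<phi>])
      finally show "norm (dist (LINT x|M. f k x *\<^sub>R grad \<phi> x) (LINT x|M. f0 x *\<^sub>R grad \<phi> x))
        \<le> L2norm M (\<lambda>x. f k x - f0 x) * L2norm M (grad \<phi>)" by (simp add: dist_norm)
    qed
    show "(\<lambda>k. L2norm M (\<lambda>x. f k x - f0 x) * L2norm M (grad \<phi>)) \<longlonglongrightarrow> 0"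
      using tendsto_mult_right[OF lim, of "L2norm M (grad \<phi>)"] by simp
  qed
  moreover have "(\<lambda>k. LINT x|M. f k x *\<^sub>R grad \<phi> x) \<longlonglongrightarrow> - (LINT x|M. \<phi> x *\<^sub>R g0 x)"
    using tendsto_minus[OF limg[OF \<phi>]] w \<phi> by (simp add: has_weak_grad_def)
  ultimately show "(LINT x|M. f0 x *\<^sub>R grad \<phi> x) = - (LINT x|M. \<phi> x *\<^sub>R g0 x)"
    using LIMSEQ_unique by blast
qed

lemma tendsto_integral_test:
  fixes g :: "nat \<Rightarrow> 'a \<Rightarrow> 'b::euclidean_space"
  assumes "\<And>k. sq_int M (g k)" "sq_int M g0" "(\<lambda>k. L2norm M (\<lambda>x. g k x - g0 x)) \<longlonglongrightarrow> 0" "\<phi> \<in> test_functions \<Omega>"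
  shows "(\<lambda>k. LINT x|M. \<phi> x *\<^sub>R g k x) \<longlonglongrightarrow> (LINT x|M. \<phi> x *\<^sub>R g0 x)"
proof (rule tendsto_dist_iff[THEN iffD2], rule Lim_null_comparison)
  show "\<forall>\<^sub>F k in sequentially. norm (dist (LINT x|M. \<phi> x *\<^sub>R g k x) (LINT x|M. \<phi> x *\<^sub>R g0 x))
      \<le> L2norm M \<phi> * L2norm M (\<lambda>x. g k x - g0 x)"
  proof (rule always_eventually, rule allI)
    fix k
    have "(LINT x|M. \<phi> x *\<^sub>R g k x) - (LINT x|M. \<phi> x *\<^sub>R g0 x) = (LINT x|M. \<phi> x *\<^sub>R (g k x - g0 x))"
      using assms sq_int_test[OF assms(4)] by (simp add: scaleR_diff_right sq_int_scaleR_integrable)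
    also have "norm \<dots> \<le> (LINT x|M. norm (\<phi> x *\<^sub>R (g k x - g0 x)))" by (rule integral_norm_bound)
    also have "\<dots> = (LINT x|M. norm (\<phi> x) * norm (g k x - g0 x))" by simp
    also have "\<dots> \<le> L2norm M \<phi> * L2norm M (\<lambda>x. g k x - g0 x)"
      by (intro Cauchy_Schwarz_norm_integral sq_int_diff assms sq_int_test[OF assms(4)])
    finally show "norm (dist (LINT x|M. \<phi> x *\<^sub>R g k x) (LINT x|M. \<phi> x *\<^sub>R g0 x))
      \<le> L2norm M \<phi> * L2norm M (\<lambda>x. g k x - g0 x)" by (simp add: dist_norm)
  qed
  show "(\<lambda>k. L2norm M \<phi> * L2norm M (\<lambda>x. g k x - g0 x)) \<longlonglongrightarrow> 0"
    using tendsto_mult_left[OF assms(3), of "L2norm M \<phi>"] by simp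
qed

end

section \<open>The space \<open>H01\<close>\<close>

lemma Ck_reflect: "Ck k f \<Longrightarrow> Ck k (\<lambda>y. f (x - y))"
proof (induction k arbitrary: f)
  case 0
  then show ?case using continuous_shift[of f x] by simp
next
  case (Suc k)
  show ?case
  proof (rule Ck_SucI[where g="\<lambda>y. - grad f (x - y)"])
    fix y
    have "((\<lambda>y. x - y) has_derivative (\<lambda>h. - h)) (at y)" by (auto intro!: derivative_eq_intros)
    from has_derivative_compose[OF this has_derivative_grad[OF Ck_Suc_differentiable[OF Suc.prems]]]
    show "((\<lambda>y. f (x - y)) has_derivative (\<lambda>h. (- grad f (x - y)) \<bullet> h)) (at y)" by simp
  next
    fix b :: 'a assume "b \<in> Basis"
    from Ck_mult[OF Ck_const[of k "-1"] Suc.IH[OF Ck_Suc_grad[OF Suc.prems this]]]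
    show "Ck k (\<lambda>y. (- grad f (x - y)) \<bullet> b)" by simp
  qed
qed

text \<open>For a bounded function L1 convergence upgrades to L2: the difference is at most
  \<open>2 * \<bar>B\<bar>\<close>, hence its square is at most \<open>B'\<close> times its modulus.
  The summand 1 in \<open>B'\<close> makes division by \<open>B'\<close> safe.\<close>

lemma mollify_L2_tendsto:
  fixes f :: "'a::euclidean_space \<Rightarrow> real"
  assumes f: "f \<in> borel_measurable lebesgue" and B: "AE x in lebesgue. \<bar>f x\<bar> \<le> B"
    and K: "compact K" "\<And>x. x \<notin> K \<Longrightarrow> f x = 0"
  shows "((\<lambda>r. LINT x|lebesgue. (conv (mollifier r) f x - f x)\<^sup>2) \<longlongrightarrow> 0) (at_right 0)"
    and "\<And>r. 0 < r \<Longrightarrow> integrable lebesgue (\<lambda>x. (conv (mollifier r) f x - f x)\<^sup>2)"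
proof -
  have fi: "integrable lebesgue f" by (rule bounded_support_integrable[OF f B K])
  define B' where "B' = 2 * \<bar>B\<bar> + 1"
  have B': "0 < B'" by (simp add: B'_def)
  have i: "integrable lebesgue (\<lambda>x. B' * \<bar>conv (mollifier r) f x - f x\<bar>)" if "0 < r" for r
    using conv_mollifier_L1(1)[OF that fi] fi by simp
  have le: "AE x in lebesgue. (conv (mollifier r) f x - f x)\<^sup>2 \<le> B' * \<bar>conv (mollifier r) f x - f x\<bar>" if "0 < r" for r
    using B
  proof eventually_elim
    case (elim x)
    have "\<bar>conv (mollifier r) f x - f x\<bar> \<le> B'"
      using conv_mollifier_bound[OF that fi B, of x] elim by (simp add: B'_def)
    then have "\<bar>conv (mollifier r) f x - f x\<bar> * \<bar>conv (mollifier r) f x - f x\<bar> \<le> B' * \<bar>conv (mollifier r) f x - f x\<bar>"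
      by (rule mult_right_mono) simp
    then show ?case by (simp add: power2_eq_square abs_mult[symmetric])
  qed
  show int: "integrable lebesgue (\<lambda>x. (conv (mollifier r) f x - f x)\<^sup>2)" if "0 < r" for r
    by (rule Bochner_Integration.integrable_bound[OF i[OF that]])
       (use le[OF that] conv_mollifier_L1(1)[OF that fi] fi in \<open>auto elim!: eventually_mono\<close>)
  show "((\<lambda>r. LINT x|lebesgue. (conv (mollifier r) f x - f x)\<^sup>2) \<longlongrightarrow> 0) (at_right 0)"
  proof (rule tendstoI)
    fix e :: real assume "0 < e"
    then have "0 < e / B'" using B' by simp
    then obtain R where R: "0 < R" "\<And>r. 0 < r \<Longrightarrow> r < R \<Longrightarrow> (LINT x|lebesgue. \<bar>conv (mollifier r) f x - f x\<bar>) < e / B'"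
      using mollify_L1_convergence[OF f B K] by metis
    show "\<forall>\<^sub>F r in at_right 0. dist (LINT x|lebesgue. (conv (mollifier r) f x - f x)\<^sup>2) 0 < e"
      unfolding eventually_at_right_field
    proof (intro exI[of _ R] conjI allI impI R(1))
      fix r assume r: "0 < r" "r < R"
      have "(LINT x|lebesgue. (conv (mollifier r) f x - f x)\<^sup>2) \<le> (LINT x|lebesgue. B' * \<bar>conv (mollifier r) f x - f x\<bar>)"
        by (rule integral_mono_AE[OF int[OF r(1)] i[OF r(1)] le[OF r(1)]])
      also have "\<dots> = B' * (LINT x|lebesgue. \<bar>conv (mollifier r) f x - f x\<bar>)" by simp
      also have "\<dots> < B' * (e / B')" using R(2)[OF r] B' by (intro mult_strict_left_mono)
      finally show "dist (LINT x|lebesgue. (conv (mollifier r) f x - f x)\<^sup>2) 0 < e"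
        using B' by simp
    qed
  qed
qed

context bounded_open
begin

text \<open>The L2 closure of the graph of the gradient on test functions. Carrying the gradient
  explicitly avoids the choice in \<open>wgrad\<close> and makes limits, products and compositions
  statements about pairs; \<open>H01_grad_imp_H01\<close> and \<open>H01_imp_H01_grad\<close>
  identify the first components with \<open>H01\<close>.\<close>

definition H01_grad :: "('a \<Rightarrow> real) \<Rightarrow> ('a \<Rightarrow> 'a) \<Rightarrow> bool" where
  "H01_grad u g \<longleftrightarrow> sq_int M u \<and> sq_int M g \<and> (\<exists>\<phi>. (\<forall>k::nat. \<phi> k \<in> test_functions \<Omega>) \<and>
     (\<lambda>k. L2norm M (\<lambda>x. \<phi> k x - u x)) \<longlonglongrightarrow> 0 \<and> (\<lambda>k. L2norm M (\<lambda>x. grad (\<phi> k) x - g x)) \<longlonglongrightarrow> 0)"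

lemma H01_grad_sq_int: "H01_grad u g \<Longrightarrow> sq_int M u" "H01_grad u g \<Longrightarrow> sq_int M g"
  by (auto simp: H01_grad_def)

lemma H01_gradE:
  assumes "H01_grad u g"
  obtains \<phi> where "\<And>k::nat. \<phi> k \<in> test_functions \<Omega>" "(\<lambda>k. L2norm M (\<lambda>x. \<phi> k x - u x)) \<longlonglongrightarrow> 0"
    "(\<lambda>k. L2norm M (\<lambda>x. grad (\<phi> k) x - g x)) \<longlonglongrightarrow> 0"
  using assms unfolding H01_grad_def by blast

lemma has_weak_grad_test: "\<phi> \<in> test_functions \<Omega> \<Longrightarrow> has_weak_grad \<Omega> \<phi> (grad \<phi>)"
  by (rule has_weak_grad_C1[OF sets_\<Omega> test_functions_has_derivative test_functions_continuous_grad])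

lemma H01_grad_weak:
  assumes "H01_grad u g" shows "has_weak_grad \<Omega> u g"
proof -
  obtain \<phi> where \<phi>: "\<And>k::nat. \<phi> k \<in> test_functions \<Omega>" "(\<lambda>k. L2norm M (\<lambda>x. \<phi> k x - u x)) \<longlonglongrightarrow> 0"
    "(\<lambda>k. L2norm M (\<lambda>x. grad (\<phi> k) x - g x)) \<longlonglongrightarrow> 0"
    using H01_gradE[OF assms] by blast
  show ?thesis
    by (rule has_weak_grad_limit[OF has_weak_grad_test[OF \<phi>(1)] sq_int_test(1)[OF \<phi>(1)] H01_grad_sq_int[OF assms] \<phi>(2)
          tendsto_integral_test[OF sq_int_test(2)[OF \<phi>(1)] H01_grad_sq_int(2)[OF assms] \<phi>(3)]])
qed

lemma H1_norm_eq:
  assumes "has_weak_grad \<Omega> u g" "sq_int M g"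
  shows "H1_norm \<Omega> u = sqrt ((L2norm M u)\<^sup>2 + (L2norm M g)\<^sup>2)"
  using sq_int_wgrad(2)[OF assms] by (simp add: H1_norm_def Lp_norm2)

lemma H01_grad_imp_H01:
  assumes "H01_grad u g" shows "u \<in> H01 \<Omega>"
proof -
  obtain \<phi> where \<phi>: "\<And>k::nat. \<phi> k \<in> test_functions \<Omega>" "(\<lambda>k. L2norm M (\<lambda>x. \<phi> k x - u x)) \<longlonglongrightarrow> 0"
    "(\<lambda>k. L2norm M (\<lambda>x. grad (\<phi> k) x - g x)) \<longlonglongrightarrow> 0"
    using H01_gradE[OF assms] by blast
  note s = H01_grad_sq_int[OF assms]
  have "H1_norm \<Omega> (\<lambda>x. \<phi> k x - u x) = sqrt ((L2norm M (\<lambda>x. \<phi> k x - u x))\<^sup>2 + (L2norm M (\<lambda>x. grad (\<phi> k) x - g x))\<^sup>2)" for k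
    by (rule H1_norm_eq[OF has_weak_grad_diff[OF sets_\<Omega> has_weak_grad_test[OF \<phi>(1)] H01_grad_weak[OF assms]]
          sq_int_diff[OF sq_int_test(2)[OF \<phi>(1)] s(2)]])
  moreover have "(\<lambda>k. sqrt ((L2norm M (\<lambda>x. \<phi> k x - u x))\<^sup>2 + (L2norm M (\<lambda>x. grad (\<phi> k) x - g x))\<^sup>2)) \<longlonglongrightarrow> sqrt (0\<^sup>2 + 0\<^sup>2)"
    by (intro tendsto_intros \<phi>)
  ultimately have "(\<lambda>k. H1_norm \<Omega> (\<lambda>x. \<phi> k x - u x)) \<longlonglongrightarrow> 0" by simp
  moreover have "u \<in> H1 \<Omega>"
    unfolding H1_def using s H01_grad_weak[OF assms] by (auto simp: Lp2_iff)
  ultimately show ?thesis unfolding H01_def using \<phi>(1) by blast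
qed

lemma H01_imp_H01_grad:
  assumes "u \<in> H01 \<Omega>" shows "H01_grad u (wgrad \<Omega> u)"
proof -
  obtain g where g: "sq_int M u" "sq_int M g" "has_weak_grad \<Omega> u g"
    using assms by (auto simp: H01_def H1_def Lp2_iff)
  obtain \<phi> where \<phi>: "\<And>k::nat. \<phi> k \<in> test_functions \<Omega>" "(\<lambda>k. H1_norm \<Omega> (\<lambda>x. \<phi> k x - u x)) \<longlonglongrightarrow> 0"
    using assms by (auto simp: H01_def)
  let ?g = "wgrad \<Omega> u"
  have w: "has_weak_grad \<Omega> u ?g" by (rule wgrad_eq(2)[OF op g(3)])
  have s: "sq_int M ?g" by (rule sq_int_wgrad(1)[OF g(3,2)])
  have eq: "H1_norm \<Omega> (\<lambda>x. \<phi> k x - u x) = sqrt ((L2norm M (\<lambda>x. \<phi> k x - u x))\<^sup>2 + (L2norm M (\<lambda>x. grad (\<phi> k) x - ?g x))\<^sup>2)" for k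
    by (rule H1_norm_eq[OF has_weak_grad_diff[OF sets_\<Omega> has_weak_grad_test[OF \<phi>(1)] w] sq_int_diff[OF sq_int_test(2)[OF \<phi>(1)] s]])
  have "(\<lambda>k. L2norm M (\<lambda>x. \<phi> k x - u x)) \<longlonglongrightarrow> 0"
    by (rule Lim_null_comparison[OF _ \<phi>(2)]) (simp add: eq real_le_rsqrt)
  moreover have "(\<lambda>k. L2norm M (\<lambda>x. grad (\<phi> k) x - ?g x)) \<longlonglongrightarrow> 0"
    by (rule Lim_null_comparison[OF _ \<phi>(2)]) (simp add: eq real_le_rsqrt)
  ultimately show ?thesis unfolding H01_grad_def using g(1) s \<phi>(1) by blast
qed

text \<open>A diagonal argument: the approximating pairs are themselves approximated by test
  functions, with tolerances \<open>1 / real (Suc k)\<close>. This is the closedness of the graph in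
  epsilon form.\<close>

lemma H01_gradI_approx:
  assumes "sq_int M u" "sq_int M g"
    and ap: "\<And>e. 0 < e \<Longrightarrow> \<exists>u' g'. H01_grad u' g' \<and> L2norm M (\<lambda>x. u' x - u x) < e \<and> L2norm M (\<lambda>x. g' x - g x) < e"
  shows "H01_grad u g"
proof -
  have ap2: "\<exists>\<phi>\<in>test_functions \<Omega>. L2norm M (\<lambda>x. \<phi> x - u x) < 2 * e \<and> L2norm M (\<lambda>x. grad \<phi> x - g x) < 2 * e" if e: "0 < e" for e
  proof -
    obtain u' g' where u': "H01_grad u' g'" "L2norm M (\<lambda>x. u' x - u x) < e" "L2norm M (\<lambda>x. g' x - g x) < e"
      using ap[OF e] by blast
    note s = H01_grad_sq_int[OF u'(1)]
    obtain \<phi> where \<phi>: "\<And>k::nat. \<phi> k \<in> test_functions \<Omega>" "(\<lambda>k. L2norm M (\<lambda>x. \<phi> k x - u' x)) \<longlonglongrightarrow> 0"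
      "(\<lambda>k. L2norm M (\<lambda>x. grad (\<phi> k) x - g' x)) \<longlonglongrightarrow> 0"
      using H01_gradE[OF u'(1)] by blast
    have "\<forall>\<^sub>F k in sequentially. L2norm M (\<lambda>x. \<phi> k x - u' x) < e \<and> L2norm M (\<lambda>x. grad (\<phi> k) x - g' x) < e"
      using order_tendstoD(2)[OF \<phi>(2) e] order_tendstoD(2)[OF \<phi>(3) e] by (rule eventually_conj)
    then obtain k where k: "L2norm M (\<lambda>x. \<phi> k x - u' x) < e" "L2norm M (\<lambda>x. grad (\<phi> k) x - g' x) < e"
      using eventually_happens'[OF sequentially_bot] by blast
    have "L2norm M (\<lambda>x. \<phi> k x - u x) < 2 * e"
      using L2norm_triangle3[OF sq_int_test(1)[OF \<phi>(1)[of k]] s(1) assms(1)] k u' by linarith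
    moreover have "L2norm M (\<lambda>x. grad (\<phi> k) x - g x) < 2 * e"
      using L2norm_triangle3[OF sq_int_test(2)[OF \<phi>(1)[of k]] s(2) assms(2)] k u' by linarith
    ultimately show ?thesis using \<phi>(1) by blast
  qed
  have "\<exists>\<phi>\<in>test_functions \<Omega>. L2norm M (\<lambda>x. \<phi> x - u x) < 2 * (1 / real (Suc k)) \<and> L2norm M (\<lambda>x. grad \<phi> x - g x) < 2 * (1 / real (Suc k))" for k
    by (rule ap2) simp
  then obtain \<phi> where \<phi>: "\<And>k. \<phi> k \<in> test_functions \<Omega>" "\<And>k. L2norm M (\<lambda>x. \<phi> k x - u x) < 2 * (1 / real (Suc k))"
    "\<And>k. L2norm M (\<lambda>x. grad (\<phi> k) x - g x) < 2 * (1 / real (Suc k))"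
    by metis
  have "(\<lambda>k. 2 * (1 / real (Suc k))) \<longlonglongrightarrow> 2 * 0"
    by (intro tendsto_intros LIMSEQ_Suc[OF lim_1_over_n])
  then have l0: "(\<lambda>k. 2 * (1 / real (Suc k))) \<longlonglongrightarrow> 0" by simp
  have "(\<lambda>k. L2norm M (\<lambda>x. \<phi> k x - u x)) \<longlonglongrightarrow> 0" "(\<lambda>k. L2norm M (\<lambda>x. grad (\<phi> k) x - g x)) \<longlonglongrightarrow> 0"
    by (rule Lim_null_comparison[OF always_eventually l0], use \<phi>(2,3) less_imp_le in auto)+
  then show ?thesis unfolding H01_grad_def using assms(1,2) \<phi>(1) by blast
qed

lemma H01_grad_limit:
  assumes "\<And>k::nat. H01_grad (u k) (g k)" "sq_int M u0" "sq_int M g0"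
    "(\<lambda>k. L2norm M (\<lambda>x. u k x - u0 x)) \<longlonglongrightarrow> 0" "(\<lambda>k. L2norm M (\<lambda>x. g k x - g0 x)) \<longlonglongrightarrow> 0"
  shows "H01_grad u0 g0"
proof (rule H01_gradI_approx[OF assms(2,3)])
  fix e :: real assume e: "0 < e"
  have "\<forall>\<^sub>F k in sequentially. L2norm M (\<lambda>x. u k x - u0 x) < e \<and> L2norm M (\<lambda>x. g k x - g0 x) < e"
    using order_tendstoD(2)[OF assms(4) e] order_tendstoD(2)[OF assms(5) e] by (rule eventually_conj)
  then obtain k where "L2norm M (\<lambda>x. u k x - u0 x) < e" "L2norm M (\<lambda>x. g k x - g0 x) < e"
    using eventually_happens'[OF sequentially_bot] by blast
  then show "\<exists>u' g'. H01_grad u' g' \<and> L2norm M (\<lambda>x. u' x - u0 x) < e \<and> L2norm M (\<lambda>x. g' x - g0 x) < e"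
    using assms(1) by blast
qed

lemma H01_grad_test: "\<phi> \<in> test_functions \<Omega> \<Longrightarrow> H01_grad \<phi> (grad \<phi>)"
  unfolding H01_grad_def by (intro conjI sq_int_test exI[of _ "\<lambda>_. \<phi>"]) (auto simp: L2norm_def)

lemma H01_grad_scale:
  assumes "H01_grad u g" shows "H01_grad (\<lambda>x. c * u x) (\<lambda>x. c *\<^sub>R g x)"
proof -
  obtain \<phi> where \<phi>: "\<And>k::nat. \<phi> k \<in> test_functions \<Omega>" "(\<lambda>k. L2norm M (\<lambda>x. \<phi> k x - u x)) \<longlonglongrightarrow> 0"
    "(\<lambda>k. L2norm M (\<lambda>x. grad (\<phi> k) x - g x)) \<longlonglongrightarrow> 0"
    using H01_gradE[OF assms] by blast
  note s = H01_grad_sq_int[OF assms]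
  have g: "grad (\<lambda>x. c * \<phi> k x) x = c *\<^sub>R grad (\<phi> k) x" for k x
    by (rule gradI) (use has_derivative_mult_right[OF test_functions_has_derivative[OF \<phi>(1)], of c] in simp)
  show ?thesis
  proof (rule H01_grad_limit[OF H01_grad_test[OF test_functions_scale[OF \<phi>(1), of c]]])
    have "(\<lambda>k. \<bar>c\<bar> * L2norm M (\<lambda>x. \<phi> k x - u x)) \<longlonglongrightarrow> \<bar>c\<bar> * 0" by (intro tendsto_intros \<phi>)
    then show "(\<lambda>k. L2norm M (\<lambda>x. c * \<phi> k x - c * u x)) \<longlonglongrightarrow> 0"
      by (simp add: L2norm_scaleR[of M c, symmetric] right_diff_distrib)
    have "(\<lambda>k. \<bar>c\<bar> * L2norm M (\<lambda>x. grad (\<phi> k) x - g x)) \<longlonglongrightarrow> \<bar>c\<bar> * 0" by (intro tendsto_intros \<phi>)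
    then show "(\<lambda>k. L2norm M (\<lambda>x. grad (\<lambda>x. c * \<phi> k x) x - c *\<^sub>R g x)) \<longlonglongrightarrow> 0"
      unfolding g by (simp add: L2norm_scaleR[of M c, symmetric] scaleR_diff_right)
  qed (intro sq_int_cmult sq_int_scaleR s)+
qed

lemma H01_grad_diff:
  assumes "H01_grad u g" "H01_grad v h" shows "H01_grad (\<lambda>x. u x - v x) (\<lambda>x. g x - h x)"
proof -
  obtain \<phi> where \<phi>: "\<And>k::nat. \<phi> k \<in> test_functions \<Omega>" "(\<lambda>k. L2norm M (\<lambda>x. \<phi> k x - u x)) \<longlonglongrightarrow> 0"
    "(\<lambda>k. L2norm M (\<lambda>x. grad (\<phi> k) x - g x)) \<longlonglongrightarrow> 0"
    using H01_gradE[OF assms(1)] by blast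
  obtain \<psi> where \<psi>: "\<And>k::nat. \<psi> k \<in> test_functions \<Omega>" "(\<lambda>k. L2norm M (\<lambda>x. \<psi> k x - v x)) \<longlonglongrightarrow> 0"
    "(\<lambda>k. L2norm M (\<lambda>x. grad (\<psi> k) x - h x)) \<longlonglongrightarrow> 0"
    using H01_gradE[OF assms(2)] by blast
  note s = H01_grad_sq_int[OF assms(1)] H01_grad_sq_int[OF assms(2)]
  have gr: "grad (\<lambda>x. \<phi> k x - \<psi> k x) x = grad (\<phi> k) x - grad (\<psi> k) x" for k x
    by (intro grad_diff test_functions_differentiable[OF \<phi>(1)] test_functions_differentiable[OF \<psi>(1)])
  show ?thesis
  proof (rule H01_grad_limit[OF H01_grad_test[OF test_functions_diff[OF \<phi>(1) \<psi>(1)]]])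
    have "(\<lambda>k. L2norm M (\<lambda>x. \<phi> k x - u x) + L2norm M (\<lambda>x. \<psi> k x - v x)) \<longlonglongrightarrow> 0 + 0" by (intro tendsto_intros \<phi> \<psi>)
    then have l: "(\<lambda>k. L2norm M (\<lambda>x. \<phi> k x - u x) + L2norm M (\<lambda>x. \<psi> k x - v x)) \<longlonglongrightarrow> 0" by simp
    have "L2norm M (\<lambda>x. \<phi> k x - \<psi> k x - (u x - v x)) \<le> L2norm M (\<lambda>x. \<phi> k x - u x) + L2norm M (\<lambda>x. \<psi> k x - v x)" for k
      using L2norm_triangle_diff[OF sq_int_diff[OF sq_int_test(1)[OF \<phi>(1)[of k]] s(1)] sq_int_diff[OF sq_int_test(1)[OF \<psi>(1)[of k]] s(3)]]
      by (simp add: algebra_simps)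
    then show "(\<lambda>k. L2norm M (\<lambda>x. \<phi> k x - \<psi> k x - (u x - v x))) \<longlonglongrightarrow> 0"
      by (intro Lim_null_comparison[OF always_eventually l]) auto
    have "(\<lambda>k. L2norm M (\<lambda>x. grad (\<phi> k) x - g x) + L2norm M (\<lambda>x. grad (\<psi> k) x - h x)) \<longlonglongrightarrow> 0 + 0" by (intro tendsto_intros \<phi> \<psi>)
    then have l: "(\<lambda>k. L2norm M (\<lambda>x. grad (\<phi> k) x - g x) + L2norm M (\<lambda>x. grad (\<psi> k) x - h x)) \<longlonglongrightarrow> 0" by simp
    have "L2norm M (\<lambda>x. grad (\<phi> k) x - grad (\<psi> k) x - (g x - h x)) \<le> L2norm M (\<lambda>x. grad (\<phi> k) x - g x) + L2norm M (\<lambda>x. grad (\<psi> k) x - h x)" for k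
      using L2norm_triangle_diff[OF sq_int_diff[OF sq_int_test(2)[OF \<phi>(1)[of k]] s(2)] sq_int_diff[OF sq_int_test(2)[OF \<psi>(1)[of k]] s(4)]]
      by (simp add: algebra_simps)
    then show "(\<lambda>k. L2norm M (\<lambda>x. grad (\<lambda>x. \<phi> k x - \<psi> k x) x - (g x - h x))) \<longlonglongrightarrow> 0"
      unfolding gr by (intro Lim_null_comparison[OF always_eventually l]) auto
  qed (intro sq_int_diff s)+
qed

lemma H01_grad_add:
  assumes "H01_grad u g" "H01_grad v h" shows "H01_grad (\<lambda>x. u x + v x) (\<lambda>x. g x + h x)"
  using H01_grad_diff[OF assms(1) H01_grad_scale[OF assms(2), of "-1"]] by simp

section \<open>Weakly differentiable functions of compact support\<close>

lemma grad_conv_weak: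
  fixes f :: "'a \<Rightarrow> real" and g :: "'a \<Rightarrow> 'a"
  assumes K: "compact K" "K \<subseteq> \<Omega>" and f: "integrable lebesgue f" "\<And>x. x \<notin> K \<Longrightarrow> f x = 0"
    and g: "integrable lebesgue g" "\<And>x. x \<notin> K \<Longrightarrow> g x = 0" and w: "has_weak_grad \<Omega> f g" and r: "0 < r"
  shows "grad (conv (mollifier r) f) x \<bullet> b = conv (mollifier r) (\<lambda>y. g y \<bullet> b) x"
proof -
  let ?\<rho> = "mollifier r :: 'a \<Rightarrow> real"
  note \<rho> = mollifier(1)[OF r, where 'a='a]
  obtain \<eta> U where \<eta>: "\<eta> \<in> test_functions \<Omega>" "open U" "K \<subseteq> U" "\<And>x. x \<in> U \<Longrightarrow> \<eta> x = 1"
    using cutoff[OF K(1) op K(2)] by metis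
  \<comment> \<open>As a function of \<open>y\<close> the mollifier centred at \<open>x\<close> need
    not be supported in \<open>\<Omega>\<close>. The factor \<open>\<eta>\<close>, equal to 1 near
    the support \<open>K\<close> of \<open>f\<close> and \<open>g\<close>, makes it an admissible
    test function without changing the integrals.\<close>
  define \<psi> where "\<psi> y = \<eta> y * ?\<rho> (x - y)" for y
  have \<psi>: "\<psi> \<in> test_functions \<Omega>"
    unfolding \<psi>_def[abs_def] by (rule test_functions_mult(1)[OF \<eta>(1) Ck_reflect[OF test_functions_Ck[OF \<rho>]]])
  have g\<psi>: "grad \<psi> y = - grad ?\<rho> (x - y)" if "y \<in> K" for y
  proof (rule gradI)
    have "((\<lambda>y. x - y) has_derivative (\<lambda>h. - h)) (at y)" by (auto intro!: derivative_eq_intros)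
    from has_derivative_compose[OF this test_functions_has_derivative[OF \<rho>]]
    have "((\<lambda>y. ?\<rho> (x - y)) has_derivative (\<lambda>h. (- grad ?\<rho> (x - y)) \<bullet> h)) (at y)" by simp
    then show "(\<psi> has_derivative (\<lambda>h. (- grad ?\<rho> (x - y)) \<bullet> h)) (at y)"
      by (rule has_derivative_transform_within_open[where s=U]) (use \<eta> that in \<open>auto simp: \<psi>_def\<close>)
  qed
  have "(LINT y|M. f y *\<^sub>R grad \<psi> y) = (LINT y|lebesgue. f y *\<^sub>R grad \<psi> y)"
    by (rule lebesgue_on_support(1)[OF sets_\<Omega>]) (metis f(2) K(2) scaleR_zero_left subsetD)
  also have "\<dots> = (LINT y|lebesgue. - (f y *\<^sub>R grad ?\<rho> (x - y)))"
  proof (rule Bochner_Integration.integral_cong[OF refl])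
    fix y show "f y *\<^sub>R grad \<psi> y = - (f y *\<^sub>R grad ?\<rho> (x - y))"
      using f(2) g\<psi> by (cases "y \<in> K") auto
  qed
  finally have 1: "(LINT y|M. f y *\<^sub>R grad \<psi> y) = - (LINT y|lebesgue. f y *\<^sub>R grad ?\<rho> (x - y))"
    by simp
  have "(LINT y|M. \<psi> y *\<^sub>R g y) = (LINT y|lebesgue. \<psi> y *\<^sub>R g y)"
    by (rule lebesgue_on_support(1)[OF sets_\<Omega>]) (metis g(2) K(2) scaleR_zero_right subsetD)
  also have "\<dots> = (LINT y|lebesgue. ?\<rho> (x - y) *\<^sub>R g y)"
  proof (rule Bochner_Integration.integral_cong[OF refl])
    fix y show "\<psi> y *\<^sub>R g y = ?\<rho> (x - y) *\<^sub>R g y"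
      using g(2) \<eta>(3,4) by (cases "y \<in> K") (auto simp: \<psi>_def)
  qed
  finally have 2: "(LINT y|M. \<psi> y *\<^sub>R g y) = (LINT y|lebesgue. ?\<rho> (x - y) *\<^sub>R g y)" .
  have 3: "(LINT y|lebesgue. f y *\<^sub>R grad ?\<rho> (x - y)) = (LINT y|lebesgue. ?\<rho> (x - y) *\<^sub>R g y)"
    using w \<psi> 1 2 by (simp add: has_weak_grad_def)
  have i: "integrable lebesgue (\<lambda>y. ?\<rho> (x - y) *\<^sub>R g y)"
  proof -
    have "locally_integrable UNIV g" by (rule locally_integrable_integrable) (use g(1) in \<open>auto simp: lebesgue_on_UNIV_eq\<close>)
    moreover obtain L where "compact L" "\<And>x. x \<notin> L \<Longrightarrow> ?\<rho> x = 0" using test_functionsE[OF \<rho>] by metis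
    ultimately show ?thesis
    proof -
      have "(\<lambda>y. 1 * ?\<rho> (x - y)) \<in> test_functions UNIV"
      proof (rule test_functionsI[where K="(\<lambda>z. x - z) ` L"])
        show "compact ((\<lambda>z. x - z) ` L)" by (intro compact_continuous_image continuous_intros \<open>compact L\<close>)
        show "1 * ?\<rho> (x - y) = 0" if "y \<notin> (\<lambda>z. x - z) ` L" for y
        proof -
          have "x - y \<notin> L"
          proof
            assume "x - y \<in> L"
            then have "x - (x - y) \<in> (\<lambda>z. x - z) ` L" by (rule imageI)
            with that show False by simp
          qed
          then show ?thesis using \<open>\<And>x. x \<notin> L \<Longrightarrow> ?\<rho> x = 0\<close> by simp
        qed
      qed (use Ck_reflect[OF test_functions_Ck[OF \<rho>]] in auto)
      from locally_integrable_test(2)[OF _ \<open>locally_integrable UNIV g\<close> this] show ?thesis by simp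
    qed
  qed
  have "grad (conv ?\<rho> f) x \<bullet> b = (LINT y|lebesgue. ?\<rho> (x - y) *\<^sub>R g y) \<bullet> b"
    by (simp add: grad_conv[OF \<rho> f(1)] 3)
  also have "\<dots> = (LINT y|lebesgue. (?\<rho> (x - y) *\<^sub>R g y) \<bullet> b)"
    by (rule integral_inner_left[symmetric]) (use i in auto)
  finally show ?thesis by (simp add: conv_def)
qed

text \<open>For small radii the mollifications of \<open>f\<close> are test functions in
  \<open>\<Omega>\<close>, and by \<open>grad_conv_weak\<close> the components of their gradients
  are the mollified components of \<open>g\<close>. Boundedness and compact support make all of them
  converge in L2.\<close>

lemma H01_grad_compact_support:
  fixes f :: "'a \<Rightarrow> real" and g :: "'a \<Rightarrow> 'a"
  assumes K: "compact K" "K \<subseteq> \<Omega>"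
    and f: "f \<in> borel_measurable lebesgue" "AE x in lebesgue. \<bar>f x\<bar> \<le> B" "\<And>x. x \<notin> K \<Longrightarrow> f x = 0"
    and g: "g \<in> borel_measurable lebesgue" "AE x in lebesgue. norm (g x) \<le> B" "\<And>x. x \<notin> K \<Longrightarrow> g x = 0"
    and w: "has_weak_grad \<Omega> f g"
  shows "H01_grad f g"
proof (rule H01_gradI_approx)
  have fi: "integrable lebesgue f" by (rule bounded_support_integrable[OF f(1,2) K(1) f(3)])
  have gb: "(\<lambda>x. g x \<bullet> b) \<in> borel_measurable lebesgue" "AE x in lebesgue. \<bar>g x \<bullet> b\<bar> \<le> B" "\<And>x. x \<notin> K \<Longrightarrow> g x \<bullet> b = 0" if "b \<in> Basis" for b
  proof -
    show "(\<lambda>x. g x \<bullet> b) \<in> borel_measurable lebesgue" using g(1) by simp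
    show "AE x in lebesgue. \<bar>g x \<bullet> b\<bar> \<le> B"
      using g(2) by eventually_elim (metis Basis_le_norm order_trans that)
  qed (use g in auto)
  have gi: "integrable lebesgue g"
  proof -
    have "integrable lebesgue (\<lambda>x. \<Sum>b\<in>Basis. (g x \<bullet> b) *\<^sub>R b)"
      by (intro Bochner_Integration.integrable_sum integrable_scaleR_left bounded_support_integrable[OF gb(1,2) K(1) gb(3)])
    then show ?thesis by (simp add: euclidean_representation)
  qed
  have Bx: "sq_int M h" if "h \<in> borel_measurable lebesgue" "AE x in lebesgue. norm (h x) \<le> B" for h :: "'a \<Rightarrow> 'c::euclidean_space"
    by (rule sq_int_bounded[where K=B])
       (use that sets_\<Omega> in \<open>auto intro: measurable_restrict_space1 simp: AE_restrict_space_iff elim!: eventually_mono\<close>)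
  show sf: "sq_int M f" by (rule Bx) (use f in auto)
  show sg: "sq_int M g" by (rule Bx) (use g in auto)
  fix e :: real assume e: "0 < e"
  obtain d where d: "0 < d" "(\<Union>x\<in>K. cball x d) \<subseteq> \<Omega>"
    using compact_subset_open_imp_cball_epsilon_subset[OF K(1) op K(2)] by blast
  have e2: "0 < e\<^sup>2" using e by simp
  have l1: "((\<lambda>r. LINT x|lebesgue. (conv (mollifier r) f x - f x)\<^sup>2) \<longlongrightarrow> 0) (at_right 0)"
    by (rule mollify_L2_tendsto[OF f(1,2) K(1) f(3)])
  have "((\<lambda>r. \<Sum>b\<in>Basis. LINT x|lebesgue. (conv (mollifier r) (\<lambda>x. g x \<bullet> b) x - g x \<bullet> b)\<^sup>2) \<longlongrightarrow> (\<Sum>b\<in>(Basis :: 'a set). 0)) (at_right 0)"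
    by (intro tendsto_sum mollify_L2_tendsto(1)[OF gb(1,2) K(1) gb(3)])
  then have l2: "((\<lambda>r. \<Sum>b\<in>Basis. LINT x|lebesgue. (conv (mollifier r) (\<lambda>x. g x \<bullet> b) x - g x \<bullet> b)\<^sup>2) \<longlongrightarrow> 0) (at_right 0)"
    by simp
  have "\<forall>\<^sub>F r in at_right 0. r < d"
    using d(1) eventually_at_right_field by blast
  with order_tendstoD(2)[OF l1 e2] order_tendstoD(2)[OF l2 e2] eventually_at_right_less[of 0]
  have "\<forall>\<^sub>F r in at_right 0. (LINT x|lebesgue. (conv (mollifier r) f x - f x)\<^sup>2) < e\<^sup>2 \<and>
     (\<Sum>b\<in>Basis. LINT x|lebesgue. (conv (mollifier r) (\<lambda>x. g x \<bullet> b) x - g x \<bullet> b)\<^sup>2) < e\<^sup>2 \<and> 0 < r \<and> r < d"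
    by eventually_elim auto
  then obtain r where r: "(LINT x|lebesgue. (conv (mollifier r) f x - f x)\<^sup>2) < e\<^sup>2"
     "(\<Sum>b\<in>Basis. LINT x|lebesgue. (conv (mollifier r) (\<lambda>x. g x \<bullet> b) x - g x \<bullet> b)\<^sup>2) < e\<^sup>2" "0 < r" "r < d"
    using eventually_happens'[OF trivial_limit_at_right_real] by blast
  define \<phi> where "\<phi> = conv (mollifier r) f"
  have \<phi>: "\<phi> \<in> test_functions \<Omega>"
    unfolding \<phi>_def
  proof (rule conv_mollifier_test[OF r(3) K(1) f(3) fi])
    show "(\<Union>y\<in>K. cball y r) \<subseteq> \<Omega>" using d(2) r(4) by fastforce
  qed
  obtain L where L: "L \<subseteq> \<Omega>" "\<And>x. x \<notin> L \<Longrightarrow> \<phi> x = 0" "\<And>x. x \<notin> L \<Longrightarrow> grad \<phi> x = 0" using test_functionsE[OF \<phi>] by metis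
  have off: "\<phi> x - f x = 0" "grad \<phi> x - g x = 0" if "x \<notin> \<Omega>" for x
  proof -
    have "x \<notin> K" "x \<notin> L" using that K(2) L(1) by auto
    then show "\<phi> x - f x = 0" "grad \<phi> x - g x = 0" using f(3) g(3) L by auto
  qed
  have "(L2norm M (\<lambda>x. \<phi> x - f x))\<^sup>2 = (LINT x|lebesgue. (norm (\<phi> x - f x))\<^sup>2)"
    unfolding L2norm_sq by (rule lebesgue_on_support(1)[OF sets_\<Omega>]) (use off in auto)
  also have "\<dots> < e\<^sup>2" using r(1) by (simp add: \<phi>_def)
  finally have 1: "L2norm M (\<lambda>x. \<phi> x - f x) < e" using e by (simp add: power2_less_imp_less)
  have "(L2norm M (\<lambda>x. grad \<phi> x - g x))\<^sup>2 = (LINT x|lebesgue. (norm (grad \<phi> x - g x))\<^sup>2)"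
    unfolding L2norm_sq by (rule lebesgue_on_support(1)[OF sets_\<Omega>]) (use off in auto)
  also have "\<dots> = (LINT x|lebesgue. (\<Sum>b\<in>Basis. (conv (mollifier r) (\<lambda>x. g x \<bullet> b) x - g x \<bullet> b)\<^sup>2))"
  proof (rule Bochner_Integration.integral_cong[OF refl])
    fix x
    have "(norm (grad \<phi> x - g x))\<^sup>2 = (\<Sum>b\<in>Basis. ((grad \<phi> x - g x) \<bullet> b)\<^sup>2)"
      unfolding power2_norm_eq_inner by (subst euclidean_inner) (simp add: power2_eq_square)
    also have "\<dots> = (\<Sum>b\<in>Basis. (conv (mollifier r) (\<lambda>x. g x \<bullet> b) x - g x \<bullet> b)\<^sup>2)"
      unfolding \<phi>_def by (simp add: inner_diff_left grad_conv_weak[OF K fi f(3) gi g(3) w r(3)])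
    finally show "(norm (grad \<phi> x - g x))\<^sup>2 = (\<Sum>b\<in>Basis. (conv (mollifier r) (\<lambda>x. g x \<bullet> b) x - g x \<bullet> b)\<^sup>2)" .
  qed
  also have "\<dots> = (\<Sum>b\<in>Basis. LINT x|lebesgue. (conv (mollifier r) (\<lambda>x. g x \<bullet> b) x - g x \<bullet> b)\<^sup>2)"
    by (intro Bochner_Integration.integral_sum mollify_L2_tendsto(2)[OF gb(1,2) K(1) gb(3) r(3)])
  also have "\<dots> < e\<^sup>2" by (rule r(2))
  finally have 2: "L2norm M (\<lambda>x. grad \<phi> x - g x) < e" using e by (simp add: power2_less_imp_less)
  show "\<exists>u' g'. H01_grad u' g' \<and> L2norm M (\<lambda>x. u' x - f x) < e \<and> L2norm M (\<lambda>x. g' x - g x) < e"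
    using H01_grad_test[OF \<phi>] 1 2 by blast
qed

end

section \<open>Products and chain rules\<close>

lemma Lipschitz_of_derivative:
  fixes G :: "real \<Rightarrow> real"
  assumes "\<And>y. (G has_real_derivative G' y) (at y)" "\<And>y. \<bar>G' y\<bar> \<le> L"
  shows "\<bar>G a - G b\<bar> \<le> L * \<bar>a - b\<bar>"
  using field_differentiable_bound[of UNIV G G' L a b] assms by simp

lemma L2norm_tendsto:
  assumes "\<And>k. sq_int M (f k)" "sq_int M f0" "((\<lambda>k. L2norm M (\<lambda>x. f k x - f0 x)) \<longlongrightarrow> 0) F"
  shows "((\<lambda>k. L2norm M (f k)) \<longlongrightarrow> L2norm M f0) F"
proof (rule tendsto_dist_iff[THEN iffD2], rule Lim_null_comparison[OF _ assms(3)])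
  show "\<forall>\<^sub>F k in F. norm (dist (L2norm M (f k)) (L2norm M f0)) \<le> L2norm M (\<lambda>x. f k x - f0 x)"
    using L2norm_rev_triangle[OF assms(1,2)] by (simp add: dist_real_def)
qed

context bounded_open
begin

text \<open>A single constant for the function and its gradient leaves the product and chain rules
  with one parameter.\<close>

definition W1inf_grad :: "('a \<Rightarrow> real) \<Rightarrow> ('a \<Rightarrow> 'a) \<Rightarrow> real \<Rightarrow> bool" where
  "W1inf_grad w g B \<longleftrightarrow> w \<in> borel_measurable M \<and> g \<in> borel_measurable M \<and>
     (AE x in M. \<bar>w x\<bar> \<le> B) \<and> (AE x in M. norm (g x) \<le> B) \<and> has_weak_grad \<Omega> w g"

lemma W1inf_gradE:
  assumes "w \<in> W1inf \<Omega>"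
  obtains g B where "W1inf_grad w g B" "0 \<le> B"
proof -
  obtain g K L where g: "w \<in> borel_measurable M" "AE x in M. norm (w x) \<le> K"
    "g \<in> borel_measurable M" "AE x in M. norm (g x) \<le> L" "has_weak_grad \<Omega> w g"
    using assms by (auto simp: W1inf_def Linf_def)
  have "AE x in M. \<bar>w x\<bar> \<le> max 0 (max K L)" using g(2) by eventually_elim auto
  moreover have "AE x in M. norm (g x) \<le> max 0 (max K L)" using g(4) by eventually_elim auto
  ultimately have "W1inf_grad w g (max 0 (max K L))"
    unfolding W1inf_grad_def using g by blast
  then show ?thesis using that by simp
qed

lemma W1inf_grad_sq_int:
  assumes "W1inf_grad w g B" shows "sq_int M w" "sq_int M g"
  using assms sq_int_bounded[of w B] sq_int_bounded[of g B] by (auto simp: W1inf_grad_def)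

lemma continuous_measurable_M:
  fixes f :: "'a \<Rightarrow> 'b::euclidean_space"
  assumes "continuous_on UNIV f" shows "f \<in> borel_measurable M"
  by (rule measurable_restrict_space1[OF continuous_lebesgue_measurable[OF assms]])

text \<open>The weak Leibniz rule comes from testing the gradient of \<open>w\<close> with the
  product \<open>\<phi> x * \<psi> x\<close>, which is again a test function. The support of
  \<open>\<phi>\<close> then places the bounded product within reach of
  \<open>H01_grad_compact_support\<close>.\<close>

lemma H01_grad_test_mult:
  assumes \<phi>: "\<phi> \<in> test_functions \<Omega>" and w: "W1inf_grad w gw B"
  shows "H01_grad (\<lambda>x. \<phi> x * w x) (\<lambda>x. \<phi> x *\<^sub>R gw x + w x *\<^sub>R grad \<phi> x)"
proof -
  obtain K where K: "compact K" "K \<subseteq> \<Omega>" "\<And>x. x \<notin> K \<Longrightarrow> \<phi> x = 0" "\<And>x. x \<notin> K \<Longrightarrow> grad \<phi> x = 0"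
    using test_functionsE[OF \<phi>] by metis
  obtain A where A: "0 < A" "\<And>x. \<bar>\<phi> x\<bar> \<le> A" "\<And>x. norm (grad \<phi> x) \<le> A"
    using test_functions_bounded[OF \<phi>] by metis
  have mw: "w \<in> borel_measurable M" "gw \<in> borel_measurable M" using w by (auto simp: W1inf_grad_def)
  have m\<phi>: "\<phi> \<in> borel_measurable M" "grad \<phi> \<in> borel_measurable M"
    by (auto intro: continuous_measurable_M test_functions_continuous[OF \<phi>] test_functions_continuous_grad[OF \<phi>])
  have off: "\<phi> x = 0" "grad \<phi> x = 0" if "x \<notin> \<Omega>" for x using that K by auto
  have bw: "AE x in lebesgue. x \<in> \<Omega> \<longrightarrow> \<bar>w x\<bar> \<le> \<bar>B\<bar> \<and> norm (gw x) \<le> \<bar>B\<bar>"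
  proof -
    have "AE x in M. \<bar>w x\<bar> \<le> B" "AE x in M. norm (gw x) \<le> B" using w by (auto simp: W1inf_grad_def)
    then have "AE x in M. \<bar>w x\<bar> \<le> \<bar>B\<bar> \<and> norm (gw x) \<le> \<bar>B\<bar>" by eventually_elim auto
    then show ?thesis by (rule AE_restrict_space_iff[THEN iffD1, rotated]) (use sets_\<Omega> in simp)
  qed
  show ?thesis
  proof (rule H01_grad_compact_support[OF K(1,2), where B="2 * A * \<bar>B\<bar>"])
    show "(\<lambda>x. \<phi> x * w x) \<in> borel_measurable lebesgue"
      by (subst lebesgue_on_support(3)[OF sets_\<Omega>, symmetric]) (use off mw m\<phi> in auto)
    show "(\<lambda>x. \<phi> x *\<^sub>R gw x + w x *\<^sub>R grad \<phi> x) \<in> borel_measurable lebesgue"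
      by (subst lebesgue_on_support(3)[OF sets_\<Omega>, symmetric]) (use off mw m\<phi> in auto)
    show "AE x in lebesgue. \<bar>\<phi> x * w x\<bar> \<le> 2 * A * \<bar>B\<bar>"
      using bw
    proof eventually_elim
      case (elim x)
      show ?case
      proof (cases "x \<in> \<Omega>")
        case True
        have "\<bar>\<phi> x\<bar> * \<bar>w x\<bar> \<le> A * \<bar>B\<bar>" using elim True A by (intro mult_mono) auto
        moreover have "0 \<le> A * \<bar>B\<bar>" using A by simp
        ultimately show ?thesis by (simp add: abs_mult)
      next
        case False
        then show ?thesis using off A by simp
      qed
    qed
    show "AE x in lebesgue. norm (\<phi> x *\<^sub>R gw x + w x *\<^sub>R grad \<phi> x) \<le> 2 * A * \<bar>B\<bar>"
      using bw
    proof eventually_elim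
      case (elim x)
      show ?case
      proof (cases "x \<in> \<Omega>")
        case True
        have "norm (\<phi> x *\<^sub>R gw x + w x *\<^sub>R grad \<phi> x) \<le> \<bar>\<phi> x\<bar> * norm (gw x) + \<bar>w x\<bar> * norm (grad \<phi> x)"
          using norm_triangle_ineq[of "\<phi> x *\<^sub>R gw x" "w x *\<^sub>R grad \<phi> x"] by simp
        also have "\<dots> \<le> A * \<bar>B\<bar> + \<bar>B\<bar> * A"
          using elim True A by (intro add_mono mult_mono) auto
        finally show ?thesis by simp
      next
        case False
        then show ?thesis using off A by simp
      qed
    qed
    show "has_weak_grad \<Omega> (\<lambda>x. \<phi> x * w x) (\<lambda>x. \<phi> x *\<^sub>R gw x + w x *\<^sub>R grad \<phi> x)"
      unfolding has_weak_grad_def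
    proof (intro conjI ballI)
      have bphi: "AE x in M. \<bar>\<phi> x\<bar> \<le> A" "AE x in M. norm (grad \<phi> x) \<le> A" using A by auto
      have s1: "sq_int M (\<lambda>x. \<phi> x * w x)"
        using L2norm_bounded_mult(1)[OF W1inf_grad_sq_int(1)[OF w] m\<phi>(1) bphi(1)] A by simp
      have s2: "sq_int M (\<lambda>x. \<phi> x *\<^sub>R gw x)"
        using L2norm_bounded_mult(1)[OF W1inf_grad_sq_int(2)[OF w] m\<phi>(1) bphi(1)] A by simp
      have s3: "sq_int M (\<lambda>x. w x *\<^sub>R grad \<phi> x)"
        using L2norm_bounded_mult_right(1)[OF W1inf_grad_sq_int(1)[OF w] m\<phi>(2) bphi(2)] A by simp
      show "locally_integrable \<Omega> (\<lambda>x. \<phi> x * w x)" by (rule sq_int_locally_integrable[OF s1])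
      show "locally_integrable \<Omega> (\<lambda>x. \<phi> x *\<^sub>R gw x + w x *\<^sub>R grad \<phi> x)"
        by (rule sq_int_locally_integrable[OF sq_int_add[OF s2 s3]])
      fix \<psi> assume \<psi>: "\<psi> \<in> test_functions \<Omega>"
      have \<phi>\<psi>: "(\<lambda>x. \<phi> x * \<psi> x) \<in> test_functions \<Omega>"
        by (rule test_functions_mult(1)[OF \<phi> test_functions_Ck[OF \<psi>]])
      have gr: "grad (\<lambda>x. \<phi> x * \<psi> x) x = \<phi> x *\<^sub>R grad \<psi> x + \<psi> x *\<^sub>R grad \<phi> x" for x
        by (intro grad_mult test_functions_differentiable[OF \<phi>] test_functions_differentiable[OF \<psi>])
      have i1: "integrable M (\<lambda>x. \<psi> x *\<^sub>R (w x *\<^sub>R grad \<phi> x))" "integrable M (\<lambda>x. \<psi> x *\<^sub>R (\<phi> x *\<^sub>R gw x))"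
        by (intro sq_int_scaleR_integrable sq_int_test[OF \<psi>] s3 s2)+
      have i2: "integrable M (\<lambda>x. (\<phi> x * w x) *\<^sub>R grad \<psi> x)"
        by (intro sq_int_scaleR_integrable sq_int_test[OF \<psi>] s1)
      have "(LINT x|M. (\<phi> x * w x) *\<^sub>R grad \<psi> x) + (LINT x|M. \<psi> x *\<^sub>R (w x *\<^sub>R grad \<phi> x))
          = (LINT x|M. (\<phi> x * w x) *\<^sub>R grad \<psi> x + \<psi> x *\<^sub>R (w x *\<^sub>R grad \<phi> x))"
        using i1 i2 by simp
      also have "\<dots> = (LINT x|M. w x *\<^sub>R grad (\<lambda>x. \<phi> x * \<psi> x) x)"
        by (intro Bochner_Integration.integral_cong) (auto simp: gr scaleR_add_right mult.commute)
      also have "\<dots> = - (LINT x|M. (\<phi> x * \<psi> x) *\<^sub>R gw x)"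
        using w \<phi>\<psi> unfolding W1inf_grad_def has_weak_grad_def by blast
      also have "(LINT x|M. (\<phi> x * \<psi> x) *\<^sub>R gw x) = (LINT x|M. \<psi> x *\<^sub>R (\<phi> x *\<^sub>R gw x))"
        by (intro Bochner_Integration.integral_cong) (auto simp: mult.commute)
      finally have "(LINT x|M. (\<phi> x * w x) *\<^sub>R grad \<psi> x)
         = - ((LINT x|M. \<psi> x *\<^sub>R (\<phi> x *\<^sub>R gw x)) + (LINT x|M. \<psi> x *\<^sub>R (w x *\<^sub>R grad \<phi> x)))"
        by (simp add: eq_diff_eq[symmetric])
      also have "(LINT x|M. \<psi> x *\<^sub>R (\<phi> x *\<^sub>R gw x)) + (LINT x|M. \<psi> x *\<^sub>R (w x *\<^sub>R grad \<phi> x))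
          = (LINT x|M. \<psi> x *\<^sub>R (\<phi> x *\<^sub>R gw x + w x *\<^sub>R grad \<phi> x))"
        using i1 by (simp add: scaleR_add_right del: scaleR_scaleR)
      finally show "(LINT x|M. (\<phi> x * w x) *\<^sub>R grad \<psi> x)
         = - (LINT x|M. \<psi> x *\<^sub>R (\<phi> x *\<^sub>R gw x + w x *\<^sub>R grad \<phi> x))" .
    qed
  qed (use K in auto)
qed

lemma L2norm_tendsto_0_mult:
  assumes "(\<lambda>k. L2norm M (f k)) \<longlonglongrightarrow> 0" "\<And>k::nat. L2norm M (h k) \<le> c * L2norm M (f k)"
  shows "(\<lambda>k. L2norm M (h k)) \<longlonglongrightarrow> 0"
proof (rule Lim_null_comparison)
  show "\<forall>\<^sub>F k in sequentially. norm (L2norm M (h k)) \<le> c * L2norm M (f k)" using assms(2) by simp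
  show "(\<lambda>k. c * L2norm M (f k)) \<longlonglongrightarrow> 0" using tendsto_mult_left[OF assms(1), of c] by simp
qed

lemma L2norm_tendsto_0_add:
  assumes "\<And>k::nat. sq_int M (f k)" "\<And>k. sq_int M (h k)"
    and "(\<lambda>k. L2norm M (f k)) \<longlonglongrightarrow> 0" "(\<lambda>k. L2norm M (h k)) \<longlonglongrightarrow> 0"
  shows "(\<lambda>k. L2norm M (\<lambda>x. f k x + h k x)) \<longlonglongrightarrow> 0"
proof (rule Lim_null_comparison)
  show "\<forall>\<^sub>F k in sequentially. norm (L2norm M (\<lambda>x. f k x + h k x)) \<le> L2norm M (f k) + L2norm M (h k)"
    using L2norm_triangle[OF assms(1,2)] by simp
  show "(\<lambda>k. L2norm M (f k) + L2norm M (h k)) \<longlonglongrightarrow> 0" using tendsto_add[OF assms(3,4)] by simp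
qed

lemma H01_grad_mult:
  assumes u: "H01_grad u gu" and w: "W1inf_grad w gw B" and "0 \<le> B"
  shows "H01_grad (\<lambda>x. u x * w x) (\<lambda>x. u x *\<^sub>R gw x + w x *\<^sub>R gu x)"
    "L2norm M (\<lambda>x. u x *\<^sub>R gw x + w x *\<^sub>R gu x) \<le> B * (L2norm M u + L2norm M gu)"
proof -
  obtain \<phi> where \<phi>: "\<And>k::nat. \<phi> k \<in> test_functions \<Omega>" "(\<lambda>k. L2norm M (\<lambda>x. \<phi> k x - u x)) \<longlonglongrightarrow> 0"
    "(\<lambda>k. L2norm M (\<lambda>x. grad (\<phi> k) x - gu x)) \<longlonglongrightarrow> 0"
    using H01_gradE[OF u] by blast
  have w': "w \<in> borel_measurable M" "gw \<in> borel_measurable M" "AE x in M. \<bar>w x\<bar> \<le> B" "AE x in M. norm (gw x) \<le> B"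
    using w by (auto simp: W1inf_grad_def)
  note s = H01_grad_sq_int[OF u]
  have sw: "sq_int M (\<lambda>x. v x * w x)" "L2norm M (\<lambda>x. v x * w x) \<le> B * L2norm M v" if "sq_int M v" for v :: "'a \<Rightarrow> real"
    using L2norm_bounded_mult[OF that w'(1,3) \<open>0 \<le> B\<close>] by (simp_all add: mult.commute)
  note sg = L2norm_bounded_mult[OF _ w'(1,3) \<open>0 \<le> B\<close>]
  note sgw = L2norm_bounded_mult_right[OF _ w'(2,4) \<open>0 \<le> B\<close>]
  note d1 = sq_int_diff[OF sq_int_test(1)[OF \<phi>(1)] s(1)]
  note d2 = sq_int_diff[OF sq_int_test(2)[OF \<phi>(1)] s(2)]
  show "H01_grad (\<lambda>x. u x * w x) (\<lambda>x. u x *\<^sub>R gw x + w x *\<^sub>R gu x)"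
  proof (rule H01_grad_limit[OF H01_grad_test_mult[OF \<phi>(1) w]])
    show "sq_int M (\<lambda>x. u x * w x)" by (rule sw(1)[OF s(1)])
    show "sq_int M (\<lambda>x. u x *\<^sub>R gw x + w x *\<^sub>R gu x)" by (intro sq_int_add sgw(1) sg(1) s)
    show "(\<lambda>k. L2norm M (\<lambda>x. \<phi> k x * w x - u x * w x)) \<longlonglongrightarrow> 0"
      by (rule L2norm_tendsto_0_mult[OF \<phi>(2), of _ B]) (use sw(2)[OF d1] in \<open>simp add: left_diff_distrib\<close>)
    have "(\<lambda>k. L2norm M (\<lambda>x. (\<phi> k x - u x) *\<^sub>R gw x + w x *\<^sub>R (grad (\<phi> k) x - gu x))) \<longlonglongrightarrow> 0"
    proof (rule L2norm_tendsto_0_add)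
      show "sq_int M (\<lambda>x. (\<phi> k x - u x) *\<^sub>R gw x)" "sq_int M (\<lambda>x. w x *\<^sub>R (grad (\<phi> k) x - gu x))" for k
        by (intro sgw(1) sg(1) d1 d2)+
      show "(\<lambda>k. L2norm M (\<lambda>x. (\<phi> k x - u x) *\<^sub>R gw x)) \<longlonglongrightarrow> 0"
        by (rule L2norm_tendsto_0_mult[OF \<phi>(2)]) (rule sgw(2)[OF d1])
      show "(\<lambda>k. L2norm M (\<lambda>x. w x *\<^sub>R (grad (\<phi> k) x - gu x))) \<longlonglongrightarrow> 0"
        by (rule L2norm_tendsto_0_mult[OF \<phi>(3)]) (rule sg(2)[OF d2])
    qed
    then show "(\<lambda>k. L2norm M (\<lambda>x. \<phi> k x *\<^sub>R gw x + w x *\<^sub>R grad (\<phi> k) x - (u x *\<^sub>R gw x + w x *\<^sub>R gu x))) \<longlonglongrightarrow> 0"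
      by (simp add: scaleR_diff_left scaleR_diff_right algebra_simps)
  qed
  have "L2norm M (\<lambda>x. u x *\<^sub>R gw x + w x *\<^sub>R gu x) \<le> L2norm M (\<lambda>x. u x *\<^sub>R gw x) + L2norm M (\<lambda>x. w x *\<^sub>R gu x)"
    by (intro L2norm_triangle sgw(1) sg(1) s)
  also have "\<dots> \<le> B * L2norm M u + B * L2norm M gu" by (intro add_mono sgw(2) sg(2) s)
  finally show "L2norm M (\<lambda>x. u x *\<^sub>R gw x + w x *\<^sub>R gu x) \<le> B * (L2norm M u + L2norm M gu)"
    by (simp add: algebra_simps)
qed

lemma H01_grad_test_compose:
  assumes \<phi>: "\<phi> \<in> test_functions \<Omega>"
    and G: "\<And>y. (G has_real_derivative G' y) (at y)" "continuous_on UNIV G'" "G 0 = 0"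
  shows "H01_grad (\<lambda>x. G (\<phi> x)) (\<lambda>x. G' (\<phi> x) *\<^sub>R grad \<phi> x)"
proof -
  obtain K where K: "compact K" "K \<subseteq> \<Omega>" "\<And>x. x \<notin> K \<Longrightarrow> \<phi> x = 0" "\<And>x. x \<notin> K \<Longrightarrow> grad \<phi> x = 0"
    using test_functionsE[OF \<phi>] by metis
  have D: "((\<lambda>x. G (\<phi> x)) has_derivative (\<lambda>h. (G' (\<phi> x) *\<^sub>R grad \<phi> x) \<bullet> h)) (at x)" for x
    by (rule has_derivative_compose_inner[OF G(1) test_functions_has_derivative[OF \<phi>]])
  have c1: "continuous_on UNIV (\<lambda>x. G (\<phi> x))"
    using D by (meson continuous_at_imp_continuous_on has_derivative_continuous)
  have c2: "continuous_on UNIV (\<lambda>x. G' (\<phi> x) *\<^sub>R grad \<phi> x)"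
    by (intro continuous_intros test_functions_continuous_grad[OF \<phi>] continuous_on_compose2[OF G(2) test_functions_continuous[OF \<phi>]]) auto
  have z1: "G (\<phi> x) = 0" if "x \<notin> K" for x using that K G(3) by simp
  have z2: "G' (\<phi> x) *\<^sub>R grad \<phi> x = 0" if "x \<notin> K" for x using that K by simp
  obtain B1 where B1: "\<And>x. norm (G (\<phi> x)) \<le> B1" using compactly_supported_bounded[OF c1 K(1) z1] by metis
  obtain B2 where B2: "\<And>x. norm (G' (\<phi> x) *\<^sub>R grad \<phi> x) \<le> B2" using compactly_supported_bounded[OF c2 K(1) z2] by metis
  show ?thesis
  proof (rule H01_grad_compact_support[OF K(1,2), where B="max B1 B2"])
    show "AE x in lebesgue. \<bar>G (\<phi> x)\<bar> \<le> max B1 B2" using B1 by (auto simp: le_max_iff_disj)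
    show "AE x in lebesgue. norm (G' (\<phi> x) *\<^sub>R grad \<phi> x) \<le> max B1 B2" using B2 by (auto simp: le_max_iff_disj)
    show "has_weak_grad \<Omega> (\<lambda>x. G (\<phi> x)) (\<lambda>x. G' (\<phi> x) *\<^sub>R grad \<phi> x)" by (rule has_weak_grad_C1[OF sets_\<Omega> D c2])
  qed (use z1 z2 c1 c2 in \<open>auto intro: continuous_lebesgue_measurable\<close>)
qed

text \<open>Density of test functions. The delicate term is
  \<open>G' (\<phi> k x) *\<^sub>R gu x\<close>: as \<open>G'\<close> is merely continuous and
  bounded, its convergence needs an almost everywhere convergent subsequence and dominated
  convergence. The condition \<open>G 0 = 0\<close> preserves compact supports.\<close>

lemma H01_grad_compose:
  assumes u: "H01_grad u gu"
    and G: "\<And>y. (G has_real_derivative G' y) (at y)" "continuous_on UNIV G'" "G 0 = 0" "\<And>y. \<bar>G' y\<bar> \<le> L"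
  shows "H01_grad (\<lambda>x. G (u x)) (\<lambda>x. G' (u x) *\<^sub>R gu x)"
    "L2norm M (\<lambda>x. G (u x)) \<le> L * L2norm M u" "L2norm M (\<lambda>x. G' (u x) *\<^sub>R gu x) \<le> L * L2norm M gu"
proof -
  have L: "0 \<le> L" using G(4)[of 0] by simp
  note s = H01_grad_sq_int[OF u]
  have mu: "u \<in> borel_measurable M" using s by (simp add: sq_int_def)
  have cG: "continuous_on UNIV G" using G(1) by (meson DERIV_isCont continuous_at_imp_continuous_on)
  have mG: "G \<in> borel_measurable borel" "G' \<in> borel_measurable borel"
    by (intro borel_measurable_continuous_onI cG G(2))+
  have lip: "\<bar>G a - G b\<bar> \<le> L * \<bar>a - b\<bar>" for a b by (rule Lipschitz_of_derivative[OF G(1,4)])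
  have mGu: "(\<lambda>x. G (u x)) \<in> borel_measurable M" by (rule measurable_compose[OF mu mG(1)])
  have mGu': "(\<lambda>x. G' (v x)) \<in> borel_measurable M" if "v \<in> borel_measurable M" for v :: "'a \<Rightarrow> real"
    by (rule measurable_compose[OF that mG(2)])
  have le1: "AE x in M. norm (G (u x)) \<le> L * norm (u x)" using lip[of _ 0] G(3) by simp
  note b = L2norm_bounded_mult[OF _ mGu' _ L]
  show n1: "L2norm M (\<lambda>x. G (u x)) \<le> L * L2norm M u" by (rule L2norm_mono[OF s(1) le1 L])
  have s1: "sq_int M (\<lambda>x. G (u x))" by (rule sq_int_mono[OF mGu s(1) le1])
  show n2: "L2norm M (\<lambda>x. G' (u x) *\<^sub>R gu x) \<le> L * L2norm M gu" by (rule b(2)[OF s(2) mu]) (use G(4) in auto)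
  have s2: "sq_int M (\<lambda>x. G' (u x) *\<^sub>R gu x)" by (rule b(1)[OF s(2) mu]) (use G(4) in auto)
  obtain \<phi> where \<phi>: "\<And>k::nat. \<phi> k \<in> test_functions \<Omega>" "(\<lambda>k. L2norm M (\<lambda>x. \<phi> k x - u x)) \<longlonglongrightarrow> 0"
    "(\<lambda>k. L2norm M (\<lambda>x. grad (\<phi> k) x - gu x)) \<longlonglongrightarrow> 0"
    using H01_gradE[OF u] by blast
  obtain r where r: "strict_mono r" "AE x in M. (\<lambda>k. \<phi> (r k) x) \<longlonglongrightarrow> u x"
    using L2_AE_subseq[OF sq_int_test(1)[OF \<phi>(1)] s(1) \<phi>(2)] by blast
  have l1: "(\<lambda>k. L2norm M (\<lambda>x. \<phi> (r k) x - u x)) \<longlonglongrightarrow> 0" using LIMSEQ_subseq_LIMSEQ[OF \<phi>(2) r(1)] by (simp add: o_def)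
  have l2: "(\<lambda>k. L2norm M (\<lambda>x. grad (\<phi> (r k)) x - gu x)) \<longlonglongrightarrow> 0" using LIMSEQ_subseq_LIMSEQ[OF \<phi>(3) r(1)] by (simp add: o_def)
  have m\<phi>: "\<phi> k \<in> borel_measurable M" for k using sq_int_test(1)[OF \<phi>(1)[of k]] by (simp add: sq_int_def)
  note d1 = sq_int_diff[OF sq_int_test(1)[OF \<phi>(1)] s(1)]
  note d2 = sq_int_diff[OF sq_int_test(2)[OF \<phi>(1)] s(2)]
  show "H01_grad (\<lambda>x. G (u x)) (\<lambda>x. G' (u x) *\<^sub>R gu x)"
  proof (rule H01_grad_limit[OF H01_grad_test_compose[OF \<phi>(1) G(1-3)] s1 s2])
    show "(\<lambda>k. L2norm M (\<lambda>x. G (\<phi> (r k) x) - G (u x))) \<longlonglongrightarrow> 0"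
      by (rule L2norm_tendsto_0_mult[OF l1, of _ L], rule L2norm_mono[OF d1 _ L]) (use lip in auto)
    have "(\<lambda>k. L2norm M (\<lambda>x. G' (\<phi> (r k) x) *\<^sub>R (grad (\<phi> (r k)) x - gu x)
        + (G' (\<phi> (r k) x) *\<^sub>R gu x - G' (u x) *\<^sub>R gu x))) \<longlonglongrightarrow> 0"
    proof (rule L2norm_tendsto_0_add)
      show "sq_int M (\<lambda>x. G' (\<phi> (r k) x) *\<^sub>R (grad (\<phi> (r k)) x - gu x))" for k
        by (rule b(1)[OF d2 m\<phi>]) (use G(4) in auto)
      show "sq_int M (\<lambda>x. G' (\<phi> (r k) x) *\<^sub>R gu x - G' (u x) *\<^sub>R gu x)" for k
        by (rule sq_int_diff[OF _ s2], rule b(1)[OF s(2) m\<phi>]) (use G(4) in auto)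
      show "(\<lambda>k. L2norm M (\<lambda>x. G' (\<phi> (r k) x) *\<^sub>R (grad (\<phi> (r k)) x - gu x))) \<longlonglongrightarrow> 0"
        by (rule L2norm_tendsto_0_mult[OF l2], rule b(2)[OF d2 m\<phi>]) (use G(4) in auto)
      show "(\<lambda>k. L2norm M (\<lambda>x. G' (\<phi> (r k) x) *\<^sub>R gu x - G' (u x) *\<^sub>R gu x)) \<longlonglongrightarrow> 0"
      proof (rule L2_dominated_convergence[where h="\<lambda>x. (2 * L)\<^sup>2 * (norm (gu x))\<^sup>2"])
        show "(\<lambda>x. G' (\<phi> (r k) x) *\<^sub>R gu x) \<in> borel_measurable M" for k
          using mGu'[OF m\<phi>] s(2) by (auto simp: sq_int_def)
        show "(\<lambda>x. G' (u x) *\<^sub>R gu x) \<in> borel_measurable M" using s2 by (simp add: sq_int_def)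
        show "integrable M (\<lambda>x. (2 * L)\<^sup>2 * (norm (gu x))\<^sup>2)" using s(2) by (simp add: sq_int_def)
        show "AE x in M. (norm (G' (\<phi> (r k) x) *\<^sub>R gu x - G' (u x) *\<^sub>R gu x))\<^sup>2 \<le> (2 * L)\<^sup>2 * (norm (gu x))\<^sup>2" for k
        proof (rule AE_I2)
          fix x
          have "\<bar>G' (\<phi> (r k) x) - G' (u x)\<bar> \<le> 2 * L" using G(4)[of "\<phi> (r k) x"] G(4)[of "u x"] by linarith
          then have "norm ((G' (\<phi> (r k) x) - G' (u x)) *\<^sub>R gu x) \<le> (2 * L) * norm (gu x)"
            by (simp add: mult_right_mono)
          then have "(norm ((G' (\<phi> (r k) x) - G' (u x)) *\<^sub>R gu x))\<^sup>2 \<le> ((2 * L) * norm (gu x))\<^sup>2"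
            by (rule power_mono) simp
          then show "(norm (G' (\<phi> (r k) x) *\<^sub>R gu x - G' (u x) *\<^sub>R gu x))\<^sup>2 \<le> (2 * L)\<^sup>2 * (norm (gu x))\<^sup>2"
            unfolding scaleR_diff_left power_mult_distrib .
        qed
        show "AE x in M. (\<lambda>k. G' (\<phi> (r k) x) *\<^sub>R gu x) \<longlonglongrightarrow> G' (u x) *\<^sub>R gu x"
          using r(2)
        proof eventually_elim
          case (elim x)
          have "isCont G' (u x)" using G(2) by (simp add: continuous_on_eq_continuous_at)
          then have "(\<lambda>k. G' (\<phi> (r k) x)) \<longlonglongrightarrow> G' (u x)" using elim by (rule isCont_tendsto_compose)
          then show ?case by (intro tendsto_intros)
        qed
      qed
    qed
    then show "(\<lambda>k. L2norm M (\<lambda>x. G' (\<phi> (r k) x) *\<^sub>R grad (\<phi> (r k)) x - G' (u x) *\<^sub>R gu x)) \<longlonglongrightarrow> 0"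
      by (simp add: scaleR_diff_right)
  qed
qed

text \<open>The weak gradient is a local notion. On the support of the test function
  \<open>\<psi>\<close>, \<open>w\<close> coincides with \<open>\<eta> x * w x\<close>, a member of
  \<open>H01\<close> to which the previous chain rule applies. That rule requires the value 0 at 0,
  so \<open>G 0\<close> is subtracted; the constant is harmless because the gradient of
  \<open>\<psi>\<close> has integral 0.\<close>

lemma W1inf_grad_compose:
  assumes w: "W1inf_grad w gw B"
    and G: "\<And>y. (G has_real_derivative G' y) (at y)" "continuous_on UNIV G'" "\<And>y. \<bar>G' y\<bar> \<le> L"
  shows "W1inf_grad (\<lambda>x. G (w x)) (\<lambda>x. G' (w x) *\<^sub>R gw x) (\<bar>G 0\<bar> + L * \<bar>B\<bar>)"
proof -
  have L: "0 \<le> L" using G(3)[of 0] by simp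
  have w': "w \<in> borel_measurable M" "gw \<in> borel_measurable M" "AE x in M. \<bar>w x\<bar> \<le> B" "AE x in M. norm (gw x) \<le> B"
    "has_weak_grad \<Omega> w gw"
    using w by (auto simp: W1inf_grad_def)
  have cG: "continuous_on UNIV G" using G(1) by (meson DERIV_isCont continuous_at_imp_continuous_on)
  have mG: "G \<in> borel_measurable borel" "G' \<in> borel_measurable borel"
    by (intro borel_measurable_continuous_onI cG G(2))+
  have m: "(\<lambda>x. G (w x)) \<in> borel_measurable M" "(\<lambda>x. G' (w x) *\<^sub>R gw x) \<in> borel_measurable M"
    using measurable_compose[OF w'(1) mG(1)] measurable_compose[OF w'(1) mG(2)] w'(2) by auto
  have lip: "\<bar>G a - G b\<bar> \<le> L * \<bar>a - b\<bar>" for a b by (rule Lipschitz_of_derivative[OF G(1,3)])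
  have b1: "AE x in M. \<bar>G (w x)\<bar> \<le> \<bar>G 0\<bar> + L * \<bar>B\<bar>"
    using w'(3)
  proof eventually_elim
    case (elim x)
    have "L * \<bar>w x\<bar> \<le> L * \<bar>B\<bar>" using elim L by (intro mult_left_mono) auto
    then show ?case using lip[of "w x" 0] by simp
  qed
  have b2: "AE x in M. norm (G' (w x) *\<^sub>R gw x) \<le> \<bar>G 0\<bar> + L * \<bar>B\<bar>"
    using w'(4)
  proof eventually_elim
    case (elim x)
    have "\<bar>G' (w x)\<bar> * norm (gw x) \<le> L * \<bar>B\<bar>" using elim L G(3)[of "w x"] by (intro mult_mono) auto
    then show ?case by simp
  qed
  have "has_weak_grad \<Omega> (\<lambda>x. G (w x)) (\<lambda>x. G' (w x) *\<^sub>R gw x)"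
    unfolding has_weak_grad_def
  proof (intro conjI ballI)
    show "locally_integrable \<Omega> (\<lambda>x. G (w x))"
      by (rule sq_int_locally_integrable, rule sq_int_bounded[OF m(1)]) (use b1 in auto)
    show "locally_integrable \<Omega> (\<lambda>x. G' (w x) *\<^sub>R gw x)"
      by (rule sq_int_locally_integrable, rule sq_int_bounded[OF m(2) b2])
    have li1: "locally_integrable \<Omega> (\<lambda>x. G (w x))"
      by (rule sq_int_locally_integrable, rule sq_int_bounded[OF m(1)]) (use b1 in auto)
    fix \<psi> assume \<psi>: "\<psi> \<in> test_functions \<Omega>"
    obtain K where K: "compact K" "K \<subseteq> \<Omega>" "\<And>x. x \<notin> K \<Longrightarrow> \<psi> x = 0" "\<And>x. x \<notin> K \<Longrightarrow> grad \<psi> x = 0"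
      using test_functionsE[OF \<psi>] by metis
    obtain \<eta> U where \<eta>: "\<eta> \<in> test_functions \<Omega>" "open U" "K \<subseteq> U" "\<And>x. x \<in> U \<Longrightarrow> \<eta> x = 1"
      using cutoff[OF K(1) op K(2)] by metis
    have g\<eta>: "grad \<eta> x = 0" if "x \<in> U" for x
    proof (rule gradI)
      have "((\<lambda>_. 1) has_derivative (\<lambda>h. 0 \<bullet> h)) (at x)" by simp
      then show "(\<eta> has_derivative (\<lambda>h. 0 \<bullet> h)) (at x)"
        by (rule has_derivative_transform_within_open[where s=U]) (use \<eta> that in auto)
    qed
    have "H01_grad (\<lambda>x. G (\<eta> x * w x) - G 0) (\<lambda>x. G' (\<eta> x * w x) *\<^sub>R (\<eta> x *\<^sub>R gw x + w x *\<^sub>R grad \<eta> x))"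
      by (rule H01_grad_compose(1)[OF H01_grad_test_mult[OF \<eta>(1) w], of "\<lambda>y. G y - G 0" G' L])
         (use G in \<open>auto intro!: derivative_eq_intros\<close>)
    from H01_grad_weak[OF this] \<psi>
    have "(LINT x|M. (G (\<eta> x * w x) - G 0) *\<^sub>R grad \<psi> x)
        = - (LINT x|M. \<psi> x *\<^sub>R (G' (\<eta> x * w x) *\<^sub>R (\<eta> x *\<^sub>R gw x + w x *\<^sub>R grad \<eta> x)))"
      unfolding has_weak_grad_def by blast
    moreover have "(\<lambda>x. (G (\<eta> x * w x) - G 0) *\<^sub>R grad \<psi> x) = (\<lambda>x. G (w x) *\<^sub>R grad \<psi> x - G 0 *\<^sub>R grad \<psi> x)"
    proof
      fix x show "(G (\<eta> x * w x) - G 0) *\<^sub>R grad \<psi> x = G (w x) *\<^sub>R grad \<psi> x - G 0 *\<^sub>R grad \<psi> x"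
        using K(4) \<eta>(3,4) by (cases "x \<in> K") (auto simp: scaleR_diff_left subset_iff)
    qed
    moreover have "(\<lambda>x. \<psi> x *\<^sub>R (G' (\<eta> x * w x) *\<^sub>R (\<eta> x *\<^sub>R gw x + w x *\<^sub>R grad \<eta> x))) = (\<lambda>x. \<psi> x *\<^sub>R (G' (w x) *\<^sub>R gw x))"
    proof
      fix x show "\<psi> x *\<^sub>R (G' (\<eta> x * w x) *\<^sub>R (\<eta> x *\<^sub>R gw x + w x *\<^sub>R grad \<eta> x)) = \<psi> x *\<^sub>R (G' (w x) *\<^sub>R gw x)"
        using K(3) \<eta>(3,4) g\<eta> by (cases "x \<in> K") (auto simp: subset_iff)
    qed
    moreover have "(LINT x|M. G (w x) *\<^sub>R grad \<psi> x - G 0 *\<^sub>R grad \<psi> x) = (LINT x|M. G (w x) *\<^sub>R grad \<psi> x)"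
    proof -
      have i: "integrable M (grad \<psi>)" by (rule sq_int_imp_integrable[OF sq_int_test(2)[OF \<psi>]])
      have "(LINT x|M. grad \<psi> x) = (LINT x|lebesgue. grad \<psi> x)"
        by (rule lebesgue_on_support(1)[OF sets_\<Omega>]) (use K in auto)
      also have "\<dots> = 0"
        by (rule integral_grad_eq_0(1)[OF test_functions_has_derivative[OF \<psi>] test_functions_continuous_grad[OF \<psi>] K(1,3)])
      finally show ?thesis using i locally_integrable_grad_test[OF sets_\<Omega> li1 \<psi>] by simp
    qed
    ultimately show "(LINT x|M. G (w x) *\<^sub>R grad \<psi> x) = - (LINT x|M. \<psi> x *\<^sub>R (G' (w x) *\<^sub>R gw x))"
      by simp
  qed
  then show ?thesis unfolding W1inf_grad_def using m b1 b2 by blast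
qed

section \<open>The Poincare inequality\<close>

lemma Poincare_test:
  assumes \<phi>: "\<phi> \<in> test_functions \<Omega>" and R: "\<Omega> \<subseteq> ball 0 R"
  shows "L2norm M \<phi> \<le> 2 * R * L2norm M (grad \<phi>)"
\<comment> \<open>An empty \<open>\<Omega>\<close> is compatible with a negative radius; in all
  other cases \<open>0 \<le> R\<close>.\<close>
proof (cases "\<Omega> = {}")
  case True
  have "L2norm M \<phi> = 0" "L2norm M (grad \<phi>) = 0" using True by (auto simp: L2norm_def)
  then show ?thesis by simp
next
  case False
  then have R0: "0 \<le> R" using R by (metis ball_eq_empty not_less subset_empty less_imp_le)
  obtain b :: 'a where b: "b \<in> Basis" using nonempty_Basis by blast
  obtain K where K: "compact K" "K \<subseteq> \<Omega>" "\<And>x. x \<notin> K \<Longrightarrow> \<phi> x = 0" "\<And>x. x \<notin> K \<Longrightarrow> grad \<phi> x = 0"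
    using test_functionsE[OF \<phi>] by metis
  \<comment> \<open>This is the gradient of \<open>(x \<bullet> b) * (\<phi> x)^2\<close>. Its
    \<open>b\<close> component integrates to 0, which expresses the integral of
    \<open>(\<phi> x)^2\<close> by \<open>-2\<close> times that of
    \<open>(x \<bullet> b) * \<phi> x * (grad \<phi> x \<bullet> b)\<close>, where
    \<open>\<bar>x \<bullet> b\<bar> \<le> R\<close> on \<open>\<Omega>\<close>.\<close>
  define g where "g x = (x \<bullet> b) *\<^sub>R (\<phi> x *\<^sub>R grad \<phi> x + \<phi> x *\<^sub>R grad \<phi> x) + (\<phi> x * \<phi> x) *\<^sub>R b" for x
  have "((\<lambda>x. x \<bullet> b) has_derivative (\<lambda>h. b \<bullet> h)) (at x)" for x
    by (auto intro!: derivative_eq_intros simp: inner_commute)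
  from has_derivative_mult_inner[OF this has_derivative_mult_inner[OF test_functions_has_derivative[OF \<phi>] test_functions_has_derivative[OF \<phi>]]]
  have D: "((\<lambda>x. (x \<bullet> b) * (\<phi> x * \<phi> x)) has_derivative (\<lambda>h. g x \<bullet> h)) (at x)" for x
    by (simp add: g_def)
  have cg: "continuous_on UNIV g"
    unfolding g_def[abs_def] by (intro continuous_intros test_functions_continuous[OF \<phi>] test_functions_continuous_grad[OF \<phi>])
  note ig = integral_grad_eq_0[OF D cg K(1)]
  have ig1: "(LINT x|lebesgue. g x) = 0" by (rule ig(1)) (use K(3) in auto)
  have ig2: "integrable lebesgue g" by (rule ig(2)) (use K(3) in auto)
  have off: "g x \<bullet> b = 0" if "x \<notin> \<Omega>" for x
  proof -
    have "x \<notin> K" using that K(2) by auto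
    then show ?thesis using K(3) by (simp add: g_def)
  qed
  have "(LINT x|M. g x \<bullet> b) = (LINT x|lebesgue. g x \<bullet> b)" by (rule lebesgue_on_support(1)[OF sets_\<Omega> off])
  also have "\<dots> = 0" using ig1 ig2 by simp
  finally have g0: "(LINT x|M. g x \<bullet> b) = 0" .
  have igM: "integrable M (\<lambda>x. g x \<bullet> b)"
    using lebesgue_on_support(2)[OF sets_\<Omega> off] ig2 by simp
  note s = sq_int_test[OF \<phi>]
  have "(L2norm M \<phi>)\<^sup>2 = (LINT x|M. (\<phi> x)\<^sup>2 - g x \<bullet> b)"
    using s(1) igM g0 by (simp add: L2norm_sq sq_int_def)
  also have "\<dots> \<le> (LINT x|M. (2 * R) * (norm (\<phi> x) * norm (grad \<phi> x)))"
  proof (rule integral_mono_AE)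
    show "integrable M (\<lambda>x. (\<phi> x)\<^sup>2 - g x \<bullet> b)" using s(1) igM by (simp add: sq_int_def)
    show "integrable M (\<lambda>x. (2 * R) * (norm (\<phi> x) * norm (grad \<phi> x)))" using sq_int_norm_mult[OF s] by simp
    have "AE x in M. x \<in> \<Omega>" using AE_space[of M] by simp
    then show "AE x in M. (\<phi> x)\<^sup>2 - g x \<bullet> b \<le> (2 * R) * (norm (\<phi> x) * norm (grad \<phi> x))"
    proof eventually_elim
      case (elim x)
      have "b \<bullet> b = 1" using b by (simp add: inner_same_Basis)
      moreover have ring: "p * p - (X * (p * G + p * G) + p * p * 1) = - (2 * (X * (p * G)))" for p X G :: real
        by algebra
      moreover have "g x \<bullet> b = (x \<bullet> b) * (\<phi> x * (grad \<phi> x \<bullet> b) + \<phi> x * (grad \<phi> x \<bullet> b)) + \<phi> x * \<phi> x * (b \<bullet> b)"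
        unfolding g_def by (simp only: inner_add_left inner_scaleR_left)
      ultimately have "(\<phi> x)\<^sup>2 - g x \<bullet> b = - (2 * ((x \<bullet> b) * (\<phi> x * (grad \<phi> x \<bullet> b))))"
        using ring[of "\<phi> x" "x \<bullet> b" "grad \<phi> x \<bullet> b"] by (simp only: power2_eq_square)
      also have "\<dots> \<le> 2 * (\<bar>x \<bullet> b\<bar> * (\<bar>\<phi> x\<bar> * \<bar>grad \<phi> x \<bullet> b\<bar>))"
        using abs_ge_minus_self[of "(x \<bullet> b) * (\<phi> x * (grad \<phi> x \<bullet> b))"] by (simp only: abs_mult)
      also have "\<dots> \<le> 2 * (R * (\<bar>\<phi> x\<bar> * norm (grad \<phi> x)))"
      proof -
        have "\<bar>x \<bullet> b\<bar> \<le> R" using Basis_le_norm[OF b, of x] R elim by force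
        then show ?thesis using Basis_le_norm[OF b, of "grad \<phi> x"] R0 by (intro mult_left_mono mult_mono) auto
      qed
      finally show ?case by (simp add: mult.assoc)
    qed
  qed
  also have "\<dots> = 2 * R * (LINT x|M. norm (\<phi> x) * norm (grad \<phi> x))" by simp
  also have "\<dots> \<le> 2 * R * (L2norm M \<phi> * L2norm M (grad \<phi>))"
    using Cauchy_Schwarz_norm_integral[OF s] R0 by (intro mult_left_mono) auto
  finally have *: "L2norm M \<phi> * L2norm M \<phi> \<le> L2norm M \<phi> * (2 * R * L2norm M (grad \<phi>))"
    by (simp add: power2_eq_square algebra_simps)
  show ?thesis
  proof (cases "L2norm M \<phi> = 0")
    case True
    then show ?thesis using R0 by simp
  next
    case False
    then have "0 < L2norm M \<phi>" using L2norm_nonneg[of M \<phi>] by linarith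
    then show ?thesis using * by simp
  qed
qed

lemma Poincare:
  assumes "H01_grad u g" "\<Omega> \<subseteq> ball 0 R"
  shows "L2norm M u \<le> 2 * R * L2norm M g"
proof -
  obtain \<phi> where \<phi>: "\<And>k::nat. \<phi> k \<in> test_functions \<Omega>" "(\<lambda>k. L2norm M (\<lambda>x. \<phi> k x - u x)) \<longlonglongrightarrow> 0"
    "(\<lambda>k. L2norm M (\<lambda>x. grad (\<phi> k) x - g x)) \<longlonglongrightarrow> 0"
    using H01_gradE[OF assms(1)] by blast
  note s = H01_grad_sq_int[OF assms(1)]
  show ?thesis
  proof (rule tendsto_le[OF sequentially_bot])
    show "(\<lambda>k. L2norm M (\<phi> k)) \<longlonglongrightarrow> L2norm M u" by (rule L2norm_tendsto[OF sq_int_test(1)[OF \<phi>(1)] s(1) \<phi>(2)])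
    show "(\<lambda>k. 2 * R * L2norm M (grad (\<phi> k))) \<longlonglongrightarrow> 2 * R * L2norm M g"
      by (intro tendsto_intros L2norm_tendsto[OF sq_int_test(2)[OF \<phi>(1)] s(2) \<phi>(3)])
    show "\<forall>\<^sub>F k in sequentially. L2norm M (\<phi> k) \<le> 2 * R * L2norm M (grad (\<phi> k))"
      by (rule always_eventually) (use Poincare_test[OF \<phi>(1) assms(2)] in blast)
  qed
qed

text \<open>Both sides of the identity that defines the weak divergence are continuous in the L2
  norms, so it extends from test functions to their closure.\<close>

lemma weak_div_H01:
  assumes "has_weak_div \<Omega> G w" "sq_int M G" "sq_int M w" and u: "H01_grad u gu"
  shows "(LINT x|M. G x \<bullet> gu x) = - (LINT x|M. w x * u x)"
proof -
  obtain \<phi> where \<phi>: "\<And>k::nat. \<phi> k \<in> test_functions \<Omega>" "(\<lambda>k. L2norm M (\<lambda>x. \<phi> k x - u x)) \<longlonglongrightarrow> 0"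
    "(\<lambda>k. L2norm M (\<lambda>x. grad (\<phi> k) x - gu x)) \<longlonglongrightarrow> 0"
    using H01_gradE[OF u] by blast
  note s = H01_grad_sq_int[OF u]
  have "(\<lambda>k. LINT x|M. grad (\<phi> k) x \<bullet> G x) \<longlonglongrightarrow> (LINT x|M. gu x \<bullet> G x)"
    by (rule tendsto_integral_inner[OF sq_int_test(2)[OF \<phi>(1)] s(2) assms(2) \<phi>(3)])
  moreover have "(LINT x|M. grad (\<phi> k) x \<bullet> G x) = - (LINT x|M. \<phi> k x \<bullet> w x)" for k
    using assms(1) \<phi>(1)[of k] by (simp add: has_weak_div_def inner_commute[of _ "G _"] mult.commute)
  ultimately have "(\<lambda>k. - (LINT x|M. \<phi> k x \<bullet> w x)) \<longlonglongrightarrow> (LINT x|M. gu x \<bullet> G x)" by simp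
  moreover have "(\<lambda>k. - (LINT x|M. \<phi> k x \<bullet> w x)) \<longlonglongrightarrow> - (LINT x|M. u x \<bullet> w x)"
    by (intro tendsto_minus tendsto_integral_inner[OF sq_int_test(1)[OF \<phi>(1)] s(1) assms(3) \<phi>(2)])
  ultimately show ?thesis
    using LIMSEQ_unique by (fastforce simp: inner_commute[of _ "G _"] mult.commute)
qed

end

section \<open>Functions of time\<close>

text \<open>Because \<open>s\<close> takes finitely many values, the composition with an entirely
  arbitrary \<open>q\<close> is a finite combination of indicators. No sigma-algebra on the function
  space is involved.\<close>

lemma simple_measurable:
  fixes q :: "'c \<Rightarrow> real"
  assumes I: "I \<in> sets lebesgue" and "finite (s ` I)" "\<And>f. {t \<in> I. s t = f} \<in> sets lebesgue"
  shows "(\<lambda>t. q (s t)) \<in> borel_measurable (lebesgue_on I)"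
proof -
  have "(\<lambda>t. \<Sum>f\<in>s ` I. q f * indicator {t \<in> I. s t = f} t) \<in> borel_measurable (lebesgue_on I)"
    by (intro borel_measurable_sum borel_measurable_times borel_measurable_const borel_measurable_indicator)
       (use assms in \<open>auto simp: sets_restrict_space_iff\<close>)
  moreover have "q (s t) = (\<Sum>f\<in>s ` I. q f * indicator {t \<in> I. s t = f} t)" if "t \<in> I" for t
  proof -
    have "(\<Sum>f\<in>s ` I. q f * indicator {t \<in> I. s t = f} t) = (\<Sum>f\<in>s ` I. if f = s t then q f else 0)"
      using that by (intro sum.cong) (auto simp: indicator_def)
    then show ?thesis using assms(2) that by simp
  qed
  ultimately show ?thesis by (subst measurable_cong) auto
qed

lemma simple_measurable2:
  fixes q :: "'c \<Rightarrow> 'c \<Rightarrow> real"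
  assumes I: "I \<in> sets lebesgue" and s: "finite (s ` I)" "\<And>f. {t \<in> I. s t = f} \<in> sets lebesgue"
    and s': "finite (s' ` I)" "\<And>f. {t \<in> I. s' t = f} \<in> sets lebesgue"
  shows "(\<lambda>t. q (s t) (s' t)) \<in> borel_measurable (lebesgue_on I)"
proof -
  have "(\<lambda>t. case_prod q (s t, s' t)) \<in> borel_measurable (lebesgue_on I)"
  proof (rule simple_measurable[OF I, where s="\<lambda>t. (s t, s' t)" and q="case_prod q"])
    show "finite ((\<lambda>t. (s t, s' t)) ` I)"
      by (rule finite_subset[OF _ finite_cartesian_product[OF s(1) s'(1)]]) auto
    fix f
    have "{t \<in> I. (s t, s' t) = f} = {t \<in> I. s t = fst f} \<inter> {t \<in> I. s' t = snd f}" by auto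
    then show "{t \<in> I. (s t, s' t) = f} \<in> sets lebesgue" using s s' by auto
  qed
  then show ?thesis by simp
qed

lemma measurable_AE_LIMSEQ:
  fixes f :: "nat \<Rightarrow> 'a::euclidean_space \<Rightarrow> real"
  assumes "I \<in> sets lebesgue" "\<And>k. f k \<in> borel_measurable (lebesgue_on I)"
    and "AE t in lebesgue_on I. (\<lambda>k. f k t) \<longlonglongrightarrow> g t"
  shows "g \<in> borel_measurable (lebesgue_on I)"
proof (rule borel_measurable_lebesgue_on_AE[OF assms(1)])
  show "(\<lambda>t. lim (\<lambda>k. f k t)) \<in> borel_measurable (lebesgue_on I)"
    by (rule borel_measurable_lim_metric[OF assms(2)])
  show "AE t in lebesgue_on I. lim (\<lambda>k. f k t) = g t"
    using assms(3) by eventually_elim (rule limI)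
qed

lemma mollifier_uminus: "mollifier r (- x) = mollifier r x"
  by (simp add: mollifier_def bump_def)

lemma real_test_deriv:
  fixes \<psi> :: "real \<Rightarrow> real"
  assumes "\<psi> \<in> test_functions J"
  shows "(\<psi> has_real_derivative grad \<psi> t) (at t)" "deriv \<psi> t = grad \<psi> t"
proof -
  show *: "(\<psi> has_real_derivative grad \<psi> t) (at t)"
    using test_functions_has_derivative[OF assms, of t] by (simp add: has_field_derivative_def inner_real_def)
  show "deriv \<psi> t = grad \<psi> t" by (rule DERIV_imp_deriv[OF *])
qed

text \<open>The test function that approximates the indicator of \<open>[s,t]\<close>.\<close>

lemma mollified_interval:
  fixes s t r T :: real
  assumes r: "0 < r" "r < s" "s \<le> t" "t + r < T"
  defines "\<psi> \<equiv> conv (mollifier r) (indicator {s..t})"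
  shows "\<psi> \<in> test_functions {0<..<T}" "deriv \<psi> x = mollifier r (s - x) - mollifier r (t - x)"
    "\<bar>\<psi> x\<bar> \<le> 1" "s + r \<le> x \<Longrightarrow> x + r \<le> t \<Longrightarrow> \<psi> x = 1" "x + r \<le> s \<or> t + r \<le> x \<Longrightarrow> \<psi> x = 0"
proof -
  let ?f = "indicator {s..t} :: real \<Rightarrow> real"
  have f: "integrable lebesgue ?f"
    using lmeasurable_iff_integrable[of "{s..t}"] by simp
  note \<rho> = mollifier[OF r(1), where 'a=real]
  have sub: "(\<Union>y\<in>{s..t}. cball y r) \<subseteq> {0<..<T}"
    using r by (auto simp: dist_real_def)
  show \<psi>: "\<psi> \<in> test_functions {0<..<T}"
    unfolding \<psi>_def by (rule conv_mollifier_test[OF r(1) compact_Icc _ f sub]) simp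
  show "\<bar>\<psi> x\<bar> \<le> 1" unfolding \<psi>_def by (rule conv_mollifier_bound[OF r(1) f]) (auto simp: indicator_def)
  show "\<psi> x = 1" if "s + r \<le> x" "x + r \<le> t"
  proof -
    have "\<bar>conv (mollifier r) ?f x - ?f x\<bar> \<le> 0"
      by (rule conv_mollifier_close[OF r(1) f]) (use that r in \<open>auto simp: dist_real_def indicator_def\<close>)
    then show ?thesis using that r by (simp add: \<psi>_def indicator_def)
  qed
  show "\<psi> x = 0" if "x + r \<le> s \<or> t + r \<le> x"
  proof -
    have "\<bar>conv (mollifier r) ?f x - ?f x\<bar> \<le> 0"
      by (rule conv_mollifier_close[OF r(1) f]) (use that r in \<open>auto simp: dist_real_def indicator_def\<close>)
    then show ?thesis using that r by (auto simp: \<psi>_def indicator_def)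
  qed
  \<comment> \<open>The integrand is the derivative in \<open>y\<close> of
    \<open>- mollifier r (x - y)\<close>, so the fundamental theorem on \<open>{s..t}\<close> leaves
    two end point values; evenness of the mollifier brings them into the stated form.\<close>
  have "deriv \<psi> x = (LINT y|lebesgue. ?f y *\<^sub>R grad (mollifier r) (x - y))"
    using real_test_deriv(2)[OF \<psi>] grad_conv[OF \<rho>(1) f] by (simp add: \<psi>_def)
  also have "\<dots> = (LINT y|lborel. ?f y *\<^sub>R grad (mollifier r) (x - y))"
    by (rule integral_completion)
       (subst measurable_lborel2, intro borel_measurable_scaleR borel_measurable_indicator
          borel_measurable_continuous_onI[OF continuous_shift[OF test_functions_continuous_grad[OF \<rho>(1)], of x]]; simp)
  also have "\<dots> = - mollifier r (x - t) - (- mollifier r (x - s))"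
  proof (rule integral_FTC_atLeastAtMost[OF r(3)])
    show "continuous_on {s..t} (\<lambda>y. grad (mollifier r) (x - y))"
      using continuous_shift[OF test_functions_continuous_grad[OF \<rho>(1)], of x] continuous_on_subset by blast
    fix y :: real
    have "((\<lambda>y. - mollifier r (x - y)) has_real_derivative grad (mollifier r) (x - y)) (at y)"
    proof -
      have "((\<lambda>y. x - y) has_real_derivative - 1) (at y)" by (auto intro!: derivative_eq_intros)
      from DERIV_minus[OF DERIV_chain2[OF real_test_deriv(1)[OF \<rho>(1)] this]] show ?thesis by simp
    qed
    then show "((\<lambda>y. - mollifier r (x - y)) has_vector_derivative grad (mollifier r) (x - y)) (at y within {s..t})"
      by (simp add: has_real_derivative_iff_has_vector_derivative has_vector_derivative_at_within)
  qed
  finally show "deriv \<psi> x = mollifier r (s - x) - mollifier r (t - x)"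
    using mollifier_uminus[of r "x - t"] mollifier_uminus[of r "x - s"] by simp
qed

lemma interval_lebesgue_finite: "finite_measure (lebesgue_on {0<..<T::real})"
  by (rule finite_measure_lebesgue_on) (simp add: lmeasurable_open)

text \<open>Testing with mollified indicators recovers the fundamental theorem of calculus.\<close>

lemma weak_time_derivative_increment:
  fixes U f :: "real \<Rightarrow> real"
  assumes U: "continuous_on {0..T} U" and f: "integrable (lebesgue_on {0<..<T}) f"
    and weak: "\<And>\<psi>. \<psi> \<in> test_functions {0<..<T} \<Longrightarrow>
      (LINT t|lebesgue_on {0<..<T}. deriv \<psi> t * U t) = - (LINT t|lebesgue_on {0<..<T}. \<psi> t * f t)"
    and st: "0 < s" "s \<le> t" "t < T"
  shows "U t - U s = (LINT r|lebesgue_on {0<..<T}. indicator {s..t} r * f r)"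
proof -
  let ?I = "{0<..<T}"
  \<comment> \<open>Extension by 0 makes convolution on the whole line available. At an interior
    point small mollification radii see only values of \<open>U\<close>.\<close>
  define W where "W r = (if r \<in> ?I then U r else 0)" for r
  have W: "integrable lebesgue W"
  proof -
    have "integrable lborel (\<lambda>x. indicator {0..T} x *\<^sub>R U x)" by (rule borel_integrable_compact) (use U in auto)
    then have "integrable lebesgue (\<lambda>x. indicator {0..T} x *\<^sub>R U x)"
      using integrable_completion[of "\<lambda>x. indicator {0..T} x *\<^sub>R U x" lborel] by auto
    then have "integrable lebesgue (\<lambda>x. indicator ?I x *\<^sub>R (indicator {0..T} x *\<^sub>R U x))"
      by (rule integrable_mult_indicator[rotated]) simp
    moreover have "(\<lambda>x. indicator ?I x *\<^sub>R (indicator {0..T} x *\<^sub>R U x)) = W"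
      by (auto simp: W_def fun_eq_iff indicator_def)
    ultimately show ?thesis by simp
  qed
  \<comment> \<open>At most half the distance from \<open>{s..t}\<close> to the ends of
    \<open>(0, T)\<close>, so that the mollified indicators are supported inside.\<close>
  define \<delta> where "\<delta> n = min s (T - t) / 2 / real (Suc n)" for n
  have m0: "0 < min s (T - t) / 2" using st by simp
  have \<delta>: "0 < \<delta> n" "\<delta> n < s" "t + \<delta> n < T" for n
  proof -
    show "0 < \<delta> n" using m0 by (simp add: \<delta>_def)
    have "min s (T - t) / 2 / real (Suc n) \<le> min s (T - t) / 2 / 1"
      using m0 by (intro divide_left_mono) auto
    then have "\<delta> n \<le> min s (T - t) / 2" by (simp add: \<delta>_def)
    then show "\<delta> n < s" "t + \<delta> n < T" using st by auto
  qed
  have \<delta>0: "\<delta> \<longlonglongrightarrow> 0" unfolding \<delta>_def using LIMSEQ_Suc[OF lim_const_over_n[of "min s (T - t) / 2"]] by simp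
  define \<psi> where "\<psi> n = conv (mollifier (\<delta> n)) (indicator {s..t})" for n
  note \<psi> = mollified_interval[OF \<delta>(1,2) st(2) \<delta>(3), folded \<psi>_def]
  have lim: "(\<lambda>n. conv (mollifier (\<delta> n)) W x) \<longlonglongrightarrow> U x" if x: "0 < x" "x < T" for x
  proof (rule tendstoI)
    fix e :: real assume "0 < e"
    have "isCont U x" using U x by (simp add: continuous_on_interior)
    then obtain d where d: "0 < d" "\<And>y. dist y x < d \<Longrightarrow> dist (U y) (U x) < e / 2"
      using \<open>0 < e\<close> by (metis continuous_at_eps_delta half_gt_zero)
    define d' where "d' = min d (min x (T - x))"
    have "0 < d'" using d x by (simp add: d'_def)
    then have "\<forall>\<^sub>F n in sequentially. \<delta> n < d'" using \<delta>0 by (intro order_tendstoD)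
    then show "\<forall>\<^sub>F n in sequentially. dist (conv (mollifier (\<delta> n)) W x) (U x) < e"
    proof eventually_elim
      case (elim n)
      have "\<bar>conv (mollifier (\<delta> n)) W x - W x\<bar> \<le> e / 2"
      proof (rule conv_mollifier_close[OF \<delta>(1) W])
        fix y assume "dist y x < \<delta> n"
        then have "dist y x < d" "y \<in> ?I" using elim by (auto simp: d'_def dist_real_def)
        then show "\<bar>W y - W x\<bar> \<le> e / 2" using d(2)[of y] x by (simp add: W_def dist_real_def)
      qed
      then show ?case using x \<open>0 < e\<close> by (simp add: W_def dist_real_def)
    qed
  qed
  have lhs: "(LINT r|lebesgue_on ?I. deriv (\<psi> n) r * U r) = conv (mollifier (\<delta> n)) W s - conv (mollifier (\<delta> n)) W t" for n
  proof -
    have "(LINT r|lebesgue_on ?I. deriv (\<psi> n) r * U r) = (LINT r|lebesgue. (if r \<in> ?I then deriv (\<psi> n) r * U r else 0))"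
      by (rule Lebesgue_Measure.integral_restrict_UNIV[symmetric]) simp
    also have "\<dots> = (LINT r|lebesgue. mollifier (\<delta> n) (s - r) * W r - mollifier (\<delta> n) (t - r) * W r)"
      by (intro Bochner_Integration.integral_cong) (auto simp: W_def \<psi>(2) algebra_simps)
    also have "\<dots> = conv (mollifier (\<delta> n)) W s - conv (mollifier (\<delta> n)) W t"
      unfolding conv_def by (intro Bochner_Integration.integral_diff conv_integrable(1)[OF mollifier(1)[OF \<delta>(1)] W])
    finally show ?thesis .
  qed
  have "(\<lambda>n. - (LINT r|lebesgue_on ?I. \<psi> n r * f r)) \<longlonglongrightarrow> U s - U t"
  proof -
    have "(\<lambda>n. conv (mollifier (\<delta> n)) W s - conv (mollifier (\<delta> n)) W t) \<longlonglongrightarrow> U s - U t"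
      by (intro tendsto_intros lim) (use st in auto)
    then show ?thesis by (simp add: lhs[symmetric] weak[OF \<psi>(1)])
  qed
  moreover have "(\<lambda>n. - (LINT r|lebesgue_on ?I. \<psi> n r * f r)) \<longlonglongrightarrow> - (LINT r|lebesgue_on ?I. indicator {s..t} r * f r)"
  proof (rule tendsto_minus, rule integral_dominated_convergence[where w="\<lambda>r. norm (f r)"])
    have m: "indicator {s..t} \<in> borel_measurable (lebesgue_on ?I)"
      by (rule borel_measurable_indicator) (use st in \<open>auto simp: sets_restrict_space_iff\<close>)
    have fm: "f \<in> borel_measurable (lebesgue_on ?I)" using f by auto
    show "(\<lambda>r. indicator {s..t} r * f r) \<in> borel_measurable (lebesgue_on ?I)"
      by (rule borel_measurable_times[OF m fm])
    show "(\<lambda>r. \<psi> n r * f r) \<in> borel_measurable (lebesgue_on ?I)" for n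
      by (rule borel_measurable_times[OF measurable_restrict_space1[OF continuous_lebesgue_measurable[OF test_functions_continuous[OF \<psi>(1)]]] fm])
    show "integrable (lebesgue_on ?I) (\<lambda>r. norm (f r))" using f by simp
    show "AE r in lebesgue_on ?I. norm (\<psi> n r * f r) \<le> norm (f r)" for n
      using \<psi>(3)[of n] by (intro AE_I2) (simp add: abs_mult mult_left_le_one_le)
    \<comment> \<open>At \<open>s\<close> and \<open>t\<close> themselves the mollified indicators
      need not converge to the indicator; the two points form a null set.\<close>
    have "AE r in lebesgue. r \<notin> {s, t}"
      by (rule AE_not_in) (simp add: negligible_iff_null_sets[symmetric])
    then have "AE r in lebesgue_on ?I. r \<notin> {s, t}" by (subst AE_restrict_space_iff, simp) (erule eventually_mono, blast)
    then show "AE r in lebesgue_on ?I. (\<lambda>n. \<psi> n r * f r) \<longlonglongrightarrow> indicator {s..t} r * f r"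
    proof eventually_elim
      case (elim r)
      define d where "d = min \<bar>r - s\<bar> \<bar>r - t\<bar>"
      have "0 < d" using elim by (simp add: d_def)
      then have "\<forall>\<^sub>F n in sequentially. \<delta> n < d" using \<delta>0 by (intro order_tendstoD)
      then have "\<forall>\<^sub>F n in sequentially. indicator {s..t} r = \<psi> n r"
      proof eventually_elim
        case (elim n)
        have "\<delta> n < \<bar>r - s\<bar>" "\<delta> n < \<bar>r - t\<bar>" using elim by (auto simp: d_def)
        then consider "r + \<delta> n \<le> s" | "t + \<delta> n \<le> r" | "s + \<delta> n \<le> r" "r + \<delta> n \<le> t" by linarith
        then show ?case
        proof cases
          case 1 then show ?thesis using \<psi>(5)[of r n] \<delta>(1)[of n] by (simp add: indicator_def)
        next
          case 2 then show ?thesis using \<psi>(5)[of r n] \<delta>(1)[of n] by (simp add: indicator_def)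
        next
          case 3 then show ?thesis using \<psi>(4)[of n r] \<delta>(1)[of n] by (simp add: indicator_def)
        qed
      qed
      then have "(\<lambda>n. \<psi> n r) \<longlonglongrightarrow> indicator {s..t} r"
        by (rule Lim_transform_eventually[OF tendsto_const])
      then show ?case by (intro tendsto_intros)
    qed
  qed
  ultimately have "U s - U t = - (LINT r|lebesgue_on ?I. indicator {s..t} r * f r)"
    using LIMSEQ_unique by blast
  then show ?thesis by simp
qed

context bounded_open
begin

lemma H01_sq_int: "u \<in> H01 \<Omega> \<Longrightarrow> sq_int M u" "u \<in> H01 \<Omega> \<Longrightarrow> sq_int M (wgrad \<Omega> u)"
  using H01_grad_sq_int[OF H01_imp_H01_grad] by auto

lemma H01_zero: "(\<lambda>x. 0) \<in> H01 \<Omega>"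
  using H01_grad_imp_H01[OF H01_grad_test[OF test_functionsI[OF Ck_const compact_empty, of \<Omega> 0]]] by simp

lemma H01_diff: "u \<in> H01 \<Omega> \<Longrightarrow> v \<in> H01 \<Omega> \<Longrightarrow> (\<lambda>x. u x - v x) \<in> H01 \<Omega>"
  by (rule H01_grad_imp_H01[OF H01_grad_diff[OF H01_imp_H01_grad H01_imp_H01_grad]])

lemma H01_add: "u \<in> H01 \<Omega> \<Longrightarrow> v \<in> H01 \<Omega> \<Longrightarrow> (\<lambda>x. u x + v x) \<in> H01 \<Omega>"
  by (rule H01_grad_imp_H01[OF H01_grad_add[OF H01_imp_H01_grad H01_imp_H01_grad]])

lemma H01_scale: "u \<in> H01 \<Omega> \<Longrightarrow> (\<lambda>x. c * u x) \<in> H01 \<Omega>"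
  by (rule H01_grad_imp_H01[OF H01_grad_scale[OF H01_imp_H01_grad]])

lemma H1_norm_nonneg [simp]: "0 \<le> H1_norm \<Omega> u"
  by (simp add: H1_norm_def)

lemma H1_norm_H01_grad: "H01_grad u g \<Longrightarrow> H1_norm \<Omega> u = sqrt ((L2norm M u)\<^sup>2 + (L2norm M g)\<^sup>2)"
  by (rule H1_norm_eq[OF H01_grad_weak H01_grad_sq_int(2)])

lemma H1_norm_scale: "u \<in> H01 \<Omega> \<Longrightarrow> H1_norm \<Omega> (\<lambda>x. c * u x) = \<bar>c\<bar> * H1_norm \<Omega> u"
proof -
  assume "u \<in> H01 \<Omega>"
  then have u: "H01_grad u (wgrad \<Omega> u)" by (rule H01_imp_H01_grad)
  have "H1_norm \<Omega> (\<lambda>x. c * u x) = sqrt (c\<^sup>2 * ((L2norm M u)\<^sup>2 + (L2norm M (wgrad \<Omega> u))\<^sup>2))"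
    using H1_norm_H01_grad[OF H01_grad_scale[OF u, of c]] L2norm_scaleR[of M c u] L2norm_scaleR[of M c "wgrad \<Omega> u"]
    by (simp add: power_mult_distrib algebra_simps)
  then show ?thesis using H1_norm_H01_grad[OF u] by (simp add: real_sqrt_mult)
qed

lemma H1_norm_triangle:
  assumes "u \<in> H01 \<Omega>" "v \<in> H01 \<Omega>"
  shows "H1_norm \<Omega> (\<lambda>x. u x + v x) \<le> H1_norm \<Omega> u + H1_norm \<Omega> v"
proof -
  note u = H01_imp_H01_grad[OF assms(1)] and v = H01_imp_H01_grad[OF assms(2)]
  note s = H01_grad_sq_int[OF u] H01_grad_sq_int[OF v]
  have "H1_norm \<Omega> (\<lambda>x. u x + v x) = sqrt ((L2norm M (\<lambda>x. u x + v x))\<^sup>2 + (L2norm M (\<lambda>x. wgrad \<Omega> u x + wgrad \<Omega> v x))\<^sup>2)"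
    by (rule H1_norm_H01_grad[OF H01_grad_add[OF u v]])
  also have "\<dots> \<le> sqrt ((L2norm M u + L2norm M v)\<^sup>2 + (L2norm M (wgrad \<Omega> u) + L2norm M (wgrad \<Omega> v))\<^sup>2)"
    by (intro real_sqrt_le_mono add_mono power_mono L2norm_triangle s L2norm_nonneg)
  also have "\<dots> \<le> H1_norm \<Omega> u + H1_norm \<Omega> v"
    unfolding H1_norm_H01_grad[OF u] H1_norm_H01_grad[OF v] by (rule real_sqrt_sum_squares_triangle_ineq)
  finally show ?thesis .
qed

lemma H1_norm_minus_commute:
  assumes "u \<in> H01 \<Omega>" "v \<in> H01 \<Omega>"
  shows "H1_norm \<Omega> (\<lambda>x. u x - v x) = H1_norm \<Omega> (\<lambda>x. v x - u x)"
  using H1_norm_scale[OF H01_diff[OF assms], of "-1"] by simp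

lemma H1_norm_triangle3:
  assumes "u \<in> H01 \<Omega>" "v \<in> H01 \<Omega>" "w \<in> H01 \<Omega>"
  shows "H1_norm \<Omega> (\<lambda>x. u x - w x) \<le> H1_norm \<Omega> (\<lambda>x. u x - v x) + H1_norm \<Omega> (\<lambda>x. v x - w x)"
  using H1_norm_triangle[OF H01_diff[OF assms(1,2)] H01_diff[OF assms(2,3)]] by simp

lemma H1_norm_sum:
  assumes "finite S" "\<And>f. f \<in> S \<Longrightarrow> f \<in> H01 \<Omega>"
  shows "(\<lambda>x. \<Sum>f\<in>S. a f * f x) \<in> H01 \<Omega>" "H1_norm \<Omega> (\<lambda>x. \<Sum>f\<in>S. a f * f x) \<le> (\<Sum>f\<in>S. \<bar>a f\<bar> * H1_norm \<Omega> f)"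
proof -
  have "(\<lambda>x. \<Sum>f\<in>S. a f * f x) \<in> H01 \<Omega> \<and> H1_norm \<Omega> (\<lambda>x. \<Sum>f\<in>S. a f * f x) \<le> (\<Sum>f\<in>S. \<bar>a f\<bar> * H1_norm \<Omega> f)"
    using assms
  proof (induction S rule: finite_induct)
    case empty
    show ?case using H01_zero H1_norm_scale[OF H01_zero, of 0] by simp
  next
    case (insert f S)
    have *: "(\<lambda>x. a f * f x) \<in> H01 \<Omega>" "(\<lambda>x. \<Sum>f\<in>S. a f * f x) \<in> H01 \<Omega>"
      using insert H01_scale by auto
    have "H1_norm \<Omega> (\<lambda>x. a f * f x + (\<Sum>f\<in>S. a f * f x)) \<le> \<bar>a f\<bar> * H1_norm \<Omega> f + (\<Sum>f\<in>S. \<bar>a f\<bar> * H1_norm \<Omega> f)"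
      using H1_norm_triangle[OF *] H1_norm_scale[of f "a f"] insert by auto
    then show ?case using H01_add[OF *] insert by simp
  qed
  then show "(\<lambda>x. \<Sum>f\<in>S. a f * f x) \<in> H01 \<Omega>" "H1_norm \<Omega> (\<lambda>x. \<Sum>f\<in>S. a f * f x) \<le> (\<Sum>f\<in>S. \<bar>a f\<bar> * H1_norm \<Omega> f)"
    by auto
qed

lemma H1_norm_le: "H01_grad u g \<Longrightarrow> H1_norm \<Omega> u \<le> L2norm M u + L2norm M g"
  by (simp add: H1_norm_H01_grad sqrt_sum_squares_le_sum)

section \<open>Bounded functionals and distributional time derivatives\<close>

lemma Hm1_bound:
  assumes F: "F \<in> Hm1 \<Omega>" and u: "u \<in> H01 \<Omega>"
  shows "\<bar>F u\<bar> \<le> Hm1_norm \<Omega> F * H1_norm \<Omega> u"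
proof -
  obtain K where K: "\<And>u. u \<in> H01 \<Omega> \<Longrightarrow> \<bar>F u\<bar> \<le> K * H1_norm \<Omega> u"
    using F unfolding Hm1_def by blast
  show ?thesis
  \<comment> \<open>The supremum in \<open>Hm1_norm\<close> speaks about \<open>u\<close> after
    normalisation. An element of norm 0 cannot be normalised and is handled by the boundedness built
    into \<open>Hm1\<close>.\<close>
  proof (cases "H1_norm \<Omega> u = 0")
    case True
    then show ?thesis using K[OF u] by simp
  next
    case False
    then have N: "0 < H1_norm \<Omega> u" using H1_norm_nonneg[of u] by linarith
    define c where "c = 1 / H1_norm \<Omega> u"
    have c: "0 < c" using N by (simp add: c_def)
    have v: "(\<lambda>x. c * u x) \<in> H01 \<Omega>" "H1_norm \<Omega> (\<lambda>x. c * u x) = 1"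
      using H01_scale[OF u, of c] H1_norm_scale[OF u, of c] N by (simp_all only: c_def) simp
    have "\<bar>F (\<lambda>x. c * u x)\<bar> \<le> Hm1_norm \<Omega> F"
      unfolding Hm1_norm_def
    proof (rule cSUP_upper)
      show "(\<lambda>x. c * u x) \<in> {u \<in> H01 \<Omega>. H1_norm \<Omega> u \<le> 1}" using v by simp
      show "bdd_above ((\<lambda>u. \<bar>F u\<bar>) ` {u \<in> H01 \<Omega>. H1_norm \<Omega> u \<le> 1})"
      proof (rule bdd_aboveI2)
        fix w assume "w \<in> {u \<in> H01 \<Omega>. H1_norm \<Omega> u \<le> 1}"
        then have w: "w \<in> H01 \<Omega>" "H1_norm \<Omega> w \<le> 1" by auto
        have "K * H1_norm \<Omega> w \<le> \<bar>K\<bar> * 1" using w(2) by (intro mult_mono) auto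
        then show "\<bar>F w\<bar> \<le> \<bar>K\<bar>" using K[OF w(1)] by simp
      qed
    qed
    moreover have "F (\<lambda>x. c * u x) = c * F u" using F u by (auto simp: Hm1_def)
    ultimately have "c * \<bar>F u\<bar> \<le> Hm1_norm \<Omega> F" using c by (simp add: abs_mult)
    then show ?thesis using N by (simp add: c_def field_simps)
  qed
qed

lemma Hm1_diff:
  assumes "F \<in> Hm1 \<Omega>" "G \<in> Hm1 \<Omega>" shows "(\<lambda>u. F u - G u) \<in> Hm1 \<Omega>"
proof -
  obtain K where K: "\<And>u. u \<in> H01 \<Omega> \<Longrightarrow> \<bar>F u\<bar> \<le> K * H1_norm \<Omega> u"
    using assms(1) unfolding Hm1_def by blast
  obtain L where L: "\<And>u. u \<in> H01 \<Omega> \<Longrightarrow> \<bar>G u\<bar> \<le> L * H1_norm \<Omega> u"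
    using assms(2) unfolding Hm1_def by blast
  have "\<bar>F u - G u\<bar> \<le> (K + L) * H1_norm \<Omega> u" if "u \<in> H01 \<Omega>" for u
    using K[OF that] L[OF that] by (simp add: distrib_right)
  then show ?thesis using assms by (auto simp: Hm1_def right_diff_distrib)
qed

text \<open>Evaluation at \<open>\<phi>\<close> is continuous in the dual norm, so the approximating
  simple functions, evaluated at \<open>\<phi>\<close>, converge almost everywhere and give
  measurability. The majorant uses \<open>a \<le> 1 + a^2\<close> and the finiteness of the time
  interval.\<close>

lemma Hm1_bochner_integrable:
  assumes F: "F \<in> L2_bochner {0<..<T} (Hm1 \<Omega>) (Hm1_norm \<Omega>)" and \<phi>: "\<phi> \<in> H01 \<Omega>"
  shows "integrable (lebesgue_on {0<..<T}) (\<lambda>t. F t \<phi>)"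
proof -
  let ?I = "{0<..<T}"
  interpret I: finite_measure "lebesgue_on ?I" by (rule interval_lebesgue_finite)
  have I: "?I \<in> sets lebesgue" by simp
  obtain s where s: "\<And>k::nat. finite (s k ` ?I)" "\<And>k. s k ` ?I \<subseteq> Hm1 \<Omega>" "\<And>k f. {t \<in> ?I. s k t = f} \<in> sets lebesgue"
    and lim: "AE t in lebesgue_on ?I. F t \<in> Hm1 \<Omega> \<and> (\<lambda>k. Hm1_norm \<Omega> (\<lambda>x. s k t x - F t x)) \<longlonglongrightarrow> 0"
    using F unfolding L2_bochner_def bochner_measurable_def by blast
  have sp: "AE t in lebesgue_on ?I. t \<in> ?I" using AE_space[of "lebesgue_on ?I"] by simp
  have m: "(\<lambda>t. F t \<phi>) \<in> borel_measurable (lebesgue_on ?I)"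
  proof (rule measurable_AE_LIMSEQ[OF I])
    show "(\<lambda>t. s k t \<phi>) \<in> borel_measurable (lebesgue_on ?I)" for k
      by (rule simple_measurable[OF I s(1,3), of "\<lambda>f. f \<phi>"])
    show "AE t in lebesgue_on ?I. (\<lambda>k. s k t \<phi>) \<longlonglongrightarrow> F t \<phi>"
      using lim sp
    proof eventually_elim
      case (elim t)
      have "s k t \<in> Hm1 \<Omega>" for k using s(2)[of k] elim(2) by blast
      then have "\<bar>s k t \<phi> - F t \<phi>\<bar> \<le> Hm1_norm \<Omega> (\<lambda>x. s k t x - F t x) * H1_norm \<Omega> \<phi>" for k
        using elim by (intro Hm1_bound[OF Hm1_diff \<phi>]) auto
      moreover have "(\<lambda>k. Hm1_norm \<Omega> (\<lambda>x. s k t x - F t x) * H1_norm \<Omega> \<phi>) \<longlonglongrightarrow> 0 * H1_norm \<Omega> \<phi>"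
        using elim by (intro tendsto_intros) auto
      ultimately have "(\<lambda>k. s k t \<phi> - F t \<phi>) \<longlonglongrightarrow> 0"
        by (simp only: mult_zero_left real_norm_def[symmetric]) (rule Lim_null_comparison[OF always_eventually[OF allI]])
      then show ?case by (rule LIM_zero_cancel)
    qed
  qed
  show ?thesis
  proof (rule Bochner_Integration.integrable_bound[OF _ m])
    show "integrable (lebesgue_on ?I) (\<lambda>t. (1 + (Hm1_norm \<Omega> (F t))\<^sup>2) * H1_norm \<Omega> \<phi>)"
      using F by (simp add: L2_bochner_def)
    show "AE t in lebesgue_on ?I. norm (F t \<phi>) \<le> norm ((1 + (Hm1_norm \<Omega> (F t))\<^sup>2) * H1_norm \<Omega> \<phi>)"
      using lim
    proof eventually_elim
      case (elim t)
      have "a \<le> 1 + a\<^sup>2" for a :: real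
        using zero_le_power2[of "a - 1/2"] by (simp add: power2_diff field_simps)
      then have "Hm1_norm \<Omega> (F t) * H1_norm \<Omega> \<phi> \<le> (1 + (Hm1_norm \<Omega> (F t))\<^sup>2) * H1_norm \<Omega> \<phi>"
        by (intro mult_right_mono) auto
      then show ?case using Hm1_bound[of "F t" \<phi>] elim \<phi> by auto
    qed
  qed
qed

lemma C_L2_sq_int: "u \<in> C_L2 \<Omega> \<Longrightarrow> 0 \<le> t \<Longrightarrow> sq_int M (u t)"
  by (simp add: C_L2_def Lp2_iff)

lemma C_L2_tendsto: "u \<in> C_L2 \<Omega> \<Longrightarrow> 0 \<le> t \<Longrightarrow> ((\<lambda>s. L2norm M (\<lambda>x. u s x - u t x)) \<longlongrightarrow> 0) (at t within {0..})"
  by (simp add: C_L2_def Lp_norm2)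

text \<open>Pairing with a fixed \<open>\<phi>\<close> reduces everything to a scalar function of
  time, which is continuous by \<open>C_L2\<close> and whose distributional derivative is
  \<open>F r \<phi>\<close>.\<close>

lemma time_derivative_increment:
  assumes d: "has_time_deriv \<Omega> T u F" and u: "u \<in> C_L2 \<Omega>" and \<phi>: "\<phi> \<in> H01 \<Omega>" and st: "0 < s" "s \<le> t" "t < T"
  shows "(LINT x|M. (u t x - u s x) * \<phi> x) = (LINT r|lebesgue_on {0<..<T}. indicator {s..t} r * F r \<phi>)"
    "integrable (lebesgue_on {0<..<T}) (\<lambda>r. F r \<phi>)"
proof -
  define U where "U r = (LINT x|M. u r x * \<phi> x)" for r
  note s\<phi> = H01_sq_int(1)[OF \<phi>]
  note i = sq_int_mult_integrable[OF C_L2_sq_int[OF u] s\<phi>]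
  have "continuous_on {0..T} U"
    unfolding continuous_on
  proof
    fix r assume r: "r \<in> {0..T}"
    have l: "((\<lambda>s. L2norm M (\<lambda>x. u s x - u r x)) \<longlongrightarrow> 0) (at r within {0..T})"
      by (rule tendsto_within_subset[OF C_L2_tendsto[OF u]]) (use r in auto)
    show "(U \<longlongrightarrow> U r) (at r within {0..T})"
    proof (rule tendsto_dist_iff[THEN iffD2], rule Lim_null_comparison)
      have "\<forall>\<^sub>F s in at r within {0..T}. s \<in> {0..T}" by (simp add: eventually_at_filter)
      then show "\<forall>\<^sub>F s in at r within {0..T}. norm (dist (U s) (U r)) \<le> L2norm M (\<lambda>x. u s x - u r x) * L2norm M \<phi>"
      proof eventually_elim
        case (elim s)
        then have s: "0 \<le> s" "0 \<le> r" using r by auto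
        have "U s - U r = (LINT x|M. (u s x - u r x) \<bullet> \<phi> x)"
          using i[OF s(1)] i[OF s(2)] by (simp add: U_def left_diff_distrib)
        then show ?case
          using Cauchy_Schwarz_integral[OF sq_int_diff[OF C_L2_sq_int[OF u s(1)] C_L2_sq_int[OF u s(2)]] s\<phi>]
          by (simp add: dist_real_def)
      qed
      show "((\<lambda>s. L2norm M (\<lambda>x. u s x - u r x) * L2norm M \<phi>) \<longlongrightarrow> 0) (at r within {0..T})"
        using tendsto_mult_right[OF l, of "L2norm M \<phi>"] by simp
    qed
  qed
  moreover show int: "integrable (lebesgue_on {0<..<T}) (\<lambda>r. F r \<phi>)"
    by (rule Hm1_bochner_integrable[OF _ \<phi>]) (use d in \<open>simp add: has_time_deriv_def\<close>)
  ultimately have "U t - U s = (LINT r|lebesgue_on {0<..<T}. indicator {s..t} r * F r \<phi>)"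
    by (rule weak_time_derivative_increment[OF _ _ _ st]) (use d \<phi> in \<open>auto simp: has_time_deriv_def U_def\<close>)
  moreover have "U t - U s = (LINT x|M. (u t x - u s x) * \<phi> x)"
    using i[of t] i[of s] st by (simp add: U_def left_diff_distrib)
  ultimately show "(LINT x|M. (u t x - u s x) * \<phi> x) = (LINT r|lebesgue_on {0<..<T}. indicator {s..t} r * F r \<phi>)"
    by simp
qed

end

section \<open>Monotonicity from integrated increments\<close>

lemma lebesgue_integral_shift:
  fixes f :: "real \<Rightarrow> real"
  assumes "integrable lebesgue f"
  shows "(LINT t|lebesgue. f (t - h)) = (LINT t|lebesgue. f t)" "integrable lebesgue (\<lambda>t. f (t - h))"
proof -
  have "has_bochner_integral lebesgue f (LINT t|lebesgue. f t)" using assms by (rule has_bochner_integral_integrable)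
  then have "has_bochner_integral lebesgue (\<lambda>t. f (- h + 1 * t)) ((LINT t|lebesgue. f t) /\<^sub>R \<bar>1\<bar>)"
    by (subst (asm) has_bochner_integral_lebesgue_real_affine_iff[where c=1 and t="-h"]) auto
  then show "(LINT t|lebesgue. f (t - h)) = (LINT t|lebesgue. f t)" "integrable lebesgue (\<lambda>t. f (t - h))"
    by (auto simp: has_bochner_integral_iff)
qed

text \<open>Integrating \<open>f t - f (t - h)\<close> over \<open>{a..b}\<close> telescopes to the
  integral over the last window of length \<open>h\<close> before \<open>b\<close> minus the one
  over the window before \<open>a\<close>. Bounds of \<open>f\<close> on these windows are thus
  enough, and the inequality for the increments is needed almost everywhere only.\<close>

lemma integrated_difference_inequality:
  fixes f R :: "real \<Rightarrow> real"
  assumes h: "0 < h" "h \<le> b - a"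
    and f: "integrable lebesgue (\<lambda>t. indicator {a - h..b} t * f t)"
    and R: "integrable lebesgue (\<lambda>t. indicator {a..b} t * R t)"
    and le: "AE t in lebesgue. t \<in> {a..b} \<longrightarrow> f t - f (t - h) \<le> h * R t"
    and lo: "\<And>t. t \<in> {b - h..b} \<Longrightarrow> \<beta> \<le> f t" and up: "\<And>t. t \<in> {a - h..a} \<Longrightarrow> f t \<le> \<alpha>"
  shows "\<beta> - \<alpha> \<le> (LINT t|lebesgue. indicator {a..b} t * R t)"
proof -
  have sub: "integrable lebesgue (\<lambda>t. indicator J t * f t)" if "J \<in> sets lebesgue" "J \<subseteq> {a - h..b}" for J
  proof -
    have "integrable lebesgue (\<lambda>t. indicator J t *\<^sub>R (indicator {a - h..b} t * f t))"
      by (rule integrable_mult_indicator[OF that(1) f])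
    moreover have "(\<lambda>t. indicator J t *\<^sub>R (indicator {a - h..b} t * f t)) = (\<lambda>t. indicator J t * f t)"
      using that(2) by (auto simp: indicator_def fun_eq_iff)
    ultimately show ?thesis by simp
  qed
  have i1: "integrable lebesgue (\<lambda>t. indicator {a..b} t * f t)" by (rule sub) (use h in auto)
  have i2: "integrable lebesgue (\<lambda>t. indicator {a - h..b - h} t * f t)" by (rule sub) (use h in auto)
  have eq: "(\<lambda>t. indicator {a - h..b - h} (t - h) * f (t - h)) = (\<lambda>t. indicator {a..b} t * f (t - h))"
    by (auto simp: indicator_def fun_eq_iff)
  note sh = lebesgue_integral_shift[OF i2, of h, unfolded eq]
  have j1: "integrable lebesgue (\<lambda>t. indicator {b - h<..b} t * f t)" by (rule sub) (use h in auto)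
  have j2: "integrable lebesgue (\<lambda>t. indicator {a - h..<a} t * f t)" by (rule sub) (use h in auto)
  have ib: "integrable lebesgue (\<lambda>t. indicator {b - h<..b} t * \<beta>)" "integrable lebesgue (\<lambda>t. indicator {a - h..<a} t * \<alpha>)"
  proof -
    have "{b - h<..b} \<in> lmeasurable" "{a - h..<a} \<in> lmeasurable"
      by (auto intro!: bounded_set_imp_lmeasurable)
    then show "integrable lebesgue (\<lambda>t. indicator {b - h<..b} t * \<beta>)" "integrable lebesgue (\<lambda>t. indicator {a - h..<a} t * \<alpha>)"
      by (auto intro!: integrable_mult_left simp: lmeasurable_iff_integrable)
  qed
  have "h * \<beta> - h * \<alpha> = (LINT t|lebesgue. indicator {b - h<..b} t * \<beta>) - (LINT t|lebesgue. indicator {a - h..<a} t * \<alpha>)"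
    using h by simp
  also have "\<dots> \<le> (LINT t|lebesgue. indicator {b - h<..b} t * f t) - (LINT t|lebesgue. indicator {a - h..<a} t * f t)"
    by (intro diff_mono integral_mono ib j1 j2) (use lo up in \<open>auto simp: indicator_def\<close>)
  also have "\<dots> = (LINT t|lebesgue. indicator {a..b} t * f t) - (LINT t|lebesgue. indicator {a - h..b - h} t * f t)"
  proof -
    have "(LINT t|lebesgue. indicator {b - h<..b} t * f t) - (LINT t|lebesgue. indicator {a - h..<a} t * f t)
      = (LINT t|lebesgue. indicator {b - h<..b} t * f t - indicator {a - h..<a} t * f t)"
      using j1 j2 by simp
    \<comment> \<open>The windows are half open so that the indicators match at every point; that
      the overlap cancels uses \<open>h \<le> b - a\<close>.\<close>
    also have "\<dots> = (LINT t|lebesgue. indicator {a..b} t * f t - indicator {a - h..b - h} t * f t)"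
      by (intro Bochner_Integration.integral_cong) (use h in \<open>auto simp: indicator_def\<close>)
    also have "\<dots> = (LINT t|lebesgue. indicator {a..b} t * f t) - (LINT t|lebesgue. indicator {a - h..b - h} t * f t)"
      using i1 i2 by simp
    finally show ?thesis .
  qed
  also have "\<dots> = (LINT t|lebesgue. indicator {a..b} t * f t - indicator {a..b} t * f (t - h))"
    using i1 sh by simp
  also have "\<dots> \<le> (LINT t|lebesgue. h * (indicator {a..b} t * R t))"
    by (intro integral_mono_AE Bochner_Integration.integrable_diff i1 sh(2) integrable_mult_right R)
       (use le in \<open>auto elim!: eventually_mono simp: indicator_def\<close>)
  also have "\<dots> = h * (LINT t|lebesgue. indicator {a..b} t * R t)" by simp
  finally have "h * (\<beta> - \<alpha>) \<le> h * (LINT t|lebesgue. indicator {a..b} t * R t)" by (simp add: right_diff_distrib)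
  then show ?thesis using h by simp
qed

text \<open>Turns an estimate of the increments up to \<open>o(h)\<close>, valid for almost every
  time, into one for the values of \<open>E\<close>. The integral of \<open>G\<close> over
  \<open>{t - h..t}\<close> is itself the increment of the running integral \<open>\<Phi>\<close>,
  so it is absorbed by passing from \<open>E\<close> to \<open>f = E - \<Phi> / \<theta>\<close>;
  what remains is an increment bound of the form \<open>h * R t\<close>.\<close>

lemma increment_bound:
  fixes E B :: "real \<Rightarrow> real" and a b T C :: real
  assumes E: "continuous_on {0<..} E" and ab: "0 < a" "a < b" "b < T"
    and B: "integrable (lebesgue_on {0<..<T}) B" "\<And>t. 0 \<le> B t" and "0 \<le> C"
    and inc: "\<And>\<theta> \<eta>. 0 < \<theta> \<Longrightarrow> 0 < \<eta> \<Longrightarrow> \<exists>G \<delta>. (\<forall>t. 0 \<le> G t) \<and> integrable (lebesgue_on {0<..<T}) G \<and>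
      (LINT t|lebesgue_on {0<..<T}. G t) \<le> \<eta> \<and> 0 < \<delta> \<and>
      (\<forall>h. 0 < h \<and> h < \<delta> \<longrightarrow> (AE t in lebesgue. t \<in> {a..b} \<longrightarrow>
         E t - E (t - h) \<le> C * h + \<theta> * h * B t
           + (1 / \<theta>) * ((LINT r|lebesgue_on {0<..<T}. indicator {t - h..t} r * G r) + h * G t)))"
  shows "E b - E a \<le> C * (b - a)"
proof -
  let ?I = "{0<..<T}"
  define IB where "IB = (LINT t|lebesgue_on ?I. B t)"
  have IB: "0 \<le> IB" using B(2) by (simp add: IB_def)
  have restr: "integrable lebesgue (\<lambda>t. indicator {a..b} t * g t)"
    "(LINT t|lebesgue. indicator {a..b} t * g t) \<le> (LINT t|lebesgue_on ?I. g t)"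
    if g: "integrable (lebesgue_on ?I) g" "\<And>t. 0 \<le> g t" for g :: "real \<Rightarrow> real"
  proof -
    have *: "integrable lebesgue (\<lambda>t. if t \<in> ?I then g t else 0)"
      using g(1) by (subst Lebesgue_Measure.integrable_restrict_UNIV) auto
    have "integrable lebesgue (\<lambda>t. indicator {a..b} t *\<^sub>R (if t \<in> ?I then g t else 0))"
      by (rule integrable_mult_indicator[OF _ *]) simp
    moreover have "(\<lambda>t. indicator {a..b} t *\<^sub>R (if t \<in> ?I then g t else 0)) = (\<lambda>t. indicator {a..b} t * g t)"
      using ab by (auto simp: indicator_def fun_eq_iff)
    ultimately show i: "integrable lebesgue (\<lambda>t. indicator {a..b} t * g t)" by simp
    have "(LINT t|lebesgue. indicator {a..b} t * g t) \<le> (LINT t|lebesgue. (if t \<in> ?I then g t else 0))"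
      by (rule integral_mono[OF i *]) (use ab g(2) in \<open>auto simp: indicator_def\<close>)
    also have "\<dots> = (LINT t|lebesgue_on ?I. g t)" by (rule Lebesgue_Measure.integral_restrict_UNIV) simp
    finally show "(LINT t|lebesgue. indicator {a..b} t * g t) \<le> (LINT t|lebesgue_on ?I. g t)" .
  qed
  \<comment> \<open>Of the four \<open>\<theta>\<close>, two come from the continuity of
    \<open>E\<close> at the end points, one from \<open>\<Phi> t / \<theta>\<close> near
    \<open>b\<close>, and one from the integral of \<open>G t / \<theta>\<close>.\<close>
  have key: "E b - E a - C * (b - a) \<le> \<theta> * (IB + 4)" if \<theta>: "0 < \<theta>" for \<theta>
  proof -
    \<comment> \<open>The choice \<open>\<eta> = \<theta>^2\<close> keeps the integral of
      \<open>G\<close> of size \<open>\<theta>\<close> even after division by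
      \<open>\<theta>\<close>.\<close>
    have \<eta>: "0 < \<theta>\<^sup>2" using \<theta> by simp
    obtain G \<delta> where G: "\<And>t. 0 \<le> G t" "integrable (lebesgue_on ?I) G" "(LINT t|lebesgue_on ?I. G t) \<le> \<theta>\<^sup>2" "0 < \<delta>"
      and G': "\<And>h. 0 < h \<Longrightarrow> h < \<delta> \<Longrightarrow> AE t in lebesgue. t \<in> {a..b} \<longrightarrow>
         E t - E (t - h) \<le> C * h + \<theta> * h * B t
           + (1 / \<theta>) * ((LINT r|lebesgue_on ?I. indicator {t - h..t} r * G r) + h * G t)"
      using inc[OF \<theta> \<eta>] by blast
    define \<Phi> where "\<Phi> t = (LINT r|lebesgue_on ?I. indicator {..t} r * G r)" for t
    have iG: "integrable (lebesgue_on ?I) (\<lambda>r. indicator J r * G r)" if "J \<in> sets borel" for J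
    proof -
      have "integrable (lebesgue_on ?I) (\<lambda>r. indicator (J \<inter> ?I) r *\<^sub>R G r)"
        by (rule integrable_mult_indicator[OF _ G(2)]) (use that in \<open>auto simp: sets_restrict_space_iff\<close>)
      then show ?thesis
        by (rule Bochner_Integration.integrable_cong[THEN iffD1, rotated -1]) (auto simp: indicator_def)
    qed
    have \<Phi>0: "0 \<le> \<Phi> t" "\<Phi> t \<le> \<theta>\<^sup>2" for t
    proof -
      show "0 \<le> \<Phi> t" unfolding \<Phi>_def using G(1) by (intro Bochner_Integration.integral_nonneg) simp
      have "\<Phi> t \<le> (LINT r|lebesgue_on ?I. G r)"
        unfolding \<Phi>_def by (rule integral_mono[OF iG G(2)]) (use G(1) in \<open>auto simp: indicator_def\<close>)
      then show "\<Phi> t \<le> \<theta>\<^sup>2" using G(3) by simp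
    qed
    have \<Phi>mono: "\<Phi> s \<le> \<Phi> t" if "s \<le> t" for s t
      unfolding \<Phi>_def by (rule integral_mono[OF iG iG]) (use G(1) that in \<open>auto simp: indicator_def\<close>)
    have \<Phi>diff: "(LINT r|lebesgue_on ?I. indicator {t - h..t} r * G r) = \<Phi> t - \<Phi> (t - h)" if "0 < h" for t h
    proof -
      have "\<Phi> t - \<Phi> (t - h) = (LINT r|lebesgue_on ?I. indicator {..t} r * G r - indicator {..t - h} r * G r)"
        unfolding \<Phi>_def using iG[of "{..t}"] iG[of "{..t - h}"] by simp
      also have "\<dots> = (LINT r|lebesgue_on ?I. indicator {t - h..t} r * G r)"
      proof (rule integral_cong_AE)
        have "AE r in lebesgue. r \<notin> {t - h}"
          by (rule AE_not_in) (simp add: negligible_iff_null_sets[symmetric])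
        then have "AE r in lebesgue_on ?I. r \<notin> {t - h}" by (subst AE_restrict_space_iff, simp) (erule eventually_mono, blast)
        then show "AE r in lebesgue_on ?I. indicator {..t} r * G r - indicator {..t - h} r * G r = indicator {t - h..t} r * G r"
          by eventually_elim (use that in \<open>auto simp: indicator_def\<close>)
      qed (use iG[of "{..t}"] iG[of "{..t - h}"] iG[of "{t - h..t}"] in auto)
      finally show ?thesis by simp
    qed
    have cE: "isCont E x" if "0 < x" for x
      using E that by (simp add: continuous_on_eq_continuous_at)
    obtain d1 where d1: "0 < d1" "\<And>t. \<bar>t - a\<bar> < d1 \<Longrightarrow> \<bar>E t - E a\<bar> < \<theta>"
      using cE[OF ab(1)] \<theta> unfolding continuous_at_eps_delta dist_real_def by blast
    have "0 < b" using ab by simp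
    then obtain d2 where d2: "0 < d2" "\<And>t. \<bar>t - b\<bar> < d2 \<Longrightarrow> \<bar>E t - E b\<bar> < \<theta>"
      using cE[of b] \<theta> unfolding continuous_at_eps_delta dist_real_def by blast
    \<comment> \<open>Halving makes all comparisons strict; in particular \<open>h < a\<close> keeps
      \<open>a - h\<close> positive, where \<open>E\<close> is continuous.\<close>
    define h where "h = min (min \<delta> (min d1 d2)) (min a (b - a)) / 2"
    have h: "0 < h" "h < \<delta>" "h < d1" "h < d2" "h < a" "h \<le> b - a"
      using G(4) d1(1) d2(1) ab by (auto simp: h_def)
    define f where "f t = E t - \<Phi> t / \<theta>" for t
    define R where "R t = C + \<theta> * B t + G t / \<theta>" for t
    have "(E b - \<theta> - \<theta>) - (E a + \<theta>) \<le> (LINT t|lebesgue. indicator {a..b} t * R t)"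
    proof (rule integrated_difference_inequality[OF h(1,6)])
      show "integrable lebesgue (\<lambda>t. indicator {a - h..b} t * f t)"
      proof -
        have "integrable lborel (\<lambda>x. indicator {a - h..b} x *\<^sub>R E x)"
          by (rule borel_integrable_compact) (use E continuous_on_subset h in \<open>auto intro: continuous_on_subset\<close>)
        then have 1: "integrable lebesgue (\<lambda>x. indicator {a - h..b} x * E x)"
          using integrable_completion[of "\<lambda>x. indicator {a - h..b} x *\<^sub>R E x" lborel] by auto
        have "integrable (lebesgue_on {a - h..b}) \<Phi>"
          by (rule integrable_mono_on) (use \<Phi>mono in \<open>auto simp: mono_on_def\<close>)
        then have 2: "integrable lebesgue (\<lambda>x. indicator {a - h..b} x *\<^sub>R \<Phi> x)"
          by (subst (asm) integrable_restrict_space) auto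
        have "integrable lebesgue (\<lambda>x. indicator {a - h..b} x * E x - (indicator {a - h..b} x *\<^sub>R \<Phi> x) / \<theta>)"
          by (intro Bochner_Integration.integrable_diff 1 integrable_divide 2)
        then show ?thesis by (simp add: f_def algebra_simps)
      qed
      have iC: "integrable lebesgue (\<lambda>t. indicator {a..b} t * C)"
        using lmeasurable_iff_integrable[of "{a..b}"] by (auto intro!: integrable_mult_left)
      have "integrable lebesgue (\<lambda>t. indicator {a..b} t * C + \<theta> * (indicator {a..b} t * B t) + (indicator {a..b} t * G t) / \<theta>)"
        using iC restr(1)[OF B] restr(1)[OF G(2,1)] by simp
      then show "integrable lebesgue (\<lambda>t. indicator {a..b} t * R t)" by (simp add: R_def algebra_simps)
      show "AE t in lebesgue. t \<in> {a..b} \<longrightarrow> f t - f (t - h) \<le> h * R t"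
        using G'[OF h(1,2)]
      proof eventually_elim
        case (elim t)
        show ?case
        proof
          assume "t \<in> {a..b}"
          with elim have "E t - E (t - h) \<le> C * h + \<theta> * h * B t + (1 / \<theta>) * (\<Phi> t - \<Phi> (t - h) + h * G t)"
            unfolding \<Phi>diff[OF h(1)] by blast
          then show "f t - f (t - h) \<le> h * R t"
            by (simp add: f_def R_def algebra_simps add_divide_distrib diff_divide_distrib)
        qed
      qed
      show "E b - \<theta> - \<theta> \<le> f t" if "t \<in> {b - h..b}" for t
      proof -
        have "\<bar>E t - E b\<bar> < \<theta>" by (rule d2(2)) (use that h in auto)
        moreover have "\<Phi> t / \<theta> \<le> \<theta>" using \<Phi>0(2)[of t] \<theta> by (simp add: divide_le_eq power2_eq_square)
        ultimately show ?thesis by (simp add: f_def)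
      qed
      show "f t \<le> E a + \<theta>" if "t \<in> {a - h..a}" for t
      proof -
        have "\<bar>E t - E a\<bar> < \<theta>" by (rule d1(2)) (use that h in auto)
        moreover have "0 \<le> \<Phi> t / \<theta>" using \<Phi>0(1)[of t] \<theta> by simp
        ultimately show ?thesis by (simp add: f_def)
      qed
    qed
    also have "\<dots> = (LINT t|lebesgue. indicator {a..b} t * C + \<theta> * (indicator {a..b} t * B t) + (indicator {a..b} t * G t) / \<theta>)"
      by (intro Bochner_Integration.integral_cong) (auto simp: R_def algebra_simps)
    also have "\<dots> = C * (b - a) + \<theta> * (LINT t|lebesgue. indicator {a..b} t * B t) + (LINT t|lebesgue. indicator {a..b} t * G t) / \<theta>"
    proof -
      have "integrable lebesgue (\<lambda>t. indicator {a..b} t * C)"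
        using lmeasurable_iff_integrable[of "{a..b}"] by (auto intro!: integrable_mult_left)
      then show ?thesis using restr(1)[OF B] restr(1)[OF G(2,1)] ab by simp
    qed
    also have "\<dots> \<le> C * (b - a) + \<theta> * IB + \<theta>\<^sup>2 / \<theta>"
      using restr(2)[OF B] restr(2)[OF G(2,1)] G(3) \<theta> \<open>0 \<le> C\<close> unfolding IB_def
      by (intro add_mono mult_left_mono divide_right_mono) auto
    finally show ?thesis using \<theta> by (simp add: power2_eq_square algebra_simps)
  qed
  have "E b - E a - C * (b - a) \<le> 0"
  proof (rule field_le_epsilon)
    fix e :: real assume "0 < e"
    have "0 < e / (IB + 4)" using \<open>0 < e\<close> IB by simp
    from key[OF this] show "E b - E a - C * (b - a) \<le> 0 + e" using IB by simp
  qed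
  then show ?thesis by simp
qed

text \<open>Heine--Cantor for a pseudometric along a curve.\<close>

lemma pseudometric_uniformly_continuous:
  fixes \<rho> :: "real \<Rightarrow> real \<Rightarrow> real" and K :: "real set"
  assumes K: "compact K"
    and sym: "\<And>s t. s \<in> K \<Longrightarrow> t \<in> K \<Longrightarrow> \<rho> s t = \<rho> t s"
    and tri: "\<And>s t r. s \<in> K \<Longrightarrow> t \<in> K \<Longrightarrow> r \<in> K \<Longrightarrow> \<rho> s t \<le> \<rho> s r + \<rho> r t"
    and lim: "\<And>t. t \<in> K \<Longrightarrow> ((\<lambda>s. \<rho> s t) \<longlongrightarrow> 0) (at t within K)" and zero: "\<And>t. t \<in> K \<Longrightarrow> \<rho> t t = 0"
    and "0 < e"
  obtains \<delta> where "0 < \<delta>" "\<And>s t. s \<in> K \<Longrightarrow> t \<in> K \<Longrightarrow> \<bar>s - t\<bar> < \<delta> \<Longrightarrow> \<rho> s t < e"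
proof -
  have "\<exists>\<delta>>0. \<forall>s\<in>K. \<forall>t\<in>K. \<bar>s - t\<bar> < \<delta> \<longrightarrow> \<rho> s t < e"
  proof (rule ccontr)
    assume "\<not> ?thesis"
    then have "\<forall>n. \<exists>s t. s \<in> K \<and> t \<in> K \<and> \<bar>s - t\<bar> < 1 / real (Suc n) \<and> e \<le> \<rho> s t"
      by (metis not_less of_nat_0_less_iff zero_less_Suc zero_less_divide_1_iff)
    then obtain s t where st: "\<And>n. s n \<in> K" "\<And>n. t n \<in> K" "\<And>n. \<bar>s n - t n\<bar> < 1 / real (Suc n)" "\<And>n. e \<le> \<rho> (s n) (t n)"
      by metis
    obtain x r where x: "x \<in> K" "strict_mono (r :: nat \<Rightarrow> nat)" "(s \<circ> r) \<longlonglongrightarrow> x"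
      using K st(1) unfolding compact_def by metis
    have sx: "(\<lambda>n. s (r n)) \<longlonglongrightarrow> x" using x(3) by (simp add: o_def)
    have "(\<lambda>n. s n - t n) \<longlonglongrightarrow> 0"
    proof (rule Lim_null_comparison[OF always_eventually[OF allI] LIMSEQ_Suc[OF lim_1_over_n]])
      fix n show "norm (s n - t n) \<le> 1 / real (Suc n)" using st(3)[of n] by simp
    qed
    then have "(\<lambda>n. s (r n) - t (r n)) \<longlonglongrightarrow> 0" using LIMSEQ_subseq_LIMSEQ[OF _ x(2)] by (fastforce simp: o_def)
    from tendsto_diff[OF sx this] have tx: "(\<lambda>n. t (r n)) \<longlonglongrightarrow> x" by simp
    \<comment> \<open>The punctured limit \<open>lim\<close> says nothing about the point
      \<open>x\<close> itself, so indices with \<open>y n = x\<close> are covered by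
      \<open>zero\<close>.\<close>
    have c: "(\<lambda>n. \<rho> (y n) x) \<longlonglongrightarrow> 0" if "\<And>n. y n \<in> K" "y \<longlonglongrightarrow> x" for y
    proof (rule tendstoI)
      fix d :: real assume "0 < d"
      then have "\<forall>\<^sub>F s in at x within K. dist (\<rho> s x) 0 < d" using lim[OF x(1)] by (rule tendstoD[rotated])
      then have "\<forall>\<^sub>F s in nhds x. s \<noteq> x \<longrightarrow> s \<in> K \<longrightarrow> dist (\<rho> s x) 0 < d" by (simp add: eventually_at_filter)
      then have "\<forall>\<^sub>F n in sequentially. y n \<noteq> x \<longrightarrow> y n \<in> K \<longrightarrow> dist (\<rho> (y n) x) 0 < d"
        using that(2) by (rule eventually_compose_filterlim)
      then show "\<forall>\<^sub>F n in sequentially. dist (\<rho> (y n) x) 0 < d"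
      proof eventually_elim
        case (elim n)
        then show ?case using that(1)[of n] zero[OF x(1)] \<open>0 < d\<close> by (cases "y n = x") auto
      qed
    qed
    have "(\<lambda>n. \<rho> (s (r n)) x + \<rho> (t (r n)) x) \<longlonglongrightarrow> 0 + 0"
      by (intro tendsto_add c sx tx st)
    then have "\<forall>\<^sub>F n in sequentially. \<rho> (s (r n)) x + \<rho> (t (r n)) x < e" using \<open>0 < e\<close> by (intro order_tendstoD) auto
    then obtain n where "\<rho> (s (r n)) x + \<rho> (t (r n)) x < e" using eventually_happens'[OF sequentially_bot] by blast
    then show False
      using st(4)[of "r n"] tri[OF st(1)[of "r n"] st(2)[of "r n"] x(1)] sym[OF x(1) st(2)[of "r n"]] by linarith
  qed
  then show ?thesis using that by blast
qed

section \<open>Truncation in space and continuous approximation in time\<close>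

lemma L2norm_bounded_mult_small:
  fixes G :: "'a \<Rightarrow> 'b::euclidean_space"
  assumes G: "sq_int M G" and e: "0 < e" and K: "0 \<le> K"
  obtains m where "0 \<le> m" "\<And>f. f \<in> borel_measurable M \<Longrightarrow> sq_int M f \<Longrightarrow> AE x in M. \<bar>f x\<bar> \<le> K \<Longrightarrow>
    L2norm M (\<lambda>x. f x *\<^sub>R G x) \<le> m * L2norm M (f :: 'a \<Rightarrow> real) + e"
proof -
  have Gm: "G \<in> borel_measurable M" using G by (simp add: sq_int_def)
  \<comment> \<open>Truncation at height \<open>n\<close>: the bounded part costs
    \<open>real n * L2norm M f\<close>, while the tail is small in L2 and only meets the bound
    \<open>K\<close> of \<open>f\<close>. In this way multiplication by a merely square integrable
    field is continuous in the L2 norm on functions bounded by \<open>K\<close>.\<close>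
  define H where "H n x = (if norm (G x) \<le> real n then G x else 0)" for n :: nat and x
  have Hm: "H n \<in> borel_measurable M" for n
    unfolding H_def[abs_def] using Gm by (intro measurable_If) auto
  have "(\<lambda>n. L2norm M (\<lambda>x. H n x - G x)) \<longlonglongrightarrow> 0"
  proof (rule L2_dominated_convergence[OF Hm Gm sq_int_integrable[OF G]])
    show "AE x in M. (norm (H n x - G x))\<^sup>2 \<le> (norm (G x))\<^sup>2" for n by (simp add: H_def)
    show "AE x in M. (\<lambda>n. H n x) \<longlonglongrightarrow> G x"
    proof (rule AE_I2)
      fix x
      obtain n0 :: nat where "norm (G x) \<le> real n0" using real_arch_simple by blast
      then have "\<forall>n\<ge>n0. H n x = G x" by (auto simp: H_def)
      then show "(\<lambda>n. H n x) \<longlonglongrightarrow> G x" by (intro tendsto_eventually) (auto simp: eventually_sequentially)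
    qed
  qed
  moreover have "0 < e / (K + 1)" using e K by simp
  ultimately have "\<forall>\<^sub>F n in sequentially. L2norm M (\<lambda>x. H n x - G x) < e / (K + 1)" by (intro order_tendstoD)
  then obtain n where n: "L2norm M (\<lambda>x. H n x - G x) < e / (K + 1)" using eventually_happens'[OF sequentially_bot] by blast
  show ?thesis
  proof (rule that[of "real n"])
    fix f :: "'a \<Rightarrow> real" assume f: "f \<in> borel_measurable M" "sq_int M f" "AE x in M. \<bar>f x\<bar> \<le> K"
    have HG: "sq_int M (H n)" by (rule sq_int_mono[OF Hm G, of _ 1]) (simp add: H_def)
    have bH: "AE x in M. norm (H n x) \<le> real n" by (simp add: H_def)
    note 1 = L2norm_bounded_mult_right[OF f(2) Hm bH of_nat_0_le_iff]
    note 2 = L2norm_bounded_mult[OF sq_int_diff[OF HG G] f(1,3) K]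
    have "L2norm M (\<lambda>x. f x *\<^sub>R G x) = L2norm M (\<lambda>x. f x *\<^sub>R H n x - f x *\<^sub>R (H n x - G x))"
      by (simp add: scaleR_diff_right)
    also have "\<dots> \<le> L2norm M (\<lambda>x. f x *\<^sub>R H n x) + L2norm M (\<lambda>x. f x *\<^sub>R (H n x - G x))"
      by (rule L2norm_triangle_diff[OF 1(1) 2(1)])
    also have "\<dots> \<le> real n * L2norm M f + K * L2norm M (\<lambda>x. H n x - G x)" using 1(2) 2(2) by linarith
    also have "K * L2norm M (\<lambda>x. H n x - G x) \<le> (K + 1) * (e / (K + 1))"
      using n K e by (intro mult_mono) auto
    also have "\<dots> = e" using K by simp
    finally show "L2norm M (\<lambda>x. f x *\<^sub>R G x) \<le> real n * L2norm M f + e" by simp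
  qed simp
qed

text \<open>Density of continuous functions of time in the Bochner space. A simple approximant, set
  to 0 where it is poor, is a finite sum of indicators of time sets times elements of
  \<open>H01\<close>; replacing the indicators by continuous functions with values in
  \<open>[0, 1]\<close> gives \<open>c\<close>. The result provides a measurable majorant
  \<open>d\<close> of the distance, sparing any discussion of the measurability of the distance
  itself.\<close>

lemma (in bounded_open) L2_bochner_continuous_approx:
  assumes u: "u \<in> L2_bochner {0<..<T} (H01 \<Omega>) (H1_norm \<Omega>)" and \<eta>: "0 < \<eta>"
  obtains c d where "\<And>t. c t \<in> H01 \<Omega>"
    "\<And>e. 0 < e \<Longrightarrow> \<exists>\<delta>>0. \<forall>s\<in>{0..T}. \<forall>t\<in>{0..T}. \<bar>s - t\<bar> < \<delta> \<longrightarrow> H1_norm \<Omega> (\<lambda>x. c s x - c t x) < e"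
    "\<And>t. 0 \<le> d t" "integrable (lebesgue_on {0<..<T}) (\<lambda>t. (d t)\<^sup>2)"
    "(LINT t|lebesgue_on {0<..<T}. (d t)\<^sup>2) \<le> \<eta>"
    "AE t in lebesgue_on {0<..<T}. u t \<in> H01 \<Omega> \<and> H1_norm \<Omega> (\<lambda>x. u t x - c t x) \<le> d t"
proof -
  let ?I = "{0<..<T}"
  let ?N = "H1_norm \<Omega>"
  interpret I: finite_measure "lebesgue_on ?I" by (rule interval_lebesgue_finite)
  have I: "?I \<in> sets lebesgue" by simp
  obtain s where s: "\<And>k::nat. finite (s k ` ?I)" "\<And>k. s k ` ?I \<subseteq> H01 \<Omega>" "\<And>k f. {t \<in> ?I. s k t = f} \<in> sets lebesgue"
    and lim: "AE t in lebesgue_on ?I. u t \<in> H01 \<Omega> \<and> (\<lambda>k. ?N (\<lambda>x. s k t x - u t x)) \<longlonglongrightarrow> 0"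
    using u unfolding L2_bochner_def bochner_measurable_def by blast
  have iN: "integrable (lebesgue_on ?I) (\<lambda>t. (?N (u t))\<^sup>2)" using u by (simp add: L2_bochner_def)
  have sp: "AE t in lebesgue_on ?I. t \<in> ?I" using AE_space[of "lebesgue_on ?I"] by simp
  have good: "AE t in lebesgue_on ?I. t \<in> ?I \<and> (\<forall>k. s k t \<in> H01 \<Omega>) \<and> u t \<in> H01 \<Omega> \<and> (\<lambda>k. ?N (\<lambda>x. s k t x - u t x)) \<longlonglongrightarrow> 0"
    using sp lim
  proof eventually_elim
    case (elim t)
    have "s k t \<in> H01 \<Omega>" for k using s(2)[of k] elim(1) by blast
    then show ?case using elim by blast
  qed
  define e where "e k t = ?N (\<lambda>x. s k t x - u t x)" for k t
  \<comment> \<open>Distances between two simple functions take finitely many values and are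
    measurable; \<open>e k\<close> is their limit as the second index tends to infinity.\<close>
  have em: "e k \<in> borel_measurable (lebesgue_on ?I)" for k
  proof (rule measurable_AE_LIMSEQ[OF I])
    show "(\<lambda>t. ?N (\<lambda>x. s k t x - s j t x)) \<in> borel_measurable (lebesgue_on ?I)" for j
      by (rule simple_measurable2[OF I s(1,3) s(1,3), of "\<lambda>f g. ?N (\<lambda>x. f x - g x)"])
    show "AE t in lebesgue_on ?I. (\<lambda>j. ?N (\<lambda>x. s k t x - s j t x)) \<longlonglongrightarrow> e k t"
      using good
    proof eventually_elim
      case (elim t)
      then have H: "\<And>j. s j t \<in> H01 \<Omega>" "u t \<in> H01 \<Omega>" and l: "(\<lambda>j. ?N (\<lambda>x. s j t x - u t x)) \<longlonglongrightarrow> 0" by auto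
      show ?case
      proof (rule tendsto_dist_iff[THEN iffD2], rule Lim_null_comparison[OF always_eventually[OF allI] l])
        fix j
        show "norm (dist (?N (\<lambda>x. s k t x - s j t x)) (e k t)) \<le> ?N (\<lambda>x. s j t x - u t x)"
          using H1_norm_triangle3[OF H(1)[of k] H(2) H(1)[of j]] H1_norm_triangle3[OF H(1)[of k] H(1)[of j] H(2)]
            H1_norm_minus_commute[OF H(2) H(1)[of j]]
          by (simp add: e_def dist_real_def)
      qed
    qed
  qed
  have Nm: "(\<lambda>t. ?N (u t)) \<in> borel_measurable (lebesgue_on ?I)"
  proof -
    have "(\<lambda>t. sqrt ((?N (u t))\<^sup>2)) \<in> borel_measurable (lebesgue_on ?I)"
      by (rule measurable_compose[OF borel_measurable_integrable[OF iN]])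
         (intro borel_measurable_continuous_onI continuous_intros)
    then show ?thesis by simp
  qed
  \<comment> \<open>The distance after \<open>s k t\<close> has been replaced by 0 wherever it is
    off by more than 1. Convergence almost everywhere alone would not supply a majorant; the
    replacement does, namely \<open>2 + 2 * (?N (u t))^2\<close>.\<close>
  define e' where "e' k t = (if e k t \<le> 1 then e k t else ?N (u t))" for k t
  have e'm: "e' k \<in> borel_measurable (lebesgue_on ?I)" for k
    unfolding e'_def[abs_def] by (intro measurable_If em Nm borel_measurable_le borel_measurable_const)
  have e0: "0 \<le> e k t" for k t by (simp add: e_def)
  have e'0: "0 \<le> e' k t" for k t by (simp add: e'_def e0)
  have e'le: "(e' k t)\<^sup>2 \<le> 2 + 2 * (?N (u t))\<^sup>2" for k t
  proof (cases "e k t \<le> 1")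
    case True
    then have "(e k t)\<^sup>2 \<le> 1" using e0[of k t] by (simp add: power_le_one)
    moreover have "0 \<le> (?N (u t))\<^sup>2" by simp
    ultimately have "(e k t)\<^sup>2 \<le> 2 + 2 * (?N (u t))\<^sup>2" by linarith
    then show ?thesis using True by (simp add: e'_def)
  qed (simp add: e'_def)
  have e'i: "integrable (lebesgue_on ?I) (\<lambda>t. (e' k t)\<^sup>2)" for k
    by (rule Bochner_Integration.integrable_bound[of _ "\<lambda>t. 2 + 2 * (?N (u t))\<^sup>2"])
       (use iN e'm[of k] e'le in auto)
  have "(\<lambda>k. LINT t|lebesgue_on ?I. (e' k t)\<^sup>2) \<longlonglongrightarrow> (LINT t|lebesgue_on ?I. 0)"
  proof (rule integral_dominated_convergence[where w="\<lambda>t. 2 + 2 * (?N (u t))\<^sup>2"])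
    show "integrable (lebesgue_on ?I) (\<lambda>t. 2 + 2 * (?N (u t))\<^sup>2)" using iN by simp
    show "AE t in lebesgue_on ?I. norm ((e' k t)\<^sup>2) \<le> 2 + 2 * (?N (u t))\<^sup>2" for k using e'le by simp
    show "(\<lambda>t. (e' k t)\<^sup>2) \<in> borel_measurable (lebesgue_on ?I)" for k using e'm[of k] by simp
    show "AE t in lebesgue_on ?I. (\<lambda>k. (e' k t)\<^sup>2) \<longlonglongrightarrow> 0"
      using good
    proof eventually_elim
      case (elim t)
      then have l: "(\<lambda>k. e k t) \<longlonglongrightarrow> 0" by (simp add: e_def)
      then have "\<forall>\<^sub>F k in sequentially. e k t < 1" by (intro order_tendstoD) auto
      then have "\<forall>\<^sub>F k in sequentially. e k t = e' k t" by eventually_elim (simp add: e'_def)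
      with l have "(\<lambda>k. e' k t) \<longlonglongrightarrow> 0" by (rule Lim_transform_eventually)
      from tendsto_power[OF this, of 2] show ?case by simp
    qed
  qed simp
  then have "\<forall>\<^sub>F k in sequentially. (LINT t|lebesgue_on ?I. (e' k t)\<^sup>2) < \<eta> / 4"
    using \<eta> by (intro order_tendstoD) auto
  then obtain k where k: "(LINT t|lebesgue_on ?I. (e' k t)\<^sup>2) < \<eta> / 4"
    using eventually_happens'[OF sequentially_bot] by blast
  define S where "S = s k ` ?I"
  have S: "finite S" "\<And>f. f \<in> S \<Longrightarrow> f \<in> H01 \<Omega>" using s(1,2) by (auto simp: S_def)
  define E where "E f = {t \<in> ?I. s k t = f \<and> e k t \<le> 1}" for f
  have E: "E f \<in> sets lebesgue" "E f \<subseteq> ?I" for f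
  proof -
    have "{t \<in> space (lebesgue_on ?I). e k t \<le> 1} \<in> sets (lebesgue_on ?I)"
      by (rule borel_measurable_le) (use em in auto)
    then have "{t \<in> ?I. e k t \<le> 1} \<in> sets lebesgue" by (simp add: sets_restrict_space_iff)
    moreover have "E f = {t \<in> ?I. s k t = f} \<inter> {t \<in> ?I. e k t \<le> 1}" by (auto simp: E_def)
    ultimately show "E f \<in> sets lebesgue" using s(3) by auto
  qed (auto simp: E_def)
  define P where "P = (\<Sum>f\<in>S. ?N f)"
  have P: "0 \<le> P" by (simp add: P_def sum_nonneg)
  \<comment> \<open>The budget: the square of \<open>d\<close> is at most twice the sum of the two
    squares, whose integrals are below \<open>\<eta> / 4\<close> and at most
    \<open>P^2 * \<epsilon> \<le> \<eta> / 4\<close>. Adding 1 to \<open>P^2\<close> avoids division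
    by 0.\<close>
  define \<epsilon> where "\<epsilon> = \<eta> / (4 * (1 + P\<^sup>2))"
  have P2: "0 < 1 + P\<^sup>2" by (simp add: add_pos_nonneg)
  have \<epsilon>: "0 < \<epsilon>" "2 * (P\<^sup>2 * \<epsilon>) \<le> \<eta> / 2"
    using \<eta> P2 by (auto simp: \<epsilon>_def field_simps)
  define Q where "Q f g \<longleftrightarrow> continuous_on UNIV g \<and> (\<forall>t. 0 \<le> g t) \<and> (\<forall>t. g t \<le> 1) \<and>
      integrable (lebesgue_on ?I) (\<lambda>t. \<bar>indicator (E f) t - g t\<bar>) \<and> (LINT t|lebesgue_on ?I. \<bar>indicator (E f) t - g t\<bar>) \<le> \<epsilon>" for f g
  have "\<forall>f. \<exists>g. Q f g"
  proof
    fix f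
    have Em: "(indicator (E f) :: real \<Rightarrow> real) \<in> borel_measurable lebesgue" using E(1) by simp
    obtain h L where h: "continuous_on UNIV h" "compact L" "\<And>x. x \<notin> L \<Longrightarrow> h x = 0"
      "(LINT t|lebesgue. \<bar>indicator (E f) t - h t\<bar>) < \<epsilon>"
    proof (rule continuous_approx_L1[OF Em _ compact_Icc[of 0 T] _ \<epsilon>(1), of 1])
      show "AE x in lebesgue. \<bar>indicat_real (E f) x\<bar> \<le> 1" by (simp add: indicator_def)
      show "indicat_real (E f) x = 0" if "x \<notin> {0..T}" for x using E(2)[of f] that by (force simp: indicator_def)
    qed blast
    define g where "g t = max 0 (min 1 (h t))" for t
    have cg: "continuous_on UNIV g" unfolding g_def by (intro continuous_intros continuous_on_max continuous_on_min h)
    have gL: "g x = 0" if "x \<notin> L" for x using h(3)[OF that] by (simp add: g_def)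
    have Ei: "integrable lebesgue (indicator (E f) :: real \<Rightarrow> real)"
      by (rule bounded_support_integrable[OF Em, of 1 "{0..T}"]) (use E(2)[of f] in \<open>auto simp: indicator_def\<close>)
    have i1: "integrable lebesgue (\<lambda>t. \<bar>indicator (E f) t - g t\<bar>)"
      using Ei compactly_supported_integrable(2)[OF cg h(2) gL] by simp
    have i2: "integrable lebesgue (\<lambda>t. \<bar>indicator (E f) t - h t\<bar>)"
      using Ei compactly_supported_integrable(2)[OF h(1-3)] by simp
    have 1: "(LINT t|lebesgue. \<bar>indicator (E f) t - g t\<bar>) \<le> \<epsilon>"
    proof -
      have "(LINT t|lebesgue. \<bar>indicator (E f) t - g t\<bar>) \<le> (LINT t|lebesgue. \<bar>indicator (E f) t - h t\<bar>)"
        by (rule integral_mono[OF i1 i2]) (auto simp: g_def indicator_def)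
      then show ?thesis using h(4) by simp
    qed
    have i3: "integrable lebesgue (\<lambda>t. if t \<in> ?I then \<bar>indicator (E f) t - g t\<bar> else 0)"
    proof -
      have "(\<lambda>t. if t \<in> ?I then \<bar>indicator (E f) t - g t\<bar> else 0) = (\<lambda>t. indicator ?I t *\<^sub>R \<bar>indicator (E f) t - g t\<bar>)"
        by (auto simp: indicator_def fun_eq_iff)
      then show ?thesis using integrable_mult_indicator[OF I i1] by simp
    qed
    then have 2: "integrable (lebesgue_on ?I) (\<lambda>t. \<bar>indicator (E f) t - g t\<bar>)"
      by (subst (asm) Lebesgue_Measure.integrable_restrict_UNIV) auto
    have "(LINT t|lebesgue. (if t \<in> ?I then \<bar>indicator (E f) t - g t\<bar> else 0)) \<le> (LINT t|lebesgue. \<bar>indicator (E f) t - g t\<bar>)"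
      by (rule integral_mono[OF i3 i1]) auto
    moreover have "(LINT t|lebesgue. (if t \<in> ?I then \<bar>indicator (E f) t - g t\<bar> else 0)) = (LINT t|lebesgue_on ?I. \<bar>indicator (E f) t - g t\<bar>)"
      by (rule Lebesgue_Measure.integral_restrict_UNIV) simp
    ultimately have 3: "(LINT t|lebesgue_on ?I. \<bar>indicator (E f) t - g t\<bar>) \<le> \<epsilon>"
      using 1 by simp
    have "Q f g" unfolding Q_def using cg 2 3 by (auto simp: g_def)
    then show "\<exists>g. Q f g" by blast
  qed
  from choice[OF this] obtain g where Q: "\<And>f. Q f (g f)" by blast
  have g: "\<And>f. continuous_on UNIV (g f)" "\<And>f t. 0 \<le> g f t" "\<And>f t. g f t \<le> 1"
    "\<And>f. integrable (lebesgue_on ?I) (\<lambda>t. \<bar>indicator (E f) t - g f t\<bar>)"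
    "\<And>f. (LINT t|lebesgue_on ?I. \<bar>indicator (E f) t - g f t\<bar>) \<le> \<epsilon>"
    using Q by (simp_all add: Q_def)
  \<comment> \<open>Bounds the price of replacing indicators by continuous functions. The uniform
    bound \<open>A t \<le> P\<close> turns L1 smallness into L2 smallness.\<close>
  define A where "A t = (\<Sum>f\<in>S. \<bar>indicator (E f) t - g f t\<bar> * ?N f)" for t
  have A0: "0 \<le> A t" for t by (simp add: A_def sum_nonneg)
  have AP: "A t \<le> P" for t
    unfolding A_def P_def
  proof (rule sum_mono)
    fix f
    have "\<bar>indicator (E f) t - g f t\<bar> \<le> 1" using g(2,3)[of f t] by (auto simp: indicator_def)
    then show "\<bar>indicator (E f) t - g f t\<bar> * ?N f \<le> ?N f" by (simp add: mult_left_le_one_le)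
  qed
  have Ai: "integrable (lebesgue_on ?I) A"
    unfolding A_def[abs_def] by (intro Bochner_Integration.integrable_sum integrable_mult_left g(4))
  have LA: "(LINT t|lebesgue_on ?I. A t) \<le> P * \<epsilon>"
  proof -
    have "(LINT t|lebesgue_on ?I. A t) = (\<Sum>f\<in>S. (LINT t|lebesgue_on ?I. \<bar>indicator (E f) t - g f t\<bar>) * ?N f)"
      unfolding A_def using g(4) by (simp add: Bochner_Integration.integral_sum)
    also have "\<dots> \<le> (\<Sum>f\<in>S. \<epsilon> * ?N f)" by (intro sum_mono mult_right_mono g(5)) simp
    also have "\<dots> = P * \<epsilon>" by (simp add: P_def sum_distrib_left[symmetric] mult.commute)
    finally show ?thesis .
  qed
  have A2: "(A t)\<^sup>2 \<le> P * A t" for t using AP[of t] A0[of t] by (simp add: power2_eq_square mult_right_mono)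
  have A2i: "integrable (lebesgue_on ?I) (\<lambda>t. (A t)\<^sup>2)"
    by (rule Bochner_Integration.integrable_bound[of _ "\<lambda>t. P * A t"]) (use Ai A2 in \<open>auto simp: P A0\<close>)
  have LA2: "(LINT t|lebesgue_on ?I. (A t)\<^sup>2) \<le> P\<^sup>2 * \<epsilon>"
  proof -
    have "(LINT t|lebesgue_on ?I. (A t)\<^sup>2) \<le> (LINT t|lebesgue_on ?I. P * A t)"
      by (rule integral_mono[OF A2i _ A2]) (use Ai in auto)
    also have "\<dots> = P * (LINT t|lebesgue_on ?I. A t)" by simp
    also have "\<dots> \<le> P * (P * \<epsilon>)" using LA P by (intro mult_left_mono) auto
    finally show ?thesis by (simp add: power2_eq_square)
  qed
  define d where "d t = e' k t + A t" for t
  have d2: "(d t)\<^sup>2 \<le> 2 * (e' k t)\<^sup>2 + 2 * (A t)\<^sup>2" for t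
    using sum_squares_bound[of "e' k t" "A t"] by (simp add: d_def power2_sum)
  have dm: "d \<in> borel_measurable (lebesgue_on ?I)" unfolding d_def[abs_def] using e'm[of k] Ai by auto
  have di: "integrable (lebesgue_on ?I) (\<lambda>t. (d t)\<^sup>2)"
    by (rule Bochner_Integration.integrable_bound[of _ "\<lambda>t. 2 * (e' k t)\<^sup>2 + 2 * (A t)\<^sup>2"])
       (use e'i[of k] A2i dm d2 in auto)
  have Ld: "(LINT t|lebesgue_on ?I. (d t)\<^sup>2) \<le> \<eta>"
  proof -
    have "(LINT t|lebesgue_on ?I. (d t)\<^sup>2) \<le> (LINT t|lebesgue_on ?I. 2 * (e' k t)\<^sup>2 + 2 * (A t)\<^sup>2)"
      by (rule integral_mono[OF di _ d2]) (use e'i[of k] A2i in auto)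
    also have "\<dots> = 2 * (LINT t|lebesgue_on ?I. (e' k t)\<^sup>2) + 2 * (LINT t|lebesgue_on ?I. (A t)\<^sup>2)"
      using e'i[of k] A2i by simp
    also have "\<dots> \<le> \<eta>" using k LA2 \<epsilon>(2) by linarith
    finally show ?thesis .
  qed
  define c where "c t = (\<lambda>x. \<Sum>f\<in>S. g f t * f x)" for t
  show ?thesis
  proof (rule that[of c d])
    show "c t \<in> H01 \<Omega>" for t unfolding c_def by (rule H1_norm_sum(1)[OF S])
    show "0 \<le> d t" for t using e'0[of k t] A0[of t] by (simp add: d_def)
    show "integrable (lebesgue_on ?I) (\<lambda>t. (d t)\<^sup>2)" "(LINT t|lebesgue_on ?I. (d t)\<^sup>2) \<le> \<eta>" by fact+
    show "AE t in lebesgue_on ?I. u t \<in> H01 \<Omega> \<and> ?N (\<lambda>x. u t x - c t x) \<le> d t"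
      using good
    proof eventually_elim
      case (elim t)
      define sb where "sb = (\<lambda>x. \<Sum>f\<in>S. indicator (E f) t * f x)"
      have sb: "sb \<in> H01 \<Omega>" unfolding sb_def by (rule H1_norm_sum(1)[OF S])
      have c: "c t \<in> H01 \<Omega>" unfolding c_def by (rule H1_norm_sum(1)[OF S])
      have sbeq: "sb = (if e k t \<le> 1 then s k t else (\<lambda>x. 0))"
      proof (cases "e k t \<le> 1")
        case True
        have "sb = (\<lambda>x. \<Sum>f\<in>S. if f = s k t then f x else 0)"
          unfolding sb_def using elim True by (intro ext sum.cong) (auto simp: E_def indicator_def)
        moreover have "s k t \<in> S" using elim by (simp add: S_def)
        ultimately show ?thesis using S(1) True by simp
      qed (auto simp: sb_def E_def)
      have "?N (\<lambda>x. sb x - u t x) = e' k t"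
      proof (cases "e k t \<le> 1")
        case False
        then show ?thesis using H1_norm_scale[of "u t" "-1"] elim by (simp add: sbeq e'_def)
      qed (simp add: sbeq e'_def e_def)
      then have 1: "?N (\<lambda>x. u t x - sb x) = e' k t" using H1_norm_minus_commute[OF sb, of "u t"] elim by simp
      have "(\<lambda>x. sb x - c t x) = (\<lambda>x. \<Sum>f\<in>S. (indicator (E f) t - g f t) * f x)"
        by (simp add: sb_def c_def sum_subtractf left_diff_distrib)
      then have 2: "?N (\<lambda>x. sb x - c t x) \<le> A t" using H1_norm_sum(2)[OF S] by (simp add: A_def)
      have "?N (\<lambda>x. u t x - c t x) \<le> ?N (\<lambda>x. u t x - sb x) + ?N (\<lambda>x. sb x - c t x)"
        by (rule H1_norm_triangle3[OF _ sb c]) (use elim in auto)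
      then show ?case using 1 2 elim by (simp add: d_def)
    qed
    fix e :: real assume e: "0 < e"
    have eP: "0 < e / (1 + P)" using e P by simp
    have "\<exists>\<delta>>0. \<forall>s\<in>{0..T}. \<forall>t\<in>{0..T}. \<bar>s - t\<bar> < \<delta> \<longrightarrow> \<bar>g f s - g f t\<bar> < e / (1 + P)" for f
    proof -
      have "uniformly_continuous_on {0..T} (g f)"
        by (rule compact_uniformly_continuous[OF continuous_on_subset[OF g(1)] compact_Icc]) simp
      then obtain \<delta> where \<delta>: "\<delta> > 0" "\<And>s t. s \<in> {0..T} \<Longrightarrow> t \<in> {0..T} \<Longrightarrow> dist t s < \<delta> \<Longrightarrow> dist (g f t) (g f s) < e / (1 + P)"
        using eP unfolding uniformly_continuous_on_def by metis
      show ?thesis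
        by (rule exI[of _ \<delta>]) (use \<delta> in \<open>auto simp: dist_real_def\<close>)
    qed
    then obtain \<delta> where \<delta>: "\<And>f. 0 < \<delta> f" "\<And>f s t. s \<in> {0..T} \<Longrightarrow> t \<in> {0..T} \<Longrightarrow> \<bar>s - t\<bar> < \<delta> f \<Longrightarrow> \<bar>g f s - g f t\<bar> < e / (1 + P)"
      by metis
    \<comment> \<open>The inserted 1 gives the minimum a meaning when \<open>S\<close> is
      empty.\<close>
    define \<delta>' where "\<delta>' = Min (insert 1 (\<delta> ` S))"
    have "0 < \<delta>'" unfolding \<delta>'_def using S(1) \<delta>(1) by (subst Min_gr_iff) auto
    moreover have "\<delta>' \<le> \<delta> f" if "f \<in> S" for f unfolding \<delta>'_def using S(1) that by (intro Min_le) auto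
    moreover have "?N (\<lambda>x. c s x - c t x) < e" if st: "s \<in> {0..T}" "t \<in> {0..T}" "\<And>f. f \<in> S \<Longrightarrow> \<bar>s - t\<bar> < \<delta> f" for s t
    proof -
      have "(\<lambda>x. c s x - c t x) = (\<lambda>x. \<Sum>f\<in>S. (g f s - g f t) * f x)"
        by (simp add: c_def sum_subtractf left_diff_distrib)
      then have "?N (\<lambda>x. c s x - c t x) \<le> (\<Sum>f\<in>S. \<bar>g f s - g f t\<bar> * ?N f)" using H1_norm_sum(2)[OF S] by simp
      also have "\<dots> \<le> (\<Sum>f\<in>S. e / (1 + P) * ?N f)"
        by (intro sum_mono mult_right_mono less_imp_le[OF \<delta>(2)] st) auto
      also have "\<dots> = e / (1 + P) * P" by (simp add: P_def sum_distrib_left)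
      also have "\<dots> < e" using e P by (simp add: field_simps)
      finally show ?thesis .
    qed
    ultimately show "\<exists>\<delta>>0. \<forall>s\<in>{0..T}. \<forall>t\<in>{0..T}. \<bar>s - t\<bar> < \<delta> \<longrightarrow> ?N (\<lambda>x. c s x - c t x) < e"
    proof (intro exI[of _ \<delta>'] conjI ballI impI)
      fix s t assume *: "0 < \<delta>'" "\<And>f. f \<in> S \<Longrightarrow> \<delta>' \<le> \<delta> f"
        "\<And>s t. s \<in> {0..T} \<Longrightarrow> t \<in> {0..T} \<Longrightarrow> (\<And>f. f \<in> S \<Longrightarrow> \<bar>s - t\<bar> < \<delta> f) \<Longrightarrow> ?N (\<lambda>x. c s x - c t x) < e"
        and st: "s \<in> {0..T}" "t \<in> {0..T}" "\<bar>s - t\<bar> < \<delta>'"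
      show "?N (\<lambda>x. c s x - c t x) < e"
        by (rule *(3)[OF st(1,2)]) (use st(3) *(2) in \<open>force intro: less_le_trans\<close>)
    qed
  qed
qed

section \<open>The regularised entropy\<close>

lemma has_real_derivative_If_ge:
  fixes f g :: "real \<Rightarrow> real"
  assumes "(f has_real_derivative d) (at m)" "(g has_real_derivative d) (at m)" "f m = g m"
  shows "((\<lambda>y. if m \<le> y then f y else g y) has_real_derivative d) (at m)"
proof -
  let ?h = "\<lambda>y. if m \<le> y then f y else g y"
  have "((\<lambda>y. (?h y - ?h m) / (y - m)) \<longlongrightarrow> d) (at_left m)"
  proof (rule Lim_transform_eventually)
    show "((\<lambda>y. (g y - g m) / (y - m)) \<longlongrightarrow> d) (at_left m)"
      using has_field_derivative_at_within[OF assms(2), of "{..<m}"] by (simp add: has_field_derivative_iff)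
    show "\<forall>\<^sub>F y in at_left m. (g y - g m) / (y - m) = (?h y - ?h m) / (y - m)"
      using assms(3) by (simp add: eventually_at_filter)
  qed
  moreover have "((\<lambda>y. (?h y - ?h m) / (y - m)) \<longlongrightarrow> d) (at_right m)"
  proof (rule Lim_transform_eventually)
    show "((\<lambda>y. (f y - f m) / (y - m)) \<longlongrightarrow> d) (at_right m)"
      using has_field_derivative_at_within[OF assms(1), of "{m<..}"] by (simp add: has_field_derivative_iff)
    show "\<forall>\<^sub>F y in at_right m. (f y - f m) / (y - m) = (?h y - ?h m) / (y - m)"
      by (simp add: eventually_at_filter)
  qed
  ultimately show ?thesis by (simp add: has_field_derivative_iff filterlim_at_split)
qed

text \<open>Below \<open>m\<close> the graph is continued by its tangent, so the derivative at
  \<open>y\<close> is \<open>f' (max m y)\<close>. For \<open>ln\<close> and \<open>1 / y\<close>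
  with \<open>0 < m\<close> it is continuous and bounded on the whole line, as the chain rules
  require.\<close>

definition C1_extension :: "(real \<Rightarrow> real) \<Rightarrow> (real \<Rightarrow> real) \<Rightarrow> real \<Rightarrow> real \<Rightarrow> real" where
  "C1_extension f f' m y = (if m \<le> y then f y else f m + f' m * (y - m))"

lemma C1_extension_deriv:
  assumes "\<And>y. m \<le> y \<Longrightarrow> (f has_real_derivative f' y) (at y)"
  shows "(C1_extension f f' m has_real_derivative f' (max m y)) (at y)"
proof -
  have lin: "((\<lambda>y. f m + f' m * (y - m)) has_real_derivative f' m) (at y)" for y
    by (auto intro!: derivative_eq_intros)
  consider "y < m" | "y = m" | "m < y" by linarith
  then show ?thesis
  proof cases
    case 1
    have "(C1_extension f f' m has_real_derivative f' m) (at y)"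
      by (rule has_field_derivative_transform_within_open[OF lin, where S="{..<m}"])
         (use 1 in \<open>auto simp: C1_extension_def\<close>)
    with 1 show ?thesis by (simp add: max_def)
  next
    case 2
    then show ?thesis
      using has_real_derivative_If_ge[OF assms[of m] lin[of m]] by (simp add: C1_extension_def[abs_def])
  next
    case 3
    have "(C1_extension f f' m has_real_derivative f' y) (at y)"
      by (rule has_field_derivative_transform_within_open[OF assms, where S="{m<..}"])
         (use 3 in \<open>auto simp: C1_extension_def\<close>)
    with 3 show ?thesis by (simp add: max_def)
  qed
qed

definition ln_ext :: "real \<Rightarrow> real \<Rightarrow> real" where "ln_ext = C1_extension ln (\<lambda>y. 1 / y)"

lemma ln_ext:
  assumes "0 < m"
  shows "(ln_ext m has_real_derivative 1 / max m y) (at y)" "continuous_on UNIV (\<lambda>y. 1 / max m y)"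
    "\<bar>1 / max m y\<bar> \<le> 1 / m" "m \<le> y \<Longrightarrow> ln_ext m y = ln y"
proof -
  show "(ln_ext m has_real_derivative 1 / max m y) (at y)"
    unfolding ln_ext_def by (rule C1_extension_deriv[where f'="\<lambda>y. 1 / y"]) (use assms in \<open>auto intro!: DERIV_ln_divide\<close>)
  have "max m y \<noteq> 0" for y using assms by (auto simp: max_def)
  then show "continuous_on UNIV (\<lambda>y. 1 / max m y)" by (intro continuous_intros continuous_on_max) auto
  show "\<bar>1 / max m y\<bar> \<le> 1 / m" using assms by (auto simp: max_def divide_simps)
qed (simp add: ln_ext_def C1_extension_def)

definition inv_ext :: "real \<Rightarrow> real \<Rightarrow> real" where "inv_ext = C1_extension (\<lambda>y. 1 / y) (\<lambda>y. - 1 / y\<^sup>2)"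

lemma inv_ext:
  assumes "0 < m"
  shows "(inv_ext m has_real_derivative - 1 / (max m y)\<^sup>2) (at y)" "continuous_on UNIV (\<lambda>y. - 1 / (max m y)\<^sup>2)"
    "\<bar>- 1 / (max m y)\<^sup>2\<bar> \<le> 1 / m\<^sup>2" "m \<le> y \<Longrightarrow> inv_ext m y = 1 / y"
proof -
  have pos: "0 < max m y" for y using assms by (auto simp: max_def)
  show "(inv_ext m has_real_derivative - 1 / (max m y)\<^sup>2) (at y)"
    unfolding inv_ext_def
    by (rule C1_extension_deriv[where f'="\<lambda>y. - 1 / y\<^sup>2"])
       (use assms in \<open>auto intro!: derivative_eq_intros simp: power2_eq_square\<close>)
  have "(max m y)\<^sup>2 \<noteq> 0" for y using pos[of y] by simp
  then show "continuous_on UNIV (\<lambda>y. - 1 / (max m y)\<^sup>2)" by (intro continuous_intros continuous_on_max) auto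
  have "m\<^sup>2 \<le> (max m y)\<^sup>2" using assms by (intro power_mono) auto
  then show "\<bar>- 1 / (max m y)\<^sup>2\<bar> \<le> 1 / m\<^sup>2" using assms pos[of y] by (simp add: frac_le)
qed (simp add: inv_ext_def C1_extension_def)

text \<open>The primitive from \<open>a\<close> to \<open>y\<close> of
  \<open>ln (s + \<epsilon> * a) - ln ((1 + \<epsilon>) * a)\<close>, in closed form. The second
  logarithm is shifted too, so that the slope vanishes at \<open>y = a\<close>; this is what gives
  the corresponding test function zero boundary values.\<close>

definition entropy :: "real \<Rightarrow> real \<Rightarrow> real \<Rightarrow> real" where
  "entropy \<epsilon> a y = (y + \<epsilon> * a) * (ln (y + \<epsilon> * a) - ln ((1 + \<epsilon>) * a)) - y + a"

lemma x_ln_x_tendsto_0: "((\<lambda>x::real. x * ln x) \<longlongrightarrow> 0) (at_right 0)"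
proof -
  have "((\<lambda>s::real. ln (inverse s) / inverse s) \<longlongrightarrow> 0) (at_right 0)"
    using filterlim_compose[OF ln_x_over_x_tendsto_0 filterlim_inverse_at_top_right] by simp
  then have "((\<lambda>s::real. - (ln (inverse s) / inverse s)) \<longlongrightarrow> - 0) (at_right 0)" by (rule tendsto_minus)
  then have "((\<lambda>s::real. - (ln (inverse s) / inverse s)) \<longlongrightarrow> 0) (at_right 0)" by simp
  then show ?thesis
    by (rule Lim_transform_eventually) (simp add: eventually_at_filter ln_inverse divide_inverse mult.commute)
qed

lemma entropy_density_eq:
  assumes a: "0 < a" and y: "0 \<le> y"
  shows "entropy_density a y = entropy 0 a y"
proof -
  define F where "F s = s * ln s - s - s * ln a" for s :: real
  have F: "(F has_real_derivative ln s - ln a) (at s)" if "0 < s" for s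
    unfolding F_def using that by (auto intro!: derivative_eq_intros)
  show ?thesis
  proof (cases "y = 0")
    case False
    have "entropy_density a y = F y - F a"
      unfolding entropy_density_def
    proof (rule interval_integral_FTC_finite)
      have pos: "0 < s" if "s \<in> {min a y..max a y}" for s using that a y False by auto
      show "continuous_on {min a y..max a y} (\<lambda>s. ln s - ln a)"
        by (intro continuous_intros) (use pos in force)
      show "(F has_vector_derivative ln s - ln a) (at s within {min a y..max a y})" if "min a y \<le> s" "s \<le> max a y" for s
        using F[OF pos[of s]] that by (simp add: has_real_derivative_iff_has_vector_derivative has_vector_derivative_at_within)
    qed
    then show ?thesis by (simp add: F_def entropy_def algebra_simps)
  next
    case True
    \<comment> \<open>At \<open>y = 0\<close> the integrand is unbounded. The sign is reversed
      because the improper fundamental theorem asks for a nonnegative integrand; the limit at 0 is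
      that of \<open>s * ln s\<close>.\<close>
    have "(LBINT s=ereal 0..ereal a. ln a - ln s) = a - 0"
    proof (rule interval_integral_FTC_nonneg(2))
      show "ereal 0 < ereal a" using a by simp
      show "((\<lambda>s. - F s) has_real_derivative ln a - ln s) (at s)" if "ereal 0 < ereal s" for s
        using DERIV_minus[OF F[of s]] that by simp
      show "isCont (\<lambda>s. ln a - ln s) s" if "ereal 0 < ereal s" for s using that by (intro continuous_intros) auto
      show "AE s in lborel. ereal 0 < ereal s \<longrightarrow> ereal s < ereal a \<longrightarrow> 0 \<le> ln a - ln s"
        by (intro AE_I2) auto
      have "((\<lambda>s. - (s * ln s - s - s * ln a)) \<longlongrightarrow> - (0 - 0 - 0 * ln a)) (at_right 0)"
        by (intro tendsto_intros x_ln_x_tendsto_0)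
      then show "(((\<lambda>s. - F s) \<circ> real_of_ereal) \<longlongrightarrow> 0) (at_right (ereal 0))"
        by (simp add: ereal_tendsto_simps F_def)
      have "isCont (\<lambda>s. - F s) a" using DERIV_isCont[OF DERIV_minus[OF F[OF a]]] .
      then have "((\<lambda>s. - F s) \<longlongrightarrow> - F a) (at_left a)" by (simp add: isCont_def filterlim_at_split)
      then show "(((\<lambda>s. - F s) \<circ> real_of_ereal) \<longlongrightarrow> a) (at_left (ereal a))"
        by (simp add: ereal_tendsto_simps F_def)
    qed
    then have "(LBINT s=ereal 0..ereal a. - (ln s - ln a)) = a" by simp
    then have "- (LBINT s=ereal 0..ereal a. ln s - ln a) = a" by (simp only: interval_lebesgue_integral_uminus)
    then show ?thesis
      unfolding entropy_density_def True by (subst interval_integral_endpoints_reverse) (simp add: entropy_def)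
  qed
qed

text \<open>The graph lies above its tangent at \<open>y\<close>. After the shift by
  \<open>\<epsilon> * a\<close> this is \<open>ln q \<le> q - 1\<close> for the quotient
  \<open>q = Y / X\<close>. The tangent is taken at the later of two times in the applications, so
  that one test function serves all earlier times.\<close>

lemma entropy_convex:
  assumes "0 < \<epsilon>" "0 < a" "0 \<le> x" "0 \<le> y"
  shows "entropy \<epsilon> a y - entropy \<epsilon> a x \<le> (ln (y + \<epsilon> * a) - ln ((1 + \<epsilon>) * a)) * (y - x)"
proof -
  define X Y where "X = x + \<epsilon> * a" and "Y = y + \<epsilon> * a"
  have pos: "0 < X" "0 < Y" using assms by (auto simp: X_def Y_def intro: add_nonneg_pos)
  have "ln (Y / X) \<le> Y / X - 1" using pos by (intro ln_le_minus_one) simp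
  then have "X * (ln Y - ln X) \<le> X * (Y / X - 1)" using pos by (intro mult_left_mono) (auto simp: ln_div)
  then have "X * (ln Y - ln X) \<le> Y - X" using pos by (simp add: right_diff_distrib)
  moreover have "entropy \<epsilon> a y - entropy \<epsilon> a x - (ln Y - k) * (y - x) = X * (ln Y - ln X) - (Y - X)"
    if "k = ln ((1 + \<epsilon>) * a)" for k
    unfolding entropy_def that[symmetric] X_def[symmetric] Y_def[symmetric]
    by (simp add: X_def Y_def algebra_simps)
  from this[OF refl] have "entropy \<epsilon> a y - entropy \<epsilon> a x - (ln Y - ln ((1 + \<epsilon>) * a)) * (y - x) = X * (ln Y - ln X) - (Y - X)" .
  ultimately show ?thesis unfolding Y_def[symmetric] by linarith
qed

lemma abs_ln_le:
  fixes x :: real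
  assumes "0 < l" "l \<le> x" "x \<le> u" shows "\<bar>ln x\<bar> \<le> \<bar>ln l\<bar> + \<bar>ln u\<bar>"
proof -
  have "ln l \<le> ln x" using assms by (subst ln_le_cancel_iff) auto
  moreover have "ln x \<le> ln u" using assms by (subst ln_le_cancel_iff) auto
  ultimately show ?thesis by linarith
qed

lemma abs_x_ln_x_le:
  assumes "0 \<le> (x::real)" shows "\<bar>x * ln x\<bar> \<le> 1 + x\<^sup>2"
proof (cases "x = 0")
  case False
  then have x: "0 < x" using assms by simp
  have "ln x \<le> x - 1" by (rule ln_le_minus_one[OF x])
  then have "x * ln x \<le> x * x" using x by (intro mult_left_mono) auto
  moreover have "ln (1 / x) \<le> 1 / x - 1" using x by (intro ln_le_minus_one) simp
  then have "x * (- ln x) \<le> x * (1 / x - 1)" using x by (intro mult_left_mono) (auto simp: ln_div)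
  then have "- (x * ln x) \<le> 1 - x" using x by (simp add: right_diff_distrib)
  moreover have "0 \<le> x * x" by simp
  ultimately have "x * ln x \<le> 1 + x * x \<and> - (x * ln x) \<le> 1 + x * x" using x by linarith
  then show ?thesis unfolding power2_eq_square abs_le_iff by blast
qed simp

lemma entropy_bound:
  assumes "0 \<le> \<epsilon>" "\<epsilon> \<le> 1" "0 < m" "m \<le> a" "a \<le> A" "0 \<le> y" "y \<le> K"
  shows "\<bar>entropy \<epsilon> a y\<bar> \<le> 1 + (K + A)\<^sup>2 + (K + A) * (\<bar>ln m\<bar> + \<bar>ln (2 * A)\<bar>) + K + A"
proof -
  define X where "X = y + \<epsilon> * a"
  have "\<epsilon> * a \<le> 1 * A" using assms by (intro mult_mono) auto
  then have X: "0 \<le> X" "X \<le> K + A" using assms by (auto simp: X_def)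
  have "\<bar>X * ln X\<bar> \<le> 1 + X\<^sup>2" by (rule abs_x_ln_x_le[OF X(1)])
  also have "\<dots> \<le> 1 + (K + A)\<^sup>2" using X by (intro add_left_mono power_mono) auto
  finally have 1: "\<bar>X * ln X\<bar> \<le> 1 + (K + A)\<^sup>2" .
  have "1 * m \<le> (1 + \<epsilon>) * a" "(1 + \<epsilon>) * a \<le> 2 * A" using assms by (intro mult_mono; simp)+
  then have "\<bar>ln ((1 + \<epsilon>) * a)\<bar> \<le> \<bar>ln m\<bar> + \<bar>ln (2 * A)\<bar>" using abs_ln_le[OF assms(3)] by simp
  then have 2: "\<bar>X * ln ((1 + \<epsilon>) * a)\<bar> \<le> (K + A) * (\<bar>ln m\<bar> + \<bar>ln (2 * A)\<bar>)"
    unfolding abs_mult using X by (intro mult_mono) auto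
  have "entropy \<epsilon> a y = X * ln X - X * ln ((1 + \<epsilon>) * a) - y + a"
    by (simp add: entropy_def X_def right_diff_distrib)
  then show ?thesis using 1 2 assms by linarith
qed

lemma entropy_slope_bound:
  fixes y :: real
  assumes "0 < \<epsilon>" "\<epsilon> \<le> 1" "0 < m" "m \<le> a" "a \<le> A" "0 \<le> y" "y \<le> K"
  shows "\<bar>ln (y + \<epsilon> * a) - ln ((1 + \<epsilon>) * a)\<bar> \<le> 2 * (\<bar>ln (\<epsilon> * m)\<bar> + \<bar>ln (K + 2 * A)\<bar>)"
proof -
  have e1: "\<epsilon> * m \<le> \<epsilon> * a" using assms by (intro mult_left_mono) auto
  have e2: "\<epsilon> * a \<le> 1 * A" using assms by (intro mult_mono) auto
  note e = e1 e2
  have p: "0 < \<epsilon> * m" using assms by simp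
  have "\<bar>ln (y + \<epsilon> * a)\<bar> \<le> \<bar>ln (\<epsilon> * m)\<bar> + \<bar>ln (K + 2 * A)\<bar>"
    by (rule abs_ln_le[OF p]) (use e assms in linarith)+
  moreover have "\<bar>ln ((1 + \<epsilon>) * a)\<bar> \<le> \<bar>ln (\<epsilon> * m)\<bar> + \<bar>ln (K + 2 * A)\<bar>"
    by (rule abs_ln_le[OF p]) (use e assms distrib_right[of 1 \<epsilon> a] in linarith)+
  ultimately show ?thesis
    using abs_triangle_ineq4[of "ln (y + \<epsilon> * a)" "ln ((1 + \<epsilon>) * a)"] by simp
qed

text \<open>Convexity in both directions with the bound on the slope. The constant degenerates as
  \<open>\<epsilon>\<close> tends to 0, which is harmless: the lemma serves the continuity in time
  at fixed \<open>\<epsilon>\<close>.\<close>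

lemma entropy_Lipschitz:
  assumes "0 < \<epsilon>" "\<epsilon> \<le> 1" "0 < m" "m \<le> a" "a \<le> A" "0 \<le> x" "x \<le> K" "0 \<le> y" "y \<le> K"
  shows "\<bar>entropy \<epsilon> a y - entropy \<epsilon> a x\<bar> \<le> 2 * (\<bar>ln (\<epsilon> * m)\<bar> + \<bar>ln (K + 2 * A)\<bar>) * \<bar>y - x\<bar>"
proof -
  let ?L = "2 * (\<bar>ln (\<epsilon> * m)\<bar> + \<bar>ln (K + 2 * A)\<bar>)"
  have *: "entropy \<epsilon> a v - entropy \<epsilon> a u \<le> ?L * \<bar>v - u\<bar>" if "0 \<le> u" "u \<le> K" "0 \<le> v" "v \<le> K" for u v
  proof -
    have "entropy \<epsilon> a v - entropy \<epsilon> a u \<le> (ln (v + \<epsilon> * a) - ln ((1 + \<epsilon>) * a)) * (v - u)"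
      by (rule entropy_convex) (use assms that in auto)
    also have "\<dots> \<le> \<bar>ln (v + \<epsilon> * a) - ln ((1 + \<epsilon>) * a)\<bar> * \<bar>v - u\<bar>" unfolding abs_mult[symmetric] by simp
    also have "\<dots> \<le> ?L * \<bar>v - u\<bar>"
      by (intro mult_right_mono entropy_slope_bound) (use assms that in auto)
    finally show ?thesis .
  qed
  show ?thesis
    using *[of x y] *[of y x] assms by (simp add: abs_le_iff abs_minus_commute)
qed

lemma entropy_tendsto:
  assumes a: "0 < a" and y: "0 \<le> y" and \<epsilon>: "\<epsilon> \<longlonglongrightarrow> 0" "\<And>k::nat. 0 < \<epsilon> k"
  shows "(\<lambda>k. entropy (\<epsilon> k) a y) \<longlonglongrightarrow> entropy 0 a y"
proof -
  have "(\<lambda>k. y + \<epsilon> k * a) \<longlonglongrightarrow> y + 0 * a" by (intro tendsto_intros \<epsilon>)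
  then have X: "(\<lambda>k. y + \<epsilon> k * a) \<longlonglongrightarrow> y" by simp
  have pos: "0 < y + \<epsilon> k * a" for k using \<epsilon>(2)[of k] a y by (simp add: add_nonneg_pos)
  have "(\<lambda>k. (y + \<epsilon> k * a) * ln (y + \<epsilon> k * a)) \<longlonglongrightarrow> y * ln y"
  proof (cases "y = 0")
    case True
    have "\<forall>\<^sub>F k in sequentially. y + \<epsilon> k * a \<in> {0<..} \<and> y + \<epsilon> k * a \<noteq> 0"
      using pos by (intro always_eventually allI) (metis greaterThan_iff less_irrefl)
    moreover have "(\<lambda>k. y + \<epsilon> k * a) \<longlonglongrightarrow> 0" using X True by simp
    ultimately have "filterlim (\<lambda>k. y + \<epsilon> k * a) (at_right 0) sequentially"
      unfolding filterlim_at by blast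
    from filterlim_compose[OF x_ln_x_tendsto_0 this] True show ?thesis by simp
  next
    case False
    then show ?thesis by (intro tendsto_intros X) auto
  qed
  then have XX: "(\<lambda>k. (y + \<epsilon> k * a) * ln (y + \<epsilon> k * a)) \<longlonglongrightarrow> y * ln y" .
  have "(\<lambda>k. (1 + \<epsilon> k) * a) \<longlonglongrightarrow> (1 + 0) * a" by (intro tendsto_intros \<epsilon>)
  then have l: "(\<lambda>k. ln ((1 + \<epsilon> k) * a)) \<longlonglongrightarrow> ln a" using a by (intro tendsto_ln) auto
  have "(\<lambda>k. (y + \<epsilon> k * a) * ln (y + \<epsilon> k * a) - (y + \<epsilon> k * a) * ln ((1 + \<epsilon> k) * a) - y + a)
      \<longlonglongrightarrow> y * ln y - y * ln a - y + a"
    by (rule tendsto_add[OF tendsto_diff[OF tendsto_diff[OF XX tendsto_mult[OF X l]] tendsto_const] tendsto_const])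
  then show ?thesis by (simp add: entropy_def right_diff_distrib)
qed

text \<open>Completing the square in \<open>q = g / (z + \<epsilon>) + h\<close>.\<close>

lemma regularised_flux_bound:
  fixes g h :: "'a::real_inner"
  assumes "0 < \<epsilon>" "0 \<le> z"
  shows "- (\<epsilon> / 4 * (norm h)\<^sup>2) \<le> (g + z *\<^sub>R h) \<bullet> ((1 / (\<epsilon> + z)) *\<^sub>R g + h)"
proof -
  define q where "q = (1 / (\<epsilon> + z)) *\<^sub>R g + h"
  have "\<epsilon> + z \<noteq> 0" using assms by simp
  then have "g + z *\<^sub>R h = (\<epsilon> + z) *\<^sub>R q - \<epsilon> *\<^sub>R h" by (simp add: q_def algebra_simps)
  then have "(g + z *\<^sub>R h) \<bullet> q = (\<epsilon> + z) * (norm q)\<^sup>2 - \<epsilon> * (h \<bullet> q)"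
    by (simp add: inner_diff_left power2_norm_eq_inner)
  moreover have "\<epsilon> * (norm q)\<^sup>2 \<le> (\<epsilon> + z) * (norm q)\<^sup>2" using assms by (intro mult_right_mono) auto
  moreover have "0 \<le> \<epsilon> * (norm (q - (1 / 2) *\<^sub>R h))\<^sup>2" using assms by simp
  moreover have "(norm (q - (1 / 2) *\<^sub>R h))\<^sup>2 = (norm q)\<^sup>2 - h \<bullet> q + (norm h)\<^sup>2 / 4"
    by (simp add: power2_norm_eq_inner inner_diff_left inner_diff_right inner_commute field_simps)
  ultimately show ?thesis unfolding q_def[symmetric] by (simp add: algebra_simps)
qed

section \<open>Densities and potentials relative to the equilibrium profile\<close>

locale density_bounds = bounded_open +
  fixes a :: "'a \<Rightarrow> real" and ga :: "'a \<Rightarrow> 'a" and B m K :: real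
  assumes a: "W1inf_grad a ga B" and B: "0 \<le> B" and m: "0 < m" and am: "AE x in M. m \<le> a x" and K: "0 \<le> K"
begin

lemma a_measurable: "a \<in> borel_measurable M" "ga \<in> borel_measurable M"
  using a by (auto simp: W1inf_grad_def)

lemma a_bounds: "AE x in M. m \<le> a x \<and> a x \<le> B \<and> norm (ga x) \<le> B"
proof -
  have "AE x in M. \<bar>a x\<bar> \<le> B" "AE x in M. norm (ga x) \<le> B" using a by (auto simp: W1inf_grad_def)
  then show ?thesis using am by eventually_elim auto
qed

text \<open>The bound that \<open>W1inf_grad_compose\<close> produces for the reciprocal of
  \<open>a\<close>.\<close>

definition Bw :: real where "Bw = \<bar>inv_ext m 0\<bar> + 1 / m\<^sup>2 * \<bar>B\<bar>"

lemma Bw_nonneg: "0 \<le> Bw"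
  by (simp add: Bw_def)

lemma inverse_a: "W1inf_grad (\<lambda>x. inv_ext m (a x)) (\<lambda>x. (- 1 / (max m (a x))\<^sup>2) *\<^sub>R ga x) Bw"
  unfolding Bw_def by (rule W1inf_grad_compose[OF a inv_ext(1-3)[OF m]])

text \<open>The relative excess \<open>v = (n - a) / a\<close> lies in \<open>H01\<close> because
  \<open>1 / a\<close> is Lipschitz, and \<open>n / a = 1 + v\<close>, so \<open>gv\<close> is the
  gradient of \<open>n / a\<close>. The potential is \<open>\<phi> = G v\<close> with
  \<open>G 0 = 0\<close>. The fourth conclusion is the quotient rule in the form
  \<open>a * \<nabla>(n / a) = \<nabla>n - (n / a) * \<nabla>a\<close>, stated for every
  \<open>h\<close> so that the field can be inserted later.\<close>

lemma quasi_Fermi_potential: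
  assumes u: "H01_grad (\<lambda>x. n x - a x) gu" and n: "AE x in M. 0 \<le> n x" and \<epsilon>: "0 < \<epsilon>"
  obtains \<phi> g\<phi> gv where "H01_grad \<phi> g\<phi>"
    "AE x in M. \<phi> x = ln (n x + \<epsilon> * a x) - ln ((1 + \<epsilon>) * a x)"
    "AE x in M. g\<phi> x = (1 / (\<epsilon> + n x / a x)) *\<^sub>R gv x"
    "AE x in M. \<forall>h. gu x + ga x + n x *\<^sub>R (h - (1 / a x) *\<^sub>R ga x) = a x *\<^sub>R (gv x + (n x / a x) *\<^sub>R h)"
    "H1_norm \<Omega> \<phi> \<le> (3 * Bw / \<epsilon>) * H1_norm \<Omega> (\<lambda>x. n x - a x)"
proof -
  define w where "w x = inv_ext m (a x)" for x
  define gw where "gw x = (- 1 / (max m (a x))\<^sup>2) *\<^sub>R ga x" for x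
  define v where "v x = (n x - a x) * w x" for x
  define gv where "gv x = (n x - a x) *\<^sub>R gw x + w x *\<^sub>R gu x" for x
  have v: "H01_grad v gv" "L2norm M gv \<le> Bw * (L2norm M (\<lambda>x. n x - a x) + L2norm M gu)"
    unfolding v_def[abs_def] gv_def[abs_def] w_def gw_def
    by (rule H01_grad_mult[OF u inverse_a Bw_nonneg])+
  \<comment> \<open>On the range \<open>y \<ge> -1\<close> of \<open>v\<close> the extended
    logarithm is the logarithm, as its argument is at least \<open>\<epsilon>\<close> there.
    Globally \<open>G\<close> has Lipschitz constant \<open>1 / \<epsilon>\<close>.\<close>
  define G where "G y = ln_ext \<epsilon> (1 + \<epsilon> + y) - ln (1 + \<epsilon>)" for y
  have G: "(G has_real_derivative 1 / max \<epsilon> (1 + \<epsilon> + y)) (at y)" for y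
  proof -
    have "((\<lambda>y. 1 + \<epsilon> + y) has_real_derivative 1) (at y)" by (auto intro!: derivative_eq_intros)
    from DERIV_chain2[OF ln_ext(1)[OF \<epsilon>] this]
    have "((\<lambda>y. ln_ext \<epsilon> (1 + \<epsilon> + y)) has_real_derivative 1 / max \<epsilon> (1 + \<epsilon> + y)) (at y)" by simp
    from DERIV_diff[OF this DERIV_const[of "ln (1 + \<epsilon>)"]] show ?thesis by (simp add: G_def[abs_def])
  qed
  have G': "continuous_on UNIV (\<lambda>y. 1 / max \<epsilon> (1 + \<epsilon> + y))"
    by (rule continuous_on_compose2[OF ln_ext(2)[OF \<epsilon>]]) (auto intro!: continuous_intros)
  have G0: "G 0 = 0" using ln_ext(4)[OF \<epsilon>, of "1 + \<epsilon>"] by (simp add: G_def)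
  note \<phi> = H01_grad_compose[OF v(1) G G' G0 ln_ext(3)[OF \<epsilon>]]
  have pt: "AE x in M. 0 < a x \<and> w x = 1 / a x \<and> gw x = (- 1 / (a x)\<^sup>2) *\<^sub>R ga x \<and> 1 + \<epsilon> + v x = \<epsilon> + n x / a x \<and> \<epsilon> \<le> \<epsilon> + n x / a x"
    using am n
  proof eventually_elim
    case (elim x)
    have a0: "0 < a x" using elim m by linarith
    have "w x = 1 / a x" using inv_ext(4)[OF m elim(1)] by (simp add: w_def)
    moreover have "gw x = (- 1 / (a x)\<^sup>2) *\<^sub>R ga x" using elim by (simp add: gw_def max_def)
    moreover have "1 + \<epsilon> + v x = \<epsilon> + n x / a x" using a0 \<open>w x = 1 / a x\<close> by (simp add: v_def field_simps)
    ultimately show ?case using a0 elim by simp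
  qed
  show ?thesis
  proof (rule that[where \<phi>="\<lambda>x. G (v x)" and g\<phi>="\<lambda>x. (1 / max \<epsilon> (1 + \<epsilon> + v x)) *\<^sub>R gv x" and gv=gv])
    show "H01_grad (\<lambda>x. G (v x)) (\<lambda>x. (1 / max \<epsilon> (1 + \<epsilon> + v x)) *\<^sub>R gv x)" by (rule \<phi>(1))
    show "AE x in M. G (v x) = ln (n x + \<epsilon> * a x) - ln ((1 + \<epsilon>) * a x)"
      using pt n
    proof eventually_elim
      case (elim x)
      have "0 < n x + \<epsilon> * a x" using elim \<epsilon> by (simp add: add_nonneg_pos)
      have "1 + \<epsilon> + v x = \<epsilon> + n x / a x" "\<epsilon> \<le> \<epsilon> + n x / a x" using elim by auto
      then have "G (v x) = ln (\<epsilon> + n x / a x) - ln (1 + \<epsilon>)"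
        using ln_ext(4)[OF \<epsilon>, of "\<epsilon> + n x / a x"] unfolding G_def by metis
      moreover have "\<epsilon> + n x / a x = (n x + \<epsilon> * a x) / a x" using elim by (simp add: field_simps)
      moreover have "ln ((n x + \<epsilon> * a x) / a x) = ln (n x + \<epsilon> * a x) - ln (a x)"
        using elim \<open>0 < n x + \<epsilon> * a x\<close> by (simp add: ln_div)
      moreover have "ln ((1 + \<epsilon>) * a x) = ln (1 + \<epsilon>) + ln (a x)" using elim \<epsilon> by (simp add: ln_mult)
      ultimately show "G (v x) = ln (n x + \<epsilon> * a x) - ln ((1 + \<epsilon>) * a x)" by simp
    qed
    show "AE x in M. (1 / max \<epsilon> (1 + \<epsilon> + v x)) *\<^sub>R gv x = (1 / (\<epsilon> + n x / a x)) *\<^sub>R gv x"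
      using pt
    proof eventually_elim
      case (elim x)
      then have "max \<epsilon> (1 + \<epsilon> + v x) = \<epsilon> + n x / a x" by (metis max.absorb2)
      then show ?case by simp
    qed
    show "AE x in M. \<forall>h. gu x + ga x + n x *\<^sub>R (h - (1 / a x) *\<^sub>R ga x) = a x *\<^sub>R (gv x + (n x / a x) *\<^sub>R h)"
      using pt
    proof eventually_elim
      case (elim x)
      then have e: "gv x = ((n x - a x) * (- 1 / (a x)\<^sup>2)) *\<^sub>R ga x + (1 / a x) *\<^sub>R gu x" "a x \<noteq> 0"
        by (auto simp: gv_def)
      have c: "a x * ((n x - a x) * (- 1 / (a x)\<^sup>2)) = 1 - n x / a x" "a x * (1 / a x) = 1" "a x * (n x / a x) = n x"
        using e(2) by (auto simp: field_simps power2_eq_square)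
      show ?case
      proof
        fix h
        have "a x *\<^sub>R (gv x + (n x / a x) *\<^sub>R h)
            = (a x * ((n x - a x) * (- 1 / (a x)\<^sup>2))) *\<^sub>R ga x + (a x * (1 / a x)) *\<^sub>R gu x + (a x * (n x / a x)) *\<^sub>R h"
          unfolding e(1) by (simp only: scaleR_add_right scaleR_scaleR)
        also have "\<dots> = gu x + ga x + n x *\<^sub>R (h - (1 / a x) *\<^sub>R ga x)"
          unfolding c by (simp add: scaleR_diff_left scaleR_diff_right)
        finally show "gu x + ga x + n x *\<^sub>R (h - (1 / a x) *\<^sub>R ga x) = a x *\<^sub>R (gv x + (n x / a x) *\<^sub>R h)" by simp
      qed
    qed
    let ?u = "\<lambda>x. n x - a x"
    have Nu: "L2norm M ?u \<le> H1_norm \<Omega> ?u" "L2norm M gu \<le> H1_norm \<Omega> ?u"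
      using H1_norm_H01_grad[OF u] by (auto intro: real_le_rsqrt)
    have "L2norm M v \<le> Bw * L2norm M ?u"
    proof -
      have "AE x in M. \<bar>w x\<bar> \<le> Bw" "w \<in> borel_measurable M" using inverse_a by (auto simp: W1inf_grad_def w_def[abs_def])
      from L2norm_bounded_mult(2)[OF H01_grad_sq_int(1)[OF u] this(2,1) Bw_nonneg]
      show ?thesis by (simp add: v_def[abs_def] mult.commute)
    qed
    also have "\<dots> \<le> Bw * H1_norm \<Omega> ?u" by (intro mult_left_mono Nu Bw_nonneg)
    finally have 1: "L2norm M v \<le> Bw * H1_norm \<Omega> ?u" .
    have "L2norm M gv \<le> Bw * (L2norm M ?u + L2norm M gu)" by (rule v(2))
    also have "\<dots> \<le> Bw * (H1_norm \<Omega> ?u + H1_norm \<Omega> ?u)" by (intro mult_left_mono add_mono Nu Bw_nonneg)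
    finally have 2: "L2norm M gv \<le> Bw * (2 * H1_norm \<Omega> ?u)" by simp
    \<comment> \<open>The factor 3 collects one share for the function and two for the gradient,
      since the product rule involves both \<open>n - a\<close> and its gradient.\<close>
    have "H1_norm \<Omega> (\<lambda>x. G (v x)) \<le> L2norm M (\<lambda>x. G (v x)) + L2norm M (\<lambda>x. (1 / max \<epsilon> (1 + \<epsilon> + v x)) *\<^sub>R gv x)"
      by (rule H1_norm_le[OF \<phi>(1)])
    also have "\<dots> \<le> 1 / \<epsilon> * L2norm M v + 1 / \<epsilon> * L2norm M gv" by (intro add_mono \<phi>(2,3))
    also have "\<dots> \<le> 1 / \<epsilon> * (Bw * H1_norm \<Omega> ?u) + 1 / \<epsilon> * (Bw * (2 * H1_norm \<Omega> ?u))"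
      using \<epsilon> by (intro add_mono mult_left_mono 1 2) auto
    also have "\<dots> = (3 * Bw / \<epsilon>) * H1_norm \<Omega> ?u" by (simp add: field_simps)
    finally show "H1_norm \<Omega> (\<lambda>x. G (v x)) \<le> (3 * Bw / \<epsilon>) * H1_norm \<Omega> ?u" .
  qed
qed

text \<open>The pointwise bound \<open>regularised_flux_bound\<close> with \<open>z = n / a\<close>,
  multiplied by the weight \<open>\<sigma> x * a x\<close>, which lies between 0 and
  \<open>S * B\<close>.\<close>

lemma dissipation_bound:
  assumes \<sigma>: "\<sigma> \<in> borel_measurable M" "AE x in M. 0 \<le> \<sigma> x \<and> \<sigma> x \<le> S" and \<epsilon>: "0 < \<epsilon>" and n: "AE x in M. 0 \<le> n x"
    and J: "sq_int M J" "AE x in M. J x = a x *\<^sub>R (gv x + (n x / a x) *\<^sub>R h x)" and h: "sq_int M h"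
    and g: "sq_int M g\<phi>" "AE x in M. g\<phi> x = (1 / (\<epsilon> + n x / a x)) *\<^sub>R gv x"
  shows "- (S * B * \<epsilon> / 4 * (L2norm M h)\<^sup>2) \<le> (LINT x|M. \<sigma> x * (J x \<bullet> (g\<phi> x + h x)))"
proof -
  have "- (S * B * \<epsilon> / 4 * (L2norm M h)\<^sup>2) = (LINT x|M. - (S * B * \<epsilon> / 4 * (norm (h x))\<^sup>2))"
    by (simp add: L2norm_sq)
  also have "\<dots> \<le> (LINT x|M. \<sigma> x * (J x \<bullet> (g\<phi> x + h x)))"
  proof (rule integral_mono_AE)
    show "integrable M (\<lambda>x. - (S * B * \<epsilon> / 4 * (norm (h x))\<^sup>2))" using h by (simp add: sq_int_def)
    have "AE x in M. \<bar>\<sigma> x\<bar> \<le> \<bar>S\<bar>" using \<sigma>(2) by eventually_elim auto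
    from L2norm_bounded_mult(1)[OF J(1) \<sigma>(1) this]
    have "sq_int M (\<lambda>x. \<sigma> x *\<^sub>R J x)" by simp
    from sq_int_inner_integrable[OF this sq_int_add[OF g(1) h]]
    show "integrable M (\<lambda>x. \<sigma> x * (J x \<bullet> (g\<phi> x + h x)))" by simp
    show "AE x in M. - (S * B * \<epsilon> / 4 * (norm (h x))\<^sup>2) \<le> \<sigma> x * (J x \<bullet> (g\<phi> x + h x))"
      using \<sigma>(2) J(2) g(2) n a_bounds
    proof eventually_elim
      case (elim x)
      have a0: "0 < a x" using elim m by linarith
      let ?f = "(gv x + (n x / a x) *\<^sub>R h x) \<bullet> ((1 / (\<epsilon> + n x / a x)) *\<^sub>R gv x + h x)"
      have f: "- (\<epsilon> / 4 * (norm (h x))\<^sup>2) \<le> ?f" by (rule regularised_flux_bound[OF \<epsilon>]) (use elim a0 in simp)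
      have c: "0 \<le> \<sigma> x * a x" "\<sigma> x * a x \<le> S * B" using elim a0 by (auto intro!: mult_mono)
      have "(\<sigma> x * a x) * (\<epsilon> / 4 * (norm (h x))\<^sup>2) \<le> S * B * (\<epsilon> / 4 * (norm (h x))\<^sup>2)"
        using c \<epsilon> by (intro mult_right_mono) auto
      moreover have "(\<sigma> x * a x) * (- (\<epsilon> / 4 * (norm (h x))\<^sup>2)) \<le> (\<sigma> x * a x) * ?f"
        by (rule mult_left_mono[OF f c(1)])
      moreover have "\<sigma> x * (J x \<bullet> (g\<phi> x + h x)) = (\<sigma> x * a x) * ?f" using elim by simp
      moreover have "(\<sigma> x * a x) * (- (\<epsilon> / 4 * (norm (h x))\<^sup>2)) = - ((\<sigma> x * a x) * (\<epsilon> / 4 * (norm (h x))\<^sup>2))"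
        by (rule mult_minus_right)
      moreover have "S * B * \<epsilon> / 4 * (norm (h x))\<^sup>2 = S * B * (\<epsilon> / 4 * (norm (h x))\<^sup>2)" by simp
      ultimately show ?case by linarith
    qed
  qed
  finally show ?thesis .
qed

lemma entropy_measurable:
  assumes "n \<in> borel_measurable M" shows "(\<lambda>x. entropy \<epsilon> (a x) (n x)) \<in> borel_measurable M"
  unfolding entropy_def using assms a_measurable(1) by measurable

definition entropy_bnd :: real where
  "entropy_bnd = 1 + (K + B)\<^sup>2 + (K + B) * (\<bar>ln m\<bar> + \<bar>ln (2 * B)\<bar>) + K + B"

lemma entropy_AE_bound:
  assumes "0 \<le> \<epsilon>" "\<epsilon> \<le> 1" "AE x in M. 0 \<le> n x \<and> n x \<le> K"
  shows "AE x in M. \<bar>entropy \<epsilon> (a x) (n x)\<bar> \<le> entropy_bnd"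
  using assms(3) a_bounds
  by eventually_elim (unfold entropy_bnd_def, rule entropy_bound[OF assms(1,2) m], auto)

lemma entropy_integrable:
  assumes "0 \<le> \<epsilon>" "\<epsilon> \<le> 1" "n \<in> borel_measurable M" "AE x in M. 0 \<le> n x \<and> n x \<le> K"
  shows "integrable M (\<lambda>x. entropy \<epsilon> (a x) (n x))"
proof (rule Bochner_Integration.integrable_bound[OF _ entropy_measurable[OF assms(3)]])
  show "integrable M (\<lambda>_. entropy_bnd)" by simp
  show "AE x in M. norm (entropy \<epsilon> (a x) (n x)) \<le> norm entropy_bnd"
    using entropy_AE_bound[OF assms(1,2,4)] by eventually_elim simp
qed

lemma entropy_integral_tendsto:
  assumes n: "n \<in> borel_measurable M" "AE x in M. 0 \<le> n x \<and> n x \<le> K"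
    and \<epsilon>: "\<epsilon> \<longlonglongrightarrow> 0" "\<And>k::nat. 0 < \<epsilon> k" "\<And>k. \<epsilon> k \<le> 1"
  shows "(\<lambda>k. LINT x|M. entropy (\<epsilon> k) (a x) (n x)) \<longlonglongrightarrow> (LINT x|M. entropy 0 (a x) (n x))"
proof (rule integral_dominated_convergence[where w="\<lambda>_. entropy_bnd"])
  show "AE x in M. (\<lambda>k. entropy (\<epsilon> k) (a x) (n x)) \<longlonglongrightarrow> entropy 0 (a x) (n x)"
    using n(2) am by eventually_elim (rule entropy_tendsto[OF _ _ \<epsilon>(1,2)], use m in auto)
  show "AE x in M. norm (entropy (\<epsilon> k) (a x) (n x)) \<le> entropy_bnd" for k
    using entropy_AE_bound[OF less_imp_le[OF \<epsilon>(2)] \<epsilon>(3) n(2)] by simp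
qed (use entropy_measurable[OF n(1)] in auto)

lemma entropy_integral_convex:
  assumes \<epsilon>: "0 < \<epsilon>" "\<epsilon> \<le> 1" and n: "sq_int M n" "AE x in M. 0 \<le> n x \<and> n x \<le> K"
    and n': "sq_int M n'" "AE x in M. 0 \<le> n' x \<and> n' x \<le> K"
    and \<phi>: "sq_int M \<phi>" "AE x in M. \<phi> x = ln (n x + \<epsilon> * a x) - ln ((1 + \<epsilon>) * a x)"
  shows "(LINT x|M. entropy \<epsilon> (a x) (n x)) - (LINT x|M. entropy \<epsilon> (a x) (n' x)) \<le> (LINT x|M. (n x - n' x) * \<phi> x)"
proof -
  have i: "integrable M (\<lambda>x. entropy \<epsilon> (a x) (n x))" "integrable M (\<lambda>x. entropy \<epsilon> (a x) (n' x))"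
    using entropy_integrable[OF less_imp_le[OF \<epsilon>(1)] \<epsilon>(2)] n n' by (auto simp: sq_int_def)
  have "(LINT x|M. entropy \<epsilon> (a x) (n x) - entropy \<epsilon> (a x) (n' x)) \<le> (LINT x|M. (n x - n' x) * \<phi> x)"
  proof (rule integral_mono_AE[OF _ sq_int_mult_integrable[OF sq_int_diff[OF n(1) n'(1)] \<phi>(1)]])
    show "AE x in M. entropy \<epsilon> (a x) (n x) - entropy \<epsilon> (a x) (n' x) \<le> (n x - n' x) * \<phi> x"
      using n(2) n'(2) \<phi>(2) am
    proof eventually_elim
      case (elim x)
      have "entropy \<epsilon> (a x) (n x) - entropy \<epsilon> (a x) (n' x) \<le> (ln (n x + \<epsilon> * a x) - ln ((1 + \<epsilon>) * a x)) * (n x - n' x)"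
        by (rule entropy_convex[OF \<epsilon>(1)]) (use elim m in auto)
      then show ?case using elim by (simp add: mult.commute)
    qed
  qed (use i in simp)
  then show ?thesis using i by simp
qed

text \<open>The pointwise Lipschitz bound yields an L1 distance; pairing it with the constant 1 by
  Cauchy-Schwarz gives the L2 distance in which the densities are continuous.\<close>

lemma entropy_integral_Lipschitz:
  assumes \<epsilon>: "0 < \<epsilon>" "\<epsilon> \<le> 1" and n: "sq_int M n" "AE x in M. 0 \<le> n x \<and> n x \<le> K"
    and n': "sq_int M n'" "AE x in M. 0 \<le> n' x \<and> n' x \<le> K"
  shows "\<bar>(LINT x|M. entropy \<epsilon> (a x) (n x)) - (LINT x|M. entropy \<epsilon> (a x) (n' x))\<bar>
     \<le> 2 * (\<bar>ln (\<epsilon> * m)\<bar> + \<bar>ln (K + 2 * B)\<bar>) * (L2norm M (\<lambda>x. n x - n' x) * L2norm M (\<lambda>x. 1::real))"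
proof -
  let ?L = "2 * (\<bar>ln (\<epsilon> * m)\<bar> + \<bar>ln (K + 2 * B)\<bar>)"
  have i: "integrable M (\<lambda>x. entropy \<epsilon> (a x) (n x))" "integrable M (\<lambda>x. entropy \<epsilon> (a x) (n' x))"
    using entropy_integrable[OF less_imp_le[OF \<epsilon>(1)] \<epsilon>(2)] n n' by (auto simp: sq_int_def)
  have one: "sq_int M (\<lambda>x. 1::real)" by (rule sq_int_bounded[where K=1]) auto
  note nn = sq_int_norm_mult[OF sq_int_diff[OF n(1) n'(1)] one]
  have "\<bar>(LINT x|M. entropy \<epsilon> (a x) (n x)) - (LINT x|M. entropy \<epsilon> (a x) (n' x))\<bar>
     = \<bar>LINT x|M. entropy \<epsilon> (a x) (n x) - entropy \<epsilon> (a x) (n' x)\<bar>" using i by simp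
  also have "\<dots> \<le> (LINT x|M. \<bar>entropy \<epsilon> (a x) (n x) - entropy \<epsilon> (a x) (n' x)\<bar>)" by (rule integral_abs_bound)
  also have "\<dots> \<le> (LINT x|M. ?L * (norm (n x - n' x) * norm (1::real)))"
  proof (rule integral_mono_AE)
    show "AE x in M. \<bar>entropy \<epsilon> (a x) (n x) - entropy \<epsilon> (a x) (n' x)\<bar> \<le> ?L * (norm (n x - n' x) * norm (1::real))"
      using n(2) n'(2) a_bounds
    proof eventually_elim
      case (elim x)
      then show ?case using entropy_Lipschitz[OF \<epsilon> m, of "a x" B "n' x" K "n x"] by simp
    qed
  qed (use i nn in auto)
  also have "\<dots> = ?L * (LINT x|M. norm (n x - n' x) * norm (1::real))" by simp
  also have "\<dots> \<le> ?L * (L2norm M (\<lambda>x. n x - n' x) * L2norm M (\<lambda>x. 1::real))"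
    by (intro mult_left_mono Cauchy_Schwarz_norm_integral sq_int_diff n n' one) auto
  finally show ?thesis .
qed

end

section \<open>The entropy inequality\<close>

lemma (in density_bounds) sq_int_log_grad: "sq_int M (\<lambda>x. (1 / a x) *\<^sub>R ga x)"
proof -
  have "sq_int M (\<lambda>x. (1 / max m (a x)) *\<^sub>R ga x)"
    by (rule W1inf_grad_sq_int(2)[OF W1inf_grad_compose[OF a ln_ext(1-3)[OF m]]])
  then show ?thesis by (rule sq_int_AE) (use am in \<open>auto elim!: eventually_mono simp: max_def\<close>)
qed

text \<open>\<open>W = V - VD\<close>, and \<open>- (1 / a) ga\<close> is the gradient of \<open>VD\<close>.\<close>

locale spin_entropy = density_bounds +
  fixes lam \<tau> S :: real and \<sigma>p \<sigma>m :: "'a \<Rightarrow> real" and np nm W :: "real \<Rightarrow> 'a \<Rightarrow> real"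
    and gW :: "real \<Rightarrow> 'a \<Rightarrow> 'a" and Fp Fm :: "real \<Rightarrow> ('a \<Rightarrow> real) \<Rightarrow> real"
  assumes lam: "0 < lam" and tau: "0 < \<tau>" and S: "0 \<le> S"
    and \<sigma>p: "\<sigma>p \<in> borel_measurable M" "AE x in M. 0 \<le> \<sigma>p x \<and> \<sigma>p x \<le> S"
    and \<sigma>m: "\<sigma>m \<in> borel_measurable M" "AE x in M. 0 \<le> \<sigma>m x \<and> \<sigma>m x \<le> S"
    and np: "np \<in> C_L2 \<Omega>" and nm: "nm \<in> C_L2 \<Omega>"
    and np_bounds: "\<And>t. 0 < t \<Longrightarrow> AE x in M. 0 \<le> np t x \<and> np t x \<le> K"
    and nm_bounds: "\<And>t. 0 < t \<Longrightarrow> AE x in M. 0 \<le> nm t x \<and> nm t x \<le> K"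
    and up: "\<And>T. 0 < T \<Longrightarrow> (\<lambda>t x. np t x - a x) \<in> L2_bochner {0<..<T} (H01 \<Omega>) (H1_norm \<Omega>)"
    and um: "\<And>T. 0 < T \<Longrightarrow> (\<lambda>t x. nm t x - a x) \<in> L2_bochner {0<..<T} (H01 \<Omega>) (H1_norm \<Omega>)"
    and W: "\<And>t. 0 < t \<Longrightarrow> H01_grad (W t) (gW t)"
    and Poisson: "\<And>s t \<phi> g\<phi>. 0 < s \<Longrightarrow> 0 < t \<Longrightarrow> H01_grad \<phi> g\<phi> \<Longrightarrow>
      lam\<^sup>2 * (LINT x|M. (gW t x - gW s x) \<bullet> g\<phi> x) = (LINT x|M. ((np t x - np s x) + (nm t x - nm s x)) * \<phi> x)"
    and Fp: "\<And>T. 0 < T \<Longrightarrow> has_time_deriv \<Omega> T np Fp"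
    and Fm: "\<And>T. 0 < T \<Longrightarrow> has_time_deriv \<Omega> T nm Fm"
    and equations: "AE t in lebesgue_on {0<..}. \<forall>\<phi> g\<phi> gu. H01_grad \<phi> g\<phi> \<longrightarrow>
       (H01_grad (\<lambda>x. np t x - a x) gu \<longrightarrow>
          Fp t \<phi> + (LINT x|M. \<sigma>p x * ((gu x + ga x + np t x *\<^sub>R (gW t x - (1 / a x) *\<^sub>R ga x)) \<bullet> g\<phi> x))
            = - (1 / (2 * \<tau>)) * (LINT x|M. (np t x - nm t x) * \<phi> x)) \<and>
       (H01_grad (\<lambda>x. nm t x - a x) gu \<longrightarrow>
          Fm t \<phi> + (LINT x|M. \<sigma>m x * ((gu x + ga x + nm t x *\<^sub>R (gW t x - (1 / a x) *\<^sub>R ga x)) \<bullet> g\<phi> x))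
            = (1 / (2 * \<tau>)) * (LINT x|M. (np t x - nm t x) * \<phi> x))"
begin

text \<open>The times at which the equations may be used and the densities have the right boundary
  values. Almost every positive time is of this kind.\<close>

definition good :: "real \<Rightarrow> bool" where
  "good t \<longleftrightarrow> 0 < t \<and> (\<lambda>x. np t x - a x) \<in> H01 \<Omega> \<and> (\<lambda>x. nm t x - a x) \<in> H01 \<Omega> \<and>
     (\<forall>\<phi> g\<phi> gu. H01_grad \<phi> g\<phi> \<longrightarrow>
       (H01_grad (\<lambda>x. np t x - a x) gu \<longrightarrow>
          Fp t \<phi> + (LINT x|M. \<sigma>p x * ((gu x + ga x + np t x *\<^sub>R (gW t x - (1 / a x) *\<^sub>R ga x)) \<bullet> g\<phi> x))
            = - (1 / (2 * \<tau>)) * (LINT x|M. (np t x - nm t x) * \<phi> x)) \<and>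
       (H01_grad (\<lambda>x. nm t x - a x) gu \<longrightarrow>
          Fm t \<phi> + (LINT x|M. \<sigma>m x * ((gu x + ga x + nm t x *\<^sub>R (gW t x - (1 / a x) *\<^sub>R ga x)) \<bullet> g\<phi> x))
            = (1 / (2 * \<tau>)) * (LINT x|M. (np t x - nm t x) * \<phi> x)))"

abbreviation one :: "'a \<Rightarrow> real" where "one \<equiv> \<lambda>x. 1"

lemma sq_int_one: "sq_int M one"
  by (rule sq_int_bounded[where K=1]) auto

lemma sq_int_np: "0 < t \<Longrightarrow> sq_int M (np t)" "0 < t \<Longrightarrow> sq_int M (nm t)"
  using C_L2_sq_int[OF np] C_L2_sq_int[OF nm] by auto

lemma sq_int_gW: "0 < t \<Longrightarrow> sq_int M (gW t)"
  by (rule H01_grad_sq_int(2)[OF W])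

lemma sq_int_field: "0 < t \<Longrightarrow> sq_int M (\<lambda>x. gW t x - (1 / a x) *\<^sub>R ga x)"
  by (rule sq_int_diff[OF sq_int_gW sq_int_log_grad])

section \<open>Time continuity of the electric field and the drift\<close>

definition drift :: "(real \<Rightarrow> 'a \<Rightarrow> real) \<Rightarrow> real \<Rightarrow> 'a \<Rightarrow> 'a" where
  "drift n t x = n t x *\<^sub>R (gW t x - (1 / a x) *\<^sub>R ga x)"

lemma bounded_abs: "AE x in M. 0 \<le> n x \<and> n x \<le> K \<Longrightarrow> AE x in M. \<bar>n x\<bar> \<le> K"
  by (erule eventually_mono) auto

lemma bounded_diff:
  assumes "AE x in M. 0 \<le> n x \<and> n x \<le> K" "AE x in M. 0 \<le> n' x \<and> n' x \<le> K"
  shows "AE x in M. \<bar>n x - n' x\<bar> \<le> K"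
  using assms by eventually_elim auto

lemma sq_int_drift:
  assumes "0 < t" "sq_int M (n t)" "AE x in M. 0 \<le> n t x \<and> n t x \<le> K"
  shows "sq_int M (drift n t)"
  unfolding drift_def[abs_def]
  by (rule L2norm_bounded_mult(1)[OF sq_int_field[OF assms(1)] sq_int_measurable[OF assms(2)] bounded_abs[OF assms(3)] K])

lemma sq_int_drift_np: "0 < t \<Longrightarrow> sq_int M (drift np t)"
  by (rule sq_int_drift[OF _ sq_int_np(1) np_bounds])

lemma sq_int_drift_nm: "0 < t \<Longrightarrow> sq_int M (drift nm t)"
  by (rule sq_int_drift[OF _ sq_int_np(2) nm_bounds])

text \<open>The difference of the Poisson equations at two times is tested with
  \<open>W t - W s\<close>; the Poincare inequality removes the L2 norm of the test function, and
  one factor \<open>L2norm M (\<lambda>x. gW t x - gW s x)\<close> cancels. Hence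
  \<open>2 * R / lam^2\<close>.\<close>

lemma electric_field_Lipschitz:
  obtains CP where "0 \<le> CP" "\<And>s t. 0 < s \<Longrightarrow> 0 < t \<Longrightarrow> L2norm M (\<lambda>x. gW t x - gW s x)
      \<le> CP * (L2norm M (\<lambda>x. np t x - np s x) + L2norm M (\<lambda>x. nm t x - nm s x))"
proof -
  obtain R where R: "0 < R" "\<Omega> \<subseteq> ball 0 R" using bounded_subset_ballD[OF bd] by blast
  show ?thesis
  proof (rule that[of "2 * R / lam\<^sup>2"])
    show "0 \<le> 2 * R / lam\<^sup>2" using R by simp
    fix s t :: real assume st: "0 < s" "0 < t"
    let ?D = "\<lambda>x. gW t x - gW s x" and ?N = "\<lambda>x. (np t x - np s x) + (nm t x - nm s x)"
    let ?w = "\<lambda>x. W t x - W s x"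
    have w: "H01_grad ?w ?D" by (rule H01_grad_diff[OF W[OF st(2)] W[OF st(1)]])
    note s = H01_grad_sq_int[OF w]
    note sp = sq_int_diff[OF sq_int_np(1)[OF st(2)] sq_int_np(1)[OF st(1)]]
    note sm = sq_int_diff[OF sq_int_np(2)[OF st(2)] sq_int_np(2)[OF st(1)]]
    have N: "L2norm M ?N \<le> L2norm M (\<lambda>x. np t x - np s x) + L2norm M (\<lambda>x. nm t x - nm s x)"
      by (rule L2norm_triangle[OF sp sm])
    have "lam\<^sup>2 * (L2norm M ?D)\<^sup>2 = lam\<^sup>2 * (LINT x|M. ?D x \<bullet> ?D x)" by (simp add: L2norm_sq power2_norm_eq_inner)
    also have "\<dots> = (LINT x|M. ?N x * ?w x)" by (rule Poisson[OF st w])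
    also have "\<dots> = (LINT x|M. ?N x \<bullet> ?w x)" by simp
    also have "\<dots> \<le> L2norm M ?N * L2norm M ?w"
      using Cauchy_Schwarz_integral[OF sq_int_add[OF sp sm] s(1)] by linarith
    also have "\<dots> \<le> L2norm M ?N * (2 * R * L2norm M ?D)"
      by (intro mult_left_mono Poincare[OF w R(2)]) simp
    finally have *: "L2norm M ?D * (lam\<^sup>2 * L2norm M ?D) \<le> L2norm M ?D * (2 * R * L2norm M ?N)"
      by (simp add: power2_eq_square algebra_simps)
    have "L2norm M ?D \<le> 2 * R / lam\<^sup>2 * L2norm M ?N"
    proof (cases "L2norm M ?D = 0")
      case True
      then show ?thesis using R by simp
    next
      case False
      then have "0 < L2norm M ?D" using L2norm_nonneg[of M ?D] by linarith
      then have "lam\<^sup>2 * L2norm M ?D \<le> 2 * R * L2norm M ?N" using * by simp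
      then show ?thesis using lam by (simp add: field_simps)
    qed
    also have "\<dots> \<le> 2 * R / lam\<^sup>2 * (L2norm M (\<lambda>x. np t x - np s x) + L2norm M (\<lambda>x. nm t x - nm s x))"
      using R N by (intro mult_left_mono) auto
    finally show "L2norm M ?D \<le> 2 * R / lam\<^sup>2 * (L2norm M (\<lambda>x. np t x - np s x) + L2norm M (\<lambda>x. nm t x - nm s x))" .
  qed
qed

lemma L2norm_bounded_diff:
  assumes "AE x in M. 0 \<le> n x \<and> n x \<le> K" "AE x in M. 0 \<le> n' x \<and> n' x \<le> K"
  shows "L2norm M (\<lambda>x. n x - n' x) \<le> K * L2norm M one"
  by (rule L2norm_mono[OF sq_int_one _ K]) (use bounded_diff[OF assms] in simp)

text \<open>Comparison with the field at the arbitrary reference time 1: the densities at any two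
  times differ by at most \<open>K\<close>.\<close>

lemma electric_field_bounded:
  obtains GW where "0 \<le> GW" "\<And>t. 0 < t \<Longrightarrow> L2norm M (gW t) \<le> GW"
proof -
  obtain CP where CP: "0 \<le> CP" "\<And>s t. 0 < s \<Longrightarrow> 0 < t \<Longrightarrow> L2norm M (\<lambda>x. gW t x - gW s x)
      \<le> CP * (L2norm M (\<lambda>x. np t x - np s x) + L2norm M (\<lambda>x. nm t x - nm s x))"
    using electric_field_Lipschitz by blast
  show ?thesis
  proof (rule that[of "L2norm M (gW 1) + CP * (K * L2norm M one + K * L2norm M one)"])
    show "0 \<le> L2norm M (gW 1) + CP * (K * L2norm M one + K * L2norm M one)"
      using CP(1) K by (intro add_nonneg_nonneg mult_nonneg_nonneg) auto
    fix t :: real assume t: "0 < t"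
    have "L2norm M (gW t) \<le> L2norm M (gW 1) + L2norm M (\<lambda>x. gW t x - gW 1 x)"
      using L2norm_rev_triangle[OF sq_int_gW[OF t] sq_int_gW[OF zero_less_one]] by linarith
    also have "L2norm M (\<lambda>x. gW t x - gW 1 x) \<le> CP * (L2norm M (\<lambda>x. np t x - np 1 x) + L2norm M (\<lambda>x. nm t x - nm 1 x))"
      by (rule CP(2)) (use t in auto)
    also have "\<dots> \<le> CP * (K * L2norm M one + K * L2norm M one)"
      by (intro mult_left_mono add_mono L2norm_bounded_diff np_bounds nm_bounds t CP(1)) auto
    finally show "L2norm M (gW t) \<le> L2norm M (gW 1) + CP * (K * L2norm M one + K * L2norm M one)" by simp
  qed
qed

lemma density_tendsto:
  assumes "n \<in> C_L2 \<Omega>" "0 < t" "J \<subseteq> {0<..}"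
  shows "((\<lambda>s. L2norm M (\<lambda>x. n s x - n t x)) \<longlongrightarrow> 0) (at t within J)"
  by (rule tendsto_within_subset[OF C_L2_tendsto[OF assms(1)]]) (use assms in auto)

lemma electric_field_tendsto:
  assumes t: "0 < t" and J: "J \<subseteq> {0<..}"
  shows "((\<lambda>s. L2norm M (\<lambda>x. gW s x - gW t x)) \<longlongrightarrow> 0) (at t within J)"
proof -
  obtain CP where CP: "0 \<le> CP" "\<And>s t. 0 < s \<Longrightarrow> 0 < t \<Longrightarrow> L2norm M (\<lambda>x. gW t x - gW s x)
      \<le> CP * (L2norm M (\<lambda>x. np t x - np s x) + L2norm M (\<lambda>x. nm t x - nm s x))"
    using electric_field_Lipschitz by blast
  have "((\<lambda>s. CP * (L2norm M (\<lambda>x. np s x - np t x) + L2norm M (\<lambda>x. nm s x - nm t x))) \<longlongrightarrow> CP * (0 + 0)) (at t within J)"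
    by (intro tendsto_intros density_tendsto np nm t J)
  then have l: "((\<lambda>s. CP * (L2norm M (\<lambda>x. np s x - np t x) + L2norm M (\<lambda>x. nm s x - nm t x))) \<longlongrightarrow> 0) (at t within J)" by simp
  have "\<forall>\<^sub>F s in at t within J. s \<in> J" by (simp add: eventually_at_filter)
  then have "\<forall>\<^sub>F s in at t within J. norm (L2norm M (\<lambda>x. gW s x - gW t x))
      \<le> CP * (L2norm M (\<lambda>x. np s x - np t x) + L2norm M (\<lambda>x. nm s x - nm t x))"
  proof eventually_elim
    case (elim s)
    then have "0 < s" using J by auto
    from CP(2)[OF t this] show ?case by simp
  qed
  from Lim_null_comparison[OF this l] show ?thesis .
qed

text \<open>The difference splits into \<open>n s\<close> times the change of the field and the
  change of \<open>n\<close> times the field at \<open>t\<close>. The first is controlled by the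
  bound \<open>K\<close>; in the second the field is only square integrable, which is where the
  truncation lemma \<open>L2norm_bounded_mult_small\<close> comes in.\<close>

lemma drift_tendsto:
  assumes n: "n \<in> C_L2 \<Omega>" "\<And>t. 0 < t \<Longrightarrow> AE x in M. 0 \<le> n t x \<and> n t x \<le> K" and t: "0 < t" and J: "J \<subseteq> {0<..}"
  shows "((\<lambda>s. L2norm M (\<lambda>x. drift n s x - drift n t x)) \<longlongrightarrow> 0) (at t within J)"
proof (rule tendstoI)
  fix e :: real assume e: "0 < e"
  have sn: "sq_int M (n s)" if "0 < s" for s using C_L2_sq_int[OF n(1)] that by simp
  have "0 < e / 2" using e by simp
  from L2norm_bounded_mult_small[OF sq_int_field[OF t] this K]
  obtain q where q: "0 \<le> q" "\<And>f. f \<in> borel_measurable M \<Longrightarrow> sq_int M f \<Longrightarrow> AE x in M. \<bar>f x\<bar> \<le> K \<Longrightarrow>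
    L2norm M (\<lambda>x. f x *\<^sub>R (gW t x - (1 / a x) *\<^sub>R ga x)) \<le> q * L2norm M f + e / 2" by blast
  have "((\<lambda>s. K * L2norm M (\<lambda>x. gW s x - gW t x) + q * L2norm M (\<lambda>x. n s x - n t x)) \<longlongrightarrow> K * 0 + q * 0) (at t within J)"
    by (intro tendsto_intros electric_field_tendsto density_tendsto n t J)
  then have "\<forall>\<^sub>F s in at t within J. K * L2norm M (\<lambda>x. gW s x - gW t x) + q * L2norm M (\<lambda>x. n s x - n t x) < e / 2"
    using e by (intro order_tendstoD) auto
  moreover have "\<forall>\<^sub>F s in at t within J. s \<in> J" by (simp add: eventually_at_filter)
  ultimately show "\<forall>\<^sub>F s in at t within J. dist (L2norm M (\<lambda>x. drift n s x - drift n t x)) 0 < e"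
  proof eventually_elim
    case (elim s)
    then have s: "0 < s" using J by auto
    note d1 = sq_int_diff[OF sq_int_gW[OF s] sq_int_gW[OF t]]
    note d2 = sq_int_diff[OF sn[OF s] sn[OF t]]
    note b1 = L2norm_bounded_mult[OF d1 sq_int_measurable[OF sn[OF s]] bounded_abs[OF n(2)[OF s]] K]
    note b2 = L2norm_bounded_mult(1)[OF sq_int_field[OF t] sq_int_measurable[OF d2] bounded_diff[OF n(2)[OF s] n(2)[OF t]] K]
    have eq: "(\<lambda>x. drift n s x - drift n t x)
        = (\<lambda>x. n s x *\<^sub>R (gW s x - gW t x) + (n s x - n t x) *\<^sub>R (gW t x - (1 / a x) *\<^sub>R ga x))"
    proof
      fix x
      show "drift n s x - drift n t x = n s x *\<^sub>R (gW s x - gW t x) + (n s x - n t x) *\<^sub>R (gW t x - (1 / a x) *\<^sub>R ga x)"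
        unfolding drift_def by (simp only: scaleR_diff_left scaleR_diff_right) simp
    qed
    have "L2norm M (\<lambda>x. drift n s x - drift n t x)
        \<le> L2norm M (\<lambda>x. n s x *\<^sub>R (gW s x - gW t x)) + L2norm M (\<lambda>x. (n s x - n t x) *\<^sub>R (gW t x - (1 / a x) *\<^sub>R ga x))"
      unfolding eq by (rule L2norm_triangle[OF b1(1) b2])
    also have "\<dots> \<le> K * L2norm M (\<lambda>x. gW s x - gW t x) + (q * L2norm M (\<lambda>x. n s x - n t x) + e / 2)"
      by (intro add_mono b1(2) q(2) sq_int_measurable[OF d2] d2 bounded_diff[OF n(2)[OF s] n(2)[OF t]])
    also have "\<dots> < e" using elim by linarith
    finally show ?case by simp
  qed
qed

section \<open>The energy and its test functions at a fixed time\<close>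

definition regularised_energy :: "real \<Rightarrow> real \<Rightarrow> real" where
  "regularised_energy \<epsilon> t = (LINT x|M. entropy \<epsilon> (a x) (np t x)) + (LINT x|M. entropy \<epsilon> (a x) (nm t x)) + lam\<^sup>2 / 2 * (L2norm M (gW t))\<^sup>2"

lemma continuous_on_regularised_energy:
  assumes \<epsilon>: "0 < \<epsilon>" "\<epsilon> \<le> 1"
  shows "continuous_on {0<..} (regularised_energy \<epsilon>)"
  unfolding continuous_on
proof
  fix t :: real assume "t \<in> {0<..}"
  then have t: "0 < t" by simp
  have c: "((\<lambda>s. LINT x|M. entropy \<epsilon> (a x) (n s x)) \<longlongrightarrow> (LINT x|M. entropy \<epsilon> (a x) (n t x))) (at t within {0<..})"
    if n: "n \<in> C_L2 \<Omega>" "\<And>t. 0 < t \<Longrightarrow> AE x in M. 0 \<le> n t x \<and> n t x \<le> K" for n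
  proof (rule tendsto_dist_iff[THEN iffD2], rule Lim_null_comparison)
    let ?L = "2 * (\<bar>ln (\<epsilon> * m)\<bar> + \<bar>ln (K + 2 * B)\<bar>)"
    have sn: "sq_int M (n s)" if "0 < s" for s using C_L2_sq_int[OF n(1)] that by simp
    have "\<forall>\<^sub>F s in at t within {0<..}. s \<in> {0<..}" by (simp add: eventually_at_filter)
    then show "\<forall>\<^sub>F s in at t within {0<..}. norm (dist (LINT x|M. entropy \<epsilon> (a x) (n s x)) (LINT x|M. entropy \<epsilon> (a x) (n t x)))
        \<le> ?L * (L2norm M (\<lambda>x. n s x - n t x) * L2norm M one)"
    proof eventually_elim
      case (elim s)
      then have s: "0 < s" by simp
      show ?case
        using entropy_integral_Lipschitz[OF \<epsilon> sn[OF s] n(2)[OF s] sn[OF t] n(2)[OF t]] by (simp add: dist_real_def)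
    qed
    have "((\<lambda>s. ?L * (L2norm M (\<lambda>x. n s x - n t x) * L2norm M one)) \<longlongrightarrow> ?L * (0 * L2norm M one)) (at t within {0<..})"
      by (intro tendsto_intros density_tendsto n t) auto
    then show "((\<lambda>s. ?L * (L2norm M (\<lambda>x. n s x - n t x) * L2norm M one)) \<longlongrightarrow> 0) (at t within {0<..})" by simp
  qed
  have g: "((\<lambda>s. L2norm M (gW s)) \<longlongrightarrow> L2norm M (gW t)) (at t within {0<..})"
  proof (rule tendsto_dist_iff[THEN iffD2], rule Lim_null_comparison[OF _ electric_field_tendsto[OF t order_refl]])
    have "\<forall>\<^sub>F s in at t within {0<..}. s \<in> {0<..}" by (simp add: eventually_at_filter)
    then show "\<forall>\<^sub>F s in at t within {0<..}. norm (dist (L2norm M (gW s)) (L2norm M (gW t))) \<le> L2norm M (\<lambda>x. gW s x - gW t x)"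
      by eventually_elim (use L2norm_rev_triangle[OF sq_int_gW sq_int_gW] t in \<open>simp add: dist_real_def\<close>)
  qed
  show "(regularised_energy \<epsilon> \<longlongrightarrow> regularised_energy \<epsilon> t) (at t within {0<..})"
    unfolding regularised_energy_def by (intro tendsto_intros c g np nm np_bounds nm_bounds)
qed

text \<open>Convexity of the square, \<open>\<bar>x\<bar>^2 - \<bar>y\<bar>^2 \<le> 2 (x - y)
  \<bullet> x\<close> for the fields \<open>x\<close> at \<open>t\<close> and \<open>y\<close> at
  \<open>s\<close>, followed by the difference of the Poisson equations tested with
  \<open>W t\<close>.\<close>

lemma electrostatic_energy_convex:
  assumes "0 < s" "0 < t"
  shows "lam\<^sup>2 / 2 * (L2norm M (gW t))\<^sup>2 - lam\<^sup>2 / 2 * (L2norm M (gW s))\<^sup>2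
    \<le> (LINT x|M. (np t x - np s x) * W t x) + (LINT x|M. (nm t x - nm s x) * W t x)"
proof -
  note g = sq_int_gW[OF assms(1)] sq_int_gW[OF assms(2)]
  note W1 = H01_grad_sq_int(1)[OF W[OF assms(2)]]
  have i: "integrable M (\<lambda>x. gW t x \<bullet> gW t x)" "integrable M (\<lambda>x. gW s x \<bullet> gW s x)" "integrable M (\<lambda>x. gW s x \<bullet> gW t x)"
    by (intro sq_int_inner_integrable g)+
  have "(L2norm M (gW t))\<^sup>2 - (L2norm M (gW s))\<^sup>2 = (LINT x|M. gW t x \<bullet> gW t x - gW s x \<bullet> gW s x)"
    using i by (simp add: L2norm_sq power2_norm_eq_inner)
  also have "\<dots> \<le> (LINT x|M. 2 * ((gW t x - gW s x) \<bullet> gW t x))"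
  proof (rule integral_mono)
    show "integrable M (\<lambda>x. gW t x \<bullet> gW t x - gW s x \<bullet> gW s x)" using i by simp
    show "integrable M (\<lambda>x. 2 * ((gW t x - gW s x) \<bullet> gW t x))" using i by (simp add: inner_diff_left)
    fix x
    have "0 \<le> (gW t x - gW s x) \<bullet> (gW t x - gW s x)" by simp
    then show "gW t x \<bullet> gW t x - gW s x \<bullet> gW s x \<le> 2 * ((gW t x - gW s x) \<bullet> gW t x)"
      by (simp add: inner_diff_left inner_diff_right inner_commute[of "gW s x" "gW t x"])
  qed
  also have "\<dots> = 2 * (LINT x|M. (gW t x - gW s x) \<bullet> gW t x)" by simp
  finally have "lam\<^sup>2 / 2 * ((L2norm M (gW t))\<^sup>2 - (L2norm M (gW s))\<^sup>2) \<le> lam\<^sup>2 / 2 * (2 * (LINT x|M. (gW t x - gW s x) \<bullet> gW t x))"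
    by (rule mult_left_mono) simp
  also have "\<dots> = lam\<^sup>2 * (LINT x|M. (gW t x - gW s x) \<bullet> gW t x)" by simp
  also have "\<dots> = (LINT x|M. ((np t x - np s x) + (nm t x - nm s x)) * W t x)"
    by (rule Poisson[OF assms W[OF assms(2)]])
  also have "\<dots> = (LINT x|M. (np t x - np s x) * W t x) + (LINT x|M. (nm t x - nm s x) * W t x)"
  proof -
    have "integrable M (\<lambda>x. (np t x - np s x) * W t x)" "integrable M (\<lambda>x. (nm t x - nm s x) * W t x)"
      by (intro sq_int_mult_integrable sq_int_diff sq_int_np W1 assms)+
    then show ?thesis by (simp add: distrib_right)
  qed
  finally show ?thesis by (simp add: right_diff_distrib)
qed

text \<open>The summand 1 absorbs the contribution of \<open>W\<close> to the test functions, which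
  is bounded but not small, so that their norms are multiples of
  \<open>density_norm t\<close>.\<close>

definition density_norm :: "real \<Rightarrow> real" where
  "density_norm t = 1 + H1_norm \<Omega> (\<lambda>x. np t x - a x) + H1_norm \<Omega> (\<lambda>x. nm t x - a x)"

lemma density_norm_ge: "1 \<le> density_norm t" "H1_norm \<Omega> (\<lambda>x. np t x - a x) \<le> density_norm t" "H1_norm \<Omega> (\<lambda>x. nm t x - a x) \<le> density_norm t"
  using H1_norm_nonneg[of "\<lambda>x. np t x - a x"] H1_norm_nonneg[of "\<lambda>x. nm t x - a x"] unfolding density_norm_def by linarith+

text \<open>The test functions are the regularised logarithms plus \<open>W t\<close>. Both
  properties needed later refer to this one pair: the time derivatives at \<open>t\<close> nearly
  dissipate along it, each flux losing at most \<open>S * B * \<epsilon> / 4 * GW^2\<close>, and by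
  convexity it bounds the energy increment from every \<open>s\<close>.\<close>

lemma electrochemical_potentials:
  assumes \<epsilon>: "0 < \<epsilon>" "\<epsilon> \<le> 1" and t: "good t"
    and GW: "0 \<le> GW" "\<And>t. 0 < t \<Longrightarrow> L2norm M (gW t) \<le> GW" and WW: "0 \<le> WW" "\<And>t. 0 < t \<Longrightarrow> H1_norm \<Omega> (W t) \<le> WW"
  obtains \<psi>p gp \<psi>m gm where "H01_grad \<psi>p gp" "H01_grad \<psi>m gm"
    "H1_norm \<Omega> \<psi>p \<le> (3 * Bw / \<epsilon> + WW) * density_norm t" "H1_norm \<Omega> \<psi>m \<le> (3 * Bw / \<epsilon> + WW) * density_norm t"
    "Fp t \<psi>p + Fm t \<psi>m \<le> S * B * \<epsilon> / 2 * GW\<^sup>2"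
    "\<And>s. 0 < s \<Longrightarrow> regularised_energy \<epsilon> t - regularised_energy \<epsilon> s \<le> (LINT x|M. (np t x - np s x) * \<psi>p x) + (LINT x|M. (nm t x - nm s x) * \<psi>m x)"
proof -
  have t0: "0 < t" using t by (simp add: good_def)
  have upH: "H01_grad (\<lambda>x. np t x - a x) (wgrad \<Omega> (\<lambda>x. np t x - a x))" (is "H01_grad _ ?gup")
    using t H01_imp_H01_grad unfolding good_def by blast
  have umH: "H01_grad (\<lambda>x. nm t x - a x) (wgrad \<Omega> (\<lambda>x. nm t x - a x))" (is "H01_grad _ ?gum")
    using t H01_imp_H01_grad unfolding good_def by blast
  note bp = np_bounds[OF t0] and bm = nm_bounds[OF t0]
  have bp0: "AE x in M. 0 \<le> np t x" using bp by eventually_elim auto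
  have bm0: "AE x in M. 0 \<le> nm t x" using bm by eventually_elim auto
  obtain \<phi>p g\<phi>p gvp where \<phi>p: "H01_grad \<phi>p g\<phi>p" "AE x in M. \<phi>p x = ln (np t x + \<epsilon> * a x) - ln ((1 + \<epsilon>) * a x)"
    "AE x in M. g\<phi>p x = (1 / (\<epsilon> + np t x / a x)) *\<^sub>R gvp x"
    "AE x in M. \<forall>h. ?gup x + ga x + np t x *\<^sub>R (h - (1 / a x) *\<^sub>R ga x) = a x *\<^sub>R (gvp x + (np t x / a x) *\<^sub>R h)"
    "H1_norm \<Omega> \<phi>p \<le> (3 * Bw / \<epsilon>) * H1_norm \<Omega> (\<lambda>x. np t x - a x)"
    using quasi_Fermi_potential[OF upH bp0 \<epsilon>(1)] by blast
  obtain \<phi>m g\<phi>m gvm where \<phi>m: "H01_grad \<phi>m g\<phi>m" "AE x in M. \<phi>m x = ln (nm t x + \<epsilon> * a x) - ln ((1 + \<epsilon>) * a x)"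
    "AE x in M. g\<phi>m x = (1 / (\<epsilon> + nm t x / a x)) *\<^sub>R gvm x"
    "AE x in M. \<forall>h. ?gum x + ga x + nm t x *\<^sub>R (h - (1 / a x) *\<^sub>R ga x) = a x *\<^sub>R (gvm x + (nm t x / a x) *\<^sub>R h)"
    "H1_norm \<Omega> \<phi>m \<le> (3 * Bw / \<epsilon>) * H1_norm \<Omega> (\<lambda>x. nm t x - a x)"
    using quasi_Fermi_potential[OF umH bm0 \<epsilon>(1)] by blast
  note Wt = W[OF t0]
  define \<psi>p where "\<psi>p x = \<phi>p x + W t x" for x
  define \<psi>m where "\<psi>m x = \<phi>m x + W t x" for x
  define gp where "gp x = g\<phi>p x + gW t x" for x
  define gm where "gm x = g\<phi>m x + gW t x" for x
  have p: "H01_grad \<psi>p gp" unfolding \<psi>p_def[abs_def] gp_def[abs_def] by (rule H01_grad_add[OF \<phi>p(1) Wt])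
  have mm: "H01_grad \<psi>m gm" unfolding \<psi>m_def[abs_def] gm_def[abs_def] by (rule H01_grad_add[OF \<phi>m(1) Wt])
  note sp = H01_grad_sq_int[OF p] and sm = H01_grad_sq_int[OF mm]
  have Bw\<epsilon>: "0 \<le> 3 * Bw / \<epsilon>" using Bw_nonneg \<epsilon> by simp
  have norm_le: "H1_norm \<Omega> (\<lambda>x. \<phi> x + W t x) \<le> (3 * Bw / \<epsilon> + WW) * density_norm t"
    if "\<phi> \<in> H01 \<Omega>" "H1_norm \<Omega> \<phi> \<le> (3 * Bw / \<epsilon>) * N" "N \<le> density_norm t" for \<phi> N
  proof -
    have "H1_norm \<Omega> (\<lambda>x. \<phi> x + W t x) \<le> H1_norm \<Omega> \<phi> + H1_norm \<Omega> (W t)"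
      by (rule H1_norm_triangle[OF that(1) H01_grad_imp_H01[OF Wt]])
    also have "\<dots> \<le> (3 * Bw / \<epsilon>) * N + WW" using that(2) WW(2)[OF t0] by linarith
    also have "\<dots> \<le> (3 * Bw / \<epsilon>) * density_norm t + WW * density_norm t"
      using that(3) Bw\<epsilon> WW(1) density_norm_ge(1)[of t] by (intro add_mono mult_left_mono) (auto simp: mult_le_cancel_left1)
    finally show ?thesis by (simp add: distrib_right)
  qed
  show ?thesis
  proof (rule that[OF p mm])
    show "H1_norm \<Omega> \<psi>p \<le> (3 * Bw / \<epsilon> + WW) * density_norm t" unfolding \<psi>p_def[abs_def]
      by (rule norm_le[OF H01_grad_imp_H01[OF \<phi>p(1)] \<phi>p(5) density_norm_ge(2)])
    show "H1_norm \<Omega> \<psi>m \<le> (3 * Bw / \<epsilon> + WW) * density_norm t" unfolding \<psi>m_def[abs_def]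
      by (rule norm_le[OF H01_grad_imp_H01[OF \<phi>m(1)] \<phi>m(5) density_norm_ge(3)])
    let ?Jp = "\<lambda>x. ?gup x + ga x + np t x *\<^sub>R (gW t x - (1 / a x) *\<^sub>R ga x)"
    let ?Jm = "\<lambda>x. ?gum x + ga x + nm t x *\<^sub>R (gW t x - (1 / a x) *\<^sub>R ga x)"
    have eqp: "Fp t \<psi>p + (LINT x|M. \<sigma>p x * (?Jp x \<bullet> gp x)) = - (1 / (2 * \<tau>)) * (LINT x|M. (np t x - nm t x) * \<psi>p x)"
      using t p upH unfolding good_def by blast
    have eqm: "Fm t \<psi>m + (LINT x|M. \<sigma>m x * (?Jm x \<bullet> gm x)) = (1 / (2 * \<tau>)) * (LINT x|M. (np t x - nm t x) * \<psi>m x)"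
      using t mm umH unfolding good_def by blast
    have Jp: "sq_int M ?Jp" and Jm: "sq_int M ?Jm"
      using sq_int_add[OF sq_int_add[OF H01_grad_sq_int(2)[OF upH] W1inf_grad_sq_int(2)[OF a]] sq_int_drift_np[OF t0]]
        sq_int_add[OF sq_int_add[OF H01_grad_sq_int(2)[OF umH] W1inf_grad_sq_int(2)[OF a]] sq_int_drift_nm[OF t0]]
      unfolding drift_def .
    have "- (S * B * \<epsilon> / 4 * (L2norm M (gW t))\<^sup>2) \<le> (LINT x|M. \<sigma>p x * (?Jp x \<bullet> (g\<phi>p x + gW t x)))"
      by (rule dissipation_bound[OF \<sigma>p \<epsilon>(1) bp0 Jp _ sq_int_gW[OF t0] H01_grad_sq_int(2)[OF \<phi>p(1)] \<phi>p(3)])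
         (use \<phi>p(4) in \<open>eventually_elim, blast\<close>)
    then have dp: "- (S * B * \<epsilon> / 4 * (L2norm M (gW t))\<^sup>2) \<le> (LINT x|M. \<sigma>p x * (?Jp x \<bullet> gp x))" by (simp only: gp_def)
    have "- (S * B * \<epsilon> / 4 * (L2norm M (gW t))\<^sup>2) \<le> (LINT x|M. \<sigma>m x * (?Jm x \<bullet> (g\<phi>m x + gW t x)))"
      by (rule dissipation_bound[OF \<sigma>m \<epsilon>(1) bm0 Jm _ sq_int_gW[OF t0] H01_grad_sq_int(2)[OF \<phi>m(1)] \<phi>m(3)])
         (use \<phi>m(4) in \<open>eventually_elim, blast\<close>)
    then have dm: "- (S * B * \<epsilon> / 4 * (L2norm M (gW t))\<^sup>2) \<le> (LINT x|M. \<sigma>m x * (?Jm x \<bullet> gm x))" by (simp only: gm_def)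
    have i: "integrable M (\<lambda>x. (np t x - nm t x) * \<psi>p x)" "integrable M (\<lambda>x. (np t x - nm t x) * \<psi>m x)"
      by (intro sq_int_mult_integrable sq_int_diff sq_int_np t0 sp sm)+
    \<comment> \<open>The reaction term: \<open>W t\<close> and
      \<open>ln ((1 + \<epsilon>) * a x)\<close> cancel in \<open>\<psi>p - \<psi>m\<close>, which
      leaves a difference of logarithms with the sign of \<open>np - nm\<close>.\<close>
    have "0 \<le> (LINT x|M. (np t x - nm t x) * \<psi>p x - (np t x - nm t x) * \<psi>m x)"
    proof (rule integral_nonneg_AE)
      show "AE x in M. 0 \<le> (np t x - nm t x) * \<psi>p x - (np t x - nm t x) * \<psi>m x"
        using \<phi>p(2) \<phi>m(2) bp0 bm0 am
      proof eventually_elim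
        case (elim x)
        have "0 < \<epsilon> * a x" using elim m \<epsilon> by simp
        then have pos: "0 < np t x + \<epsilon> * a x" "0 < nm t x + \<epsilon> * a x" using elim by auto
        have "(np t x - nm t x) * \<psi>p x - (np t x - nm t x) * \<psi>m x
            = (np t x - nm t x) * (ln (np t x + \<epsilon> * a x) - ln (nm t x + \<epsilon> * a x))"
          using elim by (simp add: \<psi>p_def \<psi>m_def right_diff_distrib[symmetric])
        also have "0 \<le> \<dots>"
        proof (cases "nm t x \<le> np t x")
          case True
          then show ?thesis using pos by (intro mult_nonneg_nonneg) auto
        next
          case False
          then show ?thesis using pos by (intro mult_nonpos_nonpos) auto
        qed
        finally show ?case .
      qed
    qed
    then have "0 \<le> (LINT x|M. (np t x - nm t x) * \<psi>p x) - (LINT x|M. (np t x - nm t x) * \<psi>m x)" using i by simp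
    then have r: "0 \<le> 1 / (2 * \<tau>) * ((LINT x|M. (np t x - nm t x) * \<psi>p x) - (LINT x|M. (np t x - nm t x) * \<psi>m x))"
      using tau by (intro mult_nonneg_nonneg) auto
    have "Fp t \<psi>p + Fm t \<psi>m \<le> S * B * \<epsilon> / 2 * (L2norm M (gW t))\<^sup>2"
      using eqp eqm dp dm r by (simp add: right_diff_distrib)
    also have "\<dots> \<le> S * B * \<epsilon> / 2 * GW\<^sup>2"
      using S B \<epsilon> GW(2)[OF t0] by (intro mult_left_mono power_mono) auto
    finally show "Fp t \<psi>p + Fm t \<psi>m \<le> S * B * \<epsilon> / 2 * GW\<^sup>2" .
    fix s :: real assume s: "0 < s"
    have 1: "(LINT x|M. entropy \<epsilon> (a x) (np t x)) - (LINT x|M. entropy \<epsilon> (a x) (np s x)) \<le> (LINT x|M. (np t x - np s x) * \<phi>p x)"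
      by (rule entropy_integral_convex[OF \<epsilon> sq_int_np(1)[OF t0] bp sq_int_np(1)[OF s] np_bounds[OF s] H01_grad_sq_int(1)[OF \<phi>p(1)] \<phi>p(2)])
    have 2: "(LINT x|M. entropy \<epsilon> (a x) (nm t x)) - (LINT x|M. entropy \<epsilon> (a x) (nm s x)) \<le> (LINT x|M. (nm t x - nm s x) * \<phi>m x)"
      by (rule entropy_integral_convex[OF \<epsilon> sq_int_np(2)[OF t0] bm sq_int_np(2)[OF s] nm_bounds[OF s] H01_grad_sq_int(1)[OF \<phi>m(1)] \<phi>m(2)])
    have j: "integrable M (\<lambda>x. (np t x - np s x) * \<phi>p x)" "integrable M (\<lambda>x. (nm t x - nm s x) * \<phi>m x)"
      "integrable M (\<lambda>x. (np t x - np s x) * W t x)" "integrable M (\<lambda>x. (nm t x - nm s x) * W t x)"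
      by (intro sq_int_mult_integrable sq_int_diff sq_int_np t0 s H01_grad_sq_int(1)[OF \<phi>p(1)] H01_grad_sq_int(1)[OF \<phi>m(1)] H01_grad_sq_int(1)[OF Wt])+
    have "(LINT x|M. (np t x - np s x) * \<psi>p x) = (LINT x|M. (np t x - np s x) * \<phi>p x) + (LINT x|M. (np t x - np s x) * W t x)"
      "(LINT x|M. (nm t x - nm s x) * \<psi>m x) = (LINT x|M. (nm t x - nm s x) * \<phi>m x) + (LINT x|M. (nm t x - nm s x) * W t x)"
      using j by (simp_all add: \<psi>p_def \<psi>m_def distrib_left)
    then show "regularised_energy \<epsilon> t - regularised_energy \<epsilon> s \<le> (LINT x|M. (np t x - np s x) * \<psi>p x) + (LINT x|M. (nm t x - nm s x) * \<psi>m x)"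
      using 1 2 electrostatic_energy_convex[OF s t0] unfolding regularised_energy_def by linarith
  qed
qed

section \<open>Dependence of the time derivatives on time\<close>

lemma functional_difference:
  assumes \<sigma>: "\<sigma> \<in> borel_measurable M" "AE x in M. 0 \<le> \<sigma> x \<and> \<sigma> x \<le> S"
    and J: "sq_int M J" "sq_int M J'" and q: "sq_int M q" "sq_int M q'" and \<psi>: "H01_grad \<psi> g"
    and eq: "f + (LINT x|M. \<sigma> x * (J x \<bullet> g x)) = c * (LINT x|M. q x * \<psi> x)"
      "f' + (LINT x|M. \<sigma> x * (J' x \<bullet> g x)) = c * (LINT x|M. q' x * \<psi> x)"
  shows "f - f' \<le> (S * L2norm M (\<lambda>x. J x - J' x) + \<bar>c\<bar> * L2norm M (\<lambda>x. q x - q' x)) * H1_norm \<Omega> \<psi>"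
proof -
  note s = H01_grad_sq_int[OF \<psi>]
  have N: "L2norm M \<psi> \<le> H1_norm \<Omega> \<psi>" "L2norm M g \<le> H1_norm \<Omega> \<psi>"
    using H1_norm_H01_grad[OF \<psi>] by (auto intro: real_le_rsqrt)
  have bs: "AE x in M. \<bar>\<sigma> x\<bar> \<le> S" using \<sigma>(2) by eventually_elim auto
  note bJ = L2norm_bounded_mult[OF _ \<sigma>(1) bs S]
  have iJ: "integrable M (\<lambda>x. \<sigma> x * (J x \<bullet> g x))" if "sq_int M J" for J
    using sq_int_inner_integrable[OF bJ(1)[OF that] s(2)] by simp
  have "(LINT x|M. \<sigma> x * (J' x \<bullet> g x)) - (LINT x|M. \<sigma> x * (J x \<bullet> g x)) = - (LINT x|M. (\<sigma> x *\<^sub>R (J x - J' x)) \<bullet> g x)"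
  proof -
    have "(LINT x|M. (\<sigma> x *\<^sub>R (J x - J' x)) \<bullet> g x) = (LINT x|M. \<sigma> x * (J x \<bullet> g x) - \<sigma> x * (J' x \<bullet> g x))"
      by (intro Bochner_Integration.integral_cong) (auto simp: inner_diff_left right_diff_distrib)
    then show ?thesis using iJ[OF J(1)] iJ[OF J(2)] by simp
  qed
  also have "\<dots> \<le> L2norm M (\<lambda>x. \<sigma> x *\<^sub>R (J x - J' x)) * L2norm M g"
    using Cauchy_Schwarz_integral[OF bJ(1)[OF sq_int_diff[OF J]] s(2)] by linarith
  also have "\<dots> \<le> (S * L2norm M (\<lambda>x. J x - J' x)) * H1_norm \<Omega> \<psi>"
    by (intro mult_mono bJ(2) sq_int_diff J N) (auto simp: S)
  finally have 1: "(LINT x|M. \<sigma> x * (J' x \<bullet> g x)) - (LINT x|M. \<sigma> x * (J x \<bullet> g x)) \<le> (S * L2norm M (\<lambda>x. J x - J' x)) * H1_norm \<Omega> \<psi>" .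
  have "c * (LINT x|M. q x * \<psi> x) - c * (LINT x|M. q' x * \<psi> x) = c * (LINT x|M. (q x - q' x) \<bullet> \<psi> x)"
    using sq_int_mult_integrable[OF q(1) s(1)] sq_int_mult_integrable[OF q(2) s(1)]
    by (simp add: left_diff_distrib right_diff_distrib[symmetric])
  also have "\<dots> \<le> \<bar>c\<bar> * \<bar>LINT x|M. (q x - q' x) \<bullet> \<psi> x\<bar>" unfolding abs_mult[symmetric] by simp
  also have "\<dots> \<le> \<bar>c\<bar> * (L2norm M (\<lambda>x. q x - q' x) * H1_norm \<Omega> \<psi>)"
    using Cauchy_Schwarz_integral[OF sq_int_diff[OF q] s(1)] mult_left_mono[OF N(1), of "L2norm M (\<lambda>x. q x - q' x)"]
    by (intro mult_left_mono) auto
  finally have 2: "c * (LINT x|M. q x * \<psi> x) - c * (LINT x|M. q' x * \<psi> x) \<le> \<bar>c\<bar> * (L2norm M (\<lambda>x. q x - q' x) * H1_norm \<Omega> \<psi>)" .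
  show ?thesis using eq 1 2 by (simp add: distrib_right)
qed

text \<open>Gathers those ingredients of the equations that are continuous in time with values in
  L2. The gradients of the densities are absent, since they are only square integrable in time;
  their distance is tracked separately through \<open>H1_norm\<close>.\<close>

definition modulus :: "real \<Rightarrow> real \<Rightarrow> real" where
  "modulus s t = L2norm M (\<lambda>x. drift np s x - drift np t x) + L2norm M (\<lambda>x. drift nm s x - drift nm t x)
    + L2norm M (\<lambda>x. np s x - np t x) + L2norm M (\<lambda>x. nm s x - nm t x)"

lemma modulus_nonneg: "0 \<le> modulus s t"
  by (simp add: modulus_def)

lemma modulus_small:
  assumes "0 < l" "0 < e"
  obtains \<delta> where "0 < \<delta>" "\<And>s t. s \<in> {l..u} \<Longrightarrow> t \<in> {l..u} \<Longrightarrow> \<bar>s - t\<bar> < \<delta> \<Longrightarrow> modulus s t < e"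
proof (rule pseudometric_uniformly_continuous[of "{l..u}" modulus e])
  have pos: "0 < t" if "t \<in> {l..u}" for t using that assms by auto
  note sd = sq_int_drift_np sq_int_drift_nm
  show "modulus s t = modulus t s" for s t
    unfolding modulus_def
    using L2norm_minus_commute[of M "drift np s"] L2norm_minus_commute[of M "drift nm s"]
      L2norm_minus_commute[of M "np s"] L2norm_minus_commute[of M "nm s"] by simp
  show "modulus s t \<le> modulus s r + modulus r t" if "s \<in> {l..u}" "t \<in> {l..u}" "r \<in> {l..u}" for s t r
  proof -
    have p: "0 < s" "0 < t" "0 < r" using that pos by auto
    show ?thesis
      unfolding modulus_def
      using L2norm_triangle3[OF sd(1)[OF p(1)] sd(1)[OF p(3)] sd(1)[OF p(2)]]
        L2norm_triangle3[OF sd(2)[OF p(1)] sd(2)[OF p(3)] sd(2)[OF p(2)]]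
        L2norm_triangle3[OF sq_int_np(1)[OF p(1)] sq_int_np(1)[OF p(3)] sq_int_np(1)[OF p(2)]]
        L2norm_triangle3[OF sq_int_np(2)[OF p(1)] sq_int_np(2)[OF p(3)] sq_int_np(2)[OF p(2)]]
      by linarith
  qed
  show "((\<lambda>s. modulus s t) \<longlongrightarrow> 0) (at t within {l..u})" if "t \<in> {l..u}" for t
  proof -
    have J: "{l..u} \<subseteq> {0<..}" using assms by auto
    have "((\<lambda>s. modulus s t) \<longlongrightarrow> 0 + 0 + 0 + 0) (at t within {l..u})"
      unfolding modulus_def
      by (intro tendsto_add drift_tendsto density_tendsto np nm np_bounds nm_bounds pos[OF that] J)
    then show ?thesis by simp
  qed
  show "modulus t t = 0" for t by (simp add: modulus_def L2norm_def)
qed (use assms that in auto)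

text \<open>The equations at two times are subtracted with the same test functions, so only fluxes
  and reaction terms differ. Each species is bounded by the common sum
  \<open>D + D' + modulus r t\<close>, and the factor 2 counts the species.\<close>

lemma total_functional_difference:
  assumes r: "good r" and t: "good t" and \<psi>p: "H01_grad \<psi>p gp" and \<psi>m: "H01_grad \<psi>m gm"
    and N: "H1_norm \<Omega> \<psi>p \<le> N" "H1_norm \<Omega> \<psi>m \<le> N"
    and D: "H1_norm \<Omega> (\<lambda>x. (np r x - a x) - (np t x - a x)) \<le> D" "H1_norm \<Omega> (\<lambda>x. (nm r x - a x) - (nm t x - a x)) \<le> D'"
  shows "(Fp r \<psi>p + Fm r \<psi>m) - (Fp t \<psi>p + Fm t \<psi>m) \<le> 2 * (S + 1 / (2 * \<tau>)) * (D + D' + modulus r t) * N"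
proof -
  have r0: "0 < r" and t0: "0 < t" using r t by (auto simp: good_def)
  let ?up = "\<lambda>t x. np t x - a x" and ?um = "\<lambda>t x. nm t x - a x"
  have H: "H01_grad (?up r) (wgrad \<Omega> (?up r))" "H01_grad (?up t) (wgrad \<Omega> (?up t))"
    "H01_grad (?um r) (wgrad \<Omega> (?um r))" "H01_grad (?um t) (wgrad \<Omega> (?um t))"
    using r t H01_imp_H01_grad unfolding good_def by blast+
  note s = H01_grad_sq_int(2)[OF H(1)] H01_grad_sq_int(2)[OF H(2)] H01_grad_sq_int(2)[OF H(3)] H01_grad_sq_int(2)[OF H(4)]
  note dr = sq_int_drift_np[OF r0] sq_int_drift_np[OF t0] sq_int_drift_nm[OF r0] sq_int_drift_nm[OF t0]
  note sga = W1inf_grad_sq_int(2)[OF a]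
  let ?J = "\<lambda>g n t x. g x + ga x + drift n t x"
  have J: "sq_int M (?J (wgrad \<Omega> (?up r)) np r)" "sq_int M (?J (wgrad \<Omega> (?up t)) np t)"
    "sq_int M (?J (wgrad \<Omega> (?um r)) nm r)" "sq_int M (?J (wgrad \<Omega> (?um t)) nm t)"
    by (intro sq_int_add s dr sga)+
  have q: "sq_int M (\<lambda>x. np r x - nm r x)" "sq_int M (\<lambda>x. np t x - nm t x)"
    by (intro sq_int_diff sq_int_np r0 t0)+
  let ?q = "L2norm M (\<lambda>x. (np r x - nm r x) - (np t x - nm t x))"
  have qle: "?q \<le> L2norm M (\<lambda>x. np r x - np t x) + L2norm M (\<lambda>x. nm r x - nm t x)"
    using L2norm_triangle_diff[OF sq_int_diff[OF sq_int_np(1)[OF r0] sq_int_np(1)[OF t0]] sq_int_diff[OF sq_int_np(2)[OF r0] sq_int_np(2)[OF t0]]]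
    by (simp add: algebra_simps)
  have Jle: "L2norm M (\<lambda>x. ?J g n r x - ?J g' n t x) \<le> Z + L2norm M (\<lambda>x. drift n r x - drift n t x)"
    if "H01_grad u g" "H01_grad u' g'" "H1_norm \<Omega> (\<lambda>x. u x - u' x) \<le> Z" "sq_int M (drift n r)" "sq_int M (drift n t)" for u g u' g' n Z
  proof -
    note h = H01_grad_diff[OF that(1,2)]
    have "(\<lambda>x. ?J g n r x - ?J g' n t x) = (\<lambda>x. (g x - g' x) + (drift n r x - drift n t x))" by (simp add: algebra_simps)
    then have "L2norm M (\<lambda>x. ?J g n r x - ?J g' n t x) \<le> L2norm M (\<lambda>x. g x - g' x) + L2norm M (\<lambda>x. drift n r x - drift n t x)"
      using L2norm_triangle[OF H01_grad_sq_int(2)[OF h] sq_int_diff[OF that(4,5)]] by simp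
    moreover have "L2norm M (\<lambda>x. g x - g' x) \<le> H1_norm \<Omega> (\<lambda>x. u x - u' x)"
      using H1_norm_H01_grad[OF h] by (auto intro: real_le_rsqrt)
    ultimately show ?thesis using that(3) by linarith
  qed
  have gr: "\<And>\<phi> g\<phi> gu. H01_grad \<phi> g\<phi> \<Longrightarrow> H01_grad (?up r) gu \<Longrightarrow> Fp r \<phi> + (LINT x|M. \<sigma>p x * (?J gu np r x \<bullet> g\<phi> x))
            = - (1 / (2 * \<tau>)) * (LINT x|M. (np r x - nm r x) * \<phi> x)"
    "\<And>\<phi> g\<phi> gu. H01_grad \<phi> g\<phi> \<Longrightarrow> H01_grad (?um r) gu \<Longrightarrow> Fm r \<phi> + (LINT x|M. \<sigma>m x * (?J gu nm r x \<bullet> g\<phi> x))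
            = (1 / (2 * \<tau>)) * (LINT x|M. (np r x - nm r x) * \<phi> x)"
    using r unfolding good_def drift_def by blast+
  have gt: "\<And>\<phi> g\<phi> gu. H01_grad \<phi> g\<phi> \<Longrightarrow> H01_grad (?up t) gu \<Longrightarrow> Fp t \<phi> + (LINT x|M. \<sigma>p x * (?J gu np t x \<bullet> g\<phi> x))
            = - (1 / (2 * \<tau>)) * (LINT x|M. (np t x - nm t x) * \<phi> x)"
    "\<And>\<phi> g\<phi> gu. H01_grad \<phi> g\<phi> \<Longrightarrow> H01_grad (?um t) gu \<Longrightarrow> Fm t \<phi> + (LINT x|M. \<sigma>m x * (?J gu nm t x \<bullet> g\<phi> x))
            = (1 / (2 * \<tau>)) * (LINT x|M. (np t x - nm t x) * \<phi> x)"
    using t unfolding good_def drift_def by blast+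
  have c: "\<bar>- (1 / (2 * \<tau>))\<bar> = 1 / (2 * \<tau>)" "\<bar>1 / (2 * \<tau>)\<bar> = 1 / (2 * \<tau>)" using tau by auto
  have N0: "0 \<le> N" using N(1) H1_norm_nonneg[of \<psi>p] by linarith
  have D0: "0 \<le> D" "0 \<le> D'" using D H1_norm_nonneg by (meson order_trans)+
  let ?X = "D + D' + modulus r t"
  have mod: "L2norm M (\<lambda>x. drift np r x - drift np t x) \<le> modulus r t" "L2norm M (\<lambda>x. drift nm r x - drift nm t x) \<le> modulus r t"
    "?q \<le> modulus r t"
    using qle unfolding modulus_def by (smt (verit) L2norm_nonneg)+
  have tau': "0 \<le> 1 / (2 * \<tau>)" using tau by simp
  have "Fp r \<psi>p - Fp t \<psi>p \<le> (S * L2norm M (\<lambda>x. ?J (wgrad \<Omega> (?up r)) np r x - ?J (wgrad \<Omega> (?up t)) np t x)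
      + \<bar>- (1 / (2 * \<tau>))\<bar> * ?q) * H1_norm \<Omega> \<psi>p"
    by (rule functional_difference[OF \<sigma>p J(1,2) q \<psi>p gr(1)[OF \<psi>p H(1)] gt(1)[OF \<psi>p H(2)]])
  also have "\<dots> \<le> (S * ?X + 1 / (2 * \<tau>) * ?X) * N"
    unfolding c
    using Jle[OF H(1,2) D(1) dr(1,2)] mod D0 N N0 S tau'
    by (intro mult_mono add_mono mult_left_mono) (auto intro!: add_nonneg_nonneg mult_nonneg_nonneg divide_nonneg_nonneg modulus_nonneg)
  finally have 1: "Fp r \<psi>p - Fp t \<psi>p \<le> (S + 1 / (2 * \<tau>)) * ?X * N" by (simp add: distrib_right)
  have "Fm r \<psi>m - Fm t \<psi>m \<le> (S * L2norm M (\<lambda>x. ?J (wgrad \<Omega> (?um r)) nm r x - ?J (wgrad \<Omega> (?um t)) nm t x)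
      + \<bar>1 / (2 * \<tau>)\<bar> * ?q) * H1_norm \<Omega> \<psi>m"
    by (rule functional_difference[OF \<sigma>m J(3,4) q \<psi>m gr(2)[OF \<psi>m H(3)] gt(2)[OF \<psi>m H(4)]])
  also have "\<dots> \<le> (S * ?X + 1 / (2 * \<tau>) * ?X) * N"
    unfolding c
    using Jle[OF H(3,4) D(2) dr(3,4)] mod D0 N N0 S tau'
    by (intro mult_mono add_mono mult_left_mono) (auto intro!: add_nonneg_nonneg mult_nonneg_nonneg divide_nonneg_nonneg modulus_nonneg)
  finally have 2: "Fm r \<psi>m - Fm t \<psi>m \<le> (S + 1 / (2 * \<tau>)) * ?X * N" by (simp add: distrib_right)
  have "(Fp r \<psi>p + Fm r \<psi>m) - (Fp t \<psi>p + Fm t \<psi>m) = (Fp r \<psi>p - Fp t \<psi>p) + (Fm r \<psi>m - Fm t \<psi>m)" by simp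
  also have "\<dots> \<le> (S + 1 / (2 * \<tau>)) * ?X * N + (S + 1 / (2 * \<tau>)) * ?X * N" by (rule add_mono[OF 1 2])
  also have "\<dots> = 2 * (S + 1 / (2 * \<tau>)) * ?X * N" by algebra
  finally show ?thesis .
qed

lemma AE_good: "AE t in lebesgue_on {0<..<T}. good t"
proof (cases "0 < T")
  case True
  have sp: "AE t in lebesgue_on {0<..<T}. t \<in> {0<..<T}" using AE_space[of "lebesgue_on {0<..<T}"] by simp
  have e: "AE t in lebesgue_on {0<..<T}. \<forall>\<phi> g\<phi> gu. H01_grad \<phi> g\<phi> \<longrightarrow>
       (H01_grad (\<lambda>x. np t x - a x) gu \<longrightarrow>
          Fp t \<phi> + (LINT x|M. \<sigma>p x * ((gu x + ga x + np t x *\<^sub>R (gW t x - (1 / a x) *\<^sub>R ga x)) \<bullet> g\<phi> x))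
            = - (1 / (2 * \<tau>)) * (LINT x|M. (np t x - nm t x) * \<phi> x)) \<and>
       (H01_grad (\<lambda>x. nm t x - a x) gu \<longrightarrow>
          Fm t \<phi> + (LINT x|M. \<sigma>m x * ((gu x + ga x + nm t x *\<^sub>R (gW t x - (1 / a x) *\<^sub>R ga x)) \<bullet> g\<phi> x))
            = (1 / (2 * \<tau>)) * (LINT x|M. (np t x - nm t x) * \<phi> x))" (is "AE t in _. ?P t")
  proof -
    have "AE t in lebesgue. t \<in> {0<..} \<longrightarrow> ?P t"
      by (rule AE_restrict_space_iff[THEN iffD1, OF _ equations]) simp
    then have "AE t in lebesgue. t \<in> {0<..<T} \<longrightarrow> ?P t" by eventually_elim simp
    then show ?thesis by (rule AE_restrict_space_iff[THEN iffD2, rotated]) simp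
  qed
  have h: "AE t in lebesgue_on {0<..<T}. (\<lambda>x. np t x - a x) \<in> H01 \<Omega>" "AE t in lebesgue_on {0<..<T}. (\<lambda>x. nm t x - a x) \<in> H01 \<Omega>"
    using up[OF True] um[OF True] unfolding L2_bochner_def bochner_measurable_def
    by (auto elim: eventually_mono)
  show ?thesis
    using sp e h by eventually_elim (auto simp: good_def)
next
  case False
  have "AE t in lebesgue_on {0<..<T}. t \<in> {0<..<T}" using AE_space[of "lebesgue_on {0<..<T}"] by simp
  then show ?thesis by eventually_elim (use False in auto)
qed

end

text \<open>Young's inequality, arranged so that the right side is one function of the time
  \<open>r\<close> plus the same function of the time \<open>t\<close>. Three errors
  \<open>e\<close> occur in total, two from the continuous approximants and one from
  \<open>modulus\<close>; they are shared equally, whence \<open>3 / 2 * e\<close>. The coefficient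
  \<open>3 * \<kappa>^2 / 2\<close> is \<open>\<kappa>^2 / 4\<close> times 2 for the two times and 3
  for the three summands.\<close>

lemma young_sum:
  fixes b p m p' m' e X \<kappa> \<theta> :: real
  assumes "0 < \<theta>" "0 \<le> \<kappa>" "0 \<le> b" "X \<le> (p + m + 3 / 2 * e) + (p' + m' + 3 / 2 * e)"
  shows "\<kappa> * X * b \<le> \<theta> * b\<^sup>2 + (1 / \<theta>) * (3 * \<kappa>\<^sup>2 / 2 * (p\<^sup>2 + m\<^sup>2 + 3 * e\<^sup>2) + 3 * \<kappa>\<^sup>2 / 2 * (p'\<^sup>2 + m'\<^sup>2 + 3 * e\<^sup>2))"
proof -
  define Y where "Y = p + m + 3 / 2 * e"
  define Y' where "Y' = p' + m' + 3 / 2 * e"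
  have sq: "(p + m + 3 / 2 * e)\<^sup>2 \<le> 3 * (p\<^sup>2 + m\<^sup>2 + 3 * e\<^sup>2)" for p m :: real
  proof -
    have "0 \<le> (p - m)\<^sup>2 + (p - 3 / 2 * e)\<^sup>2 + (m - 3 / 2 * e)\<^sup>2 + 9 / 4 * e\<^sup>2" by simp
    then show ?thesis by (simp add: power2_eq_square algebra_simps)
  qed
  have "(Y + Y')\<^sup>2 \<le> 2 * Y\<^sup>2 + 2 * Y'\<^sup>2"
    using zero_le_power2[of "Y - Y'"] by (simp add: power2_eq_square algebra_simps)
  also have "\<dots> \<le> 2 * (3 * (p\<^sup>2 + m\<^sup>2 + 3 * e\<^sup>2)) + 2 * (3 * (p'\<^sup>2 + m'\<^sup>2 + 3 * e\<^sup>2))"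
    unfolding Y_def Y'_def using sq[of p m] sq[of p' m'] by linarith
  finally have Y: "(Y + Y')\<^sup>2 \<le> 2 * (3 * (p\<^sup>2 + m\<^sup>2 + 3 * e\<^sup>2)) + 2 * (3 * (p'\<^sup>2 + m'\<^sup>2 + 3 * e\<^sup>2))" .
  have "\<kappa> * X * b \<le> \<kappa> * (Y + Y') * b"
    using assms by (intro mult_right_mono mult_left_mono) (auto simp: Y_def Y'_def)
  also have "\<dots> \<le> \<theta> * b\<^sup>2 + (1 / \<theta>) * (\<kappa>\<^sup>2 / 4 * (Y + Y')\<^sup>2)"
  proof -
    have "0 \<le> (1 / \<theta>) * (\<theta> * b - \<kappa> * (Y + Y') / 2)\<^sup>2" using assms(1) by simp
    also have "\<dots> = \<theta> * b\<^sup>2 + (1 / \<theta>) * (\<kappa>\<^sup>2 / 4 * (Y + Y')\<^sup>2) - \<kappa> * (Y + Y') * b"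
      using assms(1) by (simp add: power2_eq_square field_simps)
    finally show ?thesis by simp
  qed
  also have "\<dots> \<le> \<theta> * b\<^sup>2 + (1 / \<theta>) * (\<kappa>\<^sup>2 / 4 * (2 * (3 * (p\<^sup>2 + m\<^sup>2 + 3 * e\<^sup>2)) + 2 * (3 * (p'\<^sup>2 + m'\<^sup>2 + 3 * e\<^sup>2))))"
    using assms(1) by (intro add_left_mono mult_left_mono Y) auto
  also have "\<dots> = \<theta> * b\<^sup>2 + (1 / \<theta>) * (3 * \<kappa>\<^sup>2 / 2 * (p\<^sup>2 + m\<^sup>2 + 3 * e\<^sup>2) + 3 * \<kappa>\<^sup>2 / 2 * (p'\<^sup>2 + m'\<^sup>2 + 3 * e\<^sup>2))"
    by (simp add: algebra_simps)
  finally show ?thesis .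
qed

context spin_entropy
begin

section \<open>Decay of the regularised energy\<close>

lemma field_potential_bounded:
  obtains GW WW where "0 \<le> GW" "\<And>t. 0 < t \<Longrightarrow> L2norm M (gW t) \<le> GW" "0 \<le> WW" "\<And>t. 0 < t \<Longrightarrow> H1_norm \<Omega> (W t) \<le> WW"
proof -
  obtain R where R: "0 < R" "\<Omega> \<subseteq> ball 0 R" using bounded_subset_ballD[OF bd] by blast
  obtain GW where GW: "0 \<le> GW" "\<And>t. 0 < t \<Longrightarrow> L2norm M (gW t) \<le> GW" using electric_field_bounded by blast
  show ?thesis
  proof (rule that[OF GW, of "2 * R * GW + GW"])
    show "0 \<le> 2 * R * GW + GW" using R GW by simp
    fix t :: real assume t: "0 < t"
    have "H1_norm \<Omega> (W t) \<le> L2norm M (W t) + L2norm M (gW t)" by (rule H1_norm_le[OF W[OF t]])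
    also have "L2norm M (W t) \<le> 2 * R * L2norm M (gW t)" by (rule Poincare[OF W[OF t] R(2)])
    also have "\<dots> \<le> 2 * R * GW" using R GW(2)[OF t] by (intro mult_left_mono) auto
    finally show "H1_norm \<Omega> (W t) \<le> 2 * R * GW + GW" using GW(2)[OF t] by linarith
  qed auto
qed

lemma density_norm_square_integrable:
  assumes "0 < T" shows "integrable (lebesgue_on {0<..<T}) (\<lambda>t. (density_norm t)\<^sup>2)"
proof -
  let ?I = "lebesgue_on {0<..<T}"
  interpret I: finite_measure ?I by (rule interval_lebesgue_finite)
  have s: "sq_int ?I (\<lambda>t. H1_norm \<Omega> (u t))" if "u \<in> L2_bochner {0<..<T} (H01 \<Omega>) (H1_norm \<Omega>)" for u
  proof -
    have i: "integrable ?I (\<lambda>t. (H1_norm \<Omega> (u t))\<^sup>2)" using that by (simp add: L2_bochner_def)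
    have "(\<lambda>t. sqrt ((H1_norm \<Omega> (u t))\<^sup>2)) \<in> borel_measurable ?I"
      using borel_measurable_integrable[OF i] by measurable
    then show ?thesis using i by (simp add: sq_int_def)
  qed
  have "sq_int ?I density_norm" unfolding density_norm_def[abs_def]
    by (intro sq_int_add s up um assms) (simp add: sq_int_def)
  then show ?thesis by (simp add: sq_int_def)
qed

text \<open>The predicate \<open>P\<close> selects good times at which \<open>dp\<close> and
  \<open>dm\<close> really bound the distance to the continuous approximants. The approximants
  themselves vanish from the statement: the triangle inequality through them leaves \<open>e\<close>
  for their uniform continuity and one value of the majorant for each of the two times.\<close>

lemma AE_good_approx:
  assumes "0 < T" "0 < \<eta>"
  obtains dp dm :: "real \<Rightarrow> real" and P where "\<And>t. 0 \<le> dp t" "\<And>t. 0 \<le> dm t"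
    "integrable (lebesgue_on {0<..<T}) (\<lambda>t. (dp t)\<^sup>2)" "integrable (lebesgue_on {0<..<T}) (\<lambda>t. (dm t)\<^sup>2)"
    "(LINT t|lebesgue_on {0<..<T}. (dp t)\<^sup>2) \<le> \<eta>" "(LINT t|lebesgue_on {0<..<T}. (dm t)\<^sup>2) \<le> \<eta>"
    "AE t in lebesgue_on {0<..<T}. P t" "\<And>t. P t \<Longrightarrow> good t"
    "\<And>e. 0 < e \<Longrightarrow> \<exists>\<delta>>0. \<forall>r t. P r \<longrightarrow> P t \<longrightarrow> r \<in> {0..T} \<longrightarrow> t \<in> {0..T} \<longrightarrow> \<bar>r - t\<bar> < \<delta> \<longrightarrow>
       H1_norm \<Omega> (\<lambda>x. (np r x - a x) - (np t x - a x)) \<le> dp r + e + dp t \<and>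
       H1_norm \<Omega> (\<lambda>x. (nm r x - a x) - (nm t x - a x)) \<le> dm r + e + dm t"
proof -
  obtain cp dp where p: "\<And>t. cp t \<in> H01 \<Omega>"
    "\<And>e. 0 < e \<Longrightarrow> \<exists>\<delta>>0. \<forall>s\<in>{0..T}. \<forall>t\<in>{0..T}. \<bar>s - t\<bar> < \<delta> \<longrightarrow> H1_norm \<Omega> (\<lambda>x. cp s x - cp t x) < e"
    "\<And>t. 0 \<le> dp t" "integrable (lebesgue_on {0<..<T}) (\<lambda>t. (dp t)\<^sup>2)"
    "(LINT t|lebesgue_on {0<..<T}. (dp t)\<^sup>2) \<le> \<eta>"
    "AE t in lebesgue_on {0<..<T}. (\<lambda>x. np t x - a x) \<in> H01 \<Omega> \<and> H1_norm \<Omega> (\<lambda>x. (np t x - a x) - cp t x) \<le> dp t"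
    by (rule L2_bochner_continuous_approx[OF up[OF assms(1)] assms(2)]) (rule that)
  obtain cm dm where m: "\<And>t. cm t \<in> H01 \<Omega>"
    "\<And>e. 0 < e \<Longrightarrow> \<exists>\<delta>>0. \<forall>s\<in>{0..T}. \<forall>t\<in>{0..T}. \<bar>s - t\<bar> < \<delta> \<longrightarrow> H1_norm \<Omega> (\<lambda>x. cm s x - cm t x) < e"
    "\<And>t. 0 \<le> dm t" "integrable (lebesgue_on {0<..<T}) (\<lambda>t. (dm t)\<^sup>2)"
    "(LINT t|lebesgue_on {0<..<T}. (dm t)\<^sup>2) \<le> \<eta>"
    "AE t in lebesgue_on {0<..<T}. (\<lambda>x. nm t x - a x) \<in> H01 \<Omega> \<and> H1_norm \<Omega> (\<lambda>x. (nm t x - a x) - cm t x) \<le> dm t"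
    by (rule L2_bochner_continuous_approx[OF um[OF assms(1)] assms(2)]) (rule that)
  define P where "P t \<longleftrightarrow> good t \<and> H1_norm \<Omega> (\<lambda>x. (np t x - a x) - cp t x) \<le> dp t
     \<and> H1_norm \<Omega> (\<lambda>x. (nm t x - a x) - cm t x) \<le> dm t" for t
  have split: "H1_norm \<Omega> (\<lambda>x. u x - v x) \<le> d + e + d'"
    if "u \<in> H01 \<Omega>" "v \<in> H01 \<Omega>" "c \<in> H01 \<Omega>" "c' \<in> H01 \<Omega>" "H1_norm \<Omega> (\<lambda>x. u x - c x) \<le> d"
      "H1_norm \<Omega> (\<lambda>x. v x - c' x) \<le> d'" "H1_norm \<Omega> (\<lambda>x. c x - c' x) < e" for u v c c' d d' e
    using H1_norm_triangle3[OF that(1,3,2)] H1_norm_triangle3[OF that(3,4,2)] H1_norm_minus_commute[OF that(2,4)] that(5-7)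
    by linarith
  show ?thesis
  proof (rule that[OF p(3) m(3) p(4) m(4) p(5) m(5), of P])
    show "AE t in lebesgue_on {0<..<T}. P t" using AE_good p(6) m(6) by eventually_elim (simp add: P_def)
    show "good t" if "P t" for t using that by (simp add: P_def)
    fix e :: real assume e: "0 < e"
    obtain \<delta>1 where 1: "0 < \<delta>1" "\<forall>s\<in>{0..T}. \<forall>t\<in>{0..T}. \<bar>s - t\<bar> < \<delta>1 \<longrightarrow> H1_norm \<Omega> (\<lambda>x. cp s x - cp t x) < e"
      using p(2)[OF e] by blast
    obtain \<delta>2 where 2: "0 < \<delta>2" "\<forall>s\<in>{0..T}. \<forall>t\<in>{0..T}. \<bar>s - t\<bar> < \<delta>2 \<longrightarrow> H1_norm \<Omega> (\<lambda>x. cm s x - cm t x) < e"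
      using m(2)[OF e] by blast
    show "\<exists>\<delta>>0. \<forall>r t. P r \<longrightarrow> P t \<longrightarrow> r \<in> {0..T} \<longrightarrow> t \<in> {0..T} \<longrightarrow> \<bar>r - t\<bar> < \<delta> \<longrightarrow>
       H1_norm \<Omega> (\<lambda>x. (np r x - a x) - (np t x - a x)) \<le> dp r + e + dp t \<and>
       H1_norm \<Omega> (\<lambda>x. (nm r x - a x) - (nm t x - a x)) \<le> dm r + e + dm t"
    proof (intro exI[of _ "min \<delta>1 \<delta>2"] conjI allI impI)
      show "0 < min \<delta>1 \<delta>2" using 1 2 by simp
      fix r t assume rt: "P r" "P t" "r \<in> {0..T}" "t \<in> {0..T}" "\<bar>r - t\<bar> < min \<delta>1 \<delta>2"
      have g: "good r" "good t" using rt by (auto simp: P_def)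
      show "H1_norm \<Omega> (\<lambda>x. (np r x - a x) - (np t x - a x)) \<le> dp r + e + dp t"
        by (rule split[OF _ _ p(1)[of r] p(1)[of t]]) (use rt g 1 in \<open>auto simp: P_def good_def\<close>)
      show "H1_norm \<Omega> (\<lambda>x. (nm r x - a x) - (nm t x - a x)) \<le> dm r + e + dm t"
        by (rule split[OF _ _ m(1)[of r] m(1)[of t]]) (use rt g 2 in \<open>auto simp: P_def good_def\<close>)
    qed
  qed
qed

text \<open>The test functions stay fixed while the time derivatives run through
  \<open>{s..t}\<close>, so the increments of the two pairings are plain integrals. This replaces a
  chain rule for the energy.\<close>

lemma increment_le_integral:
  assumes st: "0 < s" "s \<le> t" "t < T" and \<psi>: "\<psi>p \<in> H01 \<Omega>" "\<psi>m \<in> H01 \<Omega>"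
    and le: "AE r in lebesgue_on {0<..<T}. r \<in> {s..t} \<longrightarrow> Fp r \<psi>p + Fm r \<psi>m \<le> c + G r"
    and G: "integrable (lebesgue_on {0<..<T}) G"
  shows "(LINT x|M. (np t x - np s x) * \<psi>p x) + (LINT x|M. (nm t x - nm s x) * \<psi>m x)
    \<le> c * (t - s) + (LINT r|lebesgue_on {0<..<T}. indicator {s..t} r * G r)"
proof -
  let ?I = "lebesgue_on {0<..<T}"
  interpret I: finite_measure ?I by (rule interval_lebesgue_finite)
  have T: "0 < T" using st by linarith
  note p = time_derivative_increment[OF Fp[OF T] np \<psi>(1) st] and m = time_derivative_increment[OF Fm[OF T] nm \<psi>(2) st]
  have ind: "{s..t} \<in> sets ?I"
    using st by (intro sets_restrict_space_iff[THEN iffD2]) auto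
  have i: "integrable ?I (\<lambda>r. indicator {s..t} r * f r)" if "integrable ?I f" for f :: "real \<Rightarrow> real"
    using integrable_mult_indicator[OF ind that] by simp
  have "(LINT x|M. (np t x - np s x) * \<psi>p x) + (LINT x|M. (nm t x - nm s x) * \<psi>m x)
      = (LINT r|?I. indicator {s..t} r * Fp r \<psi>p + indicator {s..t} r * Fm r \<psi>m)"
    using p(1) m(1) i[OF p(2)] i[OF m(2)] by simp
  also have "\<dots> \<le> (LINT r|?I. indicator {s..t} r * c + indicator {s..t} r * G r)"
  proof (rule integral_mono_AE)
    show "AE r in ?I. indicator {s..t} r * Fp r \<psi>p + indicator {s..t} r * Fm r \<psi>m \<le> indicator {s..t} r * c + indicator {s..t} r * G r"
      using le by eventually_elim (auto simp: indicator_def)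
  qed (use i[OF p(2)] i[OF m(2)] i[OF G] i[of "\<lambda>_. c"] in auto)
  also have "\<dots> = (LINT r|?I. indicator {s..t} r * c) + (LINT r|?I. indicator {s..t} r * G r)"
    using i[OF G] i[of "\<lambda>_. c"] by simp
  also have "(LINT r|?I. indicator {s..t} r * c) = c * (t - s)"
  proof -
    have "measure ?I {s..t} = t - s"
      using st by (subst measure_restrict_space) auto
    moreover have "{s..t} \<inter> {0<..<T} = {s..t}" using st by auto
    ultimately show ?thesis by (simp add: mult.commute)
  qed
  finally show ?thesis .
qed

text \<open>The hypotheses of \<open>increment_bound\<close> are verified with
  \<open>B t = (density_norm t)^2\<close>. The constant on the right is the loss caused by the
  shift; it vanishes with \<open>\<epsilon>\<close>, whereas \<open>\<kappa>\<close> grows like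
  \<open>1 / \<epsilon>\<close> but does not appear in the result.\<close>

lemma regularised_energy_decay:
  assumes \<epsilon>: "0 < \<epsilon>" "\<epsilon> \<le> 1" and GW: "0 \<le> GW" "\<And>t. 0 < t \<Longrightarrow> L2norm M (gW t) \<le> GW"
    and WW: "0 \<le> WW" "\<And>t. 0 < t \<Longrightarrow> H1_norm \<Omega> (W t) \<le> WW" and ab: "0 < \<alpha>" "\<alpha> < \<beta>"
  shows "regularised_energy \<epsilon> \<beta> - regularised_energy \<epsilon> \<alpha> \<le> S * B * \<epsilon> / 2 * GW\<^sup>2 * (\<beta> - \<alpha>)"
proof -
  define T where "T = \<beta> + 1"
  have T: "0 < T" "\<beta> < T" using ab by (auto simp: T_def)
  let ?I = "lebesgue_on {0<..<T}"
  interpret I: finite_measure ?I by (rule interval_lebesgue_finite)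
  define C where "C = S * B * \<epsilon> / 2 * GW\<^sup>2"
  \<comment> \<open>The constant of \<open>total_functional_difference\<close> times the factor in
    front of \<open>density_norm t\<close> in the bound for the test functions.\<close>
  define \<kappa> where "\<kappa> = 2 * (S + 1 / (2 * \<tau>)) * (3 * Bw / \<epsilon> + WW)"
  define q where "q = 3 * \<kappa>\<^sup>2 / 2"
  have C: "0 \<le> C" using S B \<epsilon> by (simp add: C_def)
  have k: "0 \<le> S + 1 / (2 * \<tau>)" using S tau by simp
  have \<kappa>: "0 \<le> \<kappa>" using k Bw_nonneg \<epsilon> WW by (auto simp: \<kappa>_def intro!: mult_nonneg_nonneg add_nonneg_nonneg)
  have q: "0 \<le> q" by (simp add: q_def)
  have "regularised_energy \<epsilon> \<beta> - regularised_energy \<epsilon> \<alpha> \<le> C * (\<beta> - \<alpha>)"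
  proof (rule increment_bound[OF continuous_on_regularised_energy[OF \<epsilon>] ab T(2) density_norm_square_integrable[OF T(1)] zero_le_power2 C])
    fix \<theta> \<eta> :: real assume \<theta>: "0 < \<theta>" and \<eta>: "0 < \<eta>"
    \<comment> \<open>The budget for the integral of \<open>G\<close>: with \<open>Q = q + 1\<close>
      the two majorants contribute \<open>\<eta> / (4 * Q)\<close> each, and the constant
      \<open>3 * e^2\<close> integrated over \<open>(0, T)\<close> contributes
      \<open>\<eta> / (2 * Q)\<close>. Multiplied by \<open>q\<close> the total is at most
      \<open>\<eta>\<close>.\<close>
    define \<eta>' where "\<eta>' = \<eta> / (4 * (q + 1))"
    define e where "e = sqrt (\<eta> / (6 * (q + 1) * T))"
    have \<eta>': "0 < \<eta>'" and e: "0 < e" and e2: "e\<^sup>2 = \<eta> / (6 * (q + 1) * T)" using \<eta> q T by (auto simp: \<eta>'_def e_def)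
    obtain dp dm :: "real \<Rightarrow> real" and P where d: "\<And>t. 0 \<le> dp t" "\<And>t. 0 \<le> dm t"
      "integrable ?I (\<lambda>t. (dp t)\<^sup>2)" "integrable ?I (\<lambda>t. (dm t)\<^sup>2)"
      "(LINT t|?I. (dp t)\<^sup>2) \<le> \<eta>'" "(LINT t|?I. (dm t)\<^sup>2) \<le> \<eta>'"
      and P: "AE t in ?I. P t" "\<And>t. P t \<Longrightarrow> good t"
      and close: "\<And>e. 0 < e \<Longrightarrow> \<exists>\<delta>>0. \<forall>r t. P r \<longrightarrow> P t \<longrightarrow> r \<in> {0..T} \<longrightarrow> t \<in> {0..T} \<longrightarrow> \<bar>r - t\<bar> < \<delta> \<longrightarrow>
       H1_norm \<Omega> (\<lambda>x. (np r x - a x) - (np t x - a x)) \<le> dp r + e + dp t \<and>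
       H1_norm \<Omega> (\<lambda>x. (nm r x - a x) - (nm t x - a x)) \<le> dm r + e + dm t"
      by (rule AE_good_approx[OF T(1) \<eta>']) (rule that)
    obtain \<delta>1 where \<delta>1: "0 < \<delta>1" "\<forall>r t. P r \<longrightarrow> P t \<longrightarrow> r \<in> {0..T} \<longrightarrow> t \<in> {0..T} \<longrightarrow> \<bar>r - t\<bar> < \<delta>1 \<longrightarrow>
       H1_norm \<Omega> (\<lambda>x. (np r x - a x) - (np t x - a x)) \<le> dp r + e + dp t \<and>
       H1_norm \<Omega> (\<lambda>x. (nm r x - a x) - (nm t x - a x)) \<le> dm r + e + dm t" using close[OF e] by blast
    have \<alpha>2: "0 < \<alpha> / 2" using ab by simp
    obtain \<delta>2 where \<delta>2: "0 < \<delta>2" "\<And>s t. s \<in> {\<alpha> / 2..\<beta>} \<Longrightarrow> t \<in> {\<alpha> / 2..\<beta>} \<Longrightarrow> \<bar>s - t\<bar> < \<delta>2 \<Longrightarrow> modulus s t < e"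
      using modulus_small[OF \<alpha>2 e] by blast
    \<comment> \<open>The bound \<open>\<alpha> / 2\<close> keeps \<open>t - h\<close> in
      \<open>{\<alpha> / 2..\<beta>}\<close>, a compact set of positive times on which
      \<open>modulus\<close> is uniformly small.\<close>
    define \<delta> where "\<delta> = min (\<alpha> / 2) (min \<delta>1 \<delta>2)"
    define G where "G t = q * ((dp t)\<^sup>2 + (dm t)\<^sup>2 + 3 * e\<^sup>2)" for t
    have iG: "integrable ?I G" unfolding G_def[abs_def] using d(3,4) by simp
    show "\<exists>G \<delta>. (\<forall>t. 0 \<le> G t) \<and> integrable ?I G \<and>
      (LINT t|?I. G t) \<le> \<eta> \<and> 0 < \<delta> \<and>
      (\<forall>h. 0 < h \<and> h < \<delta> \<longrightarrow> (AE t in lebesgue. t \<in> {\<alpha>..\<beta>} \<longrightarrow>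
         regularised_energy \<epsilon> t - regularised_energy \<epsilon> (t - h) \<le> C * h + \<theta> * h * (density_norm t)\<^sup>2
           + (1 / \<theta>) * ((LINT r|?I. indicator {t - h..t} r * G r) + h * G t)))"
    proof (intro exI[of _ G] exI[of _ \<delta>] conjI allI impI)
      show "0 \<le> G t" for t using q by (simp add: G_def)
      show "integrable ?I G" by (rule iG)
      show "(LINT t|?I. G t) \<le> \<eta>"
      proof -
        have mI: "measure ?I {0<..<T} = T" using T by (subst measure_restrict_space) auto
        have "(LINT t|?I. G t) = q * ((LINT t|?I. (dp t)\<^sup>2) + (LINT t|?I. (dm t)\<^sup>2) + T * (3 * e\<^sup>2))"
          unfolding G_def using d(3,4) mI by simp
        also have "\<dots> \<le> q * (\<eta>' + \<eta>' + T * (3 * e\<^sup>2))" using d(5,6) q T(1) by (intro mult_left_mono add_mono) auto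
        also have "\<dots> = q / (q + 1) * \<eta>"
        proof -
          have "\<eta> / (4 * Q) + \<eta> / (4 * Q) + T * (3 * (\<eta> / (6 * Q * T))) = \<eta> / Q" if "0 < Q" for Q
            using that T by (simp add: field_simps)
          from this[of "q + 1"] show ?thesis using q by (simp add: e2 \<eta>'_def)
        qed
        also have "\<dots> \<le> 1 * \<eta>" using q \<eta> by (intro mult_right_mono) auto
        finally show ?thesis by simp
      qed
      show "0 < \<delta>" using ab \<delta>1 \<delta>2 by (simp add: \<delta>_def)
      fix h assume h: "0 < h \<and> h < \<delta>"
      have PI: "AE t in lebesgue. t \<in> {0<..<T} \<longrightarrow> P t"
        by (rule AE_restrict_space_iff[THEN iffD1, OF _ P(1)]) simp
      then show "AE t in lebesgue. t \<in> {\<alpha>..\<beta>} \<longrightarrow>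
         regularised_energy \<epsilon> t - regularised_energy \<epsilon> (t - h) \<le> C * h + \<theta> * h * (density_norm t)\<^sup>2
           + (1 / \<theta>) * ((LINT r|?I. indicator {t - h..t} r * G r) + h * G t)"
      proof (eventually_elim, intro impI)
        fix t assume "t \<in> {0<..<T} \<longrightarrow> P t" and t: "t \<in> {\<alpha>..\<beta>}"
        then have Pt: "P t" using ab T by simp
        have s: "0 < t - h" "t - h \<le> t" "t < T" and s2: "\<alpha> / 2 \<le> t - h" using t h ab T by (auto simp: \<delta>_def)
        obtain \<psi>p gp \<psi>m gm where \<psi>: "H01_grad \<psi>p gp" "H01_grad \<psi>m gm"
          "H1_norm \<Omega> \<psi>p \<le> (3 * Bw / \<epsilon> + WW) * density_norm t" "H1_norm \<Omega> \<psi>m \<le> (3 * Bw / \<epsilon> + WW) * density_norm t"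
          "Fp t \<psi>p + Fm t \<psi>m \<le> S * B * \<epsilon> / 2 * GW\<^sup>2"
          "\<And>s. 0 < s \<Longrightarrow> regularised_energy \<epsilon> t - regularised_energy \<epsilon> s \<le> (LINT x|M. (np t x - np s x) * \<psi>p x) + (LINT x|M. (nm t x - nm s x) * \<psi>m x)"
          by (rule electrochemical_potentials[OF \<epsilon> P(2)[OF Pt] GW WW], assumption+) (rule that)
        have dn0: "0 \<le> density_norm t" using density_norm_ge(1)[of t] by linarith
        \<comment> \<open>All terms that do not depend on \<open>r\<close>. Integrated over a window
          of length \<open>h\<close> they yield exactly the contributions proportional to
          \<open>h\<close> in the hypothesis of \<open>increment_bound\<close>.\<close>
        define c where "c = C + \<theta> * (density_norm t)\<^sup>2 + (1 / \<theta>) * G t"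
        have "regularised_energy \<epsilon> t - regularised_energy \<epsilon> (t - h) \<le> (LINT x|M. (np t x - np (t - h) x) * \<psi>p x) + (LINT x|M. (nm t x - nm (t - h) x) * \<psi>m x)"
          by (rule \<psi>(6)[OF s(1)])
        also have "\<dots> \<le> c * (t - (t - h)) + (LINT r|?I. indicator {t - h..t} r * (1 / \<theta> * G r))"
        proof (rule increment_le_integral[OF s H01_grad_imp_H01[OF \<psi>(1)] H01_grad_imp_H01[OF \<psi>(2)]])
          show "AE r in ?I. r \<in> {t - h..t} \<longrightarrow> Fp r \<psi>p + Fm r \<psi>m \<le> c + 1 / \<theta> * G r"
            using P(1)
          proof (eventually_elim, intro impI)
            fix r assume Pr: "P r" and r: "r \<in> {t - h..t}"
            have rt: "r \<in> {0..T}" "t \<in> {0..T}" "r \<in> {\<alpha> / 2..\<beta>}" "t \<in> {\<alpha> / 2..\<beta>}" "\<bar>r - t\<bar> < \<delta>1" "\<bar>r - t\<bar> < \<delta>2"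
              using r s s2 t h ab T by (auto simp: \<delta>_def)
            note cl = \<delta>1(2)[rule_format, OF Pr Pt rt(1,2,5)]
            have mo: "modulus r t < e" by (rule \<delta>2(2)[OF rt(3,4,6)])
            let ?X = "(dp r + e + dp t) + (dm r + e + dm t) + modulus r t"
            have "(Fp r \<psi>p + Fm r \<psi>m) - (Fp t \<psi>p + Fm t \<psi>m) \<le> 2 * (S + 1 / (2 * \<tau>)) * ?X * ((3 * Bw / \<epsilon> + WW) * density_norm t)"
              by (rule total_functional_difference[OF P(2)[OF Pr] P(2)[OF Pt] \<psi>(1,2) \<psi>(3,4) conjunct1[OF cl] conjunct2[OF cl]])
            also have "\<dots> = \<kappa> * ?X * density_norm t" unfolding \<kappa>_def by (simp only: mult_ac)
            also have "\<dots> \<le> \<theta> * (density_norm t)\<^sup>2 + (1 / \<theta>) * (G r + G t)"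
              unfolding G_def q_def by (rule young_sum[OF \<theta> \<kappa> dn0]) (use mo in linarith)
            finally have "Fp r \<psi>p + Fm r \<psi>m \<le> C + (\<theta> * (density_norm t)\<^sup>2 + (1 / \<theta>) * (G r + G t))" using \<psi>(5) unfolding C_def by linarith
            then show "Fp r \<psi>p + Fm r \<psi>m \<le> c + 1 / \<theta> * G r" unfolding c_def distrib_left by linarith
          qed
        qed (use iG in simp)
        also have "\<dots> = C * h + \<theta> * h * (density_norm t)\<^sup>2 + (1 / \<theta>) * ((LINT r|?I. indicator {t - h..t} r * G r) + h * G t)"
        proof -
          have "(LINT r|?I. indicator {t - h..t} r * (1 / \<theta> * G r)) = (LINT r|?I. (1 / \<theta>) * (indicator {t - h..t} r * G r))"
            by (simp only: mult_ac)
          also have "\<dots> = (1 / \<theta>) * (LINT r|?I. indicator {t - h..t} r * G r)" by (rule integral_mult_right_zero)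
          finally show ?thesis unfolding c_def by (simp add: algebra_simps add_divide_distrib)
        qed
        finally show "regularised_energy \<epsilon> t - regularised_energy \<epsilon> (t - h) \<le> C * h + \<theta> * h * (density_norm t)\<^sup>2
           + (1 / \<theta>) * ((LINT r|?I. indicator {t - h..t} r * G r) + h * G t)" .
      qed
    qed
  qed
  then show ?thesis by (simp add: C_def)
qed

lemma energy_antimono:
  "antimono_on {0<..} (\<lambda>t. (LINT x|M. entropy 0 (a x) (np t x)) + (LINT x|M. entropy 0 (a x) (nm t x))
     + lam\<^sup>2 / 2 * (L2norm M (gW t))\<^sup>2)"
proof (rule monotone_onI)
  fix s t :: real assume "s \<in> {0<..}" "t \<in> {0<..}" "s \<le> t"
  then have s: "0 < s" and t: "0 < t" by auto
  obtain GW WW where GW: "0 \<le> GW" "\<And>t. 0 < t \<Longrightarrow> L2norm M (gW t) \<le> GW"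
    and WW: "0 \<le> WW" "\<And>t. 0 < t \<Longrightarrow> H1_norm \<Omega> (W t) \<le> WW" using field_potential_bounded by blast
  define \<epsilon> where "\<epsilon> k = 1 / real (Suc k)" for k
  have \<epsilon>: "\<epsilon> \<longlonglongrightarrow> 0" "\<And>k. 0 < \<epsilon> k" "\<And>k. \<epsilon> k \<le> 1"
    unfolding \<epsilon>_def using LIMSEQ_inverse_real_of_nat by (auto simp: inverse_eq_divide)
  have lim: "(\<lambda>k. regularised_energy (\<epsilon> k) r) \<longlonglongrightarrow> (LINT x|M. entropy 0 (a x) (np r x)) + (LINT x|M. entropy 0 (a x) (nm r x))
     + lam\<^sup>2 / 2 * (L2norm M (gW r))\<^sup>2" if r: "0 < r" for r
    unfolding regularised_energy_def
    by (intro tendsto_add tendsto_const entropy_integral_tendsto sq_int_measurable[OF sq_int_np(1)[OF r]]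
        sq_int_measurable[OF sq_int_np(2)[OF r]] np_bounds[OF r] nm_bounds[OF r] \<epsilon>)
  have "(\<lambda>k. regularised_energy (\<epsilon> k) s + S * B * \<epsilon> k / 2 * GW\<^sup>2 * (t - s)) \<longlonglongrightarrow> ((LINT x|M. entropy 0 (a x) (np s x))
     + (LINT x|M. entropy 0 (a x) (nm s x)) + lam\<^sup>2 / 2 * (L2norm M (gW s))\<^sup>2) + S * B * 0 / 2 * GW\<^sup>2 * (t - s)"
    by (intro tendsto_add lim s tendsto_intros \<epsilon>) auto
  moreover have "regularised_energy (\<epsilon> k) t \<le> regularised_energy (\<epsilon> k) s + S * B * \<epsilon> k / 2 * GW\<^sup>2 * (t - s)" for k
  proof (cases "s = t")
    case False
    then have "s < t" using \<open>s \<le> t\<close> by simp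
    have "regularised_energy (\<epsilon> k) t - regularised_energy (\<epsilon> k) s \<le> S * B * \<epsilon> k / 2 * GW\<^sup>2 * (t - s)"
      by (rule regularised_energy_decay[OF \<epsilon>(2,3) GW WW s \<open>s < t\<close>])
    then show ?thesis by linarith
  qed simp
  ultimately show "(LINT x|M. entropy 0 (a x) (np s x)) + (LINT x|M. entropy 0 (a x) (nm s x)) + lam\<^sup>2 / 2 * (L2norm M (gW s))\<^sup>2
    \<ge> (LINT x|M. entropy 0 (a x) (np t x)) + (LINT x|M. entropy 0 (a x) (nm t x)) + lam\<^sup>2 / 2 * (L2norm M (gW t))\<^sup>2"
    using LIMSEQ_le[OF lim[OF t]] by fastforce
qed

end

section \<open>Weak solutions\<close>

text \<open>The amount \<open>f\<close> by which \<open>n t\<close> leaves \<open>[l, u]\<close> is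
  at most \<open>\<bar>n s x - n t x\<bar>\<close> whenever \<open>n s\<close> obeys the bounds. A
  set of full measure contains such \<open>s\<close> arbitrarily close to \<open>t\<close>, so
  continuity in L2 forces \<open>f\<close> to vanish. This upgrades the essential bound in time to
  every positive time.\<close>

lemma (in bounded_open) C_L2_bounds:
  assumes n: "n \<in> C_L2 \<Omega>" and b: "AE t in lebesgue_on {0<..}. AE x in M. l \<le> n t x \<and> n t x \<le> u" and t: "0 < t"
  shows "AE x in M. l \<le> n t x \<and> n t x \<le> u"
proof -
  have sn: "sq_int M (n s)" if "0 < s" for s using C_L2_sq_int[OF n] that by simp
  define f where "f x = max 0 (n t x - u) + max 0 (l - n t x)" for x
  have mf: "f \<in> borel_measurable M"
    unfolding f_def[abs_def] using sq_int_measurable[OF sn[OF t]] by measurable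
  have f: "sq_int M f" "L2norm M f \<le> L2norm M (\<lambda>x. n s x - n t x)"
    if s: "0 < s" "AE x in M. l \<le> n s x \<and> n s x \<le> u" for s
  proof -
    have le: "AE x in M. norm (f x) \<le> 1 * norm (n s x - n t x)"
      using s(2) by eventually_elim (auto simp: f_def max_def)
    note d = sq_int_diff[OF sn[OF s(1)] sn[OF t]]
    show "sq_int M f" by (rule sq_int_mono[OF mf d le])
    show "L2norm M f \<le> L2norm M (\<lambda>x. n s x - n t x)" using L2norm_mono[OF d le] by simp
  qed
  have b': "AE s in lebesgue. s \<in> {0<..} \<longrightarrow> (AE x in M. l \<le> n s x \<and> n s x \<le> u)"
    by (rule AE_restrict_space_iff[THEN iffD1, OF _ b]) simp
  have ex: "\<exists>s>t. s < t + \<delta> \<and> (AE x in M. l \<le> n s x \<and> n s x \<le> u)" if \<delta>: "0 < \<delta>" for \<delta>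
  proof (rule ccontr)
    assume "\<not> ?thesis"
    with b' t have "AE s in lebesgue. s \<notin> {t<..<t + \<delta>}" by (auto elim!: eventually_mono)
    then have "{t<..<t + \<delta>} \<in> null_sets lebesgue" by (subst (asm) AE_iff_null_sets[symmetric]) auto
    then have "emeasure lebesgue {t<..<t + \<delta>} = 0" by auto
    then show False using \<delta> by simp
  qed
  have small: "L2norm M f < e" if e: "0 < e" for e
  proof -
    have "\<forall>\<^sub>F s in at t within {0..}. L2norm M (\<lambda>x. n s x - n t x) < e"
      using C_L2_tendsto[OF n, of t] t e by (intro order_tendstoD) auto
    then obtain \<delta> where \<delta>: "0 < \<delta>" "\<And>s. 0 \<le> s \<Longrightarrow> s \<noteq> t \<Longrightarrow> dist s t < \<delta> \<Longrightarrow> L2norm M (\<lambda>x. n s x - n t x) < e"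
      unfolding eventually_at by auto
    obtain s where s: "t < s" "s < t + \<delta>" "AE x in M. l \<le> n s x \<and> n s x \<le> u" using ex[OF \<delta>(1)] by blast
    have "L2norm M (\<lambda>x. n s x - n t x) < e" using \<delta>(2)[of s] s t by (simp add: dist_real_def)
    then show ?thesis using f(2)[OF _ s(3)] s t by linarith
  qed
  obtain s where s: "t < s" "AE x in M. l \<le> n s x \<and> n s x \<le> u" using ex[of 1] by auto
  have "0 < s" using s t by simp
  note sf = f(1)[OF this s(2)]
  have "L2norm M f = 0" using small[of "L2norm M f"] L2norm_nonneg[of M f] by linarith
  from L2norm_0_AE[OF sf this] show ?thesis by eventually_elim (auto simp: f_def max_def split: if_splits)
qed

text \<open>The gradient hidden in the existential of \<open>has_weak_laplacian\<close> agrees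
  almost everywhere with the explicit \<open>G\<close> by uniqueness, and the right side
  \<open>q\<close> being square integrable makes the weak Laplacian so, as the extension of the test
  class to \<open>H01\<close> requires.\<close>

lemma (in bounded_open) Poisson_weak_form:
  assumes V: "has_weak_grad \<Omega> V G" "sq_int M G" "has_weak_laplacian \<Omega> V w"
    and q: "AE x in M. - c * w x = q x" "sq_int M q" "0 < c" and \<phi>: "H01_grad \<phi> g"
  shows "c * (LINT x|M. G x \<bullet> g x) = (LINT x|M. q x * \<phi> x)"
proof -
  obtain G' where G': "has_weak_grad \<Omega> V G'" "has_weak_div \<Omega> G' w" using V(3) by (auto simp: has_weak_laplacian_def)
  note s = H01_grad_sq_int[OF \<phi>]
  have GG: "AE x in M. G x = G' x" by (rule has_weak_grad_unique[OF op V(1) G'(1)])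
  have sG: "sq_int M G'" by (rule sq_int_AE(1)[OF V(2) GG])
  have w: "AE x in M. (- 1 / c) * q x = w x" using q(1) by eventually_elim (use q(3) in \<open>auto simp: field_simps\<close>)
  have sw: "sq_int M w" by (rule sq_int_AE(1)[OF sq_int_cmult[OF q(2)] w])
  have "(LINT x|M. G x \<bullet> g x) = (LINT x|M. G' x \<bullet> g x)"
    by (rule integral_cong_AE)
       (use GG sq_int_inner_integrable[OF V(2) s(2)] sq_int_inner_integrable[OF sG s(2)] in \<open>auto elim!: eventually_mono\<close>)
  also have "\<dots> = - (LINT x|M. w x * \<phi> x)" by (rule weak_div_H01[OF G'(2) sG sw \<phi>])
  also have "(LINT x|M. w x * \<phi> x) = (LINT x|M. (- 1 / c) * (q x * \<phi> x))"
  proof (rule integral_cong_AE)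
    show "AE x in M. w x * \<phi> x = (- 1 / c) * (q x * \<phi> x)"
      using w by eventually_elim (metis mult.assoc)
  qed (use sq_int_mult_integrable[OF sw s(1)] sq_int_mult_integrable[OF q(2) s(1)] in auto)
  finally show ?thesis using q(3) by simp
qed

context density_bounds
begin

text \<open>Equilibrium means \<open>VD = c - ln a\<close> almost everywhere, and on the range of
  \<open>a\<close> the logarithm coincides with its Lipschitz extension, to which the chain rule
  applies.\<close>

lemma equilibrium_potential_grad:
  assumes "AE x in M. ln (a x) + VD x = c"
  shows "has_weak_grad \<Omega> VD (\<lambda>x. - ((1 / a x) *\<^sub>R ga x))"
proof -
  have 1: "has_weak_grad \<Omega> (\<lambda>x. ln_ext m (a x)) (\<lambda>x. (1 / max m (a x)) *\<^sub>R ga x)"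
    using W1inf_grad_compose[OF a ln_ext(1-3)[OF m]] by (simp add: W1inf_grad_def)
  have 2: "has_weak_grad \<Omega> (\<lambda>x::'a. c) (\<lambda>x. 0)" by (rule has_weak_grad_C1[OF sets_\<Omega>]) auto
  show ?thesis
  proof (rule has_weak_grad_cong_AE[OF sets_\<Omega> has_weak_grad_diff[OF sets_\<Omega> 2 1]])
    show "AE x in M. c - ln_ext m (a x) = VD x"
      using assms am by eventually_elim (simp add: ln_ext(4)[OF m])
    show "AE x in M. 0 - (1 / max m (a x)) *\<^sub>R ga x = - ((1 / a x) *\<^sub>R ga x)"
      using am by eventually_elim (simp add: max_def)
  qed
qed

lemma potential_grad:
  assumes "has_weak_grad \<Omega> VD (\<lambda>x. - ((1 / a x) *\<^sub>R ga x))" and W: "H01_grad (\<lambda>x. V x - VD x) g"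
  shows "has_weak_grad \<Omega> V (\<lambda>x. g x - (1 / a x) *\<^sub>R ga x)" "sq_int M (\<lambda>x. g x - (1 / a x) *\<^sub>R ga x)"
  using has_weak_grad_add[OF sets_\<Omega> H01_grad_weak[OF W] assms(1)] sq_int_diff[OF H01_grad_sq_int(2)[OF W] sq_int_log_grad]
  by simp_all

text \<open>Replaces the chosen representatives \<open>wgrad\<close> in the definition of a weak
  solution by the explicit gradients of the locale.\<close>

lemma drift_diffusion_form_eq:
  assumes \<sigma>: "\<sigma> \<in> borel_measurable M" and n: "n \<in> borel_measurable M" and u: "H01_grad (\<lambda>x. n x - a x) gu"
    and V: "has_weak_grad \<Omega> V G" "sq_int M G" and \<phi>: "H01_grad \<phi> g"
  shows "(LINT x|M. \<sigma> x * ((wgrad \<Omega> n x + n x *\<^sub>R wgrad \<Omega> V x) \<bullet> wgrad \<Omega> \<phi> x))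
    = (LINT x|M. \<sigma> x * ((gu x + ga x + n x *\<^sub>R G x) \<bullet> g x))"
proof -
  note sga = W1inf_grad_sq_int(2)[OF a]
  have "has_weak_grad \<Omega> a ga" using a by (simp add: W1inf_grad_def)
  from has_weak_grad_add[OF sets_\<Omega> H01_grad_weak[OF u] this]
  have n': "has_weak_grad \<Omega> n (\<lambda>x. gu x + ga x)" by simp
  note sn = sq_int_add[OF H01_grad_sq_int(2)[OF u] sga]
  note s = H01_grad_sq_int[OF \<phi>]
  note meas = sq_int_measurable[OF sq_int_wgrad(1)[OF n' sn]] sq_int_measurable[OF sq_int_wgrad(1)[OF V]]
    sq_int_measurable[OF sq_int_wgrad(1)[OF H01_grad_weak[OF \<phi>] s(2)]] sq_int_measurable[OF sn] sq_int_measurable[OF V(2)]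
    sq_int_measurable[OF s(2)]
  show ?thesis
  proof (rule integral_cong_AE)
    show "(\<lambda>x. \<sigma> x * ((wgrad \<Omega> n x + n x *\<^sub>R wgrad \<Omega> V x) \<bullet> wgrad \<Omega> \<phi> x)) \<in> borel_measurable M"
      "(\<lambda>x. \<sigma> x * ((gu x + ga x + n x *\<^sub>R G x) \<bullet> g x)) \<in> borel_measurable M"
      using \<sigma> n meas by (measurable)
    show "AE x in M. \<sigma> x * ((wgrad \<Omega> n x + n x *\<^sub>R wgrad \<Omega> V x) \<bullet> wgrad \<Omega> \<phi> x)
        = \<sigma> x * ((gu x + ga x + n x *\<^sub>R G x) \<bullet> g x)"
      using wgrad_eq(1)[OF op n'] wgrad_eq(1)[OF op V(1)] wgrad_eq(1)[OF op H01_grad_weak[OF \<phi>]]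
      by eventually_elim simp
  qed
qed

lemma entropy_density_integral_eq:
  assumes np: "np \<in> borel_measurable M" "AE x in M. 0 \<le> np x \<and> np x \<le> K"
    and nm: "nm \<in> borel_measurable M" "AE x in M. 0 \<le> nm x \<and> nm x \<le> K" and g: "sq_int M g"
  shows "(LINT x|M. entropy_density (a x) (np x) + entropy_density (a x) (nm x) + c * (norm (g x))\<^sup>2)
    = (LINT x|M. entropy 0 (a x) (np x)) + (LINT x|M. entropy 0 (a x) (nm x)) + c * (L2norm M g)\<^sup>2"
proof -
  let ?f = "\<lambda>x. entropy 0 (a x) (np x) + entropy 0 (a x) (nm x) + c * (norm (g x))\<^sup>2"
  have i: "integrable M (\<lambda>x. entropy 0 (a x) (np x))" "integrable M (\<lambda>x. entropy 0 (a x) (nm x))"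
    "integrable M (\<lambda>x. (norm (g x))\<^sup>2)"
    by (auto intro: entropy_integrable np nm sq_int_integrable[OF g])
  have m0: "?f \<in> borel_measurable M" by (rule borel_measurable_integrable) (use i in simp)
  have eq: "AE x in M. ?f x = entropy_density (a x) (np x) + entropy_density (a x) (nm x) + c * (norm (g x))\<^sup>2"
    using am np(2) nm(2)
  proof eventually_elim
    case (elim x)
    then show ?case using m by (simp add: entropy_density_eq)
  qed
  have "(LINT x|M. entropy_density (a x) (np x) + entropy_density (a x) (nm x) + c * (norm (g x))\<^sup>2) = (LINT x|M. ?f x)"
    by (rule integral_cong_AE[OF borel_measurable_lebesgue_on_AE[OF sets_\<Omega> m0 eq] m0]) (use eq in \<open>auto elim: eventually_mono\<close>)
  then show ?thesis using i by (simp add: L2norm_sq)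
qed

end

theorem proposition3:
  fixes \<Omega> :: "(real^3) set"
    and lam \<tau> \<delta>0 q0 nstar :: real
    and C D p VD nD n0p n0m :: "real^3 \<Rightarrow> real"
    and np nm V :: "real \<Rightarrow> real^3 \<Rightarrow> real"
  assumes "open \<Omega>" and "connected \<Omega>" and "\<Omega> \<noteq> {}" and "bounded \<Omega>" and "C11_boundary \<Omega>"
    and "lam > 0" and "\<tau> > 0"
    and "C \<in> Linf \<Omega>" and "D \<in> Linf \<Omega>" and "p \<in> Linf \<Omega>"
    and "\<delta>0 > 0"
    and "AE x in lebesgue_on \<Omega>. D x \<ge> \<delta>0 \<and> 0 \<le> p x \<and> p x \<le> 1 - \<delta>0"
    and "q0 > 3" and "VD \<in> W2 q0 \<Omega>"
    and "nD \<in> W1inf \<Omega>" and "nstar > 0" and "AE x in lebesgue_on \<Omega>. nD x \<ge> nstar"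
    and "\<exists>c. AE x in lebesgue_on \<Omega>. ln (nD x / 2) + VD x = c"
    and "n0p \<in> Linf \<Omega>" and "n0m \<in> Linf \<Omega>"
    and "AE x in lebesgue_on \<Omega>. 0 \<le> n0p x \<and> 0 \<le> n0m x"
    and "weak_solution \<Omega> lam \<tau> C D p q0 VD nD n0p n0m np nm V"
  shows "antimono_on {0<..} (H0 \<Omega> lam VD nD np nm V)"
proof -
  have \<Omega>: "open \<Omega>" "bounded \<Omega>" and lam: "lam > 0" and tau: "\<tau> > 0" using assms by auto
  interpret bounded_open \<Omega> by unfold_locales fact+
  have coeff: "AE x in M. D x \<ge> \<delta>0 \<and> 0 \<le> p x \<and> p x \<le> 1 - \<delta>0" "0 < \<delta>0" using assms by auto
  have eqn: "\<exists>c. AE x in M. ln (nD x / 2) + VD x = c" using assms by blast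
  note ws = \<open>weak_solution \<Omega> lam \<tau> C D p q0 VD nD n0p n0m np nm V\<close>[unfolded weak_solution_def]
  have np: "np \<in> C_L2 \<Omega>" and nm: "nm \<in> C_L2 \<Omega>" using ws by blast+
  have W12: "(\<lambda>t x. np t x - nD x / 2) \<in> W12 T \<Omega>" "(\<lambda>t x. nm t x - nD x / 2) \<in> W12 T \<Omega>" if "0 < T" for T
    using ws that by blast+
  obtain K0 where K0: "AE t in lebesgue_on {0<..}. AE x in M. 0 \<le> np t x \<and> np t x \<le> K0 \<and> 0 \<le> nm t x \<and> nm t x \<le> K0"
    using ws by blast
  obtain Fp Fm where F: "\<And>T. 0 < T \<Longrightarrow> has_time_deriv \<Omega> T np Fp" "\<And>T. 0 < T \<Longrightarrow> has_time_deriv \<Omega> T nm Fm"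
    and weak: "AE t in lebesgue_on {0<..}. \<forall>\<phi>\<in>H01 \<Omega>.
           Fp t \<phi> + (LINT x|M. D x * (1 + p x) *
               ((wgrad \<Omega> (np t) x + np t x *\<^sub>R wgrad \<Omega> (V t) x) \<bullet> wgrad \<Omega> \<phi> x))
             = - (1 / (2 * \<tau>)) * (LINT x|M. (np t x - nm t x) * \<phi> x) \<and>
           Fm t \<phi> + (LINT x|M. D x * (1 - p x) *
               ((wgrad \<Omega> (nm t) x + nm t x *\<^sub>R wgrad \<Omega> (V t) x) \<bullet> wgrad \<Omega> \<phi> x))
             = (1 / (2 * \<tau>)) * (LINT x|M. (np t x - nm t x) * \<phi> x)"
    using ws by blast
  have VW: "(\<lambda>x. V t x - VD x) \<in> H01 \<Omega>"
    "\<exists>w. has_weak_laplacian \<Omega> (V t) w \<and> (AE x in M. - lam\<^sup>2 * w x = np t x + nm t x - C x)" if "0 < t" for t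
    using ws that by (meson less_imp_le)+

  obtain g B where g: "W1inf_grad nD g B" and B: "0 \<le> B" using W1inf_gradE \<open>nD \<in> W1inf \<Omega>\<close> by blast
  define a where "a x = nD x / 2" for x
  define ga where "ga x = (1 / 2) *\<^sub>R g x" for x
  have a: "W1inf_grad a ga B"
  proof -
    have "has_weak_grad \<Omega> (\<lambda>x. 1 / 2 * nD x) (\<lambda>x. (1 / 2) *\<^sub>R g x)"
      by (rule has_weak_grad_scaleR) (use g in \<open>simp add: W1inf_grad_def\<close>)
    moreover have "AE x in M. \<bar>nD x\<bar> \<le> B" "AE x in M. norm (g x) \<le> B"
      using g unfolding W1inf_grad_def by blast+
    then have "AE x in M. \<bar>nD x / 2\<bar> \<le> B" "AE x in M. norm ((1 / 2) *\<^sub>R g x) \<le> B"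
      by (eventually_elim, use B in auto)+
    ultimately show ?thesis
      using g unfolding W1inf_grad_def a_def[abs_def] ga_def[abs_def]
      by (auto intro!: borel_measurable_divide borel_measurable_scaleR)
  qed
  \<comment> \<open>The locale asks for a nonnegative bound, and the existential bound
    \<open>K0\<close> carries no sign.\<close>
  define K where "K = max 0 K0"
  interpret density_bounds \<Omega> a ga B "nstar / 2" K
  proof unfold_locales
    show "AE x in M. nstar / 2 \<le> a x"
      using \<open>AE x in M. nD x \<ge> nstar\<close> by eventually_elim (simp add: a_def)
  qed (use a B \<open>0 < nstar\<close> in \<open>auto simp: K_def\<close>)
  \<comment> \<open>From here on the equilibrium condition acts only through this gradient: it turns
    the gradient of \<open>V t\<close> into \<open>gW t\<close> minus the logarithmic gradient of
    \<open>a\<close>.\<close>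
  have VD: "has_weak_grad \<Omega> VD (\<lambda>x. - ((1 / a x) *\<^sub>R ga x))"
    using eqn equilibrium_potential_grad unfolding a_def by blast
  define W where "W t x = V t x - VD x" for t x
  define gW where "gW t = wgrad \<Omega> (W t)" for t
  have W: "H01_grad (W t) (gW t)" if "0 < t" for t
    unfolding gW_def by (rule H01_imp_H01_grad) (use VW(1)[OF that] in \<open>simp add: W_def[abs_def]\<close>)
  have gV: "has_weak_grad \<Omega> (V t) (\<lambda>x. gW t x - (1 / a x) *\<^sub>R ga x)" "sq_int M (\<lambda>x. gW t x - (1 / a x) *\<^sub>R ga x)"
    if "0 < t" for t
    using potential_grad[OF VD, of "V t" "gW t"] W[OF that] by (simp_all add: W_def[abs_def])
  have sn: "sq_int M (np t)" "sq_int M (nm t)" if "0 < t" for t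
    using C_L2_sq_int[OF np] C_L2_sq_int[OF nm] that by auto

  obtain KD where D: "D \<in> borel_measurable M" "AE x in M. norm (D x) \<le> KD"
    using \<open>D \<in> Linf \<Omega>\<close> by (auto simp: Linf_def)
  have pm: "p \<in> borel_measurable M" using \<open>p \<in> Linf \<Omega>\<close> by (simp add: Linf_def)
  obtain KC where C: "C \<in> borel_measurable M" "AE x in M. norm (C x) \<le> KC"
    using \<open>C \<in> Linf \<Omega>\<close> by (auto simp: Linf_def)
  have sC: "sq_int M C" by (rule sq_int_bounded[OF C])
  have \<sigma>: "(\<lambda>x. D x * (1 + p x)) \<in> borel_measurable M" "(\<lambda>x. D x * (1 - p x)) \<in> borel_measurable M"
    using D(1) pm by measurable
  have \<sigma>b: "AE x in M. (0 \<le> D x * (1 + p x) \<and> D x * (1 + p x) \<le> 2 * \<bar>KD\<bar>) \<and> (0 \<le> D x * (1 - p x) \<and> D x * (1 - p x) \<le> 2 * \<bar>KD\<bar>)"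
    using D(2) coeff(1)
  proof eventually_elim
    case (elim x)
    then have 1: "0 \<le> D x" "D x \<le> \<bar>KD\<bar>" "0 \<le> 1 + p x" "1 + p x \<le> 2" "0 \<le> 1 - p x" "1 - p x \<le> 2"
      using coeff(2) by auto
    then have "D x * (1 + p x) \<le> \<bar>KD\<bar> * 2" "D x * (1 - p x) \<le> \<bar>KD\<bar> * 2" by (auto intro!: mult_mono)
    with 1 show ?case by auto
  qed

  interpret spin_entropy \<Omega> a ga B "nstar / 2" K lam \<tau> "2 * \<bar>KD\<bar>" "\<lambda>x. D x * (1 + p x)" "\<lambda>x. D x * (1 - p x)" np nm W gW Fp Fm
  proof
    show "0 < lam" "0 < \<tau>" "0 \<le> 2 * \<bar>KD\<bar>" "np \<in> C_L2 \<Omega>" "nm \<in> C_L2 \<Omega>" using lam tau np nm by auto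
    show "(\<lambda>x. D x * (1 + p x)) \<in> borel_measurable M" "(\<lambda>x. D x * (1 - p x)) \<in> borel_measurable M" by fact+
    show "AE x in M. 0 \<le> D x * (1 + p x) \<and> D x * (1 + p x) \<le> 2 * \<bar>KD\<bar>"
      "AE x in M. 0 \<le> D x * (1 - p x) \<and> D x * (1 - p x) \<le> 2 * \<bar>KD\<bar>" using \<sigma>b by (auto elim: eventually_mono)
    have "AE t in lebesgue_on {0<..}. AE x in M. 0 \<le> np t x \<and> np t x \<le> K"
      "AE t in lebesgue_on {0<..}. AE x in M. 0 \<le> nm t x \<and> nm t x \<le> K"
      by (rule eventually_mono[OF K0], erule eventually_mono, simp add: K_def le_max_iff_disj)+
    then show "AE x in M. 0 \<le> np t x \<and> np t x \<le> K" "AE x in M. 0 \<le> nm t x \<and> nm t x \<le> K" if "0 < t" for t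
      using C_L2_bounds[OF np _ that] C_L2_bounds[OF nm _ that] by blast+
    show "(\<lambda>t x. np t x - a x) \<in> L2_bochner {0<..<T} (H01 \<Omega>) (H1_norm \<Omega>)"
      "(\<lambda>t x. nm t x - a x) \<in> L2_bochner {0<..<T} (H01 \<Omega>) (H1_norm \<Omega>)" if "0 < T" for T
      using W12[OF that] by (simp_all add: W12_def a_def)
    show "H01_grad (W t) (gW t)" if "0 < t" for t by (rule W[OF that])
    show "has_time_deriv \<Omega> T np Fp" "has_time_deriv \<Omega> T nm Fm" if "0 < T" for T by (rule F(1)[OF that], rule F(2)[OF that])
    \<comment> \<open>The doping profile and the boundary potential do not depend on time, so both
      drop out of the difference of the Poisson problems at \<open>s\<close> and
      \<open>t\<close>.\<close>
    show "lam\<^sup>2 * (LINT x|M. (gW t x - gW s x) \<bullet> g\<phi> x) = (LINT x|M. ((np t x - np s x) + (nm t x - nm s x)) * \<phi> x)"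
      if st: "0 < s" "0 < t" and \<phi>: "H01_grad \<phi> g\<phi>" for s t \<phi> g\<phi>
    proof -
      let ?G = "\<lambda>t x. gW t x - (1 / a x) *\<^sub>R ga x" and ?q = "\<lambda>t x. np t x + nm t x - C x"
      note s\<phi> = H01_grad_sq_int[OF \<phi>]
      have sq: "sq_int M (?q t)" if "0 < t" for t by (intro sq_int_diff sq_int_add sn that sC)
      have P: "lam\<^sup>2 * (LINT x|M. ?G t x \<bullet> g\<phi> x) = (LINT x|M. ?q t x * \<phi> x)" if t: "0 < t" for t
      proof -
        obtain w where "has_weak_laplacian \<Omega> (V t) w" "AE x in M. - lam\<^sup>2 * w x = ?q t x" using VW(2)[OF t] by blast
        from Poisson_weak_form[OF gV[OF t] this sq[OF t] _ \<phi>] lam show ?thesis by simp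
      qed
      have "(LINT x|M. (gW t x - gW s x) \<bullet> g\<phi> x) = (LINT x|M. ?G t x \<bullet> g\<phi> x - ?G s x \<bullet> g\<phi> x)"
        by (simp add: inner_diff_left)
      also have "\<dots> = (LINT x|M. ?G t x \<bullet> g\<phi> x) - (LINT x|M. ?G s x \<bullet> g\<phi> x)"
        by (rule Bochner_Integration.integral_diff) (intro sq_int_inner_integrable gV(2) st s\<phi>)+
      finally have "lam\<^sup>2 * (LINT x|M. (gW t x - gW s x) \<bullet> g\<phi> x) = (LINT x|M. ?q t x * \<phi> x) - (LINT x|M. ?q s x * \<phi> x)"
        using P[OF st(1)] P[OF st(2)] by (simp add: right_diff_distrib)
      also have "\<dots> = (LINT x|M. ?q t x * \<phi> x - ?q s x * \<phi> x)"
        by (rule Bochner_Integration.integral_diff[symmetric]) (intro sq_int_mult_integrable sq st s\<phi>)+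
      also have "\<dots> = (LINT x|M. ((np t x - np s x) + (nm t x - nm s x)) * \<phi> x)"
        by (intro Bochner_Integration.integral_cong) (auto simp: algebra_simps)
      finally show ?thesis .
    qed
    have sp: "AE t in lebesgue_on {0<..}. t \<in> {0::real<..}" using AE_space[of "lebesgue_on {0::real<..}"] by simp
    show "AE t in lebesgue_on {0<..}. \<forall>\<phi> g\<phi> gu. H01_grad \<phi> g\<phi> \<longrightarrow>
       (H01_grad (\<lambda>x. np t x - a x) gu \<longrightarrow>
          Fp t \<phi> + (LINT x|M. D x * (1 + p x) * ((gu x + ga x + np t x *\<^sub>R (gW t x - (1 / a x) *\<^sub>R ga x)) \<bullet> g\<phi> x))
            = - (1 / (2 * \<tau>)) * (LINT x|M. (np t x - nm t x) * \<phi> x)) \<and>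
       (H01_grad (\<lambda>x. nm t x - a x) gu \<longrightarrow>
          Fm t \<phi> + (LINT x|M. D x * (1 - p x) * ((gu x + ga x + nm t x *\<^sub>R (gW t x - (1 / a x) *\<^sub>R ga x)) \<bullet> g\<phi> x))
            = (1 / (2 * \<tau>)) * (LINT x|M. (np t x - nm t x) * \<phi> x))"
      using weak sp
    proof (eventually_elim)
      case (elim t)
      then have t: "0 < t" by simp
      show ?case
      proof (intro allI impI conjI)
        fix \<phi> g\<phi> gu
        assume \<phi>: "H01_grad \<phi> g\<phi>" and u: "H01_grad (\<lambda>x. np t x - a x) gu"
        show "Fp t \<phi> + (LINT x|M. D x * (1 + p x) * ((gu x + ga x + np t x *\<^sub>R (gW t x - (1 / a x) *\<^sub>R ga x)) \<bullet> g\<phi> x))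
            = - (1 / (2 * \<tau>)) * (LINT x|M. (np t x - nm t x) * \<phi> x)"
          using conjunct1[OF bspec[OF elim(1) H01_grad_imp_H01[OF \<phi>]]]
            drift_diffusion_form_eq[OF \<sigma>(1) sq_int_measurable[OF sn(1)[OF t]] u gV[OF t] \<phi>] by simp
      next
        fix \<phi> g\<phi> gu
        assume \<phi>: "H01_grad \<phi> g\<phi>" and u: "H01_grad (\<lambda>x. nm t x - a x) gu"
        show "Fm t \<phi> + (LINT x|M. D x * (1 - p x) * ((gu x + ga x + nm t x *\<^sub>R (gW t x - (1 / a x) *\<^sub>R ga x)) \<bullet> g\<phi> x))
            = (1 / (2 * \<tau>)) * (LINT x|M. (np t x - nm t x) * \<phi> x)"
          using conjunct2[OF bspec[OF elim(1) H01_grad_imp_H01[OF \<phi>]]]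
            drift_diffusion_form_eq[OF \<sigma>(2) sq_int_measurable[OF sn(2)[OF t]] u gV[OF t] \<phi>] by simp
      qed
    qed
  qed
  have H0: "H0 \<Omega> lam VD nD np nm V t = (LINT x|M. entropy 0 (a x) (np t x)) + (LINT x|M. entropy 0 (a x) (nm t x))
      + lam\<^sup>2 / 2 * (L2norm M (gW t))\<^sup>2" if t: "0 < t" for t
    using entropy_density_integral_eq[OF sq_int_measurable[OF sn(1)[OF t]] np_bounds[OF t] sq_int_measurable[OF sn(2)[OF t]] nm_bounds[OF t] sq_int_gW[OF t], of "lam\<^sup>2 / 2"]
    by (simp add: H0_def a_def gW_def W_def[abs_def])
  show ?thesis
  proof (rule monotone_onI)
    fix s t :: real assume st: "s \<in> {0<..}" "t \<in> {0<..}" "s \<le> t"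
    show "H0 \<Omega> lam VD nD np nm V t \<le> H0 \<Omega> lam VD nD np nm V s"
      using monotone_onD[OF energy_antimono st] st H0 by simp
  qed
qed

end
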